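(* Let $f_0,f_1,f_2$ be analytic vector fields over $\mathbb{R}^d$ with $f_0(0)=0$. Let $k,m\in\mathbb{N}^*$, $\pi(k,m):=1+\left\lceil\frac{2k}{m}\right\rceil$, and $$\mathcal{N}^m_k:=S_{\llbracket 1,\pi(k,m)\rrbracket\setminus\{2\}}(X)\cup\{C_{j,l};\ j\in\llbracket 0,2k-2\rrbracket,\ l\in\mathbb{N}\}\cup\{W^1_{j,l},W^2_{j,l};\ j\in\llbracket 1,k-1\rrbracket,\ l\in\mathbb{N}\},$$ where the last set is empty if $k=1$. Let $\sigma:\mathbb{R}^d\to\mathbb{R}^d/\mathcal{N}^m_k(f)(0)$ be the canonical surjection, $\tilde e_1:=\sigma(f_{W^1_k}(0))$, $\tilde e_2:=\sigma(f_{W^2_k}(0))$ and $\tilde e_3:=\sigma(f_{C_{2k-1}}(0))$. If the system $$x'(t)=f_0(x(t))+u(t)f_1(x(t))+v(t)f_2(x(t)),\qquad x(0)=0,$$ is $W^{m,p}$-STLC for a given $p\in[1,+\infty]$, then one of the following conditions is satisfied: \begin{itemize} \item $\tilde e_1=0$ or $\tilde e_2=0$; \item $(\tilde e_1,\tilde e_2)$ is a linearly independent family and $\tilde e_3=a\tilde e_1+b\tilde e_2$ with $ab\ge\frac14$; \item $\tilde e_2=\beta\tilde e_1$ with $\beta<0$; \item $\tilde e_2=\beta\tilde e_1$, $\tilde e_3=\gamma\tilde e_1$ with $\beta\le\gamma^2$ and $\beta\neq0$. \end{itemize}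
   Context: Conventions: $\mathbb{N}=\{0,1,2,\dots\}$, $\mathbb{N}^*=\mathbb{N}\setminus\{0\}$, $\llbracket a,b\rrbracket$ is the set of integers $i$ with $a\le i\le b$. System. The state is $x(t)\in\mathbb{R}^d$ and the controls are scalar functions $u,v\in L^1((0,t),\mathbb{R})$; $x(\cdot;(u,v))$ denotes the maximal mild solution. Only small times and small controls are considered, and by convention the solution is then regarded as well defined up to time $t$. STLC. $\|u\|_{W^{m,p}}=\|u\|_{L^p}+\dots+\|u^{(m)}\|_{L^p}$ on $(0,t)$, and $W^{m,p}$ for a pair $(u,v)$ means $W^{m,p}\times W^{m,p}$. The system is $W^{m,p}$-STLC when for every $t,\rho>0$ there is $\delta>0$ such that for every $x^*\in B(0,\delta)$ there exist $u,v\in W^{m,p}((0,t),\mathbb{R})$ with $\|(u,v)\|_{W^{m,p}}\le\rho$ and $x(t;(u,v))=x^*$. Algebra. $X=\{X_0,X_1,X_2\}$ are non-commuting indeterminates; $\mathcal{L}(X)$ is the free Lie algebra over $\mathbb{R}$ generated by $X$ (inside the free associative algebra, with $[a,b]=ab-ba$). $\mathrm{Br}(X)$ is the set of formal iterated brackets (free magma) over $X$, and $\mathrm{E}:\mathrm{Br}(X)\to\mathcal{L}(X)$ the natural evaluation, $\mathrm{E}(X_i)=X_i$, $\mathrm{E}((a,b))=[\mathrm{E}(a),\mathrm{E}(b)]$. For $b\in\mathrm{Br}(X)$, $n_i(b)$ is the number of occurrences of $X_i$ in $b$ and $n(b):=n_1(b)+n_2(b)$. For $A\subset\mathbb{N}$,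 $S_A(X):=\mathrm{Span}\{\mathrm{E}(b);\ b\in\mathrm{Br}(X),\ n(b)\in A\}$. For $b\in\mathcal{L}(X)$, $b0^\nu:=[\cdots[b,X_0],\dots,X_0]$ with $X_0$ appearing $\nu$ times. For $i\in\{1,2\}$, $j\in\mathbb{N}^*$, $l\in\mathbb{N}$: $W^i_{j,l}:=[X_i0^{j-1},X_i0^j]0^l$; for $j,l\in\mathbb{N}$: $C_{j,l}:=(-1)^j\left[X_10^{\lfloor\frac{j+1}{2}\rfloor},X_20^{\lfloor\frac j2\rfloor}\right]0^l$. Set $W^i_j:=W^i_{j,0}$, $C_j:=C_{j,0}$. Evaluated brackets. For vector fields, $[f,g](x)=\mathrm{D}g(x)f(x)-\mathrm{D}f(x)g(x)$. For $b\in\mathcal{L}(X)$, $f_b:=\Lambda(b)$ with $\Lambda$ the unique Lie algebra homomorphism from $\mathcal{L}(X)$ to smooth vector fields with $\Lambda(X_i)=f_i$, $i=0,1,2$. For $\mathcal{N}\subset\mathcal{L}(X)$, $\mathcal{N}(f)(0):=\mathrm{Span}\{f_b(0);\ b\in\mathcal{N}\}\subset\mathbb{R}^d$. *)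

theory Defs
  imports
    "HOL-Probability.Essential_Supremum"
    "HOL-Library.Poly_Mapping"
    "HOL-Library.FuncSet"
begin

section \<open>The free Lie algebra over three indeterminates\<close>

datatype letter = X0 | X1 | X2

datatype br = Leaf letter | Bracket br br

text \<open>Words form a monoid under concatenation, so that the convolution product of
  \<^theory>\<open>HOL-Library.Poly_Mapping\<close> on finitely supported functions from words to the reals
  is the product of the free associative algebra.\<close>

instantiation list :: (type) monoid_add
begin
definition zero_list :: "'a list" where "zero_list = []"
definition plus_list :: "'a list \<Rightarrow> 'a list \<Rightarrow> 'a list" where "plus_list = append"
instance by standard (auto simp: zero_list_def plus_list_def)
end

instantiation poly_mapping :: (type, real_vector) real_vector
begin
lift_definition scaleR_poly_mapping :: "real \<Rightarrow> ('a \<Rightarrow>\<^sub>0 'b) \<Rightarrow> ('a \<Rightarrow>\<^sub>0 'b)"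
  is "\<lambda>c p w. c *\<^sub>R p w"
  by (erule finite_subset[rotated]) auto
instance by standard (transfer; simp add: scaleR_add_left scaleR_add_right fun_eq_iff)+
end

type_synonym free_alg = "letter list \<Rightarrow>\<^sub>0 real"

definition gen :: "letter \<Rightarrow> free_alg" where
  "gen i = Poly_Mapping.single [i] 1"

definition comm :: "free_alg \<Rightarrow> free_alg \<Rightarrow> free_alg" where
  "comm a b = a * b - b * a"

definition free_Lie :: "free_alg set" where
  "free_Lie = \<Inter>{V. subspace V \<and> range gen \<subseteq> V \<and> (\<forall>a\<in>V. \<forall>b\<in>V. comm a b \<in> V)}"

primrec Ev :: "br \<Rightarrow> free_alg" where
  "Ev (Leaf i) = gen i"
| "Ev (Bracket a b) = comm (Ev a) (Ev b)"

primrec occ :: "letter \<Rightarrow> br \<Rightarrow> nat" where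
  "occ i (Leaf j) = (if i = j then 1 else 0)"
| "occ i (Bracket a b) = occ i a + occ i b"

definition S_span :: "nat set \<Rightarrow> free_alg set" where
  "S_span A = span {Ev b | b. occ X1 b + occ X2 b \<in> A}"

definition ad0 :: "free_alg \<Rightarrow> nat \<Rightarrow> free_alg" where
  "ad0 b \<nu> = ((\<lambda>a. comm a (gen X0)) ^^ \<nu>) b"

text \<open>The first argument is meant to be \<open>X1\<close> or \<open>X2\<close>, and \<open>j \<ge> 1\<close>.\<close>

definition Wbr :: "letter \<Rightarrow> nat \<Rightarrow> nat \<Rightarrow> free_alg" where
  "Wbr i j l = ad0 (comm (ad0 (gen i) (j - 1)) (ad0 (gen i) j)) l"

definition Cbr :: "nat \<Rightarrow> nat \<Rightarrow> free_alg" where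
  "Cbr j l = (-1) ^ j *\<^sub>R ad0 (comm (ad0 (gen X1) ((j + 1) div 2)) (ad0 (gen X2) (j div 2))) l"

definition pi_km :: "nat \<Rightarrow> nat \<Rightarrow> nat" where
  "pi_km k m = 1 + nat \<lceil>2 * real k / real m\<rceil>"

definition N_set :: "nat \<Rightarrow> nat \<Rightarrow> free_alg set" where
  "N_set k m = S_span ({1..pi_km k m} - {2})
     \<union> {Cbr j l | j l. j \<in> {0..2 * k - 2}}
     \<union> {Wbr i j l | i j l. i \<in> {X1, X2} \<and> j \<in> {1..k - 1}}"


section \<open>Vector fields and evaluated brackets\<close>

definition real_analytic :: "(real^'d \<Rightarrow> real^'d) \<Rightarrow> bool" where
  "real_analytic g \<longleftrightarrow> (\<forall>x0. \<exists>r>0. \<exists>c :: ('d \<Rightarrow> nat) \<Rightarrow> real^'d. \<forall>x\<in>ball x0 r.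
     ((\<lambda>\<alpha>. (\<Prod>i\<in>UNIV. (x $ i - x0 $ i) ^ \<alpha> i) *\<^sub>R c \<alpha>) has_sum g x) UNIV)"

text \<open>\<open>Ck n g\<close>: \<open>g\<close> is \<open>n\<close> times continuously differentiable on the whole space.\<close>

primrec Ck :: "nat \<Rightarrow> (real^'d \<Rightarrow> real^'d) \<Rightarrow> bool" where
  "Ck 0 g = continuous_on UNIV g"
| "Ck (Suc n) g = (g differentiable_on UNIV \<and> (\<forall>h. Ck n (\<lambda>x. frechet_derivative g (at x) h)))"

definition smooth_field :: "(real^'d \<Rightarrow> real^'d) \<Rightarrow> bool" where
  "smooth_field g \<longleftrightarrow> (\<forall>n. Ck n g)"

definition field_bracket ::
    "(real^'d \<Rightarrow> real^'d) \<Rightarrow> (real^'d \<Rightarrow> real^'d) \<Rightarrow> (real^'d \<Rightarrow> real^'d)" where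
  "field_bracket g h = (\<lambda>x. frechet_derivative h (at x) (g x) - frechet_derivative g (at x) (h x))"

definition Lie_hom :: "(free_alg \<Rightarrow> real^'d \<Rightarrow> real^'d) \<Rightarrow> bool" where
  "Lie_hom L \<longleftrightarrow>
     (\<forall>a\<in>free_Lie. smooth_field (L a)) \<and>
     (\<forall>a\<in>free_Lie. \<forall>b\<in>free_Lie. L (a + b) = (\<lambda>x. L a x + L b x)) \<and>
     (\<forall>c. \<forall>a\<in>free_Lie. L (c *\<^sub>R a) = (\<lambda>x. c *\<^sub>R L a x)) \<and>
     (\<forall>a\<in>free_Lie. \<forall>b\<in>free_Lie. L (comm a b) = field_bracket (L a) (L b))"

text \<open>The homomorphism of the universal property. It is unique as a map on \<^const>\<open>free_Lie\<close>;
  \<^const>\<open>extensional\<close> only fixes its irrelevant values elsewhere.\<close>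

definition Lam :: "(letter \<Rightarrow> real^'d \<Rightarrow> real^'d) \<Rightarrow> free_alg \<Rightarrow> real^'d \<Rightarrow> real^'d" where
  "Lam f = (THE L. Lie_hom L \<and> (\<forall>i. L (gen i) = f i) \<and> L \<in> extensional free_Lie)"

definition eval_span :: "(letter \<Rightarrow> real^'d \<Rightarrow> real^'d) \<Rightarrow> free_alg set \<Rightarrow> (real^'d) set" where
  "eval_span f N = span {Lam f b 0 | b. b \<in> N}"


section \<open>Quotient of a vector space by a subspace\<close>

text \<open>Elements of the quotient are cosets of \<open>V\<close>; its zero is \<open>quot_proj V 0 = V\<close>. Adding \<open>V\<close>
  in \<open>quot_scale\<close> only matters for the scalar \<open>0\<close>.\<close>

definition quot_proj :: "'a::real_vector set \<Rightarrow> 'a \<Rightarrow> 'a set" where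
  "quot_proj V x = {x + n | n. n \<in> V}"

definition quot_add :: "'a::real_vector set \<Rightarrow> 'a set \<Rightarrow> 'a set" where
  "quot_add A B = {a + b | a b. a \<in> A \<and> b \<in> B}"

definition quot_scale :: "'a::real_vector set \<Rightarrow> real \<Rightarrow> 'a set \<Rightarrow> 'a set" where
  "quot_scale V c A = {c *\<^sub>R a + n | a n. a \<in> A \<and> n \<in> V}"

definition quot_indep2 :: "'a::real_vector set \<Rightarrow> 'a set \<Rightarrow> 'a set \<Rightarrow> bool" where
  "quot_indep2 V A B \<longleftrightarrow>
     (\<forall>a b. quot_add (quot_scale V a A) (quot_scale V b B) = quot_proj V 0 \<longrightarrow> a = 0 \<and> b = 0)"

lemma quot_proj_add:
  assumes "subspace V"
  shows "quot_add (quot_proj V x) (quot_proj V y) = quot_proj V (x + y)"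
proof (intro set_eqI iffI)
  fix z assume "z \<in> quot_add (quot_proj V x) (quot_proj V y)"
  then obtain n n' where "n \<in> V" "n' \<in> V" "z = (x + n) + (y + n')"
    by (auto simp: quot_add_def quot_proj_def)
  moreover have "n + n' \<in> V" using calculation assms by (simp add: subspace_add)
  ultimately show "z \<in> quot_proj V (x + y)"
    unfolding quot_proj_def by (intro CollectI exI[of _ "n + n'"]) (simp add: algebra_simps)
next
  fix z assume "z \<in> quot_proj V (x + y)"
  then obtain n where "n \<in> V" "z = (x + n) + (y + 0)"
    by (auto simp: quot_proj_def algebra_simps)
  then show "z \<in> quot_add (quot_proj V x) (quot_proj V y)"
    using subspace_0[OF assms] unfolding quot_add_def quot_proj_def by blast
qed

lemma quot_proj_scale:
  assumes "subspace V"
  shows "quot_scale V c (quot_proj V x) = quot_proj V (c *\<^sub>R x)"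
proof (intro set_eqI iffI)
  fix z assume "z \<in> quot_scale V c (quot_proj V x)"
  then obtain n n' where "n \<in> V" "n' \<in> V" "z = c *\<^sub>R (x + n) + n'"
    by (auto simp: quot_scale_def quot_proj_def)
  moreover have "c *\<^sub>R n + n' \<in> V" using calculation assms by (simp add: subspace_add subspace_scale)
  ultimately show "z \<in> quot_proj V (c *\<^sub>R x)"
    unfolding quot_proj_def
    by (intro CollectI exI[of _ "c *\<^sub>R n + n'"]) (simp add: algebra_simps)
next
  fix z assume "z \<in> quot_proj V (c *\<^sub>R x)"
  then obtain n where "n \<in> V" "z = c *\<^sub>R (x + 0) + n"
    by (auto simp: quot_proj_def)
  then show "z \<in> quot_scale V c (quot_proj V x)"
    using subspace_0[OF assms] unfolding quot_scale_def quot_proj_def by blast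
qed

lemma quot_proj_eq_iff:
  assumes "subspace V"
  shows "quot_proj V x = quot_proj V y \<longleftrightarrow> x - y \<in> V"
proof
  assume "quot_proj V x = quot_proj V y"
  moreover have "x \<in> quot_proj V x"
    using subspace_0[OF assms] by (force simp: quot_proj_def)
  ultimately show "x - y \<in> V" by (auto simp: quot_proj_def)
next
  assume D: "x - y \<in> V"
  have "quot_proj V x \<subseteq> quot_proj V y" if "x - y \<in> V" for x y
  proof
    fix z assume "z \<in> quot_proj V x"
    then obtain n where "n \<in> V" "z = y + ((x - y) + n)" by (auto simp: quot_proj_def)
    then show "z \<in> quot_proj V y"
      using subspace_add[OF assms that] unfolding quot_proj_def by blast
  qed
  moreover have "y - x \<in> V" using subspace_neg[OF assms D] by simp
  ultimately show "quot_proj V x = quot_proj V y" using D by blast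
qed


section \<open>Sobolev spaces on \<open>(0, T)\<close>\<close>

abbreviation I_leb :: "real \<Rightarrow> real measure" where
  "I_leb T \<equiv> lebesgue_on {0<..<T}"

definition in_Lp :: "real \<Rightarrow> ennreal \<Rightarrow> (real \<Rightarrow> real) \<Rightarrow> bool" where
  "in_Lp T p u \<longleftrightarrow> u \<in> borel_measurable (I_leb T) \<and>
     (if p = \<infinity> then esssup (I_leb T) (\<lambda>s. ennreal \<bar>u s\<bar>) < \<infinity>
      else integrable (I_leb T) (\<lambda>s. \<bar>u s\<bar> powr enn2real p))"

definition Lp_norm :: "real \<Rightarrow> ennreal \<Rightarrow> (real \<Rightarrow> real) \<Rightarrow> real" where
  "Lp_norm T p u =
     (if p = \<infinity> then enn2real (esssup (I_leb T) (\<lambda>s. ennreal \<bar>u s\<bar>))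
      else (LINT s|I_leb T. \<bar>u s\<bar> powr enn2real p) powr (1 / enn2real p))"

definition test_function :: "real \<Rightarrow> (real \<Rightarrow> real) \<Rightarrow> bool" where
  "test_function T \<phi> \<longleftrightarrow> (\<forall>n. (deriv ^^ n) \<phi> differentiable_on UNIV) \<and>
     (\<exists>K. compact K \<and> K \<subseteq> {0<..<T} \<and> (\<forall>s. s \<notin> K \<longrightarrow> \<phi> s = 0))"

definition locally_integrable :: "real \<Rightarrow> (real \<Rightarrow> real) \<Rightarrow> bool" where
  "locally_integrable T u \<longleftrightarrow>
     (\<forall>K. compact K \<and> K \<subseteq> {0<..<T} \<longrightarrow> integrable (lebesgue_on K) u)"

definition has_weak_deriv :: "real \<Rightarrow> nat \<Rightarrow> (real \<Rightarrow> real) \<Rightarrow> (real \<Rightarrow> real) \<Rightarrow> bool" where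
  "has_weak_deriv T j u w \<longleftrightarrow> locally_integrable T u \<and> locally_integrable T w \<and>
     (\<forall>\<phi>. test_function T \<phi> \<longrightarrow>
        (LINT s|I_leb T. u s * (deriv ^^ j) \<phi> s) = (-1) ^ j * (LINT s|I_leb T. w s * \<phi> s))"

definition in_Wmp :: "real \<Rightarrow> nat \<Rightarrow> ennreal \<Rightarrow> (real \<Rightarrow> real) \<Rightarrow> bool" where
  "in_Wmp T m p u \<longleftrightarrow> in_Lp T p u \<and> (\<forall>j\<le>m. \<exists>w. in_Lp T p w \<and> has_weak_deriv T j u w)"

text \<open>Weak derivatives are unique up to a null set, so the choice below does not affect the norm.\<close>

definition weak_deriv :: "real \<Rightarrow> nat \<Rightarrow> (real \<Rightarrow> real) \<Rightarrow> real \<Rightarrow> real" where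
  "weak_deriv T j u = (SOME w. has_weak_deriv T j u w)"

definition Wmp_norm :: "real \<Rightarrow> nat \<Rightarrow> ennreal \<Rightarrow> (real \<Rightarrow> real) \<Rightarrow> real" where
  "Wmp_norm T m p u = (\<Sum>j\<le>m. Lp_norm T p (weak_deriv T j u))"


section \<open>The control system and small-time local controllability\<close>

text \<open>The control pair lives on \<open>(0, T)\<close> only, so a mild solution on all of \<open>[0, T]\<close> is the
  maximal one. The integral equation at time \<open>0\<close> contains the initial condition \<open>x 0 = 0\<close>.\<close>

definition mild_solution ::
    "(letter \<Rightarrow> real^'d \<Rightarrow> real^'d) \<Rightarrow> (real \<Rightarrow> real) \<Rightarrow> (real \<Rightarrow> real) \<Rightarrow> real
      \<Rightarrow> (real \<Rightarrow> real^'d) \<Rightarrow> bool" where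
  "mild_solution f u v T x \<longleftrightarrow>
     integrable (I_leb T) u \<and> integrable (I_leb T) v \<and> continuous_on {0..T} x \<and>
     (\<forall>t\<in>{0..T}. x t = (LINT s|I_leb t. f X0 (x s) + u s *\<^sub>R f X1 (x s) + v s *\<^sub>R f X2 (x s)))"

definition W_STLC :: "nat \<Rightarrow> ennreal \<Rightarrow> (letter \<Rightarrow> real^'d \<Rightarrow> real^'d) \<Rightarrow> bool" where
  "W_STLC m p f \<longleftrightarrow> (\<forall>t>0. \<forall>\<rho>>0. \<exists>\<delta>>0. \<forall>xs\<in>ball 0 \<delta>. \<exists>u v x.
     in_Wmp t m p u \<and> in_Wmp t m p v \<and> Wmp_norm t m p u + Wmp_norm t m p v \<le> \<rho> \<and>
     mild_solution f u v t x \<and> x t = xs)"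

end

theory Submission
  imports
    Defs
    "HOL-Computational_Algebra.Formal_Power_Series"
    "HOL-Computational_Algebra.Polynomial"
    "HOL-Probability.Discrete_Topology"
begin

text \<open>Suppose that none of the four conditions holds. Linear algebra in the quotient by
  \<open>V = \<N>(f)(0)\<close> then yields a vector \<open>c\<close> orthogonal to \<open>V\<close> for which
  \<open>q(a, b) = A a\<^sup>2 + 2 C a b + B b\<^sup>2\<close>, where \<open>A\<close>, \<open>B\<close>, \<open>C\<close> are the products of \<open>c\<close> with
  \<open>f\<^bsub>W\<^sup>1\<^sub>k\<^esub>(0)\<close>, \<open>f\<^bsub>W\<^sup>2\<^sub>k\<^esub>(0)\<close>, \<open>f\<^bsub>C\<^sub>2\<^sub>k\<^sub>-\<^sub>1\<^esub>(0)\<close>, is positive definite.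
  Carleman linearisation turns the system into a matrix equation up to terms of high order. In
  the interaction picture with respect to \<open>f\<^sub>0\<close> its fundamental solution is the exponential of a Magnus
  series, and the endpoint is the sum of the evaluations of the homogeneous components of that
  series. Since \<open>c\<close> vanishes on \<open>V\<close>, only the quadratic component contributes to \<open>c \<bullet> x(T)\<close>, and
  integration by parts shows that it is \<open>1/2 \<integral> q(u\<^sub>k, v\<^sub>k)\<close> up to small terms, where \<open>u\<^sub>k\<close>, \<open>v\<^sub>k\<close> are the
  \<open>k\<close>-th primitives of the controls. The boundary terms are absorbed by a closed-loop estimate:
  positive definiteness makes the vectors \<open>[X\<^sub>i0\<^sup>l](f)(0)\<close>, \<open>l < k\<close>, independent of the brackets of
  intermediate length, so that the primitives at the final time are controlled by \<open>x(T)\<close>.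
  Interpolation between \<open>u\<^sub>k\<close> and the \<open>m\<close>-th derivative of \<open>u\<close> bounds the remainder of order
  \<open>\<pi>(k,m) + 1\<close> in the controls by a small multiple of \<open>\<integral> u\<^sub>k\<^sup>2 + v\<^sub>k\<^sup>2\<close>. Hence no target
  \<open>- \<delta> c\<close> can be reached in small time with small controls.\<close>

section \<open>Smooth functions and derivations\<close>

text \<open>The logarithm is used because its homogeneous components are Lie elements: a functional
  that vanishes on all bracket values of degree n vanishes on the n-th component, while the
  components of the solution itself contain products. The obstacle is scale. The size of the targets
  is unrelated to that of the controls, so every error must be a small multiple of |x(T)| or of the
  squared L2 norm A2 of the \<open>k\<close>-th primitives. The degrees are tuned by interpolation:
  if g is the L1 norm of the controls and \<rho> their Sobolev bound, then g^(2(m+k)) <= D A2^m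
  \<rho>^(2k). Hence g^(N+1) is negligible against A2 if (N+1) m >= 2(m+k), which holds for N =
  \<pi>(k,m), and g^(r+1) against sqrt A2 for r = ceil(k/m). The weaker bound is enough for the
  primitives at the final time, since these are multiplied by an L1 norm of size O(sqrt A2). On the
  other hand 2r <= \<pi>(k,m), so the independence argument, which brackets two elements of degree
  at most r, stays among annihilated degrees. The 1/4 is the threshold below which (a s + b t)^2 < s
  t has a solution s > 0.\<close>

definition pd :: "'d => (real^'d::finite => real) => real^'d => real" where
  "pd j g x = frechet_derivative g (at x) (axis j 1)"

primrec dn :: "nat => (real^'d::finite => real) => bool" where
  "dn 0 g = True"
| "dn (Suc n) g = ((\<forall>x. g differentiable (at x)) \<and> (\<forall>j. dn n (pd j g)))"

definition smooth :: "(real^'d::finite => real) => bool" where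
  "smooth g \<longleftrightarrow> (\<forall>n. dn n g)"

lemma smooth_iff: "smooth g \<longleftrightarrow> (\<forall>x. g differentiable (at x)) \<and> (\<forall>j. smooth (pd j g))"
proof
  assume g: "smooth g"
  have "dn (Suc n) g" for n using g unfolding smooth_def by blast
  thus "(\<forall>x. g differentiable (at x)) \<and> (\<forall>j. smooth (pd j g))"
    unfolding smooth_def dn.simps by blast
next
  assume g: "(\<forall>x. g differentiable (at x)) \<and> (\<forall>j. smooth (pd j g))"
  have "dn n g" for n using g by (cases n) (auto simp: smooth_def)
  thus "smooth g" by (simp add: smooth_def)
qed

lemma smooth_differentiable: "smooth g ==> g differentiable (at x)"
  using smooth_iff by blast

lemma smooth_pd: "smooth g ==> smooth (pd j g)"
  using smooth_iff by blast

lemma dn_mono: "dn (Suc n) g ==> dn n g"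
  by (induction n arbitrary: g) auto

lemma frechet_eq_pd:
  assumes "g differentiable (at x)"
  shows "frechet_derivative g (at x) h = (\<Sum>j\<in>UNIV. h $ j * pd j g x)"
proof -
  have L: "linear (frechet_derivative g (at x))" by (rule linear_frechet_derivative[OF assms])
  have h: "h = (\<Sum>j\<in>UNIV. h $ j *\<^sub>R axis j 1)"
    using basis_expansion[of h] by (simp add: scalar_mult_eq_scaleR)
  have "frechet_derivative g (at x) (\<Sum>j\<in>UNIV. h $ j *\<^sub>R axis j 1)
      = (\<Sum>j\<in>UNIV. h $ j *\<^sub>R frechet_derivative g (at x) (axis j 1))"
    by (simp add: linear_sum[OF L] linear_cmul[OF L])
  thus ?thesis by (simp add: pd_def flip: h)
qed

lemma has_derivative_pd:
  assumes "g differentiable (at x)"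
  shows "(g has_derivative (\<lambda>h. \<Sum>j\<in>UNIV. h $ j * pd j g x)) (at x)"
  using assms frechet_derivative_works frechet_eq_pd[OF assms]
  by (metis (no_types, lifting) ext)

lemma pd_eqI:
  assumes "(g has_derivative D) (at x)"
  shows "pd j g x = D (axis j 1)"
  unfolding pd_def using frechet_derivative_at[OF assms] by simp

lemma pd_const [simp]: "pd j (\<lambda>x. c) = (\<lambda>x. 0)"
  by (rule ext) (simp add: pd_def)

lemma pd_coord: "pd j (\<lambda>x. x $ i) = (\<lambda>x. if i = j then 1 else 0)"
proof
  fix x :: "real^'a"
  have "((\<lambda>x. x $ i) has_derivative (\<lambda>h. h $ i)) (at x)"
    by (rule bounded_linear_imp_has_derivative) (rule bounded_linear_vec_nth)
  thus "pd j (\<lambda>x. x $ i) x = (if i = j then 1 else 0)"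
    by (simp add: pd_eqI axis_def)
qed

lemma pd_add:
  assumes "\<And>x. g differentiable (at x)" "\<And>x. h differentiable (at x)"
  shows "pd j (\<lambda>x. g x + h x) = (\<lambda>x. pd j g x + pd j h x)"
proof
  fix x
  show "pd j (\<lambda>x. g x + h x) x = pd j g x + pd j h x"
    unfolding pd_def
    by (subst pd_eqI[unfolded pd_def, OF has_derivative_add]) 
      (use assms frechet_derivative_works in auto)
qed

lemma pd_mult:
  assumes "\<And>x. g differentiable (at x)" "\<And>x. h differentiable (at x)"
  shows "pd j (\<lambda>x. g x * h x) = (\<lambda>x. pd j g x * h x + g x * pd j h x)"
proof
  fix x
  have "((\<lambda>x. g x * h x) has_derivative
     (\<lambda>k. g x * frechet_derivative h (at x) k + frechet_derivative g (at x) k * h x)) (at x)"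
    by (rule has_derivative_mult) (use assms frechet_derivative_works in auto)
  from pd_eqI[OF this] show "pd j (\<lambda>x. g x * h x) x = pd j g x * h x + g x * pd j h x"
    by (simp add: pd_def)
qed

lemma dn_const: "dn n (\<lambda>x. c)"
  by (induction n arbitrary: c) auto

lemma dn_coord: "dn n (\<lambda>x. x $ i)"
proof (cases n)
  case (Suc m)
  have "(\<lambda>x. x $ i) differentiable (at x)" for x :: "real^'a"
    by (rule bounded_linear_imp_differentiable) (rule bounded_linear_vec_nth)
  thus ?thesis by (simp add: Suc pd_coord dn_const)
qed simp

lemma dn_add: "dn n g ==> dn n h ==> dn n (\<lambda>x. g x + h x)"
  by (induction n arbitrary: g h) (auto simp: pd_add)

lemma dn_mult: "dn n g ==> dn n h ==> dn n (\<lambda>x. g x * h x)"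
proof (induction n arbitrary: g h)
  case (Suc n)
  hence d: "\<And>x. g differentiable (at x)" "\<And>x. h differentiable (at x)" by auto
  have "dn n (pd j g)" "dn n (pd j h)" "dn n g" "dn n h" for j
    using Suc.prems dn_mono by auto
  hence "dn n (pd j (\<lambda>x. g x * h x))" for j
    unfolding pd_mult[OF d] by (intro dn_add Suc.IH)
  thus ?case using d by auto
qed simp

lemma smooth_const [simp]: "smooth (\<lambda>x. c)" by (simp add: smooth_def dn_const)
lemma smooth_coord [simp]: "smooth (\<lambda>x. x $ i)" by (simp add: smooth_def dn_coord)
lemma smooth_add: "smooth g ==> smooth h ==> smooth (\<lambda>x. g x + h x)"
  by (simp add: smooth_def dn_add)
lemma smooth_mult: "smooth g ==> smooth h ==> smooth (\<lambda>x. g x * h x)"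
  by (simp add: smooth_def dn_mult)
lemma smooth_cmult: "smooth g ==> smooth (\<lambda>x. c * g x)"
  by (simp add: smooth_mult)
lemma smooth_minus: "smooth g ==> smooth (\<lambda>x. - g x)"
  using smooth_cmult[of g "-1"] by simp
lemma smooth_diff: "smooth g ==> smooth h ==> smooth (\<lambda>x. g x - h x)"
  using smooth_add[OF _ smooth_minus] by fastforce
lemma smooth_sum: "(\<And>i. i \<in> I ==> smooth (g i)) ==> smooth (\<lambda>x. \<Sum>i\<in>I. g i x)"
  by (induction I rule: infinite_finite_induct) (auto simp: smooth_add)
lemma smooth_prod: "(\<And>i. i \<in> I ==> smooth (g i)) ==> smooth (\<lambda>x. \<Prod>i\<in>I. g i x)"
  by (induction I rule: infinite_finite_induct) (auto simp: smooth_mult)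
lemma smooth_power: "smooth g ==> smooth (\<lambda>x. g x ^ n)"
  by (induction n) (auto simp: smooth_mult)

lemma pd_sadd: "smooth g ==> smooth h ==> pd j (\<lambda>x. g x + h x) = (\<lambda>x. pd j g x + pd j h x)"
  by (simp add: pd_add smooth_differentiable)
lemma pd_smult: "smooth g ==> smooth h ==> pd j (\<lambda>x. g x * h x) = (\<lambda>x. pd j g x * h x + g x * pd j h x)"
  by (simp add: pd_mult smooth_differentiable)
lemma pd_cmult: "smooth g ==> pd j (\<lambda>x. c * g x) = (\<lambda>x. c * pd j g x)"
  by (subst pd_smult) auto
lemma pd_diff: "smooth g ==> smooth h ==> pd j (\<lambda>x. g x - h x) = (\<lambda>x. pd j g x - pd j h x)"
  using pd_sadd[of g "\<lambda>x. -1 * h x" j] smooth_cmult[of h "-1"] pd_cmult[of h j "-1"] by simp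
lemma smooth_continuous: "smooth g ==> continuous_on S g"
  by (meson smooth_differentiable continuous_at_imp_continuous_on differentiable_imp_continuous_within)

text \<open>The one-variable mean value theorem along a coordinate line; two applications evaluate
  the second differences in \<open>pd_commute\<close>.\<close>

lemma pd_axis_mvt:
  assumes "smooth g" "h > 0"
  obtains z where "0 < z" "z < h" "g (x + h *\<^sub>R axis i 1) - g x = h * pd i g (x + z *\<^sub>R axis i 1)"
proof -
  have "DERIV (\<lambda>s. g (x + s *\<^sub>R axis i 1)) s :> pd i g (x + s *\<^sub>R axis i 1)" for s
  proof -
    have g: "(g has_derivative (\<lambda>k. \<Sum>j\<in>UNIV. k $ j * pd j g (x + s *\<^sub>R axis i 1))) (at (x + s *\<^sub>R axis i 1))"
      by (rule has_derivative_pd[OF smooth_differentiable[OF assms(1)]])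
    have "((\<lambda>s. g (x + s *\<^sub>R axis i 1)) has_derivative
      (\<lambda>t. \<Sum>j\<in>UNIV. (t *\<^sub>R axis i 1) $ j * pd j g (x + s *\<^sub>R axis i 1))) (at s)"
      by (rule has_derivative_compose[where g=g and f="\<lambda>s. x + s *\<^sub>R axis i 1" and f'="\<lambda>t. t *\<^sub>R axis i 1", OF _ g]) (auto intro!: derivative_eq_intros)
    also have "(\<lambda>t. \<Sum>j\<in>UNIV. (t *\<^sub>R axis i 1) $ j * pd j g (x + s *\<^sub>R axis i 1))
       = (\<lambda>t. t * pd i g (x + s *\<^sub>R axis i 1))"
      by (simp add: axis_def if_distrib if_distribR cong: if_cong)
    also have "\<dots> = (*) (pd i g (x + s *\<^sub>R axis i 1))"
      by (rule ext) simp
    finally show ?thesis unfolding has_field_derivative_def .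
  qed
  from MVT2[OF assms(2) this] show ?thesis using that by auto
qed

text \<open>Schwarz's theorem. The second difference \<open>\<Delta> h\<close> is symmetric in the
  two directions, and two mean value steps write it as \<open>h * h\<close> times either mixed
  derivative at a point within \<open>2 * h\<close> of \<open>x\<close>; continuity then forces the
  two values at \<open>x\<close> to agree.\<close>

lemma pd_commute:
  assumes "smooth g"
  shows "pd i (pd j g) = pd j (pd i g)"
proof
  fix x :: "real^'a"
  define \<Delta> where "\<Delta> h = g (x + h *\<^sub>R axis i 1 + h *\<^sub>R axis j 1) - g (x + h *\<^sub>R axis i 1)
    - g (x + h *\<^sub>R axis j 1) + g x" for h
  have key: "\<exists>y. norm (y - x) <= 2 * h \<and> \<Delta>' = h * h * pd b (pd a g) y"
    if "h > 0" and \<Delta>': "\<Delta>' = g (x + h *\<^sub>R axis a 1 + h *\<^sub>R axis b 1) - g (x + h *\<^sub>R axis a 1)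
    - g (x + h *\<^sub>R axis b 1) + g x" for h a b \<Delta>'
  proof -
    let ?G = "\<lambda>y. g (y + h *\<^sub>R axis b 1) - g y"
    \<comment> \<open>Differentiation commutes with translations, which is what the mean value step
      needs for the difference \<open>?G\<close>.\<close>
    have sh: "smooth (\<lambda>y. g (y + c)) \<and> pd k (\<lambda>y. g (y + c)) = (\<lambda>y. pd k g (y + c))" if "smooth g" for c :: "real^'a" and k g
    proof -
      have c: "((\<lambda>y. g (y + c)) has_derivative frechet_derivative g (at (y + c))) (at y)" if "smooth g" for g :: "real^'a => real" and y
      proof -
        have "(g has_derivative frechet_derivative g (at (y + c))) (at (y + c))"
          using smooth_differentiable[OF that] frechet_derivative_works by blast
        from has_derivative_compose[where f="\<lambda>y. y + c" and f'="\<lambda>h. h" and g=g, OF _ this]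
        moreover have "((\<lambda>y. y + c) has_derivative (\<lambda>h. h)) (at y)"
          by (auto intro!: derivative_eq_intros)
        ultimately show ?thesis by blast
      qed
      hence p: "pd k (\<lambda>y. g (y + c)) = (\<lambda>y. pd k g (y + c))" if "smooth g" for g :: "real^'a => real" and k
        using pd_eqI[OF c[OF that]] unfolding pd_def by auto
      have "dn n (\<lambda>y. g (y + c))" if "smooth g" for n and g :: "real^'a => real"
        using that
      proof (induction n arbitrary: g)
        case (Suc n)
        thus ?case using c[OF Suc.prems] p[OF Suc.prems] Suc.IH[OF smooth_pd[OF Suc.prems]]
          by (auto simp: differentiable_def)
      qed simp
      thus ?thesis using p that by (auto simp: smooth_def)
    qed
    have "smooth ?G" using assms sh smooth_diff by blast
    from pd_axis_mvt[OF this \<open>h > 0\<close>, of x a] obtain z where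
      z: "0 < z" "z < h" "?G (x + h *\<^sub>R axis a 1) - ?G x = h * pd a ?G (x + z *\<^sub>R axis a 1)" by blast
    have "pd a ?G = (\<lambda>y. pd a g (y + h *\<^sub>R axis b 1) - pd a g y)"
      using pd_diff[of "\<lambda>y. g (y + h *\<^sub>R axis b 1)" g a] sh[OF assms] assms by auto
    moreover obtain w where "0 < w" "w < h"
      "pd a g (x + z *\<^sub>R axis a 1 + h *\<^sub>R axis b 1) - pd a g (x + z *\<^sub>R axis a 1)
        = h * pd b (pd a g) (x + z *\<^sub>R axis a 1 + w *\<^sub>R axis b 1)"
      using pd_axis_mvt[OF smooth_pd[OF assms] \<open>h > 0\<close>] by metis
    moreover have "norm (z *\<^sub>R axis a 1 + w *\<^sub>R axis b 1 :: real^'a) <= 2 * h"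
      using z \<open>0 < w\<close> \<open>w < h\<close> by (intro order_trans[OF norm_triangle_ineq]) simp
    ultimately show ?thesis using z(3) \<Delta>'
      by (intro exI[of _ "x + z *\<^sub>R axis a 1 + w *\<^sub>R axis b 1"]) (auto simp: algebra_simps)
  qed
  show "pd i (pd j g) x = pd j (pd i g) x"
  proof (rule ccontr)
    let ?p = "pd i (pd j g)" let ?q = "pd j (pd i g)"
    assume "?p x \<noteq> ?q x"
    hence e: "\<bar>?p x - ?q x\<bar> / 2 > 0" by simp
    have "continuous (at x) ?p" "continuous (at x) ?q"
      using smooth_continuous[OF smooth_pd[OF smooth_pd[OF assms]], of UNIV]
      by (simp_all add: continuous_on_eq_continuous_at)
    then obtain d1 d2 where d: "d1 > 0" "d2 > 0"
      "\<And>y. dist y x < d1 ==> dist (?p y) (?p x) < \<bar>?p x - ?q x\<bar> / 2"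
      "\<And>y. dist y x < d2 ==> dist (?q y) (?q x) < \<bar>?p x - ?q x\<bar> / 2"
      using e unfolding continuous_at_eps_delta by metis
    define h where "h = min d1 d2 / 3"
    have h: "h > 0" "2 * h < d1" "2 * h < d2" using d by (auto simp: h_def)
    obtain y where y: "norm (y - x) <= 2 * h" "\<Delta> h = h * h * ?q y"
      using key[OF h(1), of "\<Delta> h" i j] by (auto simp: \<Delta>_def)
    obtain w where w: "norm (w - x) <= 2 * h" "\<Delta> h = h * h * ?p w"
      using key[OF h(1), of "\<Delta> h" j i] by (auto simp: \<Delta>_def algebra_simps)
    have "?q y = ?p w" using y w h by auto
    moreover have "dist (?q y) (?q x) < \<bar>?p x - ?q x\<bar> / 2" "dist (?p w) (?p x) < \<bar>?p x - ?q x\<bar> / 2"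
      using y w h by (intro d(3,4); simp add: dist_norm)+
    ultimately show False by (auto simp: dist_real_def abs_if split: if_splits)
  qed
qed

subsection \<open>Functions vanishing to a given order at the origin\<close>

text \<open>Recursion through first partial derivatives instead of a bound by
  \<open>norm x ^ q\<close>: the loss of one order under differentiation is then immediate, and the
  bound is recovered in \<open>flat_bound\<close>.\<close>

primrec flat :: "nat => (real^'d::finite => real) => bool" where
  "flat 0 g = True"
| "flat (Suc q) g = (g 0 = 0 \<and> (\<forall>j. flat q (pd j g)))"

lemma flat_mono: "flat (Suc q) g ==> flat q g"
  by (induction q arbitrary: g) auto

lemma flat_le: "flat q g ==> p <= q ==> flat p g"
proof (induction q)
  case (Suc q)
  thus ?case using flat_mono[of q g] by (cases "p = Suc q") auto
qed auto

lemma flat_add: "flat q g ==> flat q h ==> smooth g ==> smooth h ==> flat q (\<lambda>x. g x + h x)"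
  by (induction q arbitrary: g h) (auto simp: pd_sadd smooth_pd)

lemma flat_zero [simp]: "flat q (\<lambda>x. 0)"
  by (induction q) auto

text \<open>The product rule lowers one of the two orders by one, so the induction runs over the sum
  \<open>a + b\<close>. If the differentiated factor has order \<open>0\<close> already, the order
  of the other factor is lowered by hand.\<close>

lemma flat_mult:
  "flat a g ==> flat b h ==> smooth g ==> smooth h ==> flat (a + b) (\<lambda>x. g x * h x)"
proof (induction "a + b" arbitrary: a b g h)
  case (Suc n)
  have "flat n (\<lambda>x. pd j g x * h x + g x * pd j h x)" for j
  proof (intro flat_add smooth_mult smooth_pd Suc.prems)
    show "flat n (\<lambda>x. pd j g x * h x)"
    proof (cases a)
      case 0
      then obtain b' where "b = Suc b'" using Suc by (cases b) auto
      hence "flat b' h" "n = 0 + b'" using Suc.prems Suc.hyps(2) 0 flat_mono by auto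
      thus ?thesis using Suc.hyps(1)[of 0 b' "pd j g" h] Suc.prems smooth_pd by auto
    next
      case (Suc a')
      thus ?thesis using Suc.hyps(1)[of a' b "pd j g" h] Suc.prems Suc.hyps(2) smooth_pd by auto
    qed
    show "flat n (\<lambda>x. g x * pd j h x)"
    proof (cases b)
      case 0
      then obtain a' where "a = Suc a'" using Suc by (cases a) auto
      hence "flat a' g" "n = a' + 0" using Suc.prems Suc.hyps(2) 0 flat_mono by auto
      thus ?thesis using Suc.hyps(1)[of a' 0 g "pd j h"] Suc.prems smooth_pd by auto
    next
      case (Suc b')
      thus ?thesis using Suc.hyps(1)[of a b' g "pd j h"] Suc.prems Suc.hyps(2) smooth_pd by auto
    qed
  qed
  moreover have "g 0 * h 0 = 0" using Suc.hyps(2) Suc.prems(1,2) by (cases a; cases b) auto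
  ultimately show ?case using Suc.prems by (simp add: pd_smult flip: Suc.hyps(2))
qed auto

lemma flat_mult1: "flat q g ==> smooth g ==> smooth h ==> flat q (\<lambda>x. h x * g x)"
  using flat_mult[of 0 h q g] by simp

lemma flat_cmult: "flat q g ==> smooth g ==> flat q (\<lambda>x. c * g x)"
  by (rule flat_mult1) auto

lemma flat_diff: "flat q g ==> flat q h ==> smooth g ==> smooth h ==> flat q (\<lambda>x. g x - h x)"
  using flat_add[of q g "\<lambda>x. -1 * h x"] flat_cmult[of q h "-1"] smooth_cmult[of h "-1"] by simp

lemma flat_sum:
  "(\<And>i. i \<in> I ==> flat q (g i)) ==> (\<And>i. i \<in> I ==> smooth (g i)) ==> flat q (\<lambda>x. \<Sum>i\<in>I. g i x)"
  by (induction I rule: infinite_finite_induct) (auto simp: flat_add smooth_sum)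

text \<open>The mean value inequality is applied on the ball of radius \<open>norm x\<close> and not
  on the unit ball: there the partial derivatives are of size \<open>norm x ^ q\<close>, and the
  length of the segment supplies the remaining power.\<close>

lemma flat_bound:
  assumes "smooth g" "flat q g"
  shows "\<exists>C\<ge>0. \<forall>x. norm x <= 1 --> \<bar>g x\<bar> <= C * norm x ^ q"
  using assms
proof (induction q arbitrary: g)
  case 0
  have "bounded (g ` cball 0 1)"
    by (intro compact_imp_bounded compact_continuous_image smooth_continuous 0 compact_cball)
  then obtain B where "\<And>x. norm x <= 1 ==> \<bar>g x\<bar> <= B"
    unfolding bounded_iff by (metis image_eqI mem_cball_0 real_norm_def)
  thus ?case by (metis abs_ge_zero mult.right_neutral norm_zero order.trans power_0 zero_le_one)
next
  case (Suc q)
  have "\<exists>C\<ge>0. \<forall>x. norm x <= 1 --> \<bar>pd j g x\<bar> <= C * norm x ^ q" for j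
    using Suc.IH[of "pd j g"] Suc.prems smooth_pd by auto
  then obtain C where C: "\<And>j. C j \<ge> 0" "\<And>j x. norm x <= 1 ==> \<bar>pd j g x\<bar> <= C j * norm x ^ q" by metis
  have "\<bar>g x\<bar> <= (\<Sum>j\<in>UNIV. C j) * norm x ^ Suc q" if x: "norm x <= 1" for x
  proof -
    have d: "(g has_derivative (\<lambda>h. \<Sum>j\<in>UNIV. h $ j * pd j g y)) (at y within cball 0 (norm x))" for y :: "real^'a"
      by (rule has_derivative_at_withinI[OF has_derivative_pd[OF smooth_differentiable[OF Suc.prems(1)]]])
    have "norm (g x - g 0) <= ((\<Sum>j\<in>UNIV. C j) * norm x ^ q) * norm (x - 0)"
    proof (rule differentiable_bound[OF convex_cball d])
      fix y :: "real^'a" assume y: "y \<in> cball 0 (norm x)"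
      show "onorm (\<lambda>h. \<Sum>j\<in>UNIV. h $ j * pd j g y) <= (\<Sum>j\<in>UNIV. C j) * norm x ^ q"
      proof (rule onorm_le)
        fix h :: "real^'a"
        have "norm (\<Sum>j\<in>UNIV. h $ j * pd j g y) <= (\<Sum>j\<in>UNIV. norm h * (C j * norm x ^ q))"
        proof (rule sum_norm_le)
          fix j :: 'a
          have "\<bar>pd j g y\<bar> <= C j * norm y ^ q" using C(2) y x by auto
          also have "\<dots> <= C j * norm x ^ q" using y C(1) by (intro mult_left_mono power_mono) auto
          finally show "norm (h $ j * pd j g y) <= norm h * (C j * norm x ^ q)"
            using component_le_norm_cart[of h j] by (simp add: abs_mult mult_mono)
        qed
        thus "norm (\<Sum>j\<in>UNIV. h $ j * pd j g y) <= (\<Sum>j\<in>UNIV. C j) * norm x ^ q * norm h"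
          by (simp add: sum_distrib_left sum_distrib_right mult_ac)
      qed
    qed auto
    thus ?thesis using Suc.prems by (simp add: mult_ac)
  qed
  moreover have "(\<Sum>j\<in>UNIV. C j) \<ge> 0" by (simp add: C(1) sum_nonneg)
  ultimately show ?case by blast
qed

subsection \<open>Derivations\<close>

definition der :: "(real^'d::finite => real^'d) => (real^'d => real) => real^'d => real" where
  "der X h x = (\<Sum>j\<in>UNIV. X x $ j * pd j h x)"

definition sfield :: "(real^'d::finite => real^'d) => bool" where
  "sfield X \<longleftrightarrow> (\<forall>j. smooth (\<lambda>x. X x $ j))"

lemma smooth_der: "sfield X ==> smooth h ==> smooth (der X h)"
  unfolding der_def[abs_def] sfield_def by (intro smooth_sum smooth_mult smooth_pd) auto

lemma der_coord [simp]: "der X (\<lambda>x. x $ i) = (\<lambda>x. X x $ i)"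
  by (rule ext) (simp add: der_def pd_coord if_distrib cong: if_cong)

lemma der_const [simp]: "der X (\<lambda>x. c) = (\<lambda>x. 0)"
  by (rule ext) (simp add: der_def)

lemma der_add: "smooth g ==> smooth h ==> der X (\<lambda>x. g x + h x) = (\<lambda>x. der X g x + der X h x)"
  by (rule ext) (simp add: der_def pd_sadd sum.distrib algebra_simps)

lemma der_cmult: "smooth g ==> der X (\<lambda>x. c * g x) = (\<lambda>x. c * der X g x)"
  by (rule ext) (simp add: der_def pd_cmult sum_distrib_left algebra_simps)

lemma der_sum: "(\<And>i. i \<in> I ==> smooth (g i)) ==> der X (\<lambda>x. \<Sum>i\<in>I. g i x) = (\<lambda>x. \<Sum>i\<in>I. der X (g i) x)"
  by (induction I rule: infinite_finite_induct) (auto simp: der_add smooth_sum)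

lemma der_mult:
  "smooth g ==> smooth h ==> der X (\<lambda>x. g x * h x) = (\<lambda>x. der X g x * h x + g x * der X h x)"
  by (rule ext) (simp add: der_def pd_smult sum.distrib sum_distrib_left sum_distrib_right algebra_simps)

lemma flat_der: "sfield X ==> smooth h ==> flat (Suc q) h ==> flat q (der X h)"
  unfolding der_def[abs_def] sfield_def
  by (intro flat_sum flat_mult1 smooth_mult smooth_pd) auto

text \<open>Differentiation loses one order, but coefficients that vanish at \<open>0\<close>
  restore it. This is why brackets with \<open>X0\<close> cost no accuracy in the Carleman
  approximation, whereas each controlled field costs one order.\<close>

lemma flat_der0:
  assumes "sfield X" "smooth h" "flat q h" "X 0 = 0"
  shows "flat q (der X h)"
proof (cases q)
  case (Suc p)
  have "flat (1 + p) (\<lambda>x. X x $ j * pd j h x)" for j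
    using assms Suc by (intro flat_mult smooth_pd) (auto simp: sfield_def)
  thus ?thesis unfolding der_def[abs_def] Suc using assms
    by (intro flat_sum smooth_mult smooth_pd) (auto simp: sfield_def)
qed simp

lemma sfield_frechet:
  assumes "sfield X"
  shows "(X has_derivative (\<lambda>h. \<chi> i. \<Sum>j\<in>UNIV. h $ j * pd j (\<lambda>x. X x $ i) x)) (at x)"
proof -
  have "((\<lambda>x. X x $ i) has_derivative (\<lambda>h. \<Sum>j\<in>UNIV. h $ j * pd j (\<lambda>x. X x $ i) x)) (at x)" for i
    using assms by (intro has_derivative_pd smooth_differentiable) (auto simp: sfield_def)
  thus ?thesis
    by (subst has_derivative_componentwise_within)
      (auto simp: Basis_vec_def inner_axis)
qed

lemma frechet_sfield:
  "sfield X ==> frechet_derivative X (at x) h = (\<chi> i. \<Sum>j\<in>UNIV. h $ j * pd j (\<lambda>x. X x $ i) x)"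
  by (simp flip: frechet_derivative_at[OF sfield_frechet])

lemma field_bracket_der:
  "sfield X ==> sfield Y ==>
    field_bracket X Y x $ i = der X (\<lambda>x. Y x $ i) x - der Y (\<lambda>x. X x $ i) x"
  by (simp add: field_bracket_def frechet_sfield der_def)

text \<open>The second order terms cancel by symmetry.\<close>
lemma der_bracket:
  assumes X: "sfield X" and Y: "sfield Y" and h: "smooth h"
  shows "der (field_bracket X Y) h x = der X (der Y h) x - der Y (der X h) x"
proof -
  have e: "der A (der B h) x = (\<Sum>i\<in>UNIV. der A (\<lambda>x. B x $ i) x * pd i h x)
      + (\<Sum>i\<in>UNIV. \<Sum>j\<in>UNIV. A x $ j * B x $ i * pd j (pd i h) x)"
    if "sfield A" "sfield B" for A B
  proof -
    have "der A (der B h) = (\<lambda>x. \<Sum>i\<in>UNIV. der A (\<lambda>x. B x $ i * pd i h x) x)"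
      unfolding der_def[of B, abs_def] using that h
      by (subst der_sum) (auto intro!: smooth_mult smooth_pd simp: sfield_def)
    moreover have "der A (\<lambda>x. B x $ i * pd i h x) x
       = der A (\<lambda>x. B x $ i) x * pd i h x + (\<Sum>j\<in>UNIV. A x $ j * B x $ i * pd j (pd i h) x)" for i
    proof -
      have "der A (\<lambda>x. B x $ i * pd i h x) = (\<lambda>x. der A (\<lambda>x. B x $ i) x * pd i h x + B x $ i * der A (pd i h) x)"
        using that h by (intro der_mult smooth_pd) (auto simp: sfield_def)
      thus ?thesis by (simp add: der_def[of A "pd i h"] sum_distrib_left mult_ac)
    qed
    ultimately show ?thesis by (simp add: sum.distrib)
  qed
  have s: "(\<Sum>i\<in>UNIV. \<Sum>j\<in>UNIV. X x $ j * Y x $ i * pd j (pd i h) x)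
     = (\<Sum>i\<in>UNIV. \<Sum>j\<in>UNIV. Y x $ j * X x $ i * pd j (pd i h) x)"
    by (subst sum.swap) (simp add: pd_commute[OF h, of _ _] mult_ac)
  have "der (field_bracket X Y) h x =
     (\<Sum>i\<in>UNIV. (der X (\<lambda>x. Y x $ i) x - der Y (\<lambda>x. X x $ i) x) * pd i h x)"
    by (simp add: der_def[of "field_bracket X Y"] field_bracket_der X Y)
  thus ?thesis using e[OF X Y] e[OF Y X] s by (simp add: left_diff_distrib sum_subtractf)
qed

text \<open>\<open>Ck\<close> differentiates in fixed directions; such a derivative of a field with
  smooth components again has smooth components, so the induction closes.\<close>

lemma Ck_sfield: "sfield X ==> Ck n X"
proof (induction n arbitrary: X)
  case 0
  thus ?case
    using has_derivative_continuous[OF sfield_frechet[OF 0]]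
    by (simp add: continuous_at_imp_continuous_on)
next
  case (Suc n)
  have "sfield (\<lambda>x. frechet_derivative X (at x) h)" for h
    unfolding frechet_sfield[OF Suc.prems] using Suc.prems
    by (auto simp: sfield_def intro!: smooth_sum smooth_mult smooth_pd)
  moreover have "X differentiable_on UNIV"
    unfolding differentiable_on_def differentiable_def
    using sfield_frechet[OF Suc.prems] by blast
  ultimately show ?case using Suc.IH by simp
qed

lemma sfield_smooth_field: "sfield X ==> smooth_field X"
  by (simp add: smooth_field_def Ck_sfield)

section \<open>Power series\<close>

definition mon :: "('d::finite => nat) => real^'d => real" where
  "mon \<alpha> x = (\<Prod>i\<in>UNIV. x $ i ^ \<alpha> i)"

definition deg :: "('d::finite => nat) => nat" where
  "deg \<alpha> = (\<Sum>i\<in>UNIV. \<alpha> i)"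

definition lower :: "'d => ('d => nat) => ('d => nat)" where
  "lower j \<alpha> = \<alpha>(j := \<alpha> j - 1)"

definition raise :: "'d => ('d => nat) => ('d => nat)" where
  "raise j \<alpha> = \<alpha>(j := Suc (\<alpha> j))"

lemma mon_zero [simp]: "mon (\<lambda>_. 0) x = 1"
  by (simp add: mon_def)

lemma mon_add: "mon (\<lambda>i. \<alpha> i + \<beta> i) x = mon \<alpha> x * mon \<beta> x"
  by (simp add: mon_def power_add prod.distrib)

lemma smooth_mon [simp]: "smooth (mon \<alpha>)"
  unfolding mon_def[abs_def] by (intro smooth_prod smooth_power) simp

lemma deg_raise [simp]: "deg (raise j \<alpha>) = Suc (deg \<alpha>)"
  by (simp add: deg_def raise_def sum.remove[of UNIV j] cong: if_cong)

lemma deg_lower: "\<alpha> j \<noteq> 0 ==> Suc (deg (lower j \<alpha>)) = deg \<alpha>"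
  by (simp add: deg_def lower_def sum.remove[of UNIV j] cong: if_cong)

lemma deg_eq_0_iff: "deg \<alpha> = 0 \<longleftrightarrow> \<alpha> = (\<lambda>_. 0)"
  by (auto simp: deg_def fun_eq_iff)

lemma finite_deg_le [simp]: "finite {\<alpha> :: 'd::finite => nat. deg \<alpha> <= N}"
proof (rule finite_subset)
  show "{\<alpha>. deg \<alpha> <= N} \<subseteq> PiE UNIV (\<lambda>_::'d. {..N})"
  proof
    fix \<alpha> :: "'d => nat" assume "\<alpha> \<in> {\<alpha>. deg \<alpha> <= N}"
    moreover have "\<alpha> i <= deg \<alpha>" for i unfolding deg_def by (rule member_le_sum) auto
    ultimately have "\<alpha> i <= N" for i using order_trans by blast
    thus "\<alpha> \<in> PiE UNIV (\<lambda>_::'d. {..N})" by auto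
  qed
qed (auto intro: finite_PiE)

lemma mon_at_0: "mon \<alpha> 0 = (if \<alpha> = (\<lambda>_. 0) then 1 else 0)"
proof (cases "\<alpha> = (\<lambda>_. 0)")
  case False
  then obtain i where "\<alpha> i \<noteq> 0" by auto
  thus ?thesis using False by (auto simp: mon_def intro!: prod_zero)
qed (simp add: mon_def)

lemma pd_line:
  assumes "g differentiable (at x)"
  shows "((\<lambda>s. g (x + s *\<^sub>R axis j 1)) has_real_derivative pd j g x) (at 0)"
proof -
  have "(g has_derivative frechet_derivative g (at x)) (at x)"
    using assms frechet_derivative_works by blast
  hence "((\<lambda>s. g (x + s *\<^sub>R axis j 1)) has_derivative
      (\<lambda>t. frechet_derivative g (at x) (t *\<^sub>R axis j 1))) (at 0)"
    by (intro has_derivative_compose[where g=g and f="\<lambda>s. x + s *\<^sub>R axis j 1" and f'="\<lambda>t. t *\<^sub>R axis j 1"])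
      (auto intro!: derivative_eq_intros)
  also have "(\<lambda>t. frechet_derivative g (at x) (t *\<^sub>R axis j 1)) = (*) (pd j g x)"
    by (rule ext) (simp add: pd_def linear_cmul[OF linear_frechet_derivative[OF assms]])
  finally show ?thesis unfolding has_field_derivative_def .
qed

lemma pd_mon: "pd j (mon \<alpha>) x = real (\<alpha> j) * mon (lower j \<alpha>) x"
proof -
  let ?R = "\<Prod>i\<in>UNIV-{j}. x $ i ^ \<alpha> i"
  have e: "mon \<alpha> (x + s *\<^sub>R axis j 1) = (x $ j + s) ^ \<alpha> j * ?R" for s
    by (simp add: mon_def prod.remove[of UNIV j] axis_def)
  have "((\<lambda>s. mon \<alpha> (x + s *\<^sub>R axis j 1)) has_real_derivative (real (\<alpha> j) * (x $ j) ^ (\<alpha> j - 1) * ?R)) (at 0)"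
    unfolding e by (auto intro!: derivative_eq_intros)
  moreover have "mon (lower j \<alpha>) x = (x $ j) ^ (\<alpha> j - 1) * ?R"
    by (simp add: mon_def lower_def prod.remove[of UNIV j])
  ultimately show ?thesis
    using DERIV_unique[OF pd_line[OF smooth_differentiable[OF smooth_mon[of \<alpha>]], of x j]] by simp
qed

lemma flat_mon: "flat (deg \<alpha>) (mon \<alpha>)"
proof (induction "deg \<alpha>" arbitrary: \<alpha>)
  case (Suc n)
  have "flat n (pd j (mon \<alpha>))" for j
  proof (cases "\<alpha> j = 0")
    case True
    hence "pd j (mon \<alpha>) = (\<lambda>x. 0)" by (simp add: pd_mon fun_eq_iff)
    thus ?thesis by simp
  next
    case False
    hence "flat n (mon (lower j \<alpha>))" using Suc deg_lower[of \<alpha> j] by (metis nat.inject)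
    moreover have "pd j (mon \<alpha>) = (\<lambda>x. real (\<alpha> j) * mon (lower j \<alpha>) x)" by (simp add: pd_mon fun_eq_iff)
    ultimately show ?thesis by (simp add: flat_cmult)
  qed
  moreover have "mon \<alpha> 0 = 0" using Suc.hyps(2) by (auto simp: mon_at_0 deg_def)
  ultimately show ?case by (simp flip: Suc.hyps(2))
qed auto

text \<open>The scalar form of the expansion in \<open>real_analytic\<close>, with explicit
  coefficients and radius because differentiation changes both.\<close>

definition psum :: "(('d::finite => nat) => real) => real^'d => real => (real^'d => real) => bool" where
  "psum c x0 r g \<longleftrightarrow> r > 0 \<and> (\<forall>x\<in>ball x0 r. ((\<lambda>\<alpha>. mon \<alpha> (x - x0) * c \<alpha>) has_sum g x) UNIV)"

text \<open>Halving the polydisc absorbs the exponent that differentiation of a monomial brings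
  down.\<close>

lemma half_power_bound: "real n * (1/2) ^ (n - 1) <= 1"
proof (induction n)
  case (Suc n)
  have "Suc n <= 2 ^ n" by (simp add: Suc_leI)
  hence "real (Suc n) <= real (2 ^ n)" by (rule of_nat_mono)
  hence "real (Suc n) <= 2 ^ n" by simp
  thus ?case by (simp add: power_divide divide_simps)
qed simp

lemma mon_abs_le:
  assumes "\<And>i. \<bar>y $ i\<bar> <= s"
  shows "\<bar>mon \<alpha> y\<bar> <= s ^ deg \<alpha>"
proof -
  have "\<bar>mon \<alpha> y\<bar> = (\<Prod>i\<in>UNIV. \<bar>y $ i\<bar> ^ \<alpha> i)"
    by (simp add: mon_def abs_prod power_abs)
  also have "\<dots> <= (\<Prod>i\<in>UNIV. s ^ \<alpha> i)"
    using assms by (intro prod_mono) (auto intro: power_mono)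
  also have "\<dots> = s ^ deg \<alpha>" by (simp add: deg_def power_sum)
  finally show ?thesis .
qed

lemma mon_lower_bound:
  assumes "\<And>i. \<bar>y $ i\<bar> <= s / 2" "s > 0"
  shows "\<bar>real (\<alpha> j) * mon (lower j \<alpha>) y\<bar> <= s ^ deg \<alpha> / s"
proof (cases "\<alpha> j = 0")
  case False
  define n where "n = deg (lower j \<alpha>)"
  have n: "deg \<alpha> = Suc n" using deg_lower[of \<alpha> j] False by (simp add: n_def)
  have "\<alpha> j <= deg \<alpha>" unfolding deg_def by (rule member_le_sum) auto
  hence "\<bar>real (\<alpha> j) * mon (lower j \<alpha>) y\<bar> <= real (Suc n) * (s / 2) ^ n"
    unfolding abs_mult using mon_abs_le[OF assms(1), of "lower j \<alpha>"] n
    by (intro mult_mono) (auto simp: n_def)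
  also have "\<dots> = (real (Suc n) * (1/2) ^ (Suc n - 1)) * s ^ n"
    by (simp add: power_divide)
  also have "\<dots> <= 1 * s ^ n" by (intro mult_right_mono half_power_bound) (use assms in auto)
  finally show ?thesis using assms(2) n by simp
qed (use assms in auto)

text \<open>Convergence at the single corner \<open>x0 + (s, ..., s)\<close> yields a summable
  majorant for the differentiated series on a smaller ball. The Weierstrass test and the theorem on
  differentiation of series then apply along an enumeration of the multi-indices.\<close>

lemma psum_derivative:
  fixes g :: "real^'d => real"
  assumes "psum c x0 r g"
  obtains r' where "0 < r'" "r' <= r" "\<And>x. x \<in> ball x0 r' ==> g differentiable (at x)"
    "\<And>j. psum (\<lambda>\<alpha>. real (Suc (\<alpha> j)) * c (raise j \<alpha>)) x0 r' (pd j g)"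
proof -
  have r: "r > 0" and hs: "\<And>x. x \<in> ball x0 r ==> ((\<lambda>\<alpha>. mon \<alpha> (x - x0) * c \<alpha>) has_sum g x) UNIV"
    using assms by (auto simp: psum_def)
  define d where "d = real CARD('d)"
  have d: "d \<ge> 1" by (simp add: d_def Suc_leI)
  \<comment> \<open>The corner has distance at most \<open>d * s = r / 2\<close> from
    \<open>x0\<close>, so it lies inside the ball of convergence.\<close>
  define s where "s = r / (2 * d)"
  have s: "s > 0" using r d by (simp add: s_def)
  have sd: "d * s < r" using r d by (simp add: s_def)
  define b where "b \<alpha> = s ^ deg \<alpha> / s * \<bar>c \<alpha>\<bar>" for \<alpha> :: "'d => nat"
  have "norm ((\<chi> i. s) :: real^'d) <= (\<Sum>i\<in>UNIV. \<bar>((\<chi> i. s) :: real^'d) $ i\<bar>)" by (rule norm_le_l1_cart)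
  also have "\<dots> = d * s" using s by (simp add: d_def)
  finally have "x0 + (\<chi> i. s) \<in> ball x0 r" using sd by (simp add: dist_norm)
  from hs[OF this] have "((\<lambda>\<alpha>. mon \<alpha> (\<chi> i. s) * c \<alpha>) has_sum g (x0 + (\<chi> i. s))) UNIV" by simp
  moreover have "mon \<alpha> (\<chi> i. s) = s ^ deg \<alpha>" for \<alpha> :: "'d => nat"
    by (simp add: mon_def deg_def power_sum)
  ultimately have "(\<lambda>\<alpha>. s ^ deg \<alpha> * c \<alpha>) summable_on UNIV"
    unfolding summable_on_def by auto
  hence "(\<lambda>\<alpha>. \<bar>s ^ deg \<alpha> * c \<alpha>\<bar>) summable_on UNIV"
    by (rule summable_on_iff_abs_summable_on_real[THEN iffD1, unfolded real_norm_def])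
  hence "(\<lambda>\<alpha>. 1 / s * \<bar>s ^ deg \<alpha> * c \<alpha>\<bar>) summable_on UNIV" by (rule summable_on_cmult_right)
  moreover have "(\<lambda>\<alpha>. 1 / s * \<bar>s ^ deg \<alpha> * c \<alpha>\<bar>) = b"
  proof
    fix \<alpha> :: "'d => nat"
    have "\<bar>s ^ deg \<alpha>\<bar> = s ^ deg \<alpha>" using s by simp
    thus "1 / s * \<bar>s ^ deg \<alpha> * c \<alpha>\<bar> = b \<alpha>" by (simp only: b_def abs_mult) simp
  qed
  ultimately have bs: "b summable_on UNIV" by metis
  define e where "e = (from_nat_into UNIV :: nat => 'd => nat)"
  have "infinite (UNIV :: ('d => nat) set)"
    using finite_fun_UNIVD2 infinite_UNIV_nat by blast
  hence e: "bij_betw e UNIV UNIV"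
    unfolding e_def by (intro bij_betw_from_nat_into) auto
  have "(\<lambda>n. b (e n)) summable_on UNIV"
    using summable_on_reindex_bij_betw[OF e] bs by blast
  hence be: "summable (\<lambda>n. b (e n))" by (rule summable_on_imp_summable)
  define r' where "r' = min r (s / 2)"
  have r': "r' > 0" "r' <= r" "r' <= s / 2" using r s by (auto simp: r'_def)
  define S where "S = ball x0 r'"
  define t where "t j \<alpha> x = real (\<alpha> j) * mon (lower j \<alpha>) (x - x0) * c \<alpha>" for j \<alpha> x
  define D where "D j x = suminf (\<lambda>n. t j (e n) x)" for j x
  have comp: "\<bar>(x - x0) $ i\<bar> <= s / 2" if "x \<in> S" for x i
    using component_le_norm_cart[of "x - x0" i] that r' by (simp add: S_def dist_norm norm_minus_commute)
  have tb: "\<bar>t j \<alpha> x\<bar> <= b \<alpha>" if "x \<in> S" for j \<alpha> x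
    unfolding t_def b_def abs_mult[of _ "c \<alpha>"]
    by (intro mult_right_mono mon_lower_bound comp[OF that] s) auto
  have ul: "uniform_limit S (\<lambda>n x. \<Sum>i<n. t j (e i) x) (D j) sequentially" for j
    unfolding D_def[abs_def] by (rule Weierstrass_m_test[OF _ be]) (use tb in auto)
  have "\<exists>G. \<forall>x\<in>S. (\<lambda>n. mon (e n) (x - x0) * c (e n)) sums G x \<and>
      (G has_derivative (\<lambda>h. \<Sum>j\<in>UNIV. h $ j * D j x)) (at x within S)"
  proof (rule has_derivative_series)
    show "convex S" by (simp add: S_def)
    show "((\<lambda>x. mon (e n) (x - x0) * c (e n)) has_derivative (\<lambda>h. \<Sum>j\<in>UNIV. h $ j * t j (e n) x)) (at x within S)"
      for n x
    proof -
      have "(mon (e n) has_derivative (\<lambda>h. \<Sum>j\<in>UNIV. h $ j * pd j (mon (e n)) (x - x0))) (at (x - x0))"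
        by (rule has_derivative_pd[OF smooth_differentiable]) simp
      moreover have "((\<lambda>x. x - x0) has_derivative (\<lambda>h. h)) (at x within S)"
        by (auto intro!: derivative_eq_intros)
      ultimately have "((\<lambda>x. mon (e n) (x - x0)) has_derivative (\<lambda>h. \<Sum>j\<in>UNIV. h $ j * pd j (mon (e n)) (x - x0))) (at x within S)"
        using has_derivative_compose[where f="\<lambda>x. x - x0" and f'="\<lambda>h. h" and g="mon (e n)"] by blast
      from has_derivative_mult_left[OF this, of "c (e n)"] show ?thesis
        by (simp add: pd_mon t_def sum_distrib_left sum_distrib_right mult_ac)
    qed
    show "\<forall>\<^sub>F n in sequentially. \<forall>x\<in>S. \<forall>h. norm ((\<Sum>i<n. \<Sum>j\<in>UNIV. h $ j * t j (e i) x)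
        - (\<Sum>j\<in>UNIV. h $ j * D j x)) <= \<epsilon> * norm h" if "\<epsilon> > 0" for \<epsilon>
    proof -
      have "\<epsilon> / d > 0" using that d by simp
      hence "\<forall>\<^sub>F n in sequentially. \<forall>x\<in>S. dist (\<Sum>i<n. t j (e i) x) (D j x) < \<epsilon> / d" for j
        using uniform_limitD[OF ul] by blast
      hence "\<forall>\<^sub>F n in sequentially. \<forall>j\<in>UNIV. \<forall>x\<in>S. dist (\<Sum>i<n. t j (e i) x) (D j x) < \<epsilon> / d"
        by (intro eventually_ball_finite) auto
      thus ?thesis
      proof (eventually_elim, intro ballI allI)
        fix n x and h :: "real^'d"
        assume a: "\<forall>j\<in>UNIV. \<forall>x\<in>S. dist (\<Sum>i<n. t j (e i) x) (D j x) < \<epsilon> / d" and x: "x \<in> S"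
        have "(\<Sum>i<n. \<Sum>j\<in>UNIV. h $ j * t j (e i) x) - (\<Sum>j\<in>UNIV. h $ j * D j x)
          = (\<Sum>j\<in>UNIV. h $ j * ((\<Sum>i<n. t j (e i) x) - D j x))"
          by (subst sum.swap) (simp add: sum_distrib_left sum_subtractf right_diff_distrib)
        also have "norm \<dots> <= (\<Sum>j\<in>(UNIV::'d set). norm h * (\<epsilon> / d))"
        proof (rule sum_norm_le)
          fix j
          have "dist (\<Sum>i<n. t j (e i) x) (D j x) < \<epsilon> / d" using a x by blast
          thus "norm (h $ j * ((\<Sum>i<n. t j (e i) x) - D j x)) <= norm h * (\<epsilon> / d)"
            unfolding norm_mult by (intro mult_mono) (auto simp: dist_real_def component_le_norm_cart)
        qed
        also have "\<dots> = \<epsilon> * norm h" using d by (simp add: d_def)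
        finally show "norm ((\<Sum>i<n. \<Sum>j\<in>UNIV. h $ j * t j (e i) x) - (\<Sum>j\<in>UNIV. h $ j * D j x)) <= \<epsilon> * norm h" .
      qed
    qed
    show "x0 \<in> S" using r' by (simp add: S_def)
    show "(\<lambda>n. mon (e n) (x0 - x0) * c (e n)) sums g x0"
    proof (rule has_sum_imp_sums)
      have "((\<lambda>\<alpha>. mon \<alpha> (x0 - x0) * c \<alpha>) has_sum g x0) UNIV" by (rule hs) (use r in simp)
      thus "((\<lambda>n. mon (e n) (x0 - x0) * c (e n)) has_sum g x0) UNIV"
        using has_sum_reindex_bij_betw[OF e, of "\<lambda>\<alpha>. mon \<alpha> (x0 - x0) * c \<alpha>"] by simp
    qed
  qed
  then obtain G where G: "\<And>x. x \<in> S ==> (\<lambda>n. mon (e n) (x - x0) * c (e n)) sums G x"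
    "\<And>x. x \<in> S ==> (G has_derivative (\<lambda>h. \<Sum>j\<in>UNIV. h $ j * D j x)) (at x within S)" by blast
  have Gg: "G x = g x" if "x \<in> S" for x
  proof -
    have "x \<in> ball x0 r" using that r' by (auto simp: S_def)
    hence "(\<lambda>n. mon (e n) (x - x0) * c (e n)) sums g x"
      using has_sum_reindex_bij_betw[OF e, of "\<lambda>\<alpha>. mon \<alpha> (x - x0) * c \<alpha>"] hs
      by (intro has_sum_imp_sums) simp
    thus ?thesis using G(1)[OF that] sums_unique2 by blast
  qed
  have dg: "(g has_derivative (\<lambda>h. \<Sum>j\<in>UNIV. h $ j * D j x)) (at x)" if "x \<in> S" for x
  proof (rule has_derivative_transform_within_open[where s=S])
    show "(G has_derivative (\<lambda>h. \<Sum>j\<in>UNIV. h $ j * D j x)) (at x)"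
      using G(2)[OF that] that by (simp add: S_def at_within_open[OF _ open_ball])
  qed (use Gg that in \<open>auto simp: S_def\<close>)
  have "pd j g x = D j x" if "x \<in> S" for x j
    by (subst pd_eqI[OF dg[OF that]]) (simp add: axis_def if_distrib if_distribR cong: if_cong)
  moreover have "((\<lambda>\<alpha>. mon \<alpha> (x - x0) * (real (Suc (\<alpha> j)) * c (raise j \<alpha>))) has_sum D j x) UNIV" if "x \<in> S" for x j
  proof -
    have "(\<lambda>\<alpha>. norm (t j \<alpha> x)) summable_on UNIV"
      by (rule Infinite_Sum.abs_summable_on_comparison_test'[OF bs]) (use tb[OF that] in auto)
    hence "(\<lambda>\<alpha>. t j \<alpha> x) summable_on UNIV" by (rule abs_summable_summable)
    then obtain l where l: "((\<lambda>\<alpha>. t j \<alpha> x) has_sum l) UNIV" by (auto simp: summable_on_def)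
    hence "(\<lambda>n. t j (e n) x) sums l"
      using has_sum_reindex_bij_betw[OF e, of "\<lambda>\<alpha>. t j \<alpha> x"] by (intro has_sum_imp_sums) simp
    hence lD: "l = D j x" unfolding D_def by (simp add: sums_iff)
    \<comment> \<open>Outside the range of \<open>raise j\<close> the exponent
      \<open>\<alpha> j\<close> is \<open>0\<close> and the term vanishes, so the sum can be
      reindexed into a power series.\<close>
    have "((\<lambda>\<alpha>. t j \<alpha> x) has_sum l) (range (raise j))"
    proof (rule has_sum_cong_neutral[THEN iffD1, OF _ _ _ l])
      fix \<alpha> assume "\<alpha> \<in> UNIV - range (raise j)"
      moreover have "\<alpha> = raise j (lower j \<alpha>)" if "\<alpha> j \<noteq> 0" using that by (auto simp: raise_def lower_def)
      ultimately have "\<alpha> j = 0" by blast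
      thus "t j \<alpha> x = 0" by (simp add: t_def)
    qed auto
    moreover have "inj (raise j)"
      by (rule injI) (metis raise_def fun_upd_same fun_upd_triv fun_upd_upd nat.inject)
    ultimately have "((\<lambda>\<alpha>. t j (raise j \<alpha>) x) has_sum l) UNIV"
      by (simp add: has_sum_reindex o_def)
    moreover have "lower j (raise j \<alpha>) = \<alpha>" for \<alpha> by (simp add: lower_def raise_def)
    hence "t j (raise j \<alpha>) x = mon \<alpha> (x - x0) * (real (Suc (\<alpha> j)) * c (raise j \<alpha>))" for \<alpha>
      by (simp add: t_def) (simp add: raise_def)
    ultimately show ?thesis using lD by simp
  qed
  ultimately have "psum (\<lambda>\<alpha>. real (Suc (\<alpha> j)) * c (raise j \<alpha>)) x0 r' (pd j g)" for j
    using r' by (simp add: psum_def S_def)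
  moreover have "g differentiable (at x)" if "x \<in> ball x0 r'" for x
    using dg that by (auto simp: S_def differentiable_def)
  ultimately show ?thesis using r' that by blast
qed

definition analytic_fun :: "(real^'d::finite => real) => bool" where
  "analytic_fun g \<longleftrightarrow> (\<forall>x0. \<exists>c r. psum c x0 r g)"

lemma analytic_fun_pd: "analytic_fun g ==> analytic_fun (pd j g)"
  unfolding analytic_fun_def by (meson psum_derivative)

lemma analytic_fun_smooth:
  assumes "analytic_fun g" shows "smooth g"
proof -
  have "dn n g" if "analytic_fun g" for n and g :: "real^'a => real"
    using that
  proof (induction n arbitrary: g)
    case (Suc n)
    have "g differentiable (at x)" for x
    proof -
      obtain c r where "psum c x r g" using Suc.prems unfolding analytic_fun_def by blast
      from psum_derivative[OF this] show ?thesis by (metis centre_in_ball)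
    qed
    thus ?case using Suc analytic_fun_pd by auto
  qed simp
  thus ?thesis using assms by (simp add: smooth_def)
qed

lemma analytic_component:
  assumes "real_analytic F"
  shows "analytic_fun (\<lambda>x. F x $ j)"
  unfolding analytic_fun_def
proof
  fix x0
  obtain r c where r: "r > 0" and
    h: "\<And>x. x \<in> ball x0 r ==> ((\<lambda>\<alpha>. (\<Prod>i\<in>UNIV. (x $ i - x0 $ i) ^ \<alpha> i) *\<^sub>R c \<alpha>) has_sum F x) UNIV"
    using assms unfolding real_analytic_def by meson
  have "psum (\<lambda>\<alpha>. c \<alpha> $ j) x0 r (\<lambda>x. F x $ j)"
    unfolding psum_def
    using r has_sum_bounded_linear[OF bounded_linear_vec_nth h, of _ j] by (auto simp: mon_def)
  thus "\<exists>c r. psum c x0 r (\<lambda>x. F x $ j)" by blast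
qed

text \<open>The series of \<open>pd j g\<close> starts at most one degree earlier than that of
  \<open>g\<close>, so the induction passes to the partial derivatives.\<close>

lemma psum_flat:
  assumes "smooth g" "psum c 0 r g" "\<And>\<alpha>. deg \<alpha> < q ==> c \<alpha> = 0"
  shows "flat q g"
  using assms
proof (induction q arbitrary: g c r)
  case (Suc q)
  have "((\<lambda>\<alpha>. mon \<alpha> 0 * c \<alpha>) has_sum g 0) UNIV" using Suc.prems(2) by (force simp: psum_def)
  moreover have "(\<lambda>\<alpha>. mon \<alpha> 0 * c \<alpha>) = (\<lambda>\<alpha>. 0)"
    using Suc.prems(3) by (auto simp: mon_at_0 fun_eq_iff deg_def)
  ultimately have "g 0 = 0" using has_sum_0 has_sum_unique by (metis (mono_tags, lifting))
  moreover have "flat q (pd j g)" for j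
  proof -
    obtain r' where "psum (\<lambda>\<alpha>. real (Suc (\<alpha> j)) * c (raise j \<alpha>)) 0 r' (pd j g)"
      using psum_derivative[OF Suc.prems(2)] by metis
    thus ?thesis by (rule Suc.IH[rotated]) (use Suc.prems smooth_pd in auto)
  qed
  ultimately show ?case by simp
qed simp

text \<open>Removing the finitely many terms of low degree from the expansion at \<open>0\<close>
  leaves a series for \<open>psum_flat\<close>. Later arguments use analyticity only through such
  finite expansions and smoothness.\<close>

lemma analytic_taylor:
  assumes "analytic_fun g"
  obtains c where "flat (Suc N) (\<lambda>x. g x - (\<Sum>\<alpha>\<in>{\<alpha>. deg \<alpha> <= N}. c \<alpha> * mon \<alpha> x))"
proof -
  obtain c r where c: "psum c 0 r g" using assms unfolding analytic_fun_def by blast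
  let ?p = "\<lambda>x. \<Sum>\<alpha>\<in>{\<alpha>. deg \<alpha> <= N}. c \<alpha> * mon \<alpha> x"
  have "psum (\<lambda>\<alpha>. if deg \<alpha> <= N then 0 else c \<alpha>) 0 r (\<lambda>x. g x - ?p x)"
    unfolding psum_def
  proof (intro conjI ballI)
    show "r > 0" using c by (simp add: psum_def)
    fix x assume "x \<in> ball (0::real^'a) r"
    hence "((\<lambda>\<alpha>. mon \<alpha> (x - 0) * c \<alpha>) has_sum g x) UNIV" using c by (auto simp: psum_def)
    moreover have "((\<lambda>\<alpha>. - (if deg \<alpha> <= N then c \<alpha> * mon \<alpha> x else 0)) has_sum - ?p x) UNIV"
      by (rule has_sum_finite_neutralI[where B="{\<alpha>. deg \<alpha> <= N}"]) (auto simp: sum_negf)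
    ultimately have "((\<lambda>\<alpha>. mon \<alpha> (x - 0) * c \<alpha> + - (if deg \<alpha> <= N then c \<alpha> * mon \<alpha> x else 0)) has_sum (g x + - ?p x)) UNIV"
      by (rule has_sum_add)
    thus "((\<lambda>\<alpha>. mon \<alpha> (x - 0) * (if deg \<alpha> <= N then 0 else c \<alpha>)) has_sum (g x - ?p x)) UNIV"
      by (simp add: if_distrib cong: if_cong)
  qed
  moreover have "smooth (\<lambda>x. g x - ?p x)"
    by (intro smooth_diff smooth_sum smooth_cmult smooth_mon analytic_fun_smooth[OF assms])
  ultimately have "flat (Suc N) (\<lambda>x. g x - ?p x)"
    by (intro psum_flat[where c="\<lambda>\<alpha>. if deg \<alpha> <= N then 0 else c \<alpha>"]) auto
  thus ?thesis using that by blast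
qed

section \<open>The Lie algebra homomorphism to vector fields\<close>

subsection \<open>The free associative algebra as differential operators\<close>

primrec wact :: "(letter => real^'d::finite => real^'d) => letter list => (real^'d => real) => real^'d => real" where
  "wact f [] h = h"
| "wact f (i # w) h = der (f i) (wact f w h)"

text \<open>\<open>Lam\<close> is a definite description, so existence has to be shown. Differential
  operators form an associative algebra, hence the derivations along the generators extend freely to
  words; the homomorphism to vector fields is the restriction of this representation to
  \<open>free_Lie\<close>.\<close>

definition rho :: "(letter => real^'d::finite => real^'d) => free_alg => (real^'d => real) => real^'d => real" where
  "rho f a h x = (\<Sum>w\<in>Poly_Mapping.keys a. Poly_Mapping.lookup a w * wact f w h x)"

lemma rho_superset:
  "finite S ==> Poly_Mapping.keys a \<subseteq> S ==> rho f a h x = (\<Sum>w\<in>S. Poly_Mapping.lookup a w * wact f w h x)"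
  unfolding rho_def by (rule sum.mono_neutral_left) (auto simp: in_keys_iff)

lemma rho_add: "rho f (a + b) h x = rho f a h x + rho f b h x"
proof -
  let ?S = "Poly_Mapping.keys a \<union> Poly_Mapping.keys b"
  have "rho f c h x = (\<Sum>w\<in>?S. Poly_Mapping.lookup c w * wact f w h x)" if "c \<in> {a, b, a + b}" for c
    using that Poly_Mapping.keys_add[of a b] by (intro rho_superset) auto
  thus ?thesis by (simp add: lookup_add algebra_simps sum.distrib)
qed

lemma rho_scaleR: "rho f (c *\<^sub>R a) h x = c * rho f a h x"
proof -
  have l: "Poly_Mapping.lookup (c *\<^sub>R a) w = c * Poly_Mapping.lookup a w" for w
    by (simp add: scaleR_poly_mapping.rep_eq)
  have "Poly_Mapping.keys (c *\<^sub>R a) \<subseteq> Poly_Mapping.keys a"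
    by (auto simp: in_keys_iff l)
  thus ?thesis
    by (subst rho_superset[of "Poly_Mapping.keys a"]) (auto simp: l rho_def sum_distrib_left mult_ac)
qed

lemma rho_uminus: "rho f (- a) h x = - rho f a h x"
  using rho_scaleR[of f "-1" a] by simp

lemma rho_diff: "rho f (a - b) h x = rho f a h x - rho f b h x"
  using rho_add[of f a "- b"] by (simp add: rho_uminus)

lemma rho_zero: "rho f 0 h x = 0"
  by (simp add: rho_def)

lemma rho_single: "rho f (Poly_Mapping.single w c) h x = c * wact f w h x"
  by (cases "c = 0") (simp_all add: rho_def)

lemma free_alg_induct [case_names zero single add]:
  fixes a :: free_alg
  assumes "P 0" "\<And>w c. P (Poly_Mapping.single w c)" "\<And>a b. P a ==> P b ==> P (a + b)"
  shows "P a"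
proof -
  have "P (\<Sum>w\<in>S. Poly_Mapping.single w (Poly_Mapping.lookup a w))" if "finite S" for S
    using that assms by (induction S) auto
  moreover have "a = (\<Sum>w\<in>Poly_Mapping.keys a. Poly_Mapping.single w (Poly_Mapping.lookup a w))"
    by (rule poly_mapping_eqI) (auto simp: lookup_sum lookup_single when_def in_keys_iff)
  ultimately show ?thesis by (metis finite_keys)
qed

context
  fixes f :: "letter => real^'d::finite => real^'d"
  assumes sf: "\<And>i. sfield (f i)"
begin

lemma smooth_wact: "smooth h ==> smooth (wact f w h)"
  by (induction w) (auto intro: smooth_der sf)

lemma smooth_rho: "smooth h ==> smooth (rho f a h)"
  unfolding rho_def[abs_def] by (intro smooth_sum smooth_cmult smooth_wact)

lemma wact_lin:
  "smooth g ==> smooth h ==> wact f w (\<lambda>x. g x + h x) = (\<lambda>x. wact f w g x + wact f w h x)"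
  "smooth h ==> wact f w (\<lambda>x. c * h x) = (\<lambda>x. c * wact f w h x)"
  by (induction w) (auto simp: der_add der_cmult smooth_wact)

lemma wact_append: "wact f (v @ w) h = wact f v (wact f w h)"
  by (induction v) auto

lemma rho_add_fun: "smooth g ==> smooth h ==> rho f a (\<lambda>x. g x + h x) x = rho f a g x + rho f a h x"
  by (simp add: rho_def wact_lin algebra_simps sum.distrib)

lemma rho_zero_fun: "rho f a (\<lambda>x. 0) x = 0"
  using rho_add_fun[of "\<lambda>x. 0" "\<lambda>x. 0" a x] by simp

lemma rho_mult:
  assumes h: "smooth h"
  shows "rho f (a * b) h = rho f a (rho f b h)"
proof
  fix x
  show "rho f (a * b) h x = rho f a (rho f b h) x"
  proof (induction a rule: free_alg_induct)
    case (single v c)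
    show ?case
    proof (induction b rule: free_alg_induct)
      case zero
      thus ?case by (simp add: rho_zero rho_zero_fun rho_zero[abs_def])
    next
      case (single w d)
      have "rho f (Poly_Mapping.single w d) h = (\<lambda>x. d * wact f w h x)" by (simp add: rho_single fun_eq_iff)
      thus ?case
        by (simp add: mult_single rho_single plus_list_def wact_append wact_lin smooth_wact h)
    next
      case (add a b)
      have "rho f (a + b) h = (\<lambda>x. rho f a h x + rho f b h x)" by (simp add: rho_add fun_eq_iff)
      thus ?case using add by (simp add: distrib_left rho_add rho_add_fun smooth_rho h)
    qed
  qed (simp_all add: rho_zero rho_add distrib_right)
qed

end

subsection \<open>The homomorphism to vector fields\<close>

lemma subspace_free_Lie: "subspace free_Lie"
  unfolding free_Lie_def by (rule subspace_Inter) auto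

lemma gen_free_Lie [simp]: "gen i \<in> free_Lie"
  by (auto simp: free_Lie_def)

lemma comm_free_Lie [simp]: "a \<in> free_Lie ==> b \<in> free_Lie ==> comm a b \<in> free_Lie"
  by (simp add: free_Lie_def)

lemma free_Lie_simps [simp]:
  "0 \<in> free_Lie" "a \<in> free_Lie ==> b \<in> free_Lie ==> a + b \<in> free_Lie" "a \<in> free_Lie ==> c *\<^sub>R a \<in> free_Lie"
  using subspace_free_Lie by (auto simp: subspace_def)

lemma sum_free_Lie: "(\<And>i. i \<in> I ==> a i \<in> free_Lie) ==> (\<Sum>i\<in>I. a i) \<in> free_Lie"
  using subspace_sum[OF subspace_free_Lie] by blast

lemma Ev_free_Lie [simp]: "Ev b \<in> free_Lie"
  by (induction b) auto

lemma free_Lie_induct [consumes 1, case_names zero gen add scale comm]: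
  assumes "a \<in> free_Lie"
    and "P 0" "\<And>i. P (gen i)"
    and "\<And>a b. a \<in> free_Lie ==> b \<in> free_Lie ==> P a ==> P b ==> P (a + b)"
    and "\<And>c a. a \<in> free_Lie ==> P a ==> P (c *\<^sub>R a)"
    and "\<And>a b. a \<in> free_Lie ==> b \<in> free_Lie ==> P a ==> P b ==> P (comm a b)"
  shows "P a"
proof -
  have "free_Lie \<subseteq> {a \<in> free_Lie. P a}"
    by (subst (1) free_Lie_def, rule Inter_lower) (use assms(2-) in \<open>auto simp: subspace_def\<close>)
  thus ?thesis using assms(1) by blast
qed

text \<open>A derivation is determined by its values on the coordinate functions. For elements of
  \<open>free_Lie\<close> these values recover the whole operator, see
  \<open>rho_lfield\<close>.\<close>

definition lfield :: "(letter => real^'d::finite => real^'d) => free_alg => real^'d => real^'d" where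
  "lfield f a x = (\<chi> j. rho f a (\<lambda>y. y $ j) x)"

context
  fixes f :: "letter => real^'d::finite => real^'d"
  assumes sf: "\<And>i. sfield (f i)"
begin

lemma lfield_sfield: "sfield (lfield f a)"
  by (simp add: sfield_def lfield_def smooth_rho[OF sf])

lemma lfield_gen: "lfield f (gen i) = f i"
  by (simp add: lfield_def gen_def rho_single fun_eq_iff vec_eq_iff)

lemma lfield_add: "lfield f (a + b) = (\<lambda>x. lfield f a x + lfield f b x)"
  by (simp add: lfield_def rho_add fun_eq_iff vec_eq_iff)

lemma lfield_scaleR: "lfield f (c *\<^sub>R a) = (\<lambda>x. c *\<^sub>R lfield f a x)"
  by (simp add: lfield_def rho_scaleR fun_eq_iff vec_eq_iff)

lemma rho_comm: "smooth h ==> rho f (comm a b) h x = rho f a (rho f b h) x - rho f b (rho f a h) x"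
  by (simp add: comm_def rho_diff rho_mult[OF sf])

text \<open>Lie elements act as derivations, because the commutator of two derivations is the
  derivation along the bracket of the fields (\<open>der_bracket\<close>).\<close>

lemma rho_lfield: "a \<in> free_Lie ==> smooth h ==> rho f a h = der (lfield f a) h"
proof (induction a arbitrary: h rule: free_Lie_induct)
  case zero
  show ?case by (simp add: rho_zero der_def lfield_def fun_eq_iff)
next
  case (gen i)
  thus ?case by (simp only: lfield_gen) (simp add: gen_def rho_single fun_eq_iff)
next
  case (add a b)
  thus ?case
    by (simp add: fun_eq_iff rho_add lfield_add der_def algebra_simps sum.distrib)
next
  case (scale c a)
  thus ?case
    by (simp add: fun_eq_iff rho_scaleR lfield_scaleR der_def sum_distrib_left mult_ac)
next
  case (comm a b)
  have *: "rho f (Defs.comm a b) h x = der (field_bracket (lfield f a) (lfield f b)) h x" if "smooth h" for h x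
    using that by (simp add: rho_comm comm smooth_rho[OF sf] smooth_der lfield_sfield der_bracket)
  have "lfield f (Defs.comm a b) x = field_bracket (lfield f a) (lfield f b) x" for x
    by (simp add: vec_eq_iff lfield_def[of f "Defs.comm a b"] *)
  hence "lfield f (Defs.comm a b) = field_bracket (lfield f a) (lfield f b)" by (rule ext)
  thus ?case using * comm.prems by (simp add: fun_eq_iff)
qed

lemma lfield_comm:
  assumes "a \<in> free_Lie" "b \<in> free_Lie"
  shows "lfield f (comm a b) = field_bracket (lfield f a) (lfield f b)"
proof (intro ext, subst vec_eq_iff, intro allI)
  fix x j
  have "lfield f (comm a b) x $ j = rho f a (rho f b (\<lambda>y. y $ j)) x - rho f b (rho f a (\<lambda>y. y $ j)) x"
    by (simp add: lfield_def[of f "comm a b"] rho_comm)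
  also have "\<dots> = field_bracket (lfield f a) (lfield f b) x $ j"
    by (simp add: rho_lfield assms smooth_der lfield_sfield field_bracket_der)
      (simp add: rho_lfield assms sfield_def[THEN iffD1, OF lfield_sfield])
  finally show "lfield f (comm a b) x $ j = field_bracket (lfield f a) (lfield f b) x $ j" .
qed

lemma Lam_eq:
  "Lam f = (\<lambda>a. if a \<in> free_Lie then lfield f a else undefined)" (is "_ = ?L")
  unfolding Lam_def
proof (rule the_equality)
  show "Lie_hom ?L \<and> (\<forall>i. ?L (gen i) = f i) \<and> ?L \<in> extensional free_Lie"
    by (auto simp: Lie_hom_def lfield_gen lfield_add lfield_scaleR lfield_comm lfield_sfield sfield_smooth_field extensional_def)
next
  fix L :: "free_alg => real^'d => real^'d"
  assume L: "Lie_hom L \<and> (\<forall>i. L (gen i) = f i) \<and> L \<in> extensional free_Lie"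
  have "L a = lfield f a" if "a \<in> free_Lie" for a
    using that
  proof (induction rule: free_Lie_induct)
    case zero
    \<comment> \<open>\<open>Lie_hom\<close> does not speak about \<open>0\<close>, which is reached
      as a multiple of a generator.\<close>
    have "L (0 *\<^sub>R gen X0) = (\<lambda>x. 0 *\<^sub>R L (gen X0) x)" using L gen_free_Lie[of X0] unfolding Lie_hom_def by metis
    thus ?case using lfield_scaleR[of 0 "gen X0"] by simp
  qed (use L in \<open>auto simp: Lie_hom_def lfield_gen lfield_add lfield_scaleR lfield_comm\<close>)
  thus "L = ?L" using L by (auto simp: fun_eq_iff extensional_def)
qed

lemma Lam_sfield: "a \<in> free_Lie ==> sfield (Lam f a)"
  by (simp add: Lam_eq lfield_sfield)

lemma Lam_gen: "Lam f (gen i) = f i"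
  by (simp add: Lam_eq lfield_gen)

lemma Lam_add: "a \<in> free_Lie ==> b \<in> free_Lie ==> Lam f (a + b) x = Lam f a x + Lam f b x"
  by (simp add: Lam_eq lfield_add)

lemma Lam_scaleR: "a \<in> free_Lie ==> Lam f (c *\<^sub>R a) x = c *\<^sub>R Lam f a x"
  by (simp add: Lam_eq lfield_scaleR)

lemma Lam_zero: "Lam f 0 x = 0"
  using Lam_scaleR[of "gen X0" 0 x] by simp

lemma Lam_sum: "(\<And>i. i \<in> I ==> a i \<in> free_Lie) ==> Lam f (\<Sum>i\<in>I. a i) x = (\<Sum>i\<in>I. Lam f (a i) x)"
  by (induction I rule: infinite_finite_induct) (auto simp: Lam_zero Lam_add sum_free_Lie)

lemma Lam_comm:
  "a \<in> free_Lie ==> b \<in> free_Lie ==> Lam f (comm a b) = field_bracket (Lam f a) (Lam f b)"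
  by (simp add: Lam_eq lfield_comm)

end

section \<open>The Magnus logarithm\<close>

subsection \<open>Linear differential equations on short intervals\<close>

lemma hvd_continuous_on:
  "(\<And>t. t \<in> S ==> (f has_vector_derivative f' t) (at t within S)) ==> continuous_on S f"
  unfolding continuous_on_eq_continuous_within using has_vector_derivative_continuous by blast

text \<open>Gronwall without an exponential: at the maximum of \<open>norm (y t)\<close> the linear
  term contributes at most half of that maximum and is absorbed. Many factors \<open>2\<close> in
  later bounds come from here.\<close>

lemma gronwall_short:
  fixes y :: "real => 'b::banach"
  assumes T: "T \<ge> 0" and y0: "y 0 = 0"
    and d: "\<And>t. t \<in> {0..T} ==> (y has_vector_derivative y' t) (at t within {0..T})"
    and b: "\<And>t. t \<in> {0..T} ==> norm (y' t) <= l t * norm (y t) + q t"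
    and c: "continuous_on {0..T} l" "continuous_on {0..T} q"
    and pos: "\<And>t. t \<in> {0..T} ==> l t \<ge> 0" "\<And>t. t \<in> {0..T} ==> q t \<ge> 0"
    and small: "integral {0..T} l <= 1/2"
    and t: "t \<in> {0..T}"
  shows "norm (y t) <= 2 * integral {0..T} q"
proof -
  have cy: "continuous_on {0..T} y"
    by (rule hvd_continuous_on[OF d])
  have il: "l integrable_on {0..T}" and iq: "q integrable_on {0..T}"
    using c integrable_continuous_real by auto
  obtain m where m: "m \<in> {0..T}" "\<And>s. s \<in> {0..T} ==> norm (y s) <= norm (y m)"
    using continuous_attains_sup[OF compact_Icc _ continuous_on_norm[OF cy]] T by force
  have sub: "{0..m} \<subseteq> {0..T}" using m by auto
  have ftc: "(y' has_integral (y m - y 0)) {0..m}"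
    by (rule fundamental_theorem_of_calculus) (use m d sub has_vector_derivative_within_subset[OF d sub] in auto)
  have i: "(\<lambda>s. l s * norm (y m) + q s) integrable_on {0..m}"
    using integrable_on_subinterval[OF il sub] integrable_on_subinterval[OF iq sub]
    by (intro integrable_add integrable_on_mult_left)
  have "norm (y m) <= integral {0..m} (\<lambda>s. l s * norm (y m) + q s)"
  proof -
    have "norm (integral {0..m} y') <= integral {0..m} (\<lambda>s. l s * norm (y m) + q s)"
    proof (rule integral_norm_bound_integral)
      show "y' integrable_on {0..m}" using ftc by blast
      fix s assume "s \<in> {0..m}"
      hence s: "s \<in> {0..T}" using sub by auto
      have "l s * norm (y s) <= l s * norm (y m)" by (intro mult_left_mono m pos s)
      thus "norm (y' s) <= l s * norm (y m) + q s" using b[OF s] by linarith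
    qed (rule i)
    thus ?thesis using ftc y0 by (simp add: integral_unique)
  qed
  also have "\<dots> <= integral {0..T} (\<lambda>s. l s * norm (y m) + q s)"
    by (rule integral_subset_le[OF sub i]) (use il iq pos in \<open>auto intro!: integrable_add integrable_on_mult_left\<close>)
  also have "\<dots> = integral {0..T} l * norm (y m) + integral {0..T} q"
    using il iq by (simp add: integral_add integrable_on_mult_left integral_mult_left)
  also have "\<dots> <= 1/2 * norm (y m) + integral {0..T} q"
    using small by (intro add_right_mono mult_right_mono) auto
  finally show ?thesis using m(2)[OF t] by linarith
qed

definition lbr :: "'a::ring => 'a => 'a" where
  "lbr a b = a * b - b * a"

lemma norm_lbr_le:
  fixes a b :: "'a::real_normed_algebra"
  shows "norm (lbr a b) <= 2 * norm a * norm b"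
proof -
  have "norm (lbr a b) <= norm (a * b) + norm (b * a)" unfolding lbr_def by (rule norm_triangle_ineq4)
  also have "\<dots> <= norm a * norm b + norm b * norm a" by (intro add_mono norm_mult_ineq)
  finally show ?thesis by (simp add: mult_ac)
qed

text \<open>Variation of constants: conjugation by \<open>exp (t *\<^sub>R A)\<close> trivialises
  the inner derivation \<open>lbr A\<close>, and the source is integrated in the conjugated
  frame.\<close>

lemma lbr_ode_exists:
  fixes A :: "'a::{real_normed_algebra_1,banach}"
  assumes Q: "continuous_on {0..T} Q" and T: "T \<ge> 0"
  shows "\<exists>R. R 0 = 0 \<and> (\<forall>t\<in>{0..T}. (R has_vector_derivative (lbr A (R t) + Q t)) (at t within {0..T}))"
proof -
  define e where "e s = exp (s *\<^sub>R A)" for s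
  have e: "(e has_vector_derivative e s * A) (at s within S)" "(e has_vector_derivative A * e s) (at s within S)" for s S
    unfolding e_def
    by (intro exp_scaleR_has_vector_derivative_right has_vector_derivative_at_within[OF exp_scaleR_has_vector_derivative_left])+
  have inv: "e s * e (- s) = 1" "e (- s) * e s = 1" for s
    using exp_minus_inverse[of "s *\<^sub>R A"] exp_minus_inverse[of "- s *\<^sub>R A"] by (simp_all add: e_def)
  have ce: "continuous_on S e" for S
    by (rule hvd_continuous_on[OF e(1)])
  define F where "F s = e (- s) * Q s * e s" for s
  have "continuous_on {0..T} (\<lambda>s. e (- s))"
    by (rule continuous_on_compose2[OF ce[of UNIV]]) (auto intro!: continuous_intros)
  hence "continuous_on {0..T} F" unfolding F_def by (intro continuous_on_mult Q ce)
  hence I: "((\<lambda>u. integral {0..u} F) has_vector_derivative F t) (at t within {0..T})" if "t \<in> {0..T}" for t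
    using integral_has_vector_derivative that by blast
  define R where "R t = e t * integral {0..t} F * e (- t)" for t
  have em: "((\<lambda>t. e (- t)) has_vector_derivative (- (A * e (- t)))) (at t within S)" for t S
  proof -
    have "((e \<circ> uminus) has_vector_derivative (-1 *\<^sub>R (A * e (- t)))) (at t within S)"
      by (rule vector_diff_chain_within) (auto intro!: derivative_eq_intros e)
    thus ?thesis by (simp add: o_def)
  qed
  have "(R has_vector_derivative (lbr A (R t) + Q t)) (at t within {0..T})" if t: "t \<in> {0..T}" for t
  proof -
    have "(R has_vector_derivative
       ((e t * integral {0..t} F) * (- (A * e (- t))) + (e t * F t + (A * e t) * integral {0..t} F) * e (- t))) (at t within {0..T})"
      unfolding R_def by (intro has_vector_derivative_mult e em I t)
    moreover have "e t * F t * e (- t) = Q t"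
      unfolding F_def using inv[of t] by (metis mult.assoc mult.right_neutral mult.left_neutral)
    moreover have "A * e (- t) = e (- t) * A"
      using exp_times_scaleR_commute[of "- t" A] by (simp add: e_def)
    ultimately show ?thesis by (simp add: R_def lbr_def algebra_simps)
  qed
  thus ?thesis by (intro exI[of _ R]) (simp add: R_def)
qed

subsection \<open>Closed Lie subspaces\<close>

text \<open>Bi-annihilators avoid having to show that spans are closed.\<close>
definition bispan :: "'a::real_normed_vector set => 'a set" where
  "bispan S = {b. \<forall>\<Psi>::'a => 'a. bounded_linear \<Psi> --> (\<forall>x\<in>S. \<Psi> x = 0) --> \<Psi> b = 0}"

lemma bispanD:
  fixes \<Psi> :: "'a::real_normed_vector => 'a"
  shows "b \<in> bispan S ==> bounded_linear \<Psi> ==> (\<And>x. x \<in> S ==> \<Psi> x = 0) ==> \<Psi> b = 0"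
  by (auto simp: bispan_def)

lemma bispan_base: "x \<in> S ==> x \<in> bispan S"
  by (auto simp: bispan_def)

lemma subspace_bispan: "subspace (bispan S)"
proof -
  have "0 \<in> bispan S"
    by (auto simp: bispan_def linear_0 bounded_linear.linear)
  moreover have "x + y \<in> bispan S" if "x \<in> bispan S" "y \<in> bispan S" for x y
    using that by (auto simp: bispan_def linear_add bounded_linear.linear)
  moreover have "c *\<^sub>R x \<in> bispan S" if "x \<in> bispan S" for x c
    using that by (auto simp: bispan_def linear_cmul bounded_linear.linear)
  ultimately show ?thesis unfolding subspace_def by blast
qed

text \<open>\<open>bispan\<close> tests with maps of the algebra to itself, so that tests can be
  composed with brackets; real functionals are recovered by multiplying their values with the
  unit.\<close>

lemma bispan_real:
  fixes lam :: "'a::real_normed_algebra_1 => real"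
  assumes "b \<in> bispan S" "bounded_linear lam" "\<And>x. x \<in> S ==> lam x = 0"
  shows "lam b = 0"
proof -
  have "lam b *\<^sub>R (1::'a) = 0"
    by (rule bispanD[OF assms(1), of "\<lambda>x. lam x *\<^sub>R 1"])
      (use assms in \<open>auto intro: bounded_linear_scaleR_const\<close>)
  thus ?thesis by simp
qed

lemma bounded_linear_lbr:
  fixes a :: "'a::real_normed_algebra"
  shows "bounded_linear (\<lambda>b. lbr a b)" "bounded_linear (\<lambda>b. lbr b a)"
  unfolding lbr_def
  by (intro bounded_linear_sub bounded_linear_mult_left bounded_linear_mult_right)+

text \<open>A test of the bracket is linear in each argument separately, so the two memberships are
  used one after the other.\<close>

lemma bispan_lbr:
  fixes b c :: "'a::real_normed_algebra"
  assumes b: "b \<in> bispan S" and c: "c \<in> bispan S'"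
    and S: "\<And>x y. x \<in> S ==> y \<in> S' ==> lbr x y \<in> bispan S''"
  shows "lbr b c \<in> bispan S''"
  unfolding bispan_def
proof (intro CollectI allI impI)
  fix \<Psi> :: "'a => 'a" assume \<Psi>: "bounded_linear \<Psi>" "\<forall>x\<in>S''. \<Psi> x = 0"
  have "\<Psi> (lbr x y) = 0" if "x \<in> S" "y \<in> S'" for x y
    using bispanD[OF S[OF that] \<Psi>(1)] \<Psi>(2) by blast
  hence "\<Psi> (lbr x c) = 0" if "x \<in> S" for x
    using that by (intro bispanD[OF c bounded_linear_compose[OF \<Psi>(1) bounded_linear_lbr(1)]])
  thus "\<Psi> (lbr b c) = 0"
    by (intro bispanD[OF b bounded_linear_compose[OF \<Psi>(1) bounded_linear_lbr(2)]])
qed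

text \<open>If \<open>\<Psi>\<close> annihilates \<open>S\<close>, then \<open>\<Psi> z\<close> has
  derivative \<open>\<Psi> (lbr A z)\<close>, and the composition of \<open>\<Psi>\<close> with
  \<open>lbr A\<close> annihilates \<open>S\<close> again. Each of these integrations gains a factor
  \<open>2 * norm A * T <= 1/2\<close>, so \<open>\<Psi> z\<close> is bounded by a constant times
  \<open>(1/2) ^ n\<close> for every \<open>n\<close>.\<close>

lemma bispan_ode:
  fixes A :: "'a::{real_normed_algebra_1,banach}"
  assumes T: "T > 0" "4 * norm A * T <= 1" and z0: "z 0 = 0"
    and d: "\<And>t. t \<in> {0..T} ==> (z has_vector_derivative (lbr A (z t) + Y t)) (at t within {0..T})"
    and Y: "\<And>t. t \<in> {0..T} ==> Y t \<in> bispan S"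
    and S: "\<And>x. x \<in> S ==> lbr A x \<in> bispan S"
    and t: "t \<in> {0..T}"
  shows "z t \<in> bispan S"
proof -
  have cz: "continuous_on {0..T} z"
    by (rule hvd_continuous_on[OF d])
  obtain B where B: "\<And>t. t \<in> {0..T} ==> norm (z t) <= B"
    using compact_imp_bounded[OF compact_continuous_image[OF cz compact_Icc]]
    unfolding bounded_iff by blast
  have key: "norm (\<Psi> (z t)) <= K * B * (1/2) ^ n"
    if "bounded_linear \<Psi>" "\<forall>x\<in>S. \<Psi> x = 0" "\<And>x. norm (\<Psi> x) <= K * norm x" "t \<in> {0..T}" "K \<ge> 0"
    for \<Psi> :: "'a => 'a" and K t n
    using that
  proof (induction n arbitrary: \<Psi> K t)
    case 0
    have "norm (\<Psi> (z t)) <= K * norm (z t)" by (rule 0)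
    also have "\<dots> <= K * B" by (intro mult_left_mono B 0)
    finally show ?case by simp
  next
    case (Suc n)
    let ?L = "\<lambda>b. \<Psi> (lbr A b)"
    have L: "bounded_linear ?L" by (rule bounded_linear_compose[OF Suc.prems(1) bounded_linear_lbr(1)])
    have L0: "\<forall>x\<in>S. ?L x = 0" using S bispanD Suc.prems(1,2) by blast
    have LK: "norm (?L x) <= (K * (2 * norm A)) * norm x" for x
    proof -
      have "norm (?L x) <= K * norm (lbr A x)" by (rule Suc.prems(3))
      also have "\<dots> <= K * (2 * norm A * norm x)" by (intro mult_left_mono norm_lbr_le Suc.prems)
      finally show ?thesis by (simp add: mult_ac)
    qed
    have IH: "norm (?L (z s)) <= K * (2 * norm A) * B * (1/2) ^ n" if "s \<in> {0..T}" for s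
      by (rule Suc.IH[OF L L0 LK that]) (use Suc.prems in auto)
    have sub: "{0..t} \<subseteq> {0..T}" using Suc.prems by auto
    have dz: "((\<lambda>s. \<Psi> (z s)) has_vector_derivative ?L (z s)) (at s within {0..t})" if "s \<in> {0..t}" for s
    proof -
      have s: "s \<in> {0..T}" using that sub by auto
      have "((\<lambda>s. \<Psi> (z s)) has_vector_derivative \<Psi> (lbr A (z s) + Y s)) (at s within {0..t})"
        by (rule bounded_linear.has_vector_derivative[OF Suc.prems(1) has_vector_derivative_within_subset[OF d[OF s] sub]])
      moreover have "\<Psi> (Y s) = 0" using bispanD[OF Y[OF s]] Suc.prems by blast
      ultimately show ?thesis
        using linear_add[OF bounded_linear.linear[OF Suc.prems(1)]] by simp
    qed
    have B0: "B \<ge> 0" using B[of 0] T by (auto intro: order_trans[OF norm_ge_zero])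
    have "((\<lambda>s. ?L (z s)) has_integral (\<Psi> (z t) - \<Psi> (z 0))) {0..t}"
      by (rule fundamental_theorem_of_calculus) (use Suc.prems dz in auto)
    moreover have "0 <= K * (2 * norm A) * B * (1/2) ^ n" using Suc.prems B0 by simp
    ultimately have "norm (\<Psi> (z t) - \<Psi> (z 0)) <= (K * (2 * norm A) * B * (1/2) ^ n) * measure lborel {0..t}"
      by (intro has_integral_bound_real[OF _ finite.emptyI]) (use IH sub in auto)
    also have "\<dots> = (K * B * (1/2) ^ n) * (2 * norm A * t)" using Suc.prems by simp
    also have "\<dots> <= (K * B * (1/2) ^ n) * (1/2)"
    proof (rule mult_left_mono)
      have "norm A * t <= norm A * T" using Suc.prems by (intro mult_left_mono) auto
      thus "2 * norm A * t <= 1/2" using T by linarith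
    qed (use Suc.prems B0 in auto)
    finally show ?case using z0 linear_0[OF bounded_linear.linear[OF Suc.prems(1)]] by simp
  qed
  show ?thesis
    unfolding bispan_def
  proof (intro CollectI allI impI)
    fix \<Psi> :: "'a => 'a" assume \<Psi>: "bounded_linear \<Psi>" "\<forall>x\<in>S. \<Psi> x = 0"
    obtain K where K: "K \<ge> 0" "\<And>x. norm (\<Psi> x) <= K * norm x"
      using bounded_linear.nonneg_bounded[OF \<Psi>(1)] by (metis mult.commute)
    have "(\<lambda>n. K * B * (1/2) ^ n) \<longlonglongrightarrow> K * B * 0"
      by (intro tendsto_mult_left LIMSEQ_power_zero) auto
    hence "norm (\<Psi> (z t)) <= K * B * 0"
      by (rule LIMSEQ_le_const) (use key[OF \<Psi> K(2) t K(1)] in auto)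
    thus "\<Psi> (z t) = 0" by simp
  qed
qed

subsection \<open>Formal power series over a normed algebra\<close>

notation fps_nth (infixl "$$" 75)

text \<open>The scalars \<open>1 / fact j\<close> as constant series: they are central in the ring
  of series, so that the exponential can be written with ring operations alone.\<close>

definition cf :: "nat => 'a::real_algebra_1 fps" where
  "cf j = fps_const (of_real (1 / fact j))"

lemma cf_commute: "cf j * a = a * cf j"
  by (rule fps_ext) (simp add: cf_def fps_mult_left_const_nth fps_mult_right_const_nth scaleR_conv_of_real[symmetric] of_real_def)

lemma cf_nth: "(cf j * a) $$ n = (1 / fact j) *\<^sub>R (a $$ n)"
  by (simp add: cf_def fps_mult_left_const_nth of_real_def)

definition eqm :: "nat => 'a::ring_1 fps => 'a fps => bool" where
  "eqm M a b \<longleftrightarrow> (\<forall>n\<le>M. a $$ n = b $$ n)"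

lemma eqm_refl [simp]: "eqm M a a" by (simp add: eqm_def)
lemma eqm_sym: "eqm M a b ==> eqm M b a" by (simp add: eqm_def)
lemma eqm_trans [trans]: "eqm M a b ==> eqm M b c ==> eqm M a c" by (simp add: eqm_def)
lemma eqm_add: "eqm M a b ==> eqm M c d ==> eqm M (a + c) (b + d)" by (simp add: eqm_def)
lemma eqm_diff: "eqm M a b ==> eqm M c d ==> eqm M (a - c) (b - d)" by (simp add: eqm_def)
lemma eqm_mult: "eqm M a b ==> eqm M c d ==> eqm M (a * c) (b * d)"
  by (simp add: eqm_def fps_mult_nth)
lemma eqm_sum: "(\<And>i. i \<in> I ==> eqm M (a i) (b i)) ==> eqm M (\<Sum>i\<in>I. a i) (\<Sum>i\<in>I. b i)"
  by (simp add: eqm_def fps_sum_nth)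

text \<open>Without constant terms, the coefficient of degree \<open>k + 1\<close> of a product only
  involves coefficients of degree at most \<open>k\<close> of the factors. This makes the iteration
  for the logarithm settle.\<close>

lemma eqm_mult_gain:
  assumes "eqm k a b" "eqm k c d" "a $$ 0 = 0" "b $$ 0 = 0" "c $$ 0 = 0" "d $$ 0 = 0"
  shows "eqm (Suc k) (a * c) (b * d)"
  unfolding eqm_def
proof (intro allI impI)
  fix n assume n: "n <= Suc k"
  have "a $$ i * c $$ (n - i) = b $$ i * d $$ (n - i)" if "i <= n" for i
    using assms n that by (cases "i = 0"; cases "i = n") (auto simp: eqm_def)
  thus "(a * c) $$ n = (b * d) $$ n" by (simp add: fps_mult_nth)
qed

lemma eqm_cancel_right:
  assumes "eqm M (a * p) (b * p)" "p $$ 0 = 1"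
  shows "eqm M a b"
  unfolding eqm_def
proof (intro allI impI)
  fix n assume "n <= M"
  thus "a $$ n = b $$ n"
  proof (induction n rule: less_induct)
    case (less n)
    have "(\<Sum>i=0..n. a $$ i * p $$ (n - i)) = (\<Sum>i=0..n. b $$ i * p $$ (n - i))"
      using assms(1) less.prems by (simp add: eqm_def fps_mult_nth)
    moreover have "(\<Sum>i=0..<n. a $$ i * p $$ (n - i)) = (\<Sum>i=0..<n. b $$ i * p $$ (n - i))"
      using less by (intro sum.cong) auto
    moreover have "(\<Sum>i=0..n. c i) = (\<Sum>i=0..<n. c i) + c n" for c :: "nat => 'a"
      by (simp add: sum.atLeast0_atMost_Suc atLeastLessThanSuc_atLeastAtMost[symmetric])
    ultimately show ?case using assms(2) by simp
  qed
qed

text \<open>\<open>ord0 q a\<close>: the series \<open>a\<close> is divisible by the \<open>q\<close>-th power of the variable.\<close>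
definition ord0 :: "nat => 'a::ring_1 fps => bool" where
  "ord0 q a \<longleftrightarrow> (\<forall>n<q. a $$ n = 0)"

lemma ord0_mult:
  assumes "ord0 p a" "ord0 q b" shows "ord0 (p + q) (a * b)"
proof -
  have "a $$ i * b $$ (n - i) = 0" if "n < p + q" "i <= n" for n i
    using assms that by (cases "i < p") (auto simp: ord0_def)
  thus ?thesis by (simp add: ord0_def fps_mult_nth)
qed

lemma ord0_diff: "ord0 p a ==> ord0 p b ==> ord0 p (a - b)" by (simp add: ord0_def)
lemma ord0_0 [simp]: "ord0 0 a" by (simp add: ord0_def)
lemma ord0_power: "ord0 1 a ==> ord0 n (a ^ n)"
proof (induction n)
  case (Suc n) thus ?case using ord0_mult[of 1 a n "a ^ n"] by simp
qed simp

lemma ord0_lbr: "ord0 p a ==> ord0 q b ==> ord0 (p + q) (lbr a b)"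
  unfolding lbr_def using ord0_mult[of p a q b] ord0_mult[of q b p a] by (simp add: ord0_diff add.commute)

lemma ord0_lbr_pow: "ord0 1 z ==> ord0 q Y ==> ord0 (j + q) ((lbr z ^^ j) Y)"
proof (induction j)
  case (Suc j) thus ?case using ord0_lbr[of 1 z "j + q" "(lbr z ^^ j) Y"] by simp
qed simp

text \<open>The logarithm of a series with constant term 1, up to order \<open>M\<close>, as the iterated fixed point
  of \<open>z = p - 1 - (exp z - 1 - z)\<close>.\<close>
primrec logit :: "nat => nat => 'a::real_algebra_1 fps => 'a fps" where
  "logit M 0 p = 0"
| "logit M (Suc k) p = p - 1 - (\<Sum>j=2..M. cf j * logit M k p ^ j)"

lemma logit_0: "p $$ 0 = 1 ==> logit M k p $$ 0 = 0"
proof (induction k)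
  case (Suc k)
  hence "ord0 1 (logit M k p)" by (simp add: ord0_def)
  hence "(logit M k p ^ j) $$ 0 = 0" if "j \<in> {2..M}" for j
    using ord0_power[of "logit M k p" j] that by (simp add: ord0_def)
  thus ?case using Suc.prems by (simp add: fps_sum_nth cf_nth)
qed simp

lemma logit_one: "logit M k 1 = 0"
  by (induction k) (simp_all add: power_0_left)

text \<open>All powers in the iteration have exponent at least \<open>2\<close>, so by
  \<open>eqm_mult_gain\<close> each step settles one more coefficient.\<close>

lemma logit_stable:
  assumes "p $$ 0 = 1"
  shows "eqm k (logit M k p) (logit M (Suc k) p)"
proof (induction k)
  case 0
  show ?case using logit_0[OF assms, of M "Suc 0"] logit_0[OF assms, of M 0] by (simp add: eqm_def)
next
  case (Suc k)
  let ?a = "logit M k p" and ?b = "logit M (Suc k) p"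
  have z: "?a $$ 0 = 0" "?b $$ 0 = 0" using logit_0[OF assms] by blast+
  have pw: "eqm (Suc k) (?a ^ j) (?b ^ j)" if "j \<ge> 2" for j
  proof -
    define i where "i = j - 2"
    have i: "j = Suc (Suc i)" using that by (simp add: i_def)
    have pn: "eqm k (?a ^ n) (?b ^ n)" for n
      by (induction n) (simp_all add: eqm_mult[OF Suc] del: logit.simps)
    have "eqm (Suc k) (?a * ?a ^ Suc i) (?b * ?b ^ Suc i)"
      by (intro eqm_mult_gain Suc pn) (simp_all add: z fps_mult_nth_0 del: logit.simps)
    thus ?thesis by (simp add: i)
  qed
  have "eqm (Suc k) (\<Sum>j=2..M. cf j * ?a ^ j) (\<Sum>j=2..M. cf j * ?b ^ j)"
    by (intro eqm_sum eqm_mult eqm_refl pw) auto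
  thus ?case unfolding logit.simps(2)[of M k] logit.simps(2)[of M "Suc k"]
    by (intro eqm_diff) auto
qed

text \<open>After \<open>M\<close> steps the coefficients up to degree \<open>M\<close> no longer
  change, and a fixed point of the iteration is a logarithm.\<close>

lemma exp_logit:
  assumes "p $$ 0 = 1" "M \<ge> 1"
  shows "eqm M p (\<Sum>j\<le>M. cf j * logit M M p ^ j)"
proof -
  let ?z = "logit M M p"
  have "{..M} = {0, 1} \<union> {2..M}" using assms(2) by auto
  hence "(\<Sum>j\<le>M. cf j * ?z ^ j) = cf 0 + cf 1 * ?z + (\<Sum>j=2..M. cf j * ?z ^ j)"
    by (simp add: sum.union_disjoint add.assoc)
  also have "\<dots> = 1 + ?z + (\<Sum>j=2..M. cf j * ?z ^ j)" by (simp add: cf_def)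
  finally have e: "(\<Sum>j\<le>M. cf j * ?z ^ j) = 1 + ?z + (\<Sum>j=2..M. cf j * ?z ^ j)" .
  have "eqm M (1 + logit M (Suc M) p + (\<Sum>j=2..M. cf j * ?z ^ j)) (1 + ?z + (\<Sum>j=2..M. cf j * ?z ^ j))"
    by (intro eqm_add eqm_refl eqm_sym[OF logit_stable] assms)
  thus ?thesis unfolding e by simp
qed

text \<open>With left and right multiplication by \<open>z\<close> called \<open>L\<close> and \<open>R\<close>, this is
  \<open>(L^(n+1) - R^(n+1)) / (L - R)\<close> expanded in powers of \<open>L - R\<close>.\<close>
lemma sum_conj_powers:
  fixes z Y :: "'a::ring_1"
  shows "(\<Sum>i\<le>n. z ^ i * Y * z ^ (n - i)) = (\<Sum>j\<le>n. of_nat (Suc n choose Suc j) * ((lbr z ^^ j) Y * z ^ (n - j)))"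
proof -
  have pw: "z ^ n * Y = (\<Sum>j\<le>n. of_nat (n choose j) * ((lbr z ^^ j) Y * z ^ (n - j)))" for n
  proof (induction n)
    case (Suc n)
    have s: "z * (lbr z ^^ j) Y = (lbr z ^^ Suc j) Y + (lbr z ^^ j) Y * z" for j
      by (simp add: lbr_def)
    have cm: "z * (of_nat k * x) = of_nat k * (z * x)" for k x
      by (metis mult.assoc mult_of_nat_commute)
    have "z ^ Suc n * Y = (\<Sum>j\<le>n. of_nat (n choose j) * ((lbr z ^^ Suc j) Y * z ^ (n - j)))
        + (\<Sum>j\<le>n. of_nat (n choose j) * ((lbr z ^^ j) Y * z ^ (Suc n - j)))"
    proof -
      have "z ^ Suc n * Y = z * (z ^ n * Y)" by (simp add: mult.assoc)
      also have "\<dots> = (\<Sum>j\<le>n. of_nat (n choose j) * (z * (lbr z ^^ j) Y * z ^ (n - j)))"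
        by (simp add: Suc sum_distrib_left cm mult.assoc)
      also have "\<dots> = (\<Sum>j\<le>n. of_nat (n choose j) * ((lbr z ^^ Suc j) Y * z ^ (n - j))
         + of_nat (n choose j) * ((lbr z ^^ j) Y * z ^ (Suc n - j)))"
        by (intro sum.cong refl) (simp only: s, simp add: distrib_left distrib_right Suc_diff_le mult.assoc)
      finally show ?thesis by (simp only: sum.distrib)
    qed
    also have "(\<Sum>j\<le>n. of_nat (n choose j) * ((lbr z ^^ Suc j) Y * z ^ (n - j)))
       = (\<Sum>j\<in>{1..Suc n}. of_nat (n choose (j - 1)) * ((lbr z ^^ j) Y * z ^ (Suc n - j)))"
      by (rule sum.reindex_bij_witness[of _ "\<lambda>j. j - 1" Suc]) auto
    also have "\<dots> = (\<Sum>j\<le>Suc n. (if j = 0 then 0 else of_nat (n choose (j - 1))) * ((lbr z ^^ j) Y * z ^ (Suc n - j)))"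
      by (rule sum.mono_neutral_cong_left) auto
    also have "(\<Sum>j\<le>n. of_nat (n choose j) * ((lbr z ^^ j) Y * z ^ (Suc n - j)))
      = (\<Sum>j\<le>Suc n. of_nat (n choose j) * ((lbr z ^^ j) Y * z ^ (Suc n - j)))" by (simp add: binomial_eq_0)
    also have "(\<Sum>j\<le>Suc n. (if j = 0 then 0 else of_nat (n choose (j - 1))) * ((lbr z ^^ j) Y * z ^ (Suc n - j)))
       + (\<Sum>j\<le>Suc n. of_nat (n choose j) * ((lbr z ^^ j) Y * z ^ (Suc n - j)))
       = (\<Sum>j\<le>Suc n. of_nat (Suc n choose j) * ((lbr z ^^ j) Y * z ^ (Suc n - j)))"
      unfolding sum.distrib[symmetric]
      by (intro sum.cong refl) (auto simp: distrib_right[symmetric] choose_reduce_nat[of "Suc n"])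
    finally show ?case .
  qed simp
  show ?thesis
  proof (induction n)
    case (Suc n)
    have zz: "z ^ (Suc n - i) = z ^ (n - i) * z" if "i <= n" for i
      using that by (simp add: Suc_diff_le power_commutes)
    have "(\<Sum>i\<le>Suc n. z ^ i * Y * z ^ (Suc n - i)) = (\<Sum>i\<le>n. z ^ i * Y * z ^ (n - i)) * z + z ^ Suc n * Y"
      unfolding sum.atMost_Suc sum_distrib_right
      by (intro arg_cong2[where f="(+)"] sum.cong) (simp_all only: zz atMost_iff mult.assoc diff_self_eq_0 power_0 mult_1_right)
    also have "(\<Sum>i\<le>n. z ^ i * Y * z ^ (n - i)) * z
       = (\<Sum>j\<le>n. of_nat (Suc n choose Suc j) * ((lbr z ^^ j) Y * z ^ (Suc n - j)))"
      unfolding Suc sum_distrib_right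
      by (intro sum.cong) (simp_all only: zz atMost_iff mult.assoc)
    also have "\<dots> = (\<Sum>j\<le>Suc n. of_nat (Suc n choose Suc j) * ((lbr z ^^ j) Y * z ^ (Suc n - j)))"
      by (simp add: binomial_eq_0 del: binomial_Suc_Suc)
    finally show ?case unfolding pw sum.distrib[symmetric]
      by (rule trans) (intro sum.cong refl, simp only: binomial_Suc_Suc[of "Suc n"] of_nat_add distrib_right add.commute)
  qed simp
qed

text \<open>\<open>Y\<close> is the value of the operator \<open>d/dt - lbr A\<close> on the series,
  coefficient by coefficient. Since \<open>lbr A\<close> is a derivation, this operator obeys the
  product rule; it realises the interaction picture without conjugation by exponentials.\<close>

definition hasDD :: "'a::real_normed_algebra_1 => real set => real => (real => 'a fps) => 'a fps => bool" where
  "hasDD A S t F Y \<longleftrightarrow>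
     (\<forall>n. ((\<lambda>s. F s $$ n) has_vector_derivative (Y $$ n + lbr A (F t $$ n))) (at t within S))"

lemma lbr_one [simp]: "lbr A 1 = 0" and lbr_zero [simp]: "lbr A 0 = 0"
  for A :: "'a::ring_1" by (simp_all add: lbr_def)

lemma lbr_simps:
  "lbr a (b + c) = lbr a b + lbr a c" "lbr a (b - c) = lbr a b - lbr a c"
  "lbr (b + c) a = lbr b a + lbr c a" "lbr (b - c) a = lbr b a - lbr c a"
  by (simp_all add: lbr_def algebra_simps)

lemma lbr_scaleR:
  fixes a b :: "'a::real_algebra"
  shows "lbr a (r *\<^sub>R b) = r *\<^sub>R lbr a b" "lbr (r *\<^sub>R a) b = r *\<^sub>R lbr a b"
  by (simp_all add: lbr_def algebra_simps)

lemma lbr_sum: "lbr a (\<Sum>i\<in>I. b i) = (\<Sum>i\<in>I. lbr a (b i))" "lbr (\<Sum>i\<in>I. b i) a = (\<Sum>i\<in>I. lbr (b i) a)"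
  by (simp_all add: lbr_def sum_distrib_left sum_distrib_right sum_subtractf)

lemma hasDD_const: "hasDD A S t (\<lambda>_. 1) 0" "hasDD A S t (\<lambda>_. 0) 0"
  by (simp_all add: hasDD_def fps_one_nth)

lemma hasDD_add: "hasDD A S t F Y ==> hasDD A S t G W ==> hasDD A S t (\<lambda>s. F s + G s) (Y + W)"
  unfolding hasDD_def
proof
  fix n assume "\<forall>n. ((\<lambda>s. F s $$ n) has_vector_derivative (Y $$ n + lbr A (F t $$ n))) (at t within S)"
    "\<forall>n. ((\<lambda>s. G s $$ n) has_vector_derivative (W $$ n + lbr A (G t $$ n))) (at t within S)"
  hence "((\<lambda>s. F s $$ n + G s $$ n) has_vector_derivative ((Y $$ n + lbr A (F t $$ n)) + (W $$ n + lbr A (G t $$ n)))) (at t within S)"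
    by (intro has_vector_derivative_add) auto
  thus "((\<lambda>s. (F s + G s) $$ n) has_vector_derivative ((Y + W) $$ n + lbr A ((F t + G t) $$ n))) (at t within S)"
    by (simp add: lbr_simps algebra_simps)
qed

lemma hasDD_cf: "hasDD A S t F Y ==> hasDD A S t (\<lambda>s. cf j * F s) (cf j * Y)"
  unfolding hasDD_def cf_nth
proof
  fix n assume "\<forall>n. ((\<lambda>s. F s $$ n) has_vector_derivative (Y $$ n + lbr A (F t $$ n))) (at t within S)"
  hence "((\<lambda>s. (1 / fact j) *\<^sub>R (F s $$ n)) has_vector_derivative ((1 / fact j) *\<^sub>R (Y $$ n + lbr A (F t $$ n)))) (at t within S)"
    by (intro bounded_linear.has_vector_derivative[OF bounded_linear_scaleR_right]) auto
  thus "((\<lambda>s. (1 / fact j) *\<^sub>R (F s $$ n)) has_vector_derivative ((1 / fact j) *\<^sub>R Y $$ n + lbr A ((1 / fact j) *\<^sub>R F t $$ n))) (at t within S)"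
    by (simp add: lbr_scaleR algebra_simps)
qed

lemma hasDD_uminus: "hasDD A S t F Y ==> hasDD A S t (\<lambda>s. - F s) (- Y)"
  unfolding hasDD_def
proof
  fix n assume "\<forall>n. ((\<lambda>s. F s $$ n) has_vector_derivative (Y $$ n + lbr A (F t $$ n))) (at t within S)"
  hence "((\<lambda>s. - (F s $$ n)) has_vector_derivative (- (Y $$ n + lbr A (F t $$ n)))) (at t within S)"
    by (intro has_vector_derivative_minus) auto
  thus "((\<lambda>s. (- F s) $$ n) has_vector_derivative ((- Y) $$ n + lbr A ((- F t) $$ n))) (at t within S)"
    by (simp add: lbr_def algebra_simps)
qed

lemma hasDD_diff: "hasDD A S t F Y ==> hasDD A S t G W ==> hasDD A S t (\<lambda>s. F s - G s) (Y - W)"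
  using hasDD_add[OF _ hasDD_uminus] by fastforce

lemma hasDD_sum:
  "(\<And>i. i \<in> I ==> hasDD A S t (F i) (Y i)) ==> hasDD A S t (\<lambda>s. \<Sum>i\<in>I. F i s) (\<Sum>i\<in>I. Y i)"
  by (induction I rule: infinite_finite_induct) (auto simp: hasDD_const hasDD_add)

lemma hasDD_mult:
  assumes "hasDD A S t F Y" "hasDD A S t G W"
  shows "hasDD A S t (\<lambda>s. F s * G s) (Y * G t + F t * W)"
  unfolding hasDD_def
proof
  fix n
  have "((\<lambda>s. \<Sum>i=0..n. F s $$ i * G s $$ (n - i)) has_vector_derivative
     (\<Sum>i=0..n. F t $$ i * (W $$ (n - i) + lbr A (G t $$ (n - i))) + (Y $$ i + lbr A (F t $$ i)) * G t $$ (n - i))) (at t within S)"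
    using assms unfolding hasDD_def by (intro has_vector_derivative_sum has_vector_derivative_mult) auto
  moreover have "F t $$ i * (W $$ (n - i) + lbr A (G t $$ (n - i))) + (Y $$ i + lbr A (F t $$ i)) * G t $$ (n - i)
     = (Y $$ i * G t $$ (n - i) + F t $$ i * W $$ (n - i)) + lbr A (F t $$ i * G t $$ (n - i))" for i
    by (simp add: lbr_def algebra_simps)
  ultimately show "((\<lambda>s. (F s * G s) $$ n) has_vector_derivative ((Y * G t + F t * W) $$ n + lbr A ((F t * G t) $$ n))) (at t within S)"
    by (simp add: fps_mult_nth sum.distrib lbr_sum)
qed

lemma hasDD_power:
  assumes "hasDD A S t z Y"
  shows "hasDD A S t (\<lambda>s. z s ^ Suc n) (\<Sum>i\<le>n. z t ^ i * Y * z t ^ (n - i))"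
proof (induction n)
  case 0
  show ?case using assms by simp
next
  case (Suc n)
  have "hasDD A S t (\<lambda>s. z s * z s ^ Suc n) (Y * z t ^ Suc n + z t * (\<Sum>i\<le>n. z t ^ i * Y * z t ^ (n - i)))"
    by (rule hasDD_mult[OF assms Suc])
  moreover have "Y * z t ^ Suc n + z t * (\<Sum>i\<le>n. z t ^ i * Y * z t ^ (n - i)) = (\<Sum>i\<le>Suc n. z t ^ i * Y * z t ^ (Suc n - i))"
    unfolding sum.atMost_Suc_shift by (simp add: sum_distrib_left mult.assoc)
  ultimately show ?case by simp
qed

text \<open>Derivatives within a nondegenerate closed interval are unique, so agreement of two
  series up to degree \<open>M\<close> passes to their derivatives.\<close>

lemma hasDD_unique:
  assumes F: "hasDD A {0..T} t F Y" and G: "hasDD A {0..T} t G W" and T: "0 < T" "t \<in> {0..T}"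
    and e: "\<And>s. s \<in> {0..T} ==> eqm M (F s) (G s)"
  shows "eqm M Y W"
  unfolding eqm_def
proof (intro allI impI)
  fix n assume n: "n <= M"
  have eq: "F s $$ n = G s $$ n" if "s \<in> {0..T}" for s using e[OF that] n by (simp add: eqm_def)
  have "((\<lambda>s. G s $$ n) has_vector_derivative (Y $$ n + lbr A (F t $$ n))) (at t within {0..T})"
    using F eq unfolding hasDD_def
    by (intro has_vector_derivative_transform[OF T(2), of "\<lambda>s. G s $$ n" "\<lambda>s. F s $$ n"]) metis+
  moreover have "((\<lambda>s. G s $$ n) has_vector_derivative (W $$ n + lbr A (G t $$ n))) (at t within {0..T})"
    using G by (simp add: hasDD_def)
  ultimately have "Y $$ n + lbr A (F t $$ n) = W $$ n + lbr A (G t $$ n)"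
    using vector_derivative_unique_within_closed_interval[of 0 T t] T by (auto simp: box_real)
  thus "Y $$ n = W $$ n" using eq[OF T(2)] by simp
qed

lemma cf_binomial: "j <= n ==> cf (Suc n) * (of_nat (Suc n choose Suc j) * x) = cf (Suc j) * (cf (n - j) * x)"
proof -
  assume j: "j <= n"
  have e: "1 / fact (Suc n) * real (Suc n choose Suc j) = 1 / fact (Suc j) * (1 / fact (n - j))"
    using j by (simp add: binomial_fact del: binomial_Suc_Suc fact_Suc)
  show ?thesis
  proof (rule fps_ext)
    fix k
    have "(of_nat (Suc n choose Suc j) * x) $$ k = real (Suc n choose Suc j) *\<^sub>R (x $$ k)"
      by (simp add: fps_of_nat[symmetric] fps_mult_left_const_nth scaleR_conv_of_real del: binomial_Suc_Suc fps_of_nat)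
    thus "(cf (Suc n) * (of_nat (Suc n choose Suc j) * x)) $$ k = (cf (Suc j) * (cf (n - j) * x)) $$ k"
      using e by (simp add: cf_nth del: binomial_Suc_Suc fact_Suc)
  qed
qed

text \<open>The derivative of the exponential,
  \<open>D (exp z) = ((exp (ad z) - 1) / ad z) Y * exp z\<close>, truncated at degree
  \<open>M\<close>. The left-hand side is the noncommutative power rule, regrouped by
  \<open>sum_conj_powers\<close>.\<close>

lemma dexp_algebra:
  fixes z Y :: "'a::real_algebra_1 fps"
  assumes z: "z $$ 0 = 0" and Y: "Y $$ 0 = 0"
  shows "eqm M (\<Sum>n<M. cf (Suc n) * (\<Sum>i\<le>n. z ^ i * Y * z ^ (n - i)))
     ((\<Sum>j<M. cf (Suc j) * (lbr z ^^ j) Y) * (\<Sum>i\<le>M. cf i * z ^ i))"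
proof -
  define g where "g j i = cf (Suc j) * (cf i * ((lbr z ^^ j) Y * z ^ i))" for j i
  have L: "(\<Sum>n<M. cf (Suc n) * (\<Sum>i\<le>n. z ^ i * Y * z ^ (n - i))) = (\<Sum>(j, i)\<in>{(j, i). j + i < M}. g j i)"
    unfolding sum_conj_powers sum.triangle_reindex
    by (intro sum.cong refl) (simp add: sum_distrib_left cf_binomial g_def del: binomial_Suc_Suc)
  have R: "(\<Sum>j<M. cf (Suc j) * (lbr z ^^ j) Y) * (\<Sum>i\<le>M. cf i * z ^ i) = (\<Sum>(j, i)\<in>{..<M} \<times> {..M}. g j i)"
    unfolding sum_product sum.cartesian_product
  proof (intro sum.cong refl, clarify)
    fix j i
    have "(lbr z ^^ j) Y * (cf i * z ^ i) = cf i * ((lbr z ^^ j) Y * z ^ i)"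
      by (metis cf_commute mult.assoc)
    thus "cf (Suc j) * (lbr z ^^ j) Y * (cf i * z ^ i) = g j i" by (simp add: g_def mult.assoc)
  qed
  have z1: "ord0 1 z" and Y1: "ord0 1 Y" using z Y by (simp_all add: ord0_def)
  \<comment> \<open>Both \<open>z\<close> and \<open>Y\<close> start in degree one, so the pairs
    outside the triangle contribute only above degree \<open>M\<close>.\<close>
  have "g j i $$ n = 0" if "\<not> j + i < M" "n <= M" for j i n
  proof -
    have "ord0 (j + 1 + i) ((lbr z ^^ j) Y * z ^ i)" by (intro ord0_mult ord0_lbr_pow ord0_power z1 Y1)
    thus ?thesis using that by (simp add: g_def cf_nth ord0_def)
  qed
  thus ?thesis unfolding L R eqm_def fps_sum_nth
    by (intro allI impI sum.mono_neutral_left) (auto simp: fps_sum_nth)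
qed

text \<open>Iterated integrals in the interaction picture: \<open>P n\<close> is homogeneous of
  degree \<open>n\<close> in \<open>G\<close>, and the sum of the \<open>P n t\<close>, multiplied
  by \<open>exp (t *\<^sub>R A)\<close> from the right, formally solves
  \<open>X' = (A + G) X\<close>.\<close>

definition chen_seq :: "'a::real_normed_algebra_1 => (real => 'a) => real => (nat => real => 'a) => bool" where
  "chen_seq A G T P \<longleftrightarrow> (\<forall>t. P 0 t = 1) \<and> (\<forall>n. P (Suc n) 0 = 0) \<and>
     (\<forall>n. \<forall>t\<in>{0..T}. (P (Suc n) has_vector_derivative (lbr A (P (Suc n) t) + G t * P n t)) (at t within {0..T}))"

lemma chen_seqD:
  assumes "chen_seq A G T P"
  shows "P 0 t = 1" "P (Suc n) 0 = 0"
    "t \<in> {0..T} ==> (P (Suc n) has_vector_derivative (lbr A (P (Suc n) t) + G t * P n t)) (at t within {0..T})"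
  using assms by (auto simp: chen_seq_def)

lemma chen_exists:
  fixes A :: "'a::{real_normed_algebra_1,banach}"
  assumes G: "continuous_on {0..T} G" and T: "T \<ge> 0"
  obtains P where "chen_seq A G T P"
proof -
  have "\<exists>P. \<forall>n. (continuous_on {0..T} (P n) \<and> (n = 0 --> P n = (\<lambda>_. 1))) \<and>
    (P (Suc n) 0 = 0 \<and> (\<forall>t\<in>{0..T}. (P (Suc n) has_vector_derivative (lbr A (P (Suc n) t) + G t * P n t)) (at t within {0..T})))"
  proof (rule dependent_nat_choice)
    show "\<exists>x. continuous_on {0..T} x \<and> (0 = (0::nat) --> x = (\<lambda>_. 1::'a))"
      by (intro exI[of _ "\<lambda>_. 1"]) simp
  next
    fix p :: "real => 'a" and n :: nat
    assume p: "continuous_on {0..T} p \<and> (n = 0 --> p = (\<lambda>_. 1))"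
    then obtain R where "R 0 = 0" "\<forall>t\<in>{0..T}. (R has_vector_derivative (lbr A (R t) + G t * p t)) (at t within {0..T})"
      using lbr_ode_exists[of T "\<lambda>t. G t * p t" A] G T continuous_on_mult by blast
    thus "\<exists>y. (continuous_on {0..T} y \<and> (Suc n = 0 --> y = (\<lambda>_. 1))) \<and> y 0 = 0 \<and>
       (\<forall>t\<in>{0..T}. (y has_vector_derivative (lbr A (y t) + G t * p t)) (at t within {0..T}))"
      using hvd_continuous_on[of "{0..T}" R "\<lambda>t. lbr A (R t) + G t * p t"] by (intro exI[of _ R]) auto
  qed
  then obtain P where P: "\<forall>n. (continuous_on {0..T} (P n) \<and> (n = 0 --> P n = (\<lambda>_. 1))) \<and>
    (P (Suc n) 0 = 0 \<and> (\<forall>t\<in>{0..T}. (P (Suc n) has_vector_derivative (lbr A (P (Suc n) t) + G t * P n t)) (at t within {0..T})))"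
    by blast
  have "P 0 t = 1" for t using spec[OF P, of 0] by simp
  with P have "chen_seq A G T P" by (simp add: chen_seq_def)
  thus ?thesis by (rule that)
qed

text \<open>Each degree integrates one further factor \<open>G\<close>; by the smallness of
  \<open>T\<close> the inner derivation costs only the factor \<open>2\<close> of
  \<open>gronwall_short\<close>.\<close>

lemma chen_bound:
  fixes A :: "'a::{real_normed_algebra_1,banach}"
  assumes G: "continuous_on {0..T} G" and T: "T \<ge> 0" "4 * norm A * T <= 1"
    and chen: "chen_seq A G T P"
    and t: "t \<in> {0..T}"
  shows "norm (P n t) <= (2 * integral {0..T} (\<lambda>s. norm (G s))) ^ n"
  using t
proof (induction n arbitrary: t)
  case 0
  show ?case by (simp add: chen_seqD[OF chen])
next
  case (Suc n)
  let ?g = "integral {0..T} (\<lambda>s. norm (G s))"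
  have "norm (P (Suc n) t) <= 2 * integral {0..T} (\<lambda>s. norm (G s) * (2 * ?g) ^ n)"
  proof (rule gronwall_short[where l="\<lambda>_. 2 * norm A", OF T(1) chen_seqD(2,3)[OF chen]])
    fix s assume s: "s \<in> {0..T}"
    have "norm (lbr A (P (Suc n) s) + G s * P n s) <= norm (lbr A (P (Suc n) s)) + norm (G s * P n s)"
      by (rule norm_triangle_ineq)
    also have "\<dots> <= 2 * norm A * norm (P (Suc n) s) + norm (G s) * norm (P n s)"
      by (intro add_mono norm_lbr_le norm_mult_ineq)
    also have "\<dots> <= 2 * norm A * norm (P (Suc n) s) + norm (G s) * (2 * ?g) ^ n"
      by (intro add_left_mono mult_left_mono Suc.IH s) simp
    finally show "norm (lbr A (P (Suc n) s) + G s * P n s) <= 2 * norm A * norm (P (Suc n) s) + norm (G s) * (2 * ?g) ^ n" .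
    show "0 <= norm (G s) * (2 * ?g) ^ n"
      using integral_nonneg[OF integrable_continuous_real[OF continuous_on_norm[OF G]]] by simp
  qed (use Suc.prems G T in \<open>auto intro!: continuous_intros simp: mult_ac\<close>)
  thus ?case by (simp add: integral_mult_left)
qed

text \<open>The generating series \<open>p\<close> of the \<open>P n\<close> satisfies
  \<open>D p = fps_X * G * p\<close>. Comparing this with the derivative of \<open>exp z\<close> and
  cancelling \<open>p\<close> leaves the differential equation of the Magnus logarithm.\<close>

lemma magnus_derivative:
  fixes A :: "'a::{real_normed_algebra_1,banach}"
  assumes T: "T > 0" and M: "M \<ge> 1"
    and chen: "chen_seq A G T P"
  defines "z \<equiv> \<lambda>t. logit M M (Abs_fps (\<lambda>n. P n t))"
  obtains Y where "\<And>t. t \<in> {0..T} ==> hasDD A {0..T} t z (Y t)"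
    "\<And>t. t \<in> {0..T} ==> Y t $$ 0 = 0"
    "\<And>t. t \<in> {0..T} ==> eqm M (\<Sum>j<M. cf (Suc j) * (lbr (z t) ^^ j) (Y t)) (fps_X * fps_const (G t))"
proof -
  note P = chen_seqD[OF chen]
  define p where "p t = Abs_fps (\<lambda>n. P n t)" for t
  have p0: "p t $$ 0 = 1" for t by (simp add: p_def P)
  have Dp: "hasDD A {0..T} t p (fps_X * fps_const (G t) * p t)" if t: "t \<in> {0..T}" for t
    unfolding hasDD_def
  proof
    fix n
    show "((\<lambda>s. p s $$ n) has_vector_derivative (fps_X * fps_const (G t) * p t) $$ n + lbr A (p t $$ n)) (at t within {0..T})"
    proof (cases n)
      case 0
      thus ?thesis by (simp add: p_def P mult.assoc)
    next
      case (Suc m)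
      have "(fps_X * fps_const (G t) * p t) $$ Suc m = G t * P m t" by (simp add: mult.assoc p_def)
      thus ?thesis using P(3)[OF t, of m] by (simp add: Suc p_def add.commute)
    qed
  qed
  \<comment> \<open>\<open>logit\<close> is a noncommutative polynomial in \<open>p\<close>. Only
    the existence of its derivative is extracted here; the value follows below from the
    exponential.\<close>
  have "\<exists>Y. \<forall>t\<in>{0..T}. hasDD A {0..T} t (\<lambda>t. logit M k (p t)) (Y t)" for k
  proof (induction k)
    case 0
    show ?case by (intro exI[of _ "\<lambda>_. 0"]) (simp add: hasDD_const)
  next
    case (Suc k)
    then obtain Y where Y: "\<And>t. t \<in> {0..T} ==> hasDD A {0..T} t (\<lambda>t. logit M k (p t)) (Y t)" by blast
    have "hasDD A {0..T} t (\<lambda>t. logit M k (p t) ^ j) (\<Sum>i\<le>j - 1. logit M k (p t) ^ i * Y t * logit M k (p t) ^ (j - 1 - i))"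
      if "t \<in> {0..T}" "j \<in> {2..M}" for t j
    proof -
      have e: "Suc (j - 1) = j" using that(2) by auto
      show ?thesis using hasDD_power[OF Y[OF that(1)], of "j - 1"] unfolding e .
    qed
    hence "hasDD A {0..T} t (\<lambda>t. logit M (Suc k) (p t)) (fps_X * fps_const (G t) * p t - 0
      - (\<Sum>j=2..M. cf j * (\<Sum>i\<le>j - 1. logit M k (p t) ^ i * Y t * logit M k (p t) ^ (j - 1 - i))))" if "t \<in> {0..T}" for t
      unfolding logit.simps using that by (intro hasDD_diff hasDD_sum hasDD_cf hasDD_const Dp) auto
    thus ?case by (intro exI ballI)
  qed
  from this[of M] obtain Y where Y: "\<And>t. t \<in> {0..T} ==> hasDD A {0..T} t z (Y t)"
    unfolding z_def p_def by blast
  have z0: "z t $$ 0 = 0" for t unfolding z_def by (rule logit_0) (simp add: P)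
  have Y0: "Y t $$ 0 = 0" if t: "t \<in> {0..T}" for t
  proof -
    have "eqm 0 (Y t) 0"
      by (rule hasDD_unique[OF Y[OF t] hasDD_const(2) T t]) (simp add: eqm_def z0)
    thus ?thesis by (simp add: eqm_def)
  qed
  have "eqm M (\<Sum>j<M. cf (Suc j) * (lbr (z t) ^^ j) (Y t)) (fps_X * fps_const (G t))" if t: "t \<in> {0..T}" for t
  proof -
    let ?D = "\<Sum>j<M. cf (Suc j) * (lbr (z t) ^^ j) (Y t)"
    have E: "eqm M (p s) (\<Sum>j\<le>M. cf j * z s ^ j)" for s
      unfolding z_def p_def by (rule exp_logit) (use M P in auto)
    have E1: "(\<Sum>j\<le>M. cf j * z s ^ j) = 1 + (\<Sum>n<M. cf (Suc n) * z s ^ Suc n)" for s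
      by (simp add: cf_def lessThan_Suc_atMost[symmetric] sum.lessThan_Suc_shift del: sum.lessThan_Suc power_Suc)
    have "hasDD A {0..T} t (\<lambda>s. \<Sum>j\<le>M. cf j * z s ^ j) (0 + (\<Sum>n<M. cf (Suc n) * (\<Sum>i\<le>n. z t ^ i * Y t * z t ^ (n - i))))"
      unfolding E1 by (intro hasDD_add hasDD_const hasDD_sum hasDD_cf hasDD_power Y t)
    from hasDD_unique[OF Dp[OF t] this T t E]
    have "eqm M (fps_X * fps_const (G t) * p t) (\<Sum>n<M. cf (Suc n) * (\<Sum>i\<le>n. z t ^ i * Y t * z t ^ (n - i)))" by simp
    also have "eqm M \<dots> (?D * (\<Sum>i\<le>M. cf i * z t ^ i))" by (rule dexp_algebra[OF z0 Y0[OF t]])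
    also have "eqm M \<dots> (?D * p t)" by (intro eqm_mult eqm_refl eqm_sym[OF E])
    finally show ?thesis using eqm_cancel_right p0 eqm_sym by blast
  qed
  with Y Y0 that show ?thesis by blast
qed

subsection \<open>Bounds and the Lie property\<close>

text \<open>Degree \<open>n\<close> scales like \<open>g ^ n\<close>, where \<open>g\<close>
  measures the controls. The profile \<open>c\<close> is always chosen before \<open>g\<close> and
  the series, which keeps the constants uniform over all trajectories.\<close>

definition hb :: "(nat => real) => real => 'a::real_normed_algebra_1 fps => bool" where
  "hb c g a \<longleftrightarrow> (\<forall>n. norm (a $$ n) <= c n * g ^ n)"

lemma hb_mult:
  assumes "hb c g a" "hb d g b"
  shows "hb (\<lambda>n. \<Sum>i=0..n. c i * d (n - i)) g (a * b)"
  unfolding hb_def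
proof
  fix n
  have "norm ((a * b) $$ n) <= (\<Sum>i=0..n. (c i * g ^ i) * (d (n - i) * g ^ (n - i)))"
    unfolding fps_mult_nth
  proof (rule sum_norm_le)
    fix i
    have "norm (a $$ i * b $$ (n - i)) <= norm (a $$ i) * norm (b $$ (n - i))" by (rule norm_mult_ineq)
    also have "\<dots> <= (c i * g ^ i) * (d (n - i) * g ^ (n - i))"
      using assms unfolding hb_def by (intro mult_mono) (auto intro: order_trans[OF norm_ge_zero])
    finally show "norm (a $$ i * b $$ (n - i)) <= (c i * g ^ i) * (d (n - i) * g ^ (n - i))" .
  qed
  also have "\<dots> = (\<Sum>i=0..n. c i * d (n - i)) * g ^ n"
    unfolding sum_distrib_right
  proof (intro sum.cong refl)
    fix i assume "i \<in> {0..n}"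
    hence "g ^ n = g ^ i * g ^ (n - i)" by (simp flip: power_add)
    thus "c i * g ^ i * (d (n - i) * g ^ (n - i)) = c i * d (n - i) * g ^ n" by simp
  qed
  finally show "norm ((a * b) $$ n) <= (\<Sum>i=0..n. c i * d (n - i)) * g ^ n" .
qed

lemma hb_power: "\<exists>d. \<forall>g (a::'a::real_normed_algebra_1 fps). g \<ge> 0 --> hb c g a --> hb d g (a ^ j)"
proof (induction j)
  case 0
  have "hb (\<lambda>_. 1) g (1 :: 'a fps)" if "g \<ge> 0" for g using that by (auto simp: hb_def fps_one_nth)
  thus ?case by (intro exI[of _ "\<lambda>_. 1"]) auto
next
  case (Suc j)
  then obtain d where "\<And>g (a::'a fps). g \<ge> 0 ==> hb c g a ==> hb d g (a ^ j)" by blast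
  thus ?case unfolding power_Suc using hb_mult by blast
qed

lemma hb_logit:
  "\<exists>c. \<forall>g (p::'a::real_normed_algebra_1 fps). g \<ge> 0 --> hb (\<lambda>_. 1) g p --> hb c g (logit M k p)"
proof (induction k)
  case 0
  show ?case by (intro exI[of _ "\<lambda>_. 0"]) (auto simp: hb_def)
next
  case (Suc k)
  then obtain c where c: "\<And>g (p::'a fps). g \<ge> 0 ==> hb (\<lambda>_. 1) g p ==> hb c g (logit M k p)" by blast
  have "\<forall>j. \<exists>d. \<forall>g (a::'a fps). g \<ge> 0 --> hb c g a --> hb d g (a ^ j)" using hb_power by blast
  then obtain d where d: "\<And>j g (a::'a fps). g \<ge> 0 ==> hb c g a ==> hb (d j) g (a ^ j)" by metis
  show ?case
  proof (intro exI allI impI)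
    fix g :: real and p :: "'a fps" assume g: "g \<ge> 0" and p: "hb (\<lambda>_. 1) g p"
    show "hb (\<lambda>n. 2 + (\<Sum>j=2..M. d j n)) g (logit M (Suc k) p)"
      unfolding hb_def
    proof
      fix n
      have "norm (logit M (Suc k) p $$ n) <= norm (p $$ n) + norm ((1::'a fps) $$ n) + norm (\<Sum>j=2..M. (cf j * logit M k p ^ j) $$ n)"
        by (simp add: fps_sum_nth norm_triangle_le_diff norm_triangle_ineq4 order_trans[OF norm_triangle_ineq4])
      also have "norm (\<Sum>j=2..M. (cf j * logit M k p ^ j) $$ n) <= (\<Sum>j=2..M. d j n * g ^ n)"
      proof (rule sum_norm_le)
        fix j
        have "norm ((cf j * logit M k p ^ j) $$ n) = (1 / fact j) * norm ((logit M k p ^ j) $$ n)"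
          by (simp add: cf_nth)
        also have "\<dots> <= 1 * norm ((logit M k p ^ j) $$ n)"
          by (intro mult_right_mono) (auto simp: fact_ge_1)
        also have "\<dots> <= d j n * g ^ n" using d[OF g c[OF g p]] by (simp add: hb_def)
        finally show "norm ((cf j * logit M k p ^ j) $$ n) <= d j n * g ^ n" .
      qed
      also have "norm (p $$ n) <= g ^ n" using p by (simp add: hb_def)
      also have "norm ((1::'a fps) $$ n) <= g ^ n" using g by (auto simp: fps_one_nth)
      finally show "norm (logit M (Suc k) p $$ n) <= (2 + (\<Sum>j=2..M. d j n)) * g ^ n"
        by (simp add: algebra_simps sum_distrib_left sum_distrib_right)
    qed
  qed
qed

lemma fps_lbr_nth:
  fixes z w :: "'a::ring_1 fps"
  shows "lbr z w $$ n = (\<Sum>i=0..n. lbr (z $$ i) (w $$ (n - i)))"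
proof -
  have "(w * z) $$ n = (\<Sum>i=0..n. w $$ (n - i) * z $$ i)"
    unfolding fps_mult_nth by (rule sum.reindex_bij_witness[of _ "\<lambda>i. n - i" "\<lambda>i. n - i"]) auto
  thus ?thesis by (simp add: lbr_def fps_mult_nth sum_subtractf)
qed

text \<open>The equation is solved degree by degree: the summand \<open>j = 0\<close> is
  \<open>Y\<close> itself, and the iterated brackets involve only lower coefficients. Degrees one
  and two are the familiar first terms of the Magnus expansion.\<close>

lemma dexp_coeff:
  assumes z0: "z $$ 0 = 0" and Y0: "Y $$ 0 = 0" and M: "M \<ge> 2"
    and e: "eqm M (\<Sum>j<M. cf (Suc j) * (lbr z ^^ j) Y) (fps_X * fps_const G)"
  shows "n <= M ==> Y $$ n = (if n = 1 then G else 0) - (\<Sum>j=1..<M. (1 / fact (Suc j)) *\<^sub>R ((lbr z ^^ j) Y $$ n))"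
    and "Y $$ 1 = G" and "Y $$ 2 = - (1/2) *\<^sub>R lbr (z $$ 1) G"
proof -
  have c: "Y $$ n = (if n = 1 then G else 0) - (\<Sum>j=1..<M. (1 / fact (Suc j)) *\<^sub>R ((lbr z ^^ j) Y $$ n))" if "n <= M" for n
  proof -
    have "(\<Sum>j<M. (1 / fact (Suc j)) *\<^sub>R ((lbr z ^^ j) Y $$ n)) = (if n = 1 then G else 0)"
      using e that unfolding eqm_def by (simp add: fps_sum_nth cf_nth del: fact_Suc)
    moreover have "{..<M} = insert 0 {1..<M}" using M by auto
    ultimately have "Y $$ n + (\<Sum>j=1..<M. (1 / fact (Suc j)) *\<^sub>R ((lbr z ^^ j) Y $$ n)) = (if n = 1 then G else 0)"
      by simp
    thus ?thesis by (simp add: algebra_simps)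
  qed
  thus "n <= M ==> Y $$ n = (if n = 1 then G else 0) - (\<Sum>j=1..<M. (1 / fact (Suc j)) *\<^sub>R ((lbr z ^^ j) Y $$ n))" .
  have o: "(lbr z ^^ j) Y $$ n = 0" if "n < j + 1" for j n
    using ord0_lbr_pow[of z 1 Y j] that z0 Y0 by (simp add: ord0_def)
  show Y1: "Y $$ 1 = G" using c[of 1] M o by simp
  have "{1..<M} = insert 1 {2..<M}" using M by auto
  hence "Y $$ 2 = - ((1/2) *\<^sub>R (lbr z Y $$ 2))" using c[of 2] M o[of 2] by simp
  moreover have "lbr z Y $$ 2 = lbr (z $$ 1) (Y $$ 1)"
    by (simp add: fps_lbr_nth z0 Y0 numeral_2_eq_2) (simp add: lbr_def)
  ultimately show "Y $$ 2 = - (1/2) *\<^sub>R lbr (z $$ 1) G" using Y1 by simp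
qed

text \<open>Induction on the degree: the source \<open>Y t $$ n\<close> is a combination of brackets
  of lower components, plus \<open>G t\<close> in degree one, and \<open>bispan_ode\<close>
  transfers membership from the source to the solution \<open>z t $$ n\<close>.\<close>

lemma magnus_Lie:
  fixes A :: "'a::{real_normed_algebra_1,banach}" and S :: "nat => 'a set"
  assumes T: "T > 0" "4 * norm A * T <= 1" and M: "M \<ge> 2"
    and z: "\<And>t. t \<in> {0..T} ==> hasDD A {0..T} t z (Y t)" "\<And>t. z t $$ 0 = 0" "z 0 = 0"
    and Y0: "\<And>t. t \<in> {0..T} ==> Y t $$ 0 = 0"
    and e: "\<And>t. t \<in> {0..T} ==> eqm M (\<Sum>j<M. cf (Suc j) * (lbr (z t) ^^ j) (Y t)) (fps_X * fps_const (G t))"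
    and G: "\<And>t. t \<in> {0..T} ==> G t \<in> bispan (S 1)"
    and S: "\<And>i j x y. i \<ge> 1 ==> j \<ge> 1 ==> x \<in> S i ==> y \<in> S j ==> lbr x y \<in> bispan (S (i + j))"
    and SA: "\<And>i x. i \<ge> 1 ==> x \<in> S i ==> lbr A x \<in> bispan (S i)"
    and n: "1 <= n" "n <= M"
  shows "t \<in> {0..T} ==> z t $$ n \<in> bispan (S n)"
proof -
  have "\<forall>t\<in>{0..T}. z t $$ n \<in> bispan (S n) \<and> Y t $$ n \<in> bispan (S n)"
    using n
  proof (induction n rule: less_induct)
    case (less n)
    have YL: "Y t $$ n \<in> bispan (S n)" if t: "t \<in> {0..T}" for t
    proof -
      have br: "\<forall>m\<in>{1..n}. lbr (z t) w $$ m \<in> bispan (S m)"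
        if w: "w $$ 0 = 0" "\<forall>m\<in>{1..<n}. w $$ m \<in> bispan (S m)" for w
      proof
        fix m assume m: "m \<in> {1..n}"
        have "lbr (z t $$ i) (w $$ (m - i)) \<in> bispan (S m)" if i: "i \<in> {0..m}" for i
        proof (cases "i = 0 \<or> i = m")
          case True
          thus ?thesis using z(2) w(1) subspace_0[OF subspace_bispan] by (auto simp: lbr_def)
        next
          case False
          hence i': "1 <= i" "i < n" "1 <= m - i" "m - i < n" "i + (m - i) = m" using i m by auto
          have "z t $$ i \<in> bispan (S i)" using less.IH[OF i'(2)] i' less.prems t by auto
          moreover have "w $$ (m - i) \<in> bispan (S (m - i))" using w(2) i' by auto
          ultimately have "lbr (z t $$ i) (w $$ (m - i)) \<in> bispan (S (i + (m - i)))"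
            by (rule bispan_lbr) (rule S[OF i'(1) i'(3)])
          thus ?thesis using i' by simp
        qed
        thus "lbr (z t) w $$ m \<in> bispan (S m)"
          unfolding fps_lbr_nth by (intro subspace_sum[OF subspace_bispan]) auto
      qed
      have ad: "((lbr (z t) ^^ Suc j) (Y t) $$ 0 = 0) \<and> (\<forall>m\<in>{1..n}. (lbr (z t) ^^ Suc j) (Y t) $$ m \<in> bispan (S m))" for j
      proof (induction j)
        case 0
        have "\<forall>m\<in>{1..<n}. Y t $$ m \<in> bispan (S m)" using less.IH less.prems t by auto
        thus ?case using br[of "Y t"] Y0[OF t] z(2) by (auto simp: fps_lbr_nth)
      next
        case (Suc j)
        thus ?case using br[of "(lbr (z t) ^^ Suc j) (Y t)"] z(2) by (auto simp: fps_lbr_nth)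
      qed
      have "Y t $$ n = (if n = 1 then G t else 0) - (\<Sum>j=1..<M. (1 / fact (Suc j)) *\<^sub>R ((lbr (z t) ^^ j) (Y t) $$ n))"
        by (rule dexp_coeff(1)[OF z(2) Y0[OF t] M e[OF t]]) (use less.prems in auto)
      also have "\<dots> \<in> bispan (S n)"
      proof (intro subspace_diff[OF subspace_bispan] subspace_sum[OF subspace_bispan] subspace_scale[OF subspace_bispan])
        show "(if n = 1 then G t else 0) \<in> bispan (S n)" using G[OF t] subspace_0[OF subspace_bispan] by auto
        fix j assume "j \<in> {1..<M}"
        thus "(lbr (z t) ^^ j) (Y t) $$ n \<in> bispan (S n)" using ad[of "j - 1"] less.prems by auto
      qed
      finally show ?thesis .
    qed
    have "z t $$ n \<in> bispan (S n)" if t: "t \<in> {0..T}" for t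
    proof (rule bispan_ode[OF T, where z="\<lambda>t. z t $$ n" and Y="\<lambda>t. Y t $$ n"])
      show "((\<lambda>t. z t $$ n) has_vector_derivative lbr A (z t $$ n) + Y t $$ n) (at t within {0..T})" if "t \<in> {0..T}" for t
        using z(1)[OF that] by (simp add: hasDD_def add.commute)
    qed (use YL SA t less.prems z in auto)
    thus ?case using YL by blast
  qed
  thus "t \<in> {0..T} ==> z t $$ n \<in> bispan (S n)" by blast
qed

text \<open>The error is measured relative to the logarithm. In a power \<open>z ^ j\<close> with
  \<open>j \<ge> 2\<close> the last factor, applied to \<open>e\<close>, is completed to the full
  sum of the \<open>z $$ n * e\<close>. The factors in front of it contribute at least one
  \<open>g\<close>, and the completion costs only degrees beyond \<open>M\<close>.\<close>

lemma exp_column: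
  fixes M :: nat
  assumes M: "M \<ge> 1"
  shows "\<exists>C\<ge>0. \<forall>g (p::'a::real_normed_algebra_1 fps) e. 0 <= g --> g <= 1 --> p $$ 0 = 1 --> hb (\<lambda>_. 1) g p -->
     norm ((\<Sum>n=1..M. p $$ n * e) - (\<Sum>n=1..M. logit M M p $$ n * e))
       <= C * (g * norm (\<Sum>n=1..M. logit M M p $$ n * e) + g ^ Suc M * norm e)"
proof -
  obtain c where c: "\<And>g (p::'a fps). g \<ge> 0 ==> hb (\<lambda>_. 1) g p ==> hb c g (logit M M p)" using hb_logit by blast
  have "\<forall>j. \<exists>d. \<forall>g (a::'a fps). g \<ge> 0 --> hb c g a --> hb d g (a ^ j)" using hb_power by blast
  then obtain d where d: "\<And>j g (a::'a fps). g \<ge> 0 ==> hb c g a ==> hb (d j) g (a ^ j)" by metis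
  define C where "C = (\<Sum>j=2..M. \<Sum>i=1..M. \<bar>d (j - 1) i\<bar> * (1 + (\<Sum>l=1..M. \<bar>c l\<bar>)))"
  have "norm ((\<Sum>n=1..M. p $$ n * e) - (\<Sum>n=1..M. logit M M p $$ n * e))
       <= C * (g * norm (\<Sum>n=1..M. logit M M p $$ n * e) + g ^ Suc M * norm e)"
    if g: "0 <= g" "g <= 1" and p0: "p $$ 0 = 1" and hp: "hb (\<lambda>_. 1) g p" for g and p :: "'a fps" and e
  proof -
    define z where "z = logit M M p"
    define \<zeta> where "\<zeta> = (\<Sum>n=1..M. z $$ n * e)"
    have z0: "z $$ 0 = 0" unfolding z_def by (rule logit_0[OF p0])
    have zc: "hb c g z" unfolding z_def by (rule c[OF g(1) hp])
    let ?B = "g * norm \<zeta> + g ^ Suc M * norm e"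
    have pn: "p $$ n - z $$ n = (\<Sum>j=2..M. (1 / fact j) *\<^sub>R (z ^ j $$ n))" if "n \<in> {1..M}" for n
    proof -
      have "p $$ n = (\<Sum>j\<le>M. (1 / fact j) *\<^sub>R (z ^ j $$ n))"
        using exp_logit[OF p0 M] that by (simp add: eqm_def z_def fps_sum_nth cf_nth)
      moreover have "{..M} = {0, 1} \<union> {2..M}" using M by auto
      ultimately show ?thesis using that by (simp add: sum.union_disjoint fps_one_nth)
    qed
    have bnd: "norm (\<Sum>n=1..M. z ^ j $$ n * e) <= (\<Sum>i=1..M. \<bar>d (j - 1) i\<bar> * (1 + (\<Sum>l=1..M. \<bar>c l\<bar>))) * ?B"
      if j: "j \<in> {2..M}" for j
    proof -
      define q where "q = z ^ (j - 1)"
      have qz: "z ^ j = q * z" unfolding q_def using j by (metis Suc_1 Suc_diff_1 atLeastAtMost_iff less_le_trans power_Suc2 zero_less_Suc)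
      have qb: "norm (q $$ i) <= \<bar>d (j - 1) i\<bar> * g ^ i" for i
      proof -
        have "norm (q $$ i) <= d (j - 1) i * g ^ i" using d[OF g(1) zc, of "j - 1"] by (simp add: hb_def q_def)
        also have "\<dots> <= \<bar>d (j - 1) i\<bar> * g ^ i" using g by (intro mult_right_mono) auto
        finally show ?thesis .
      qed
      have q0: "q $$ 0 = 0" using ord0_power[of z "j - 1"] j z0 by (simp add: q_def ord0_def)
      have "(\<Sum>n=1..M. z ^ j $$ n * e) = (\<Sum>n\<le>M. \<Sum>i\<le>n. q $$ i * z $$ (n - i) * e)"
      proof -
        have "(\<Sum>n=1..M. z ^ j $$ n * e) = (\<Sum>n\<le>M. z ^ j $$ n * e)"
          by (rule sum.mono_neutral_left) (use z0 in \<open>auto simp: qz not_le\<close>)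
        thus ?thesis by (simp add: qz fps_mult_nth sum_distrib_right atLeast0AtMost)
      qed
      also have "\<dots> = (\<Sum>(i, l)\<in>{(i, l). i + l <= M}. q $$ i * z $$ l * e)"
        by (rule sum.triangle_reindex_eq[symmetric])
      also have "\<dots> = (\<Sum>(i, l)\<in>(SIGMA i:{1..M}. {1..M - i}). q $$ i * z $$ l * e)"
      proof (rule sum.mono_neutral_right)
        show "finite {(i, l). i + l <= M}"
          by (rule finite_subset[of _ "{..M} \<times> {..M}"]) auto
        show "\<forall>x\<in>{(i, l). i + l <= M} - (SIGMA i:{1..M}. {1..M - i}). (case x of (i, l) => q $$ i * z $$ l * e) = 0"
        proof
          fix x assume x: "x \<in> {(i, l). i + l <= M} - (SIGMA i:{1..M}. {1..M - i})"
          obtain i l where il: "x = (i, l)" by fastforce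
          have "i = 0 \<or> l = 0" using x by (auto simp: il)
          thus "(case x of (i, l) => q $$ i * z $$ l * e) = 0" using q0 z0 by (auto simp: il)
        qed
      qed auto
      also have "\<dots> = (\<Sum>i=1..M. \<Sum>l=1..M - i. q $$ i * z $$ l * e)"
        by (subst sum.Sigma) auto
      also have "norm \<dots> <= (\<Sum>i=1..M. (\<bar>d (j - 1) i\<bar> * (1 + (\<Sum>l=1..M. \<bar>c l\<bar>))) * ?B)"
      proof (rule sum_norm_le)
        fix i assume i: "i \<in> {1..M}"
        \<comment> \<open>The indices added by the completion satisfy \<open>i + l > M\<close> and
          end up in \<open>g ^ Suc M\<close>.\<close>
        have "(\<Sum>l=1..M - i. z $$ l * e) = \<zeta> - (\<Sum>l\<in>{Suc (M - i)..M}. z $$ l * e)"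
        proof -
          have "{1..M} = {1..M - i} \<union> {Suc (M - i)..M}" by auto
          thus ?thesis unfolding \<zeta>_def by (simp add: sum.union_disjoint)
        qed
        hence e1: "(\<Sum>l=1..M - i. q $$ i * z $$ l * e) = q $$ i * \<zeta> - (\<Sum>l\<in>{Suc (M - i)..M}. q $$ i * z $$ l * e)"
          by (simp add: mult.assoc sum_distrib_left[symmetric] right_diff_distrib)
        have gi: "g ^ i <= g" using g i power_decreasing[of 1 i g] by simp
        have "norm (q $$ i * \<zeta>) <= \<bar>d (j - 1) i\<bar> * (g * norm \<zeta>)"
        proof -
          have "norm (q $$ i * \<zeta>) <= norm (q $$ i) * norm \<zeta>" by (rule norm_mult_ineq)
          also have "\<dots> <= (\<bar>d (j - 1) i\<bar> * g ^ i) * norm \<zeta>" by (intro mult_right_mono qb) auto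
          also have "\<dots> <= (\<bar>d (j - 1) i\<bar> * g) * norm \<zeta>" by (intro mult_right_mono mult_left_mono gi) auto
          finally show ?thesis by (simp add: mult.assoc)
        qed
        also have "\<dots> <= \<bar>d (j - 1) i\<bar> * ?B" by (intro mult_left_mono) (use g in auto)
        finally have n1: "norm (q $$ i * \<zeta>) <= \<bar>d (j - 1) i\<bar> * ?B" .
        have "norm (\<Sum>l\<in>{Suc (M - i)..M}. q $$ i * z $$ l * e) <= (\<Sum>l\<in>{Suc (M - i)..M}. \<bar>d (j - 1) i\<bar> * \<bar>c l\<bar> * ?B)"
        proof (rule sum_norm_le)
          fix l assume l: "l \<in> {Suc (M - i)..M}"
          have "norm (q $$ i * z $$ l * e) <= norm (q $$ i) * norm (z $$ l) * norm e"
            by (intro order_trans[OF norm_mult_ineq] mult_right_mono norm_mult_ineq) auto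
          also have "\<dots> <= (\<bar>d (j - 1) i\<bar> * g ^ i) * (\<bar>c l\<bar> * g ^ l) * norm e"
          proof (intro mult_right_mono mult_mono qb)
            have "norm (z $$ l) <= c l * g ^ l" using zc by (simp add: hb_def)
            also have "\<dots> <= \<bar>c l\<bar> * g ^ l" using g by (intro mult_right_mono) auto
            finally show "norm (z $$ l) <= \<bar>c l\<bar> * g ^ l" .
          qed (use g in auto)
          also have "\<dots> = \<bar>d (j - 1) i\<bar> * \<bar>c l\<bar> * (g ^ (i + l) * norm e)" by (simp add: power_add)
          also have "\<dots> <= \<bar>d (j - 1) i\<bar> * \<bar>c l\<bar> * (g ^ Suc M * norm e)"
            using l i g by (intro mult_left_mono mult_right_mono power_decreasing) auto
          also have "\<dots> <= \<bar>d (j - 1) i\<bar> * \<bar>c l\<bar> * ?B" using g by (intro mult_left_mono) auto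
          finally show "norm (q $$ i * z $$ l * e) <= \<bar>d (j - 1) i\<bar> * \<bar>c l\<bar> * ?B" .
        qed
        also have "\<dots> <= (\<Sum>l=1..M. \<bar>d (j - 1) i\<bar> * \<bar>c l\<bar> * ?B)"
          by (rule sum_mono2) (use i g in auto)
        also have "\<dots> = \<bar>d (j - 1) i\<bar> * (\<Sum>l=1..M. \<bar>c l\<bar>) * ?B"
          by (simp add: sum_distrib_left sum_distrib_right)
        finally have n2: "norm (\<Sum>l\<in>{Suc (M - i)..M}. q $$ i * z $$ l * e) <= \<bar>d (j - 1) i\<bar> * (\<Sum>l=1..M. \<bar>c l\<bar>) * ?B" .
        have "norm (\<Sum>l=1..M - i. q $$ i * z $$ l * e) <= \<bar>d (j - 1) i\<bar> * ?B + \<bar>d (j - 1) i\<bar> * (\<Sum>l=1..M. \<bar>c l\<bar>) * ?B"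
          unfolding e1 using norm_triangle_ineq4 n1 n2 by (meson add_mono order_trans)
        also have "\<dots> = (\<bar>d (j - 1) i\<bar> * (1 + (\<Sum>l=1..M. \<bar>c l\<bar>))) * ?B" by (simp only: distrib_left distrib_right mult_1_right mult_1_left)
        finally show "norm (\<Sum>l=1..M - i. q $$ i * z $$ l * e) <= (\<bar>d (j - 1) i\<bar> * (1 + (\<Sum>l=1..M. \<bar>c l\<bar>))) * ?B" .
      qed
      finally show ?thesis by (simp only: sum_distrib_right)
    qed
    have "(\<Sum>n=1..M. p $$ n * e) - \<zeta> = (\<Sum>n=1..M. (p $$ n - z $$ n) * e)"
      by (simp add: \<zeta>_def sum_subtractf left_diff_distrib)
    also have "\<dots> = (\<Sum>n=1..M. \<Sum>j=2..M. (1 / fact j) *\<^sub>R (z ^ j $$ n * e))"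
      by (intro sum.cong refl) (simp add: pn sum_distrib_right)
    also have "\<dots> = (\<Sum>j=2..M. (1 / fact j) *\<^sub>R (\<Sum>n=1..M. z ^ j $$ n * e))"
      by (subst sum.swap) (simp add: scaleR_sum_right)
    also have "norm \<dots> <= (\<Sum>j=2..M. (\<Sum>i=1..M. \<bar>d (j - 1) i\<bar> * (1 + (\<Sum>l=1..M. \<bar>c l\<bar>))) * ?B)"
    proof (rule sum_norm_le)
      fix j assume j: "j \<in> {2..M}"
      have "norm ((1 / fact j) *\<^sub>R (\<Sum>n=1..M. z ^ j $$ n * e)) = (1 / fact j) * norm (\<Sum>n=1..M. z ^ j $$ n * e)" by simp
      also have "\<dots> <= 1 * norm (\<Sum>n=1..M. z ^ j $$ n * e)" by (intro mult_right_mono) (auto simp: fact_ge_1)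
      finally show "norm ((1 / fact j) *\<^sub>R (\<Sum>n=1..M. z ^ j $$ n * e)) <= (\<Sum>i=1..M. \<bar>d (j - 1) i\<bar> * (1 + (\<Sum>l=1..M. \<bar>c l\<bar>))) * ?B"
        using bnd[OF j] by linarith
    qed
    also have "\<dots> = C * ?B" by (simp only: C_def sum_distrib_right)
    finally show ?thesis unfolding \<zeta>_def z_def .
  qed
  moreover have "C \<ge> 0" unfolding C_def by (intro sum_nonneg mult_nonneg_nonneg add_nonneg_nonneg) auto
  ultimately show ?thesis by blast
qed

section \<open>Carleman linearisation\<close>

subsection \<open>A Banach algebra containing all finite matrices\<close>

instance bcontfun :: (metric_space, banach) banach ..

text \<open>The matrices of interest are indexed by the multi-indices of degree at most
  \<open>N\<close>, a set depending on \<open>N\<close>. They are embedded, as finite combinations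
  of matrix units, into the bounded operators on bounded functions of all multi-indices; under the
  discrete topology every such function is continuous.\<close>

type_synonym 'a bseq = "('a discrete, real) bcontfun"

typedef 'a bop = "UNIV :: ('a bseq \<Rightarrow>\<^sub>L 'a bseq) set"
  by simp

setup_lifting type_definition_bop

instantiation bop :: (type) real_normed_vector
begin
lift_definition zero_bop :: "'a bop" is 0 .
lift_definition plus_bop :: "'a bop => 'a bop => 'a bop" is "(+)" .
lift_definition minus_bop :: "'a bop => 'a bop => 'a bop" is "(-)" .
lift_definition uminus_bop :: "'a bop => 'a bop" is uminus .
lift_definition scaleR_bop :: "real => 'a bop => 'a bop" is "(*\<^sub>R)" .
lift_definition norm_bop :: "'a bop => real" is norm .
definition dist_bop :: "'a bop => 'a bop => real" where "dist_bop a b = norm (a - b)"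
definition sgn_bop :: "'a bop => 'a bop" where "sgn_bop a = inverse (norm a) *\<^sub>R a"
definition uniformity_bop :: "('a bop \<times> 'a bop) filter" where
  "uniformity_bop = (INF e\<in>{0<..}. principal {(x, y). dist x y < e})"
definition open_bop :: "'a bop set => bool" where
  "open_bop U = (\<forall>x\<in>U. \<forall>\<^sub>F (x', y) in uniformity. x' = x --> y \<in> U)"
instance
proof
  fix a b c :: "'a bop" and r s :: real
  show "a + b + c = a + (b + c)" by transfer (simp add: add.assoc)
  show "a + b = b + a" by transfer (simp add: add.commute)
  show "0 + a = a" "- a + a = 0" by (transfer; simp)+
  show "a - b = a + - b" by transfer simp
  show "r *\<^sub>R (a + b) = r *\<^sub>R a + r *\<^sub>R b" "(r + s) *\<^sub>R a = r *\<^sub>R a + s *\<^sub>R a"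
    "r *\<^sub>R s *\<^sub>R a = (r * s) *\<^sub>R a" "1 *\<^sub>R a = a"
    by (transfer; simp add: scaleR_add_right scaleR_add_left)+
  show "(norm a = 0) = (a = 0)" "norm (r *\<^sub>R a) = \<bar>r\<bar> * norm a" by (transfer; simp)+
  show "norm (a + b) <= norm a + norm b" by transfer (rule norm_triangle_ineq)
qed (simp_all add: dist_bop_def sgn_bop_def uniformity_bop_def open_bop_def)
end

lemma bseq_one_norm: "norm (const_bcontfun 1 :: 'a bseq) = 1"
proof (rule antisym)
  show "norm (const_bcontfun 1 :: 'a bseq) <= 1" by (rule norm_bound) (simp add: const_bcontfun.rep_eq)
  show "1 <= norm (const_bcontfun 1 :: 'a bseq)"
    using norm_bounded[of "const_bcontfun 1 :: 'a bseq" undefined] by (simp add: const_bcontfun.rep_eq)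
qed

instantiation bop :: (type) real_normed_algebra_1
begin
lift_definition times_bop :: "'a bop => 'a bop => 'a bop" is "blinfun_compose" .
lift_definition one_bop :: "'a bop" is id_blinfun .
instance
proof
  fix a b c :: "'a bop" and r :: real
  show "a * b * c = a * (b * c)" by transfer (simp add: blinfun_eqI)
  show "(a + b) * c = a * c + b * c" "a * (b + c) = a * b + a * c"
    by (transfer; simp add: blinfun_eqI blinfun.bilinear_simps)+
  show "r *\<^sub>R a * b = r *\<^sub>R (a * b)" "a * r *\<^sub>R b = r *\<^sub>R (a * b)"
    by (transfer; simp add: blinfun_eqI blinfun.bilinear_simps)+
  show "1 * a = a" "a * 1 = a" by (transfer; simp add: blinfun_eqI)+
  show "norm (a * b) <= norm a * norm b" by transfer (rule norm_blinfun_compose)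
  have n1: "norm (id_blinfun :: 'a bseq \<Rightarrow>\<^sub>L 'a bseq) = 1"
  proof (rule antisym)
    show "norm (id_blinfun :: 'a bseq \<Rightarrow>\<^sub>L 'a bseq) <= 1" by (rule norm_blinfun_bound) auto
    show "1 <= norm (id_blinfun :: 'a bseq \<Rightarrow>\<^sub>L 'a bseq)"
      using norm_blinfun[of id_blinfun "const_bcontfun 1 :: 'a bseq"] by (simp add: bseq_one_norm)
  qed
  show "norm (1::'a bop) = 1" by transfer (rule n1)
  show "(0::'a bop) \<noteq> 1" using n1 by transfer auto
qed
end

instance bop :: (type) banach
proof
  fix X :: "nat => 'a bop" assume X: "Cauchy X"
  have d: "dist (Rep_bop a) (Rep_bop b) = dist a b" for a b
    by (simp add: dist_norm norm_bop.rep_eq minus_bop.rep_eq)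
  have "Cauchy (\<lambda>n. Rep_bop (X n))" using X by (simp add: Cauchy_def d)
  hence "convergent (\<lambda>n. Rep_bop (X n))" by (simp only: Cauchy_convergent_iff)
  then obtain L where "(\<lambda>n. Rep_bop (X n)) \<longlonglongrightarrow> L" unfolding convergent_def by blast
  hence "(\<lambda>n. Rep_bop (X n)) \<longlonglongrightarrow> Rep_bop (Abs_bop L)" by (simp add: Abs_bop_inverse)
  hence "X \<longlonglongrightarrow> Abs_bop L" by (simp add: tendsto_iff d)
  thus "convergent X" by (auto simp: convergent_def)
qed

definition bunit :: "'a => 'a bseq" where
  "bunit i = Bcontfun (\<lambda>n. if of_discrete n = i then 1 else 0)"

definition munit_fun :: "'a => 'a => 'a bseq => 'a bseq" where
  "munit_fun i j f = apply_bcontfun f (discrete j) *\<^sub>R bunit i"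

lemma apply_bunit: "apply_bcontfun (bunit i) n = (if of_discrete n = i then 1 else 0)"
proof -
  have "(\<lambda>n. if of_discrete n = i then 1 else 0 :: real) \<in> bcontfun"
    by (auto simp: bcontfun_def bounded_iff continuous_on_open_vimage open_discrete intro!: exI[of _ 1])
  thus ?thesis by (simp add: bunit_def Bcontfun_inverse)
qed

lemma bounded_linear_apply_bcontfun: "bounded_linear (\<lambda>f::'a bseq. apply_bcontfun f j)"
proof
  show "\<exists>K. \<forall>x::'a bseq. norm (apply_bcontfun x j) <= norm x * K"
  proof (intro exI[of _ 1] allI)
    fix x :: "'a bseq"
    show "norm (apply_bcontfun x j) <= norm x * 1" using norm_bounded[of x j] by simp
  qed
qed (simp_all add: plus_bcontfun.rep_eq scaleR_bcontfun.rep_eq)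

lemma bounded_linear_munit_fun: "bounded_linear (munit_fun i j)"
  unfolding munit_fun_def[abs_def]
  by (rule bounded_linear_scaleR_const[OF bounded_linear_apply_bcontfun])

lift_definition munit :: "'a => 'a => 'a bop" is "\<lambda>i j. Blinfun (munit_fun i j)" .

lift_definition ment :: "'a => 'a => 'a bop => real" is
  "\<lambda>i j A. apply_bcontfun (blinfun_apply A (bunit j)) (discrete i)" .

lemma munit_mult: "munit i j * munit k l = (if j = k then munit i l else 0)"
  by transfer (auto intro!: blinfun_eqI simp: of_discrete_inverse discrete_inverse bounded_linear_Blinfun_apply[OF bounded_linear_munit_fun]
      munit_fun_def apply_bunit)

lemma ment_munit: "ment i j (munit k l) = (if i = k \<and> j = l then 1 else 0)"
  by transfer (auto simp: of_discrete_inverse discrete_inverse bounded_linear_Blinfun_apply[OF bounded_linear_munit_fun] munit_fun_def apply_bunit)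

lemma bounded_linear_ment: "bounded_linear (ment i j)"
proof
  show "ment i j (a + b) = ment i j a + ment i j b" for a b
    by transfer (simp add: blinfun.add_left)
  show "ment i j (r *\<^sub>R a) = r *\<^sub>R ment i j a" for r a
    by transfer (simp add: blinfun.scaleR_left)
  have "\<bar>ment i j a\<bar> <= norm a * norm (bunit j)" for a
  proof transfer
    fix i j :: 'a and a :: "'a bseq \<Rightarrow>\<^sub>L 'a bseq"
    have "\<bar>apply_bcontfun (blinfun_apply a (bunit j)) (discrete i)\<bar> <= norm (blinfun_apply a (bunit j))"
      using norm_bounded[of "blinfun_apply a (bunit j)" "discrete i"] by simp
    also have "\<dots> <= norm a * norm (bunit j)" by (rule norm_blinfun)
    finally show "\<bar>apply_bcontfun (blinfun_apply a (bunit j)) (discrete i)\<bar> <= norm a * norm (bunit j)" .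
  qed
  thus "\<exists>K. \<forall>a. norm (ment i j a) <= norm a * K" by auto
qed

lemma ment_mult_munit: "ment i j (B * munit j j) = ment i j B"
proof -
  have e: "munit_fun j j (bunit j) = bunit j" by (simp add: munit_fun_def apply_bunit discrete_inverse)
  show ?thesis
    using e by transfer (simp add: bounded_linear_Blinfun_apply[OF bounded_linear_munit_fun])
qed

section \<open>Multi-indices, bracket degrees and Taylor polynomials at the origin\<close>

abbreviation zix :: "'d => nat" where "zix \<equiv> (\<lambda>_. 0)"

definition unit_ix :: "'d => 'd => nat" where
  "unit_ix j = (\<lambda>i. if i = j then 1 else 0)"

lemma unit_ix_neq [simp]: "unit_ix j \<noteq> zix" "zix \<noteq> unit_ix j"
  by (auto simp: unit_ix_def fun_eq_iff)

lemma unit_ix_inj [simp]: "unit_ix i = unit_ix j \<longleftrightarrow> i = j"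
  by (auto simp: unit_ix_def fun_eq_iff split: if_splits)

lemma deg_zix [simp]: "deg zix = 0"
  by (simp add: deg_def)

lemma deg_unit_ix [simp]: "deg (unit_ix j) = 1"
  by (simp add: deg_def unit_ix_def)

lemma mon_unit_ix [simp]: "mon (unit_ix j) x = x $ j"
  by (simp add: mon_def unit_ix_def if_distrib prod.If_cases cong: if_cong)

text \<open>Only monomials of degree one have a nonzero derivative at the origin, so this value just
  reads off a component of \<open>X 0\<close>.\<close>

lemma der_mon_at_0:
  "der X (mon \<alpha>) 0 = (\<Sum>j\<in>UNIV. X 0 $ j * (if \<alpha> = unit_ix j then 1 else 0))"
proof -
  have "real (\<alpha> j) * mon (lower j \<alpha>) 0 = (if \<alpha> = unit_ix j then 1 else 0)" for j
  proof (cases "\<alpha> = unit_ix j")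
    case True
    have "lower j (unit_ix j) = zix" by (auto simp: lower_def unit_ix_def)
    thus ?thesis using True by (simp add: mon_at_0) (simp add: unit_ix_def)
  next
    case False
    have "\<alpha> j = 0 \<or> lower j \<alpha> \<noteq> zix"
    proof (rule ccontr)
      assume "\<not> (\<alpha> j = 0 \<or> lower j \<alpha> \<noteq> zix)"
      hence "\<alpha> j \<noteq> 0" and l: "\<And>i. lower j \<alpha> i = 0" by auto
      hence "\<alpha> i = unit_ix j i" for i using l[of i] by (cases "i = j") (auto simp: lower_def unit_ix_def)
      thus False using False by auto
    qed
    thus ?thesis using False by (auto simp: mon_at_0)
  qed
  thus ?thesis by (simp add: der_def pd_mon)
qed

definition nocc :: "br => nat" where
  "nocc b = occ X1 b + occ X2 b"

lemma nocc_simps [simp]: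
  "nocc (Leaf X0) = 0" "nocc (Leaf X1) = 1" "nocc (Leaf X2) = 1" "nocc (Bracket a b) = nocc a + nocc b"
  by (simp_all add: nocc_def)

text \<open>Existence of a Taylor polynomial of degree \<open>N\<close> at \<open>0\<close>, in the
  sense of \<open>flat\<close>. The class is closed under the operations occurring in
  \<open>f i \<cdot> \<nabla> x^\<alpha>\<close> and so provides the Carleman coefficients.\<close>

definition polyf :: "nat => (real^'d::finite => real) => bool" where
  "polyf N h \<longleftrightarrow> smooth h \<and> (\<exists>a. flat (Suc N) (\<lambda>x. h x - (\<Sum>\<beta>\<in>{\<beta>. deg \<beta> <= N}. a \<beta> * mon \<beta> x)))"

lemma polyf_flat: "smooth h ==> flat (Suc N) h ==> polyf N h"
  unfolding polyf_def by (intro conjI exI[of _ "\<lambda>_. 0"]) (auto simp del: flat.simps)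

lemma polyf_mon: "polyf N (mon \<alpha>)"
proof (cases "deg \<alpha> <= N")
  case True
  have "(\<Sum>\<beta>\<in>{\<beta>. deg \<beta> <= N}. (if \<beta> = \<alpha> then 1 else 0) * mon \<beta> x) = mon \<alpha> x" for x :: "real^'a"
    using True by (simp add: if_distrib if_distribR sum.delta cong: if_cong)
  thus ?thesis unfolding polyf_def
    by (intro conjI exI[of _ "\<lambda>\<beta>. if \<beta> = \<alpha> then 1 else 0"]) (auto simp del: flat.simps)
next
  case False
  thus ?thesis using flat_le[OF flat_mon, of "Suc N" \<alpha>] by (intro polyf_flat) auto
qed

lemma polyf_add: "polyf N g ==> polyf N h ==> polyf N (\<lambda>x. g x + h x)"
  unfolding polyf_def
proof (elim conjE exE)
  fix a b
  let ?I = "{\<beta>. deg \<beta> <= N}"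
  assume g: "smooth g" "flat (Suc N) (\<lambda>x. g x - (\<Sum>\<beta>\<in>?I. a \<beta> * mon \<beta> x))"
    and h: "smooth h" "flat (Suc N) (\<lambda>x. h x - (\<Sum>\<beta>\<in>?I. b \<beta> * mon \<beta> x))"
  have "flat (Suc N) (\<lambda>x. (g x - (\<Sum>\<beta>\<in>?I. a \<beta> * mon \<beta> x)) + (h x - (\<Sum>\<beta>\<in>?I. b \<beta> * mon \<beta> x)))"
    by (intro flat_add g h smooth_diff smooth_sum smooth_cmult smooth_mon)
  also have "(\<lambda>x. (g x - (\<Sum>\<beta>\<in>?I. a \<beta> * mon \<beta> x)) + (h x - (\<Sum>\<beta>\<in>?I. b \<beta> * mon \<beta> x)))
    = (\<lambda>x. g x + h x - (\<Sum>\<beta>\<in>?I. (a \<beta> + b \<beta>) * mon \<beta> x))"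
    by (simp add: fun_eq_iff distrib_right sum.distrib)
  finally show "smooth (\<lambda>x. g x + h x) \<and> (\<exists>a. flat (Suc N) (\<lambda>x. g x + h x - (\<Sum>\<beta>\<in>?I. a \<beta> * mon \<beta> x)))"
    using smooth_add[OF g(1) h(1)] by (intro conjI exI[of _ "\<lambda>\<beta>. a \<beta> + b \<beta>"]) (auto simp del: flat.simps)
qed

lemma polyf_cmult: "polyf N g ==> polyf N (\<lambda>x. c * g x)"
  unfolding polyf_def
proof (elim conjE exE)
  fix a
  let ?I = "{\<beta>. deg \<beta> <= N}"
  assume g: "smooth g" "flat (Suc N) (\<lambda>x. g x - (\<Sum>\<beta>\<in>?I. a \<beta> * mon \<beta> x))"
  have "flat (Suc N) (\<lambda>x. c * (g x - (\<Sum>\<beta>\<in>?I. a \<beta> * mon \<beta> x)))"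
    by (intro flat_cmult g smooth_diff smooth_sum smooth_cmult smooth_mon)
  also have "(\<lambda>x. c * (g x - (\<Sum>\<beta>\<in>?I. a \<beta> * mon \<beta> x))) = (\<lambda>x. c * g x - (\<Sum>\<beta>\<in>?I. (c * a \<beta>) * mon \<beta> x))"
    by (simp add: fun_eq_iff right_diff_distrib sum_distrib_left mult.assoc)
  finally show "smooth (\<lambda>x. c * g x) \<and> (\<exists>a. flat (Suc N) (\<lambda>x. c * g x - (\<Sum>\<beta>\<in>?I. a \<beta> * mon \<beta> x)))"
    using smooth_cmult[OF g(1)] by (intro conjI exI[of _ "\<lambda>\<beta>. c * a \<beta>"]) (auto simp del: flat.simps)
qed

lemma polyf_sum: "(\<And>i. i \<in> I ==> polyf N (g i)) ==> polyf N (\<lambda>x. \<Sum>i\<in>I. g i x)"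
proof (induction I rule: infinite_finite_induct)
  case (insert x F)
  thus ?case using polyf_add[of N "g x" "\<lambda>y. \<Sum>i\<in>F. g i y"] by simp
qed (auto intro: polyf_flat simp del: flat.simps)

lemma polyf_mult_mon:
  assumes "polyf N g" shows "polyf N (\<lambda>x. g x * mon \<gamma> x)"
proof -
  let ?I = "{\<beta>. deg \<beta> <= N}"
  obtain a where g: "smooth g" "flat (Suc N) (\<lambda>x. g x - (\<Sum>\<beta>\<in>?I. a \<beta> * mon \<beta> x))"
    using assms by (auto simp: polyf_def simp del: flat.simps)
  have s: "smooth (\<lambda>x. g x - (\<Sum>\<beta>\<in>?I. a \<beta> * mon \<beta> x))"
    by (intro g smooth_diff smooth_sum smooth_cmult smooth_mon)
  have "polyf N (\<lambda>x. mon \<gamma> x * (g x - (\<Sum>\<beta>\<in>?I. a \<beta> * mon \<beta> x)) + (\<Sum>\<beta>\<in>?I. a \<beta> * mon (\<lambda>i. \<beta> i + \<gamma> i) x))"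
    by (intro polyf_add polyf_sum polyf_cmult polyf_mon polyf_flat flat_mult1 smooth_mult s g smooth_mon)
  also have "(\<lambda>x. mon \<gamma> x * (g x - (\<Sum>\<beta>\<in>?I. a \<beta> * mon \<beta> x)) + (\<Sum>\<beta>\<in>?I. a \<beta> * mon (\<lambda>i. \<beta> i + \<gamma> i) x))
     = (\<lambda>x. g x * mon \<gamma> x)"
    by (simp add: fun_eq_iff mon_add right_diff_distrib sum_distrib_left mult_ac)
  finally show ?thesis .
qed

lemma polyf_analytic:
  assumes "analytic_fun g" shows "polyf N g"
proof -
  obtain c where "flat (Suc N) (\<lambda>x. g x - (\<Sum>\<alpha>\<in>{\<alpha>. deg \<alpha> <= N}. c \<alpha> * mon \<alpha> x))"
    using analytic_taylor[OF assms] by blast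
  thus ?thesis unfolding polyf_def using analytic_fun_smooth[OF assms] by blast
qed

lemma polyf_der_mon:
  assumes "\<And>j. analytic_fun (\<lambda>x. X x $ j)"
  shows "polyf N (der X (mon \<alpha>))"
proof -
  have "polyf N (\<lambda>x. \<Sum>j\<in>UNIV. real (\<alpha> j) * (X x $ j * mon (lower j \<alpha>) x))"
    by (intro polyf_sum polyf_cmult polyf_mult_mon polyf_analytic assms)
  thus ?thesis by (simp add: der_def[abs_def] pd_mon mult_ac)
qed

subsection \<open>Carleman linearisation\<close>

text \<open>\<open>a i \<alpha> \<beta>\<close> are the coefficients of \<open>f i \<cdot> \<nabla> x^\<alpha>\<close> in the monomials of degree at most \<open>N\<close>.\<close>
locale carleman =
  fixes f :: "letter => real^'d::finite => real^'d" and N :: nat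
    and a :: "letter => ('d => nat) => ('d => nat) => real"
  assumes sf: "\<And>i. sfield (f i)" and f00: "f X0 0 = 0" and N2: "N \<ge> 2"
    and rep: "\<And>i \<alpha>. flat (Suc N) (\<lambda>x. der (f i) (mon \<alpha>) x - (\<Sum>\<beta>\<in>{\<beta>. deg \<beta> <= N}. a i \<alpha> \<beta> * mon \<beta> x))"
begin

definition Ix :: "('d => nat) set" where "Ix = {\<beta>. deg \<beta> <= N}"

lemma finite_Ix [simp]: "finite Ix" by (simp add: Ix_def)
lemma zix_Ix [simp]: "zix \<in> Ix" by (simp add: Ix_def)
lemma unit_Ix [simp]: "unit_ix j \<in> Ix" using N2 by (simp add: Ix_def)

definition mat :: "(('d => nat) => ('d => nat) => real) => ('d => nat) bop" where
  "mat c = (\<Sum>\<alpha>\<in>Ix. \<Sum>\<beta>\<in>Ix. c \<alpha> \<beta> *\<^sub>R munit \<alpha> \<beta>)"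

lemma mat_mult: "mat c * mat d = mat (\<lambda>\<alpha> \<gamma>. \<Sum>\<beta>\<in>Ix. c \<alpha> \<beta> * d \<beta> \<gamma>)"
proof -
  have "mat c * mat d = (\<Sum>\<alpha>\<in>Ix. \<Sum>\<delta>\<in>Ix. \<Sum>\<beta>\<in>Ix. \<Sum>\<gamma>\<in>Ix. (c \<alpha> \<beta> * d \<delta> \<gamma>) *\<^sub>R (munit \<alpha> \<beta> * munit \<delta> \<gamma>))"
    by (simp add: mat_def sum_product mult.commute)
  also have "\<dots> = (\<Sum>\<alpha>\<in>Ix. \<Sum>\<delta>\<in>Ix. \<Sum>\<gamma>\<in>Ix. \<Sum>\<beta>\<in>Ix. if \<beta> = \<delta> then (c \<alpha> \<delta> * d \<delta> \<gamma>) *\<^sub>R munit \<alpha> \<gamma> else 0)"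
    by (rule sum.cong[OF refl], rule sum.cong[OF refl], subst sum.swap,
        rule sum.cong[OF refl], rule sum.cong[OF refl]) (simp add: munit_mult)
  also have "\<dots> = (\<Sum>\<alpha>\<in>Ix. \<Sum>\<delta>\<in>Ix. \<Sum>\<gamma>\<in>Ix. (c \<alpha> \<delta> * d \<delta> \<gamma>) *\<^sub>R munit \<alpha> \<gamma>)"
    by (intro sum.cong refl) (simp add: sum.delta)
  also have "\<dots> = (\<Sum>\<alpha>\<in>Ix. \<Sum>\<gamma>\<in>Ix. \<Sum>\<delta>\<in>Ix. (c \<alpha> \<delta> * d \<delta> \<gamma>) *\<^sub>R munit \<alpha> \<gamma>)"
    by (rule sum.cong[OF refl], rule sum.swap)
  finally show ?thesis by (simp add: mat_def scaleR_sum_left)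
qed

lemma mat_diff: "mat c - mat d = mat (\<lambda>\<alpha> \<beta>. c \<alpha> \<beta> - d \<alpha> \<beta>)"
  by (simp add: mat_def sum_subtractf scaleR_diff_left)

lemma mat_col: "mat c * munit \<beta> \<gamma> = (if \<beta> \<in> Ix then \<Sum>\<alpha>\<in>Ix. c \<alpha> \<beta> *\<^sub>R munit \<alpha> \<gamma> else 0)"
proof -
  have "mat c * munit \<beta> \<gamma> = (\<Sum>\<alpha>\<in>Ix. \<Sum>\<delta>\<in>Ix. if \<delta> = \<beta> then c \<alpha> \<delta> *\<^sub>R munit \<alpha> \<gamma> else 0)"
    unfolding mat_def sum_distrib_right by (intro sum.cong refl) (simp add: munit_mult)
  thus ?thesis by (simp add: sum.delta)
qed

text \<open>The order of the factors is reversed: row \<open>\<alpha>\<close> expands a field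
  applied to \<open>x^\<alpha>\<close>, so composition of operators multiplies the matrices in the
  opposite order. Accordingly \<open>Aop_Bracket\<close> swaps the two entries.\<close>

primrec cb :: "br => ('d => nat) => ('d => nat) => real" where
  "cb (Leaf i) = a i"
| "cb (Bracket b c) = (\<lambda>\<alpha> \<gamma>. (\<Sum>\<beta>\<in>Ix. cb c \<alpha> \<beta> * cb b \<beta> \<gamma>) - (\<Sum>\<beta>\<in>Ix. cb b \<alpha> \<beta> * cb c \<beta> \<gamma>))"

definition Aop :: "br => ('d => nat) bop" where "Aop b = mat (cb b)"

lemma Aop_Bracket: "Aop (Bracket b c) = lbr (Aop c) (Aop b)"
  by (simp add: Aop_def lbr_def mat_mult mat_diff)

definition Fb :: "br => real^'d => real^'d" where "Fb b = Lam f (Ev b)"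

lemma Fb_Leaf: "Fb (Leaf i) = f i"
  by (simp add: Fb_def Lam_gen[OF sf])

lemma Fb_Bracket: "Fb (Bracket b c) = field_bracket (Fb b) (Fb c)"
  by (simp add: Fb_def Lam_comm[OF sf])

lemma sfield_Fb: "sfield (Fb b)"
  by (simp add: Fb_def Lam_sfield[OF sf])

lemma field_bracket_at: "sfield X ==> sfield Y ==> X p = 0 ==> Y p = 0 ==> field_bracket X Y p = 0"
  by (simp add: field_bracket_def frechet_sfield vec_eq_iff)

lemma Fb_nocc_0: "nocc b = 0 ==> Fb b 0 = 0"
proof (induction b)
  case (Leaf i)
  hence "i = X0" by (cases i) auto
  thus ?case using f00 by (simp add: Fb_Leaf)
qed (simp add: Fb_Bracket field_bracket_at sfield_Fb)

abbreviation rem :: "br => ('d => nat) => real^'d => real" where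
  "rem b \<alpha> \<equiv> \<lambda>x. der (Fb b) (mon \<alpha>) x - (\<Sum>\<beta>\<in>Ix. cb b \<alpha> \<beta> * mon \<beta> x)"

lemma smooth_rem: "smooth (rem b \<alpha>)"
  by (intro smooth_diff smooth_der sfield_Fb smooth_mon smooth_sum smooth_cmult)

text \<open>A controlled field costs one order of accuracy, being a differentiation, and
  \<open>f X0\<close> costs none because it vanishes at \<open>0\<close>. Hence the truncated
  matrices give the right values at the origin for brackets of up to \<open>N\<close> controlled
  fields, with any number of \<open>X0\<close>.\<close>

lemma flat_rem: "flat (Suc N - nocc b) (rem b \<alpha>)"
proof (induction b arbitrary: \<alpha>)
  case (Leaf i)
  thus ?case using rep[of i \<alpha>] flat_le[OF rep[of i \<alpha>]] by (simp add: Fb_Leaf Ix_def del: flat.simps)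
next
  case (Bracket b c)
  have half: "flat (Suc N - (nocc b' + nocc c'))
     (\<lambda>x. der (Fb b') (der (Fb c') (mon \<alpha>)) x - (\<Sum>\<gamma>\<in>Ix. (\<Sum>\<beta>\<in>Ix. cb c' \<alpha> \<beta> * cb b' \<beta> \<gamma>) * mon \<gamma> x))"
    if b: "\<And>\<alpha>. flat (Suc N - nocc b') (rem b' \<alpha>)" and c: "\<And>\<alpha>. flat (Suc N - nocc c') (rem c' \<alpha>)" for b' c'
  proof -
    have "der (Fb c') (mon \<alpha>) = (\<lambda>x. (\<Sum>\<beta>\<in>Ix. cb c' \<alpha> \<beta> * mon \<beta> x) + rem c' \<alpha> x)" by (rule ext) simp
    hence "der (Fb b') (der (Fb c') (mon \<alpha>))
       = der (Fb b') (\<lambda>x. (\<Sum>\<beta>\<in>Ix. cb c' \<alpha> \<beta> * mon \<beta> x) + rem c' \<alpha> x)" by (rule arg_cong)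
    also have "\<dots> = (\<lambda>x. der (Fb b') (\<lambda>x. \<Sum>\<beta>\<in>Ix. cb c' \<alpha> \<beta> * mon \<beta> x) x + der (Fb b') (rem c' \<alpha>) x)"
      by (intro der_add smooth_sum smooth_cmult smooth_mon smooth_rem)
    also have "der (Fb b') (\<lambda>x. \<Sum>\<beta>\<in>Ix. cb c' \<alpha> \<beta> * mon \<beta> x) = (\<lambda>x. \<Sum>\<beta>\<in>Ix. der (Fb b') (\<lambda>x. cb c' \<alpha> \<beta> * mon \<beta> x) x)"
      by (intro der_sum smooth_cmult smooth_mon)
    also have "\<dots> = (\<lambda>x. \<Sum>\<beta>\<in>Ix. cb c' \<alpha> \<beta> * der (Fb b') (mon \<beta>) x)"
      by (simp add: der_cmult)
    also have "\<dots> = (\<lambda>x. (\<Sum>\<gamma>\<in>Ix. (\<Sum>\<beta>\<in>Ix. cb c' \<alpha> \<beta> * cb b' \<beta> \<gamma>) * mon \<gamma> x) + (\<Sum>\<beta>\<in>Ix. cb c' \<alpha> \<beta> * rem b' \<beta> x))"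
    proof
      fix x
      have "(\<Sum>\<beta>\<in>Ix. cb c' \<alpha> \<beta> * der (Fb b') (mon \<beta>) x)
        = (\<Sum>\<beta>\<in>Ix. \<Sum>\<gamma>\<in>Ix. cb c' \<alpha> \<beta> * cb b' \<beta> \<gamma> * mon \<gamma> x) + (\<Sum>\<beta>\<in>Ix. cb c' \<alpha> \<beta> * rem b' \<beta> x)"
        by (simp add: right_diff_distrib sum_subtractf sum_distrib_left mult.assoc)
      also have "(\<Sum>\<beta>\<in>Ix. \<Sum>\<gamma>\<in>Ix. cb c' \<alpha> \<beta> * cb b' \<beta> \<gamma> * mon \<gamma> x) = (\<Sum>\<gamma>\<in>Ix. (\<Sum>\<beta>\<in>Ix. cb c' \<alpha> \<beta> * cb b' \<beta> \<gamma>) * mon \<gamma> x)"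
        by (subst sum.swap) (simp add: sum_distrib_right)
      finally show "(\<Sum>\<beta>\<in>Ix. cb c' \<alpha> \<beta> * der (Fb b') (mon \<beta>) x)
        = (\<Sum>\<gamma>\<in>Ix. (\<Sum>\<beta>\<in>Ix. cb c' \<alpha> \<beta> * cb b' \<beta> \<gamma>) * mon \<gamma> x) + (\<Sum>\<beta>\<in>Ix. cb c' \<alpha> \<beta> * rem b' \<beta> x)" .
    qed
    finally have e: "(\<lambda>x. der (Fb b') (der (Fb c') (mon \<alpha>)) x - (\<Sum>\<gamma>\<in>Ix. (\<Sum>\<beta>\<in>Ix. cb c' \<alpha> \<beta> * cb b' \<beta> \<gamma>) * mon \<gamma> x))
      = (\<lambda>x. (\<Sum>\<beta>\<in>Ix. cb c' \<alpha> \<beta> * rem b' \<beta> x) + der (Fb b') (rem c' \<alpha>) x)"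
      by (simp add: fun_eq_iff)
    have f1: "flat (Suc N - (nocc b' + nocc c')) (\<lambda>x. \<Sum>\<beta>\<in>Ix. cb c' \<alpha> \<beta> * rem b' \<beta> x)"
      by (intro flat_sum flat_cmult flat_le[OF b] smooth_cmult smooth_rem) auto
    have f2: "flat (Suc N - (nocc b' + nocc c')) (der (Fb b') (rem c' \<alpha>))"
    \<comment> \<open>Without controlled fields the bracket vanishes at \<open>0\<close> and
      preserves the order of flatness; otherwise one order is lost, which the count
      \<open>nocc b'\<close> pays for.\<close>
    proof (cases "nocc b' = 0")
      case True
      thus ?thesis using flat_der0[OF sfield_Fb smooth_rem c Fb_nocc_0] by simp
    next
      case False
      show ?thesis
      proof (cases "Suc N - nocc c'")
        case (Suc q)
        have "flat q (der (Fb b') (rem c' \<alpha>))"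
          by (rule flat_der[OF sfield_Fb smooth_rem]) (use c[of \<alpha>] Suc in simp)
        thus ?thesis by (rule flat_le) (use False Suc in auto)
      qed simp
    qed
    show ?thesis unfolding e
      by (intro flat_add f1 f2 smooth_sum smooth_cmult smooth_rem smooth_der sfield_Fb)
  qed
  have "rem (Bracket b c) \<alpha> = (\<lambda>x.
     (der (Fb b) (der (Fb c) (mon \<alpha>)) x - (\<Sum>\<gamma>\<in>Ix. (\<Sum>\<beta>\<in>Ix. cb c \<alpha> \<beta> * cb b \<beta> \<gamma>) * mon \<gamma> x))
   - (der (Fb c) (der (Fb b) (mon \<alpha>)) x - (\<Sum>\<gamma>\<in>Ix. (\<Sum>\<beta>\<in>Ix. cb b \<alpha> \<beta> * cb c \<beta> \<gamma>) * mon \<gamma> x)))"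
    by (rule ext) (simp add: Fb_Bracket der_bracket sfield_Fb left_diff_distrib sum_subtractf)
  moreover have "flat (Suc N - nocc (Bracket b c)) \<dots>"
  proof (rule flat_diff)
    show "flat (Suc N - nocc (Bracket b c)) (\<lambda>x. der (Fb b) (der (Fb c) (mon \<alpha>)) x
        - (\<Sum>\<gamma>\<in>Ix. (\<Sum>\<beta>\<in>Ix. cb c \<alpha> \<beta> * cb b \<beta> \<gamma>) * mon \<gamma> x))"
      using half[OF Bracket.IH] by simp
    show "flat (Suc N - nocc (Bracket b c)) (\<lambda>x. der (Fb c) (der (Fb b) (mon \<alpha>)) x
        - (\<Sum>\<gamma>\<in>Ix. (\<Sum>\<beta>\<in>Ix. cb b \<alpha> \<beta> * cb c \<beta> \<gamma>) * mon \<gamma> x))"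
      using half[OF Bracket.IH(2,1)] by (simp add: add.commute)
  qed (intro smooth_diff smooth_der smooth_sum smooth_cmult smooth_mon sfield_Fb)+
  ultimately show ?case by simp
qed

lemma cb_col:
  assumes "nocc b <= N"
  shows "cb b \<alpha> zix = (\<Sum>j\<in>UNIV. Fb b 0 $ j * (if \<alpha> = unit_ix j then 1 else 0))"
proof -
  have "flat (Suc 0) (rem b \<alpha>)" by (rule flat_le[OF flat_rem]) (use assms in simp)
  hence "der (Fb b) (mon \<alpha>) 0 = (\<Sum>\<beta>\<in>Ix. cb b \<alpha> \<beta> * mon \<beta> 0)" by simp
  also have "\<dots> = cb b \<alpha> zix"
    by (simp add: mon_at_0 if_distrib sum.delta cong: if_cong)
  finally show ?thesis by (simp add: der_mon_at_0)
qed

abbreviation E0 :: "('d => nat) bop" where "E0 \<equiv> munit zix zix"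

lemma Aop_E0:
  assumes "nocc b <= N"
  shows "Aop b * E0 = (\<Sum>j\<in>UNIV. Fb b 0 $ j *\<^sub>R munit (unit_ix j) zix)"
proof -
  have "Aop b * E0 = (\<Sum>\<alpha>\<in>Ix. cb b \<alpha> zix *\<^sub>R munit \<alpha> zix)"
    by (simp add: Aop_def mat_col)
  also have "\<dots> = (\<Sum>\<alpha>\<in>Ix. \<Sum>j\<in>UNIV. if \<alpha> = unit_ix j then Fb b 0 $ j *\<^sub>R munit \<alpha> zix else 0)"
    by (intro sum.cong refl) (auto simp: cb_col[OF assms] scaleR_sum_left intro!: sum.cong)
  also have "\<dots> = (\<Sum>j\<in>UNIV. \<Sum>\<alpha>\<in>Ix. if \<alpha> = unit_ix j then Fb b 0 $ j *\<^sub>R munit \<alpha> zix else 0)"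
    by (rule sum.swap)
  finally show ?thesis by (simp add: sum.delta)
qed

definition bvec :: "('d => nat) bop => real^'d" where
  "bvec B = (\<chi> j. ment (unit_ix j) zix B)"

lemma bounded_linear_bvec: "bounded_linear bvec"
proof (subst bounded_linear_componentwise_iff, rule ballI)
  fix i :: "real^'d" assume "i \<in> Basis"
  then obtain j where "i = axis j 1" by (auto simp: Basis_vec_def)
  hence "(\<lambda>x. bvec x \<bullet> i) = ment (unit_ix j) zix" by (auto simp: bvec_def inner_axis)
  thus "bounded_linear (\<lambda>x. bvec x \<bullet> i)" using bounded_linear_ment by metis
qed

lemma ment_mat: "\<alpha> \<in> Ix ==> \<beta> \<in> Ix ==> ment \<alpha> \<beta> (mat c) = c \<alpha> \<beta>"
proof -
  assume ab: "\<alpha> \<in> Ix" "\<beta> \<in> Ix"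
  interpret bounded_linear "ment \<alpha> \<beta>" by (rule bounded_linear_ment)
  have "ment \<alpha> \<beta> (mat c) = (\<Sum>\<gamma>\<in>Ix. \<Sum>\<delta>\<in>Ix. if \<delta> = \<beta> then (if \<gamma> = \<alpha> then c \<gamma> \<delta> else 0) else 0)"
    unfolding mat_def sum scaleR by (intro sum.cong refl) (simp add: ment_munit)
  thus ?thesis using ab by (simp add: sum.delta)
qed

lemma bvec_Aop: "nocc b <= N ==> bvec (Aop b) = Fb b 0"
  by (simp add: bvec_def Aop_def ment_mat cb_col vec_eq_iff if_distrib cong: if_cong)

definition Lset :: "nat => ('d => nat) bop set" where
  "Lset n = {Aop b | b. nocc b = n}"

abbreviation Lie :: "nat => ('d => nat) bop set" where
  "Lie n \<equiv> bispan (Lset n)"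

lemma Lset_lbr: "x \<in> Lset i ==> y \<in> Lset j ==> lbr x y \<in> Lie (i + j)"
  by (rule bispan_base) (force simp: Lset_def Aop_Bracket[symmetric] intro: add.commute)

lemma Aop_Lie: "nocc b = n ==> Aop b \<in> Lie n"
  by (rule bispan_base) (auto simp: Lset_def)

lemma Lie_lbr: "x \<in> Lie i ==> y \<in> Lie j ==> lbr x y \<in> Lie (i + j)"
  by (rule bispan_lbr) (use Lset_lbr in auto)

lemma Lie_lbr_A0: "x \<in> Lie i ==> lbr (Aop (Leaf X0)) x \<in> Lie i"
  using Lie_lbr[OF Aop_Lie[of "Leaf X0" 0]] by simp

text \<open>The linearisation of the drift. Since \<open>f X0\<close> vanishes at \<open>0\<close>,
  bracketing with \<open>X0\<close> acts on values at \<open>0\<close> through this one linear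
  map.\<close>

definition Hmap :: "real^'d => real^'d" where
  "Hmap = frechet_derivative (f X0) (at 0)"

lemma linear_Hmap: "linear Hmap"
  unfolding Hmap_def using sfield_frechet[OF sf] by (intro linear_frechet_derivative) (auto simp: differentiable_def)

lemma Fb_Bracket_X0: "Fb (Bracket b (Leaf X0)) 0 = Hmap (Fb b 0)"
proof -
  have "linear (frechet_derivative (Fb b) (at 0))"
    using sfield_frechet[OF sfield_Fb] by (intro linear_frechet_derivative) (auto simp: differentiable_def)
  thus ?thesis by (simp add: Fb_Bracket Fb_Leaf field_bracket_def f00 Hmap_def linear_0)
qed

text \<open>For brackets this is \<open>Fb_Bracket_X0\<close>; it extends to the bi-annihilator one
  component at a time.\<close>

lemma bvec_lbr_A0:
  assumes "B \<in> Lie n" "n <= N"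
  shows "bvec (lbr (Aop (Leaf X0)) B) = Hmap (bvec B)"
proof -
  have H: "bounded_linear Hmap" using linear_Hmap by (rule linear_conv_bounded_linear[THEN iffD1])
  have "bvec (lbr (Aop (Leaf X0)) B) $ j - Hmap (bvec B) $ j = 0" for j
  proof (rule bispan_real[OF assms(1)])
    show "bounded_linear (\<lambda>B. bvec (lbr (Aop (Leaf X0)) B) $ j - Hmap (bvec B) $ j)"
      by (intro bounded_linear_sub bounded_linear_compose[OF bounded_linear_vec_nth]
          bounded_linear_compose[OF bounded_linear_bvec bounded_linear_lbr(1)] bounded_linear_compose[OF H bounded_linear_bvec])
    fix x assume "x \<in> Lset n"
    then obtain b where b: "x = Aop b" "nocc b = n" by (auto simp: Lset_def)
    have "bvec (lbr (Aop (Leaf X0)) x) = Hmap (bvec x)"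
      using bvec_Aop[of "Bracket b (Leaf X0)"] bvec_Aop[of b] b assms(2)
      by (simp add: Aop_Bracket Fb_Bracket_X0)
    thus "bvec (lbr (Aop (Leaf X0)) x) $ j - Hmap (bvec x) $ j = 0" by simp
  qed
  thus ?thesis by (simp add: vec_eq_iff)
qed

text \<open>The equilibrium at the origin in matrix form. On the column \<open>E0\<close> the
  commutator with this matrix becomes plain multiplication, so the exponential factor of the
  interaction picture is invisible there.\<close>

lemma A0_E0: "Aop (Leaf X0) * E0 = 0"
  using Aop_E0[of "Leaf X0"] f00 by (simp add: Fb_Leaf)

end

section \<open>The Magnus representation of trajectories\<close>

definition l1n :: "real => (real => real) => (real => real) => real" where
  "l1n T u v = integral {0..T} (\<lambda>t. \<bar>u t\<bar> + \<bar>v t\<bar>)"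

definition traj :: "(letter => real^'d::finite => real^'d) => real => (real => real) => (real => real) => (real => real^'d) => bool" where
  "traj f T u v x \<longleftrightarrow> 0 < T \<and> continuous_on {0..T} u \<and> continuous_on {0..T} v \<and> x 0 = 0 \<and>
     (\<forall>t\<in>{0..T}. (x has_vector_derivative (f X0 (x t) + u t *\<^sub>R f X1 (x t) + v t *\<^sub>R f X2 (x t))) (at t within {0..T}))"

lemma abs_add_integrable:
  fixes u v :: "real => real"
  assumes "continuous_on {0..T} u" "continuous_on {0..T} v"
  shows "(\<lambda>t. \<bar>u t\<bar> + \<bar>v t\<bar>) integrable_on {0..T}"
  using assms by (intro integrable_continuous_real continuous_intros)

lemma l1n_nonneg: "continuous_on {0..T} u ==> continuous_on {0..T} v ==> 0 <= l1n T u v"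
  unfolding l1n_def by (rule integral_nonneg[OF abs_add_integrable]) auto

context carleman
begin

section \<open>Bounds on the fields and a priori bounds on trajectories\<close>

lemma uniform_bound:
  fixes G :: "letter => real^'d => 'b::real_normed_vector"
  assumes "\<And>i. \<exists>C\<ge>0. \<forall>x. norm x <= 1 --> norm (G i x) <= C * norm x ^ q"
  shows "\<exists>C\<ge>0. \<forall>i x. norm x <= 1 --> norm (G i x) <= C * norm x ^ q"
proof -
  obtain C where C: "\<And>i. C i \<ge> 0" "\<And>i x. norm x <= 1 ==> norm (G i x) <= C i * norm x ^ q" using assms by metis
  have "C i <= C X0 + C X1 + C X2" for i using C(1)[of X0] C(1)[of X1] C(1)[of X2] by (cases i) auto
  hence "norm (G i x) <= (C X0 + C X1 + C X2) * norm x ^ q" if "norm x <= 1" for i x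
    by (rule order_trans[OF C(2)[OF that] mult_right_mono]) auto
  thus ?thesis using C(1) by (intro exI[of _ "C X0 + C X1 + C X2"]) auto
qed

lemma field_bounds: "\<exists>K\<ge>0. (\<forall>x. norm x <= 1 --> norm (f X0 x) <= K * norm x) \<and> (\<forall>i x. norm x <= 1 --> norm (f i x) <= K)"
proof -
  have fl: "\<exists>C\<ge>0. \<forall>x. norm x <= 1 --> norm (f i x) <= C * norm x ^ q"
    if "\<And>j. flat q (\<lambda>x. f i x $ j)" for i q
  proof -
    have "\<forall>j. \<exists>C\<ge>0. \<forall>x. norm x <= 1 --> \<bar>f i x $ j\<bar> <= C * norm x ^ q"
      using flat_bound[OF _ that] sf unfolding sfield_def by blast
    then obtain C where C: "\<And>j. C j \<ge> 0" "\<And>j x. norm x <= 1 ==> \<bar>f i x $ j\<bar> <= C j * norm x ^ q" by metis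
    have "norm (f i x) <= (\<Sum>j\<in>UNIV. C j) * norm x ^ q" if "norm x <= 1" for x
    proof -
      have "norm (f i x) <= (\<Sum>j\<in>UNIV. \<bar>f i x $ j\<bar>)" by (rule norm_le_l1_cart)
      also have "\<dots> <= (\<Sum>j\<in>UNIV. C j * norm x ^ q)" by (intro sum_mono C that)
      finally show ?thesis by (simp add: sum_distrib_right)
    qed
    thus ?thesis using sum_nonneg[of UNIV C] C(1) by blast
  qed
  obtain K0 where K0: "K0 \<ge> 0" "\<And>x. norm x <= 1 ==> norm (f X0 x) <= K0 * norm x"
    using fl[of 1 X0] f00 by auto
  obtain K1 where K1: "K1 \<ge> 0" "\<And>i x. norm x <= 1 ==> norm (f i x) <= K1"
    using uniform_bound[of f 0] fl[of 0] by auto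
  have "K0 * norm x <= (K0 + K1) * norm x" for x using K1(1) by (intro mult_right_mono) auto
  thus ?thesis using K0 K1 by (intro exI[of _ "K0 + K1"]) (fastforce intro: order_trans add_increasing)
qed

text \<open>The fields are only bounded in the unit ball. Up to the first time with
  \<open>norm (x t) = 1\<close> Gronwall gives a bound strictly below \<open>1\<close>, so there is
  no such time.\<close>

lemma a_priori:
  "\<exists>C\<ge>0. \<exists>T0>0. \<exists>g0>0. \<forall>T u v x. traj f T u v x --> T <= T0 --> l1n T u v <= g0 -->
     (\<forall>t\<in>{0..T}. norm (x t) <= C * l1n T u v \<and> norm (x t) <= 1)"
proof -
  obtain K where K: "K \<ge> 0" "\<And>x. norm x <= 1 ==> norm (f X0 x) <= K * norm x" "\<And>i x. norm x <= 1 ==> norm (f i x) <= K"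
    using field_bounds by blast
  define T0 where "T0 = 1 / (2 * K + 2)"
  define g0 where "g0 = 1 / (2 * K + 2)"
  have pos: "T0 > 0" "g0 > 0" using K(1) by (auto simp: T0_def g0_def)
  have "\<forall>t\<in>{0..T}. norm (x t) <= (2 * K) * l1n T u v \<and> norm (x t) <= 1"
    if tr: "traj f T u v x" and T: "T <= T0" and g: "l1n T u v <= g0" for T u v x
  proof -
    have tr': "0 < T" "continuous_on {0..T} u" "continuous_on {0..T} v" "x 0 = 0"
      "\<And>t. t \<in> {0..T} ==> (x has_vector_derivative (f X0 (x t) + u t *\<^sub>R f X1 (x t) + v t *\<^sub>R f X2 (x t))) (at t within {0..T})"
      using tr by (auto simp: traj_def)
    have g': "0 <= l1n T u v" using l1n_nonneg tr' by blast
    have cx: "continuous_on {0..T} x" by (rule hvd_continuous_on[OF tr'(5)])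
    have b: "norm (x t) <= (2 * K) * l1n T u v" if s: "s \<in> {0..T}" and le: "\<And>r. r \<in> {0..s} ==> norm (x r) <= 1" and t: "t \<in> {0..s}" for s t
    proof -
      have sub: "{0..s} \<subseteq> {0..T}" using s by auto
      have "norm (x t) <= 2 * integral {0..s} (\<lambda>t. K * (\<bar>u t\<bar> + \<bar>v t\<bar>))"
      proof (rule gronwall_short[where l="\<lambda>_. K" and y'="\<lambda>t. f X0 (x t) + u t *\<^sub>R f X1 (x t) + v t *\<^sub>R f X2 (x t)"])
        fix r assume r: "r \<in> {0..s}"
        show "(x has_vector_derivative (f X0 (x r) + u r *\<^sub>R f X1 (x r) + v r *\<^sub>R f X2 (x r))) (at r within {0..s})"
          using has_vector_derivative_within_subset[OF tr'(5) sub] r sub by blast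
        have "norm (f X0 (x r) + u r *\<^sub>R f X1 (x r) + v r *\<^sub>R f X2 (x r))
           <= norm (f X0 (x r)) + norm (u r *\<^sub>R f X1 (x r)) + norm (v r *\<^sub>R f X2 (x r))"
          by (intro norm_triangle_le add_mono) auto
        also have "\<dots> <= K * norm (x r) + \<bar>u r\<bar> * K + \<bar>v r\<bar> * K"
          unfolding norm_scaleR by (intro add_mono mult_left_mono K le r) auto
        finally show "norm (f X0 (x r) + u r *\<^sub>R f X1 (x r) + v r *\<^sub>R f X2 (x r)) <= K * norm (x r) + K * (\<bar>u r\<bar> + \<bar>v r\<bar>)"
          by (simp add: algebra_simps)
      next
        have "T0 * K <= 1/2" using K(1) by (simp add: T0_def field_simps)
        moreover have "s * K <= T0 * K" using s T K(1) by (intro mult_right_mono) auto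
        ultimately show "integral {0..s} (\<lambda>_. K) <= 1/2" using s by simp
        show "continuous_on {0..s} (\<lambda>t. K * (\<bar>u t\<bar> + \<bar>v t\<bar>))"
          using continuous_on_subset[OF tr'(2) sub] continuous_on_subset[OF tr'(3) sub] by (intro continuous_intros)
      qed (use s t tr' K in auto)
      also have "integral {0..s} (\<lambda>t. K * (\<bar>u t\<bar> + \<bar>v t\<bar>)) <= K * l1n T u v"
      proof -
        have "integral {0..s} (\<lambda>t. \<bar>u t\<bar> + \<bar>v t\<bar>) <= l1n T u v"
          unfolding l1n_def using integrable_on_subinterval[OF abs_add_integrable sub] abs_add_integrable tr'
          by (intro integral_subset_le[OF sub]) auto
        thus ?thesis using K(1) by (simp add: mult_left_mono)
      qed
      finally show ?thesis by simp
    qed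
    have sm: "(2 * K) * l1n T u v < 1"
    proof -
      have "(2 * K) * l1n T u v <= (2 * K) * g0" using K(1) g by (intro mult_left_mono) auto
      also have "\<dots> < 1" using K(1) by (simp add: g0_def field_simps)
      finally show ?thesis .
    qed
    have "norm (x t) < 1" if t: "t \<in> {0..T}" for t
    proof (rule ccontr)
      assume "\<not> norm (x t) < 1"
      define S where "S = {s \<in> {0..T}. norm (x s) = 1}"
      have ivt: "\<exists>s\<in>{0..r}. norm (x s) = 1" if "r \<in> {0..T}" "norm (x r) \<ge> 1" for r
      proof -
        have "continuous_on {0..r} (\<lambda>s. norm (x s))"
          using continuous_on_subset[OF cx] that by (intro continuous_on_norm) auto
        hence "\<exists>s. 0 <= s \<and> s <= r \<and> norm (x s) = 1"
          using IVT'[of "\<lambda>s. norm (x s)" 0 1 r] that tr'(4) by auto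
        thus ?thesis by auto
      qed
      have ne: "S \<noteq> {}" using ivt[OF t] \<open>\<not> norm (x t) < 1\<close> t by (force simp: S_def)
      have "closed ({0..T} \<inter> (\<lambda>s. norm (x s)) -` {1})"
        by (intro continuous_closed_preimage continuous_on_norm cx) auto
      moreover have "{0..T} \<inter> (\<lambda>s. norm (x s)) -` {1} = S" by (auto simp: S_def)
      ultimately have "closed S" by simp
      moreover have bb: "bdd_below S" by (rule bdd_belowI[of _ 0]) (auto simp: S_def)
      ultimately have m: "Inf S \<in> S" using closed_contains_Inf ne by blast
      define s where "s = Inf S"
      have s: "s \<in> {0..T}" "norm (x s) = 1" using m by (auto simp: S_def s_def)
      have "norm (x r) <= 1" if rs: "r \<in> {0..s}" for r
      proof (rule ccontr)
        assume "\<not> norm (x r) <= 1"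
        then obtain q where q: "q \<in> {0..r}" "norm (x q) = 1" using ivt[of r] rs s by auto
        hence "q \<in> S" using rs s by (auto simp: S_def)
        hence "s <= q" unfolding s_def using bb by (rule cInf_lower)
        hence "r = s" using q rs by auto
        thus False using \<open>\<not> norm (x r) <= 1\<close> s by simp
      qed
      hence "norm (x s) <= (2 * K) * l1n T u v" by (rule b[OF s(1)]) (use s in auto)
      thus False using s sm by simp
    qed
    thus ?thesis using b[of T] tr' by (force intro: less_imp_le)
  qed
  thus ?thesis using pos K(1) by (intro exI[of _ "2 * K"] conjI exI[of _ T0] exI[of _ g0]) auto
qed

section \<open>Moments of the state, stored as a matrix column, and the truncated Chen
  series\<close>

definition mom :: "real^'d => ('d => nat) bop" where
  "mom x = (\<Sum>\<alpha>\<in>Ix. mon \<alpha> x *\<^sub>R munit \<alpha> zix)"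

abbreviation AL :: "letter => ('d => nat) bop" where "AL i \<equiv> Aop (Leaf i)"

abbreviation inp :: "(real => real) => (real => real) => real => ('d => nat) bop" where
  "inp u v t \<equiv> u t *\<^sub>R AL X1 + v t *\<^sub>R AL X2"

definition "KA = norm (AL X0) + norm (AL X1) + norm (AL X2) + 1"

lemma KA: "KA \<ge> 1" "norm (AL X0) <= KA" "norm (AL X1) <= KA" "norm (AL X2) <= KA"
  by (auto simp: KA_def)

lemma inp_bound: "norm (inp u v t) <= KA * (\<bar>u t\<bar> + \<bar>v t\<bar>)"
proof -
  have "norm (inp u v t) <= \<bar>u t\<bar> * norm (AL X1) + \<bar>v t\<bar> * norm (AL X2)" by (rule norm_triangle_le) simp
  also have "\<dots> <= \<bar>u t\<bar> * KA + \<bar>v t\<bar> * KA" by (intro add_mono mult_left_mono KA) auto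
  finally show ?thesis by (simp add: algebra_simps)
qed

lemma inp_L1:
  assumes "continuous_on {0..T} u" "continuous_on {0..T} v"
  shows "integral {0..T} (\<lambda>t. norm (inp u v t)) <= KA * l1n T u v"
proof -
  have "integral {0..T} (\<lambda>t. norm (inp u v t)) <= integral {0..T} (\<lambda>t. KA * (\<bar>u t\<bar> + \<bar>v t\<bar>))"
    by (intro integral_le integrable_continuous_real continuous_intros inp_bound assms)
  thus ?thesis by (simp add: l1n_def)
qed

lemma KA_time: "0 < T ==> T <= 1 / (4 * KA) ==> 4 * norm (AL X0) * T <= 1"
proof -
  assume T: "0 < T" "T <= 1 / (4 * KA)"
  have "4 * norm (AL X0) * T <= 4 * KA * (1 / (4 * KA))" using KA T by (intro mult_mono) auto
  thus ?thesis using KA by simp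
qed

text \<open>The truncation error of the Carleman system, of order \<open>N + 1\<close> in the
  state.\<close>

definition remv :: "letter => real^'d => ('d => nat) bop" where
  "remv i x = (\<Sum>\<alpha>\<in>Ix. rem (Leaf i) \<alpha> x *\<^sub>R munit \<alpha> zix)"

lemma AL_mom: "(\<Sum>\<alpha>\<in>Ix. der (f i) (mon \<alpha>) x *\<^sub>R munit \<alpha> zix) = AL i * mom x + remv i x"
proof -
  have "AL i * mom x = (\<Sum>\<beta>\<in>Ix. \<Sum>\<alpha>\<in>Ix. (a i \<alpha> \<beta> * mon \<beta> x) *\<^sub>R munit \<alpha> zix)"
    by (simp add: mom_def sum_distrib_left Aop_def mat_col scaleR_sum_right mult.commute)
  also have "\<dots> = (\<Sum>\<alpha>\<in>Ix. (\<Sum>\<beta>\<in>Ix. a i \<alpha> \<beta> * mon \<beta> x) *\<^sub>R munit \<alpha> zix)"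
    by (subst sum.swap) (simp add: scaleR_sum_left)
  finally show ?thesis by (simp add: remv_def sum.distrib[symmetric] scaleR_add_left[symmetric] Fb_Leaf)
qed

lemma remv_bound: "\<exists>K\<ge>0. \<forall>i x. norm x <= 1 --> norm (remv i x) <= K * norm x ^ Suc N"
proof (rule uniform_bound)
  fix i
  have fl: "flat (Suc N) (rem (Leaf i) \<alpha>)" for \<alpha> using rep[of i \<alpha>] by (simp add: Fb_Leaf Ix_def del: flat.simps)
  have "\<forall>\<alpha>. \<exists>C\<ge>0. \<forall>x. norm x <= 1 --> \<bar>rem (Leaf i) \<alpha> x\<bar> <= C * norm x ^ Suc N"
    by (intro allI flat_bound[OF smooth_rem fl])
  from choice[OF this] obtain C where C: "\<And>\<alpha>. C \<alpha> \<ge> 0" "\<And>\<alpha> x. norm x <= 1 ==> \<bar>rem (Leaf i) \<alpha> x\<bar> <= C \<alpha> * norm x ^ Suc N"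
    by blast
  let ?m = "\<lambda>\<alpha>. norm (munit \<alpha> zix :: ('d => nat) bop)"
  have "norm (remv i x) <= (\<Sum>\<alpha>\<in>Ix. C \<alpha> * ?m \<alpha>) * norm x ^ Suc N" if "norm x <= 1" for x
  proof -
    have "norm (remv i x) <= (\<Sum>\<alpha>\<in>Ix. (C \<alpha> * norm x ^ Suc N) * ?m \<alpha>)"
      unfolding remv_def by (rule sum_norm_le) (unfold norm_scaleR, intro mult_right_mono C(2) that, simp)
    thus ?thesis by (simp add: sum_distrib_right sum_distrib_left mult_ac)
  qed
  thus "\<exists>K\<ge>0. \<forall>x. norm x <= 1 --> norm (remv i x) <= K * norm x ^ Suc N"
    using C(1) by (intro exI[of _ "\<Sum>\<alpha>\<in>Ix. C \<alpha> * ?m \<alpha>"] conjI sum_nonneg) auto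
qed

lemma mom_derivative:
  assumes "traj f T u v x" "t \<in> {0..T}"
  shows "((\<lambda>t. mom (x t)) has_vector_derivative
     (AL X0 * mom (x t) + (u t *\<^sub>R AL X1 + v t *\<^sub>R AL X2) * mom (x t)
       + (remv X0 (x t) + u t *\<^sub>R remv X1 (x t) + v t *\<^sub>R remv X2 (x t)))) (at t within {0..T})"
proof -
  let ?F = "f X0 (x t) + u t *\<^sub>R f X1 (x t) + v t *\<^sub>R f X2 (x t)"
  have dx: "(x has_vector_derivative ?F) (at t within {0..T})" using assms by (simp add: traj_def)
  have dm: "((\<lambda>t. mon \<alpha> (x t)) has_vector_derivative
     (der (f X0) (mon \<alpha>) (x t) + u t * der (f X1) (mon \<alpha>) (x t) + v t * der (f X2) (mon \<alpha>) (x t))) (at t within {0..T})" for \<alpha>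
  proof -
    have "(mon \<alpha> has_derivative (\<lambda>h. \<Sum>j\<in>UNIV. h $ j * pd j (mon \<alpha>) (x t))) (at (x t))"
      by (rule has_derivative_pd[OF smooth_differentiable]) simp
    hence "((\<lambda>t. mon \<alpha> (x t)) has_derivative (\<lambda>s. \<Sum>j\<in>UNIV. (s *\<^sub>R ?F) $ j * pd j (mon \<alpha>) (x t))) (at t within {0..T})"
      by (rule has_derivative_compose[OF dx[unfolded has_vector_derivative_def]])
    also have "(\<lambda>s. \<Sum>j\<in>UNIV. (s *\<^sub>R ?F) $ j * pd j (mon \<alpha>) (x t))
      = (\<lambda>s. s *\<^sub>R (der (f X0) (mon \<alpha>) (x t) + u t * der (f X1) (mon \<alpha>) (x t) + v t * der (f X2) (mon \<alpha>) (x t)))"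
      by (rule ext) (simp add: der_def sum_distrib_left sum.distrib[symmetric] algebra_simps)
    finally show ?thesis by (simp add: has_vector_derivative_def)
  qed
  have "((\<lambda>t. mom (x t)) has_vector_derivative
     (\<Sum>\<alpha>\<in>Ix. (der (f X0) (mon \<alpha>) (x t) + u t * der (f X1) (mon \<alpha>) (x t) + v t * der (f X2) (mon \<alpha>) (x t)) *\<^sub>R munit \<alpha> zix)) (at t within {0..T})"
    unfolding mom_def
    by (intro has_vector_derivative_sum bounded_linear.has_vector_derivative[OF bounded_linear_scaleR_left] dm)
  also have "(\<Sum>\<alpha>\<in>Ix. (der (f X0) (mon \<alpha>) (x t) + u t * der (f X1) (mon \<alpha>) (x t) + v t * der (f X2) (mon \<alpha>) (x t)) *\<^sub>R munit \<alpha> zix)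
    = (\<Sum>\<alpha>\<in>Ix. der (f X0) (mon \<alpha>) (x t) *\<^sub>R munit \<alpha> zix) + u t *\<^sub>R (\<Sum>\<alpha>\<in>Ix. der (f X1) (mon \<alpha>) (x t) *\<^sub>R munit \<alpha> zix)
      + v t *\<^sub>R (\<Sum>\<alpha>\<in>Ix. der (f X2) (mon \<alpha>) (x t) *\<^sub>R munit \<alpha> zix)"
    by (simp add: scaleR_add_left sum.distrib scaleR_sum_right)
  also have "\<dots> = AL X0 * mom (x t) + (u t *\<^sub>R AL X1 + v t *\<^sub>R AL X2) * mom (x t)
       + (remv X0 (x t) + u t *\<^sub>R remv X1 (x t) + v t *\<^sub>R remv X2 (x t))"
    unfolding AL_mom by (simp add: algebra_simps)
  finally show ?thesis .
qed

lemma mom_0: "mom 0 = E0"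
proof -
  have "mom 0 = (\<Sum>\<alpha>\<in>Ix. if \<alpha> = zix then munit \<alpha> zix else 0)"
    unfolding mom_def by (intro sum.cong refl) (simp add: mon_at_0)
  thus ?thesis by (simp add: sum.delta)
qed

lemma bvec_mom: "bvec (mom x) = x"
proof -
  have "ment (unit_ix j) zix (mom x) = x $ j" for j
  proof -
    interpret bounded_linear "ment (unit_ix j) zix" by (rule bounded_linear_ment)
    have "ment (unit_ix j) zix (mom x) = (\<Sum>\<alpha>\<in>Ix. if \<alpha> = unit_ix j then mon \<alpha> x else 0)"
      unfolding mom_def sum scaleR by (intro sum.cong refl) (simp add: ment_munit)
    thus ?thesis by (simp add: sum.delta)
  qed
  thus ?thesis by (simp add: bvec_def)
qed

lemma bvec_E0: "bvec E0 = 0"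
  by (simp add: bvec_def ment_munit vec_eq_iff)

lemma mom_bound: "\<exists>C\<ge>0. \<forall>x. norm x <= 1 --> norm (mom x - E0) <= C * norm x"
proof -
  define C where "C = (\<Sum>\<alpha>\<in>Ix. norm (munit \<alpha> zix :: ('d => nat) bop))"
  have "norm (mom x - E0) <= C * norm x" if x: "norm x <= 1" for x
  proof -
    have "mom x - E0 = (\<Sum>\<alpha>\<in>Ix. (mon \<alpha> x - (if \<alpha> = zix then 1 else 0)) *\<^sub>R munit \<alpha> zix)"
    proof -
      have "(\<Sum>\<alpha>\<in>Ix. (if \<alpha> = zix then 1 else 0) *\<^sub>R (munit \<alpha> zix :: ('d => nat) bop)) = (\<Sum>\<alpha>\<in>Ix. if \<alpha> = zix then munit \<alpha> zix else 0)"
        by (intro sum.cong refl) simp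
      also have "\<dots> = E0" by (simp add: sum.delta)
      finally show ?thesis by (simp add: mom_def scaleR_diff_left sum_subtractf)
    qed
    also have "norm \<dots> <= (\<Sum>\<alpha>\<in>Ix. norm x * norm (munit \<alpha> zix :: ('d => nat) bop))"
    proof (rule sum_norm_le)
      fix \<alpha> assume "\<alpha> \<in> Ix"
      have "\<bar>mon \<alpha> x - (if \<alpha> = zix then 1 else 0)\<bar> <= norm x"
      proof (cases "\<alpha> = zix")
        case False
        then obtain q where q: "deg \<alpha> = Suc q" using deg_eq_0_iff[of \<alpha>] by (cases "deg \<alpha>") auto
        have "\<bar>mon \<alpha> x\<bar> <= norm x ^ deg \<alpha>" by (rule mon_abs_le) (rule component_le_norm_cart)
        also have "\<dots> <= norm x" using x power_decreasing[of 1 "deg \<alpha>" "norm x"] q by simp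
        finally show ?thesis using False by simp
      qed simp
      thus "norm ((mon \<alpha> x - (if \<alpha> = zix then 1 else 0)) *\<^sub>R (munit \<alpha> zix :: ('d => nat) bop)) <= norm x * norm (munit \<alpha> zix :: ('d => nat) bop)"
        unfolding norm_scaleR by (intro mult_right_mono) auto
    qed
    also have "\<dots> = C * norm x" by (simp add: C_def sum_distrib_left mult.commute)
    finally show ?thesis .
  qed
  moreover have "C \<ge> 0" unfolding C_def by (intro sum_nonneg) auto
  ultimately show ?thesis by blast
qed

text \<open>The difference of the moments and the truncated Chen series solves the linear system
  with two sources: the Carleman truncation error and the first omitted term \<open>G * P N\<close>.
  Both are of order \<open>N + 1\<close> in the L1 norm of the controls.\<close>

lemma moment_estimate:
  "\<exists>C\<ge>0. \<exists>T0>0. \<exists>g0>0. \<forall>T u v x P. traj f T u v x --> T <= T0 --> l1n T u v <= g0 -->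
     chen_seq (AL X0) (inp u v) T P -->
     norm (x T) <= 1 \<and> norm (mom (x T) - (\<Sum>n\<le>N. P n T * E0)) <= C * l1n T u v ^ Suc N"
proof -
  obtain C1 T1 g1 where ap: "C1 \<ge> 0" "T1 > 0" "g1 > 0"
    "\<And>T u v x t. traj f T u v x ==> T <= T1 ==> l1n T u v <= g1 ==> t \<in> {0..T} ==> norm (x t) <= C1 * l1n T u v \<and> norm (x t) <= 1"
    using a_priori by metis
  obtain Kr where Kr: "Kr \<ge> 0" "\<And>i x. norm x <= 1 ==> norm (remv i x) <= Kr * norm x ^ Suc N" using remv_bound by blast
  define T0 where "T0 = min T1 (min 1 (1 / (4 * KA)))"
  define g0 where "g0 = min g1 (min 1 (1 / (4 * KA)))"
  \<comment> \<open>The outer \<open>2\<close> is the constant of \<open>gronwall_short\<close>, the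
    inner one bounds \<open>T + \<gamma>\<close>.\<close>
  define C where "C = 2 * (2 * Kr * C1 ^ Suc N + KA * (2 * KA) ^ N * norm E0)"
  have main: "norm (x T) <= 1 \<and> norm (mom (x T) - (\<Sum>n\<le>N. P n T * E0)) <= C * l1n T u v ^ Suc N"
    if tr: "traj f T u v x" and T: "T <= T0" and g: "l1n T u v <= g0"
      and ch: "chen_seq (AL X0) (inp u v) T P"
    for T u v x P
  proof -
    note P = chen_seqD[OF ch]
    define \<gamma> where "\<gamma> = l1n T u v"
    define G where "G t = inp u v t" for t
    have tr': "0 < T" "continuous_on {0..T} u" "continuous_on {0..T} v" "x 0 = 0"
      using tr by (auto simp: traj_def)
    have g': "0 <= \<gamma>" using l1n_nonneg tr' by (simp add: \<gamma>_def)
    have xb: "norm (x t) <= C1 * \<gamma>" "norm (x t) <= 1" if "t \<in> {0..T}" for t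
      using ap(4)[OF tr _ _ that] T g by (auto simp: T0_def g0_def \<gamma>_def)
    have cG: "continuous_on {0..T} G" unfolding G_def by (intro continuous_intros tr')
    have Gb: "norm (G t) <= KA * (\<bar>u t\<bar> + \<bar>v t\<bar>)" for t unfolding G_def by (rule inp_bound)
    have iu: "(\<lambda>t. \<bar>u t\<bar> + \<bar>v t\<bar>) integrable_on {0..T}" using abs_add_integrable tr' by blast
    have iG: "integral {0..T} (\<lambda>t. norm (G t)) <= KA * \<gamma>"
      unfolding G_def \<gamma>_def by (intro inp_L1 tr')
    have T4: "4 * norm (AL X0) * T <= 1" using T by (intro KA_time tr') (simp add: T0_def)
    have Pb: "norm (P N t) <= (2 * KA * \<gamma>) ^ N" if "t \<in> {0..T}" for t
    proof -
      have "norm (P N t) <= (2 * integral {0..T} (\<lambda>s. norm (G s))) ^ N"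
        by (rule chen_bound[where P=P and G=G and A="AL X0", OF cG _ T4 _ that]) (use ch tr' in \<open>auto simp: G_def[abs_def]\<close>)
      also have "\<dots> <= (2 * KA * \<gamma>) ^ N"
        using iG integral_nonneg[OF integrable_continuous_real[OF continuous_on_norm[OF cG]]]
        by (intro power_mono) auto
      finally show ?thesis .
    qed
    define d where "d t = mom (x t) - (\<Sum>n\<le>N. P n t * E0)" for t
    define R where "R t = remv X0 (x t) + u t *\<^sub>R remv X1 (x t) + v t *\<^sub>R remv X2 (x t)" for t
    have dd: "(d has_vector_derivative (AL X0 * d t + G t * d t + (R t + G t * P N t * E0))) (at t within {0..T})"
      if t: "t \<in> {0..T}" for t
    proof -
      have dP: "((\<lambda>t. P n t * E0) has_vector_derivative ((lbr (AL X0) (P n t) + (if n = 0 then 0 else G t * P (n - 1) t)) * E0)) (at t within {0..T})" for n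
      proof (cases n)
        case 0
        thus ?thesis by (simp add: P)
      next
        case (Suc q)
        have "((\<lambda>t. P (Suc q) t * E0) has_vector_derivative ((lbr (AL X0) (P (Suc q) t) + G t * P q t) * E0)) (at t within {0..T})"
          using P(3)[OF t, of q] by (intro bounded_linear.has_vector_derivative[OF bounded_linear_mult_left]) (simp add: G_def)
        thus ?thesis by (simp add: Suc)
      qed
      \<comment> \<open>Because of \<open>A0_E0\<close> the Chen series, applied to
        \<open>E0\<close>, solves the same linear equation as the moments.\<close>
      have e: "(lbr (AL X0) B + C) * E0 = AL X0 * (B * E0) + C * E0" for B C
      proof -
        have "B * AL X0 * E0 = 0" by (simp add: mult.assoc A0_E0)
        thus ?thesis by (simp add: lbr_def algebra_simps)
      qed
      have "((\<lambda>t. \<Sum>n\<le>N. P n t * E0) has_vector_derivative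
         (\<Sum>n\<le>N. AL X0 * (P n t * E0) + (if n = 0 then 0 else G t * P (n - 1) t) * E0)) (at t within {0..T})"
        using dP unfolding e by (rule has_vector_derivative_sum)
      also have "(\<Sum>n\<le>N. AL X0 * (P n t * E0) + (if n = 0 then 0 else G t * P (n - 1) t) * E0)
         = AL X0 * (\<Sum>n\<le>N. P n t * E0) + (\<Sum>n\<le>N. (if n = 0 then 0 else G t * P (n - 1) t) * E0)"
        by (simp add: sum.distrib sum_distrib_left)
      also have "(\<Sum>n\<le>N. (if n = 0 then 0 else G t * P (n - 1) t) * E0) = (\<Sum>n<N. G t * P n t * E0)"
        by (simp add: lessThan_Suc_atMost[symmetric] sum.lessThan_Suc_shift del: sum.lessThan_Suc)
      also have "\<dots> = G t * (\<Sum>n\<le>N. P n t * E0) - G t * P N t * E0"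
        by (simp add: lessThan_Suc_atMost[symmetric] sum_distrib_left distrib_left mult.assoc)
      finally have "((\<lambda>t. \<Sum>n\<le>N. P n t * E0) has_vector_derivative
         (AL X0 * (\<Sum>n\<le>N. P n t * E0) + (G t * (\<Sum>n\<le>N. P n t * E0) - G t * P N t * E0))) (at t within {0..T})" .
      from has_vector_derivative_diff[OF mom_derivative[OF tr t] this] show ?thesis
        unfolding d_def[abs_def] R_def G_def by (simp add: algebra_simps)
    qed
    have Rb: "norm (R t) <= (1 + \<bar>u t\<bar> + \<bar>v t\<bar>) * (Kr * (C1 * \<gamma>) ^ Suc N)" if t: "t \<in> {0..T}" for t
    proof -
      have r: "norm (remv i (x t)) <= Kr * (C1 * \<gamma>) ^ Suc N" for i
      proof -
        have "norm (remv i (x t)) <= Kr * norm (x t) ^ Suc N" by (rule Kr(2)[OF xb(2)[OF t]])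
        also have "\<dots> <= Kr * (C1 * \<gamma>) ^ Suc N" by (intro mult_left_mono power_mono xb t Kr) auto
        finally show ?thesis .
      qed
      have "norm (R t) <= norm (remv X0 (x t)) + norm (u t *\<^sub>R remv X1 (x t)) + norm (v t *\<^sub>R remv X2 (x t))"
        unfolding R_def by (intro norm_triangle_le add_mono) auto
      also have "\<dots> <= Kr * (C1 * \<gamma>) ^ Suc N + \<bar>u t\<bar> * (Kr * (C1 * \<gamma>) ^ Suc N) + \<bar>v t\<bar> * (Kr * (C1 * \<gamma>) ^ Suc N)"
        unfolding norm_scaleR by (intro add_mono mult_left_mono r) auto
      finally show ?thesis by (simp only: distrib_right mult_1_left)
    qed
    define q where "q t = (1 + (\<bar>u t\<bar> + \<bar>v t\<bar>)) * (Kr * (C1 * \<gamma>) ^ Suc N) + KA * (\<bar>u t\<bar> + \<bar>v t\<bar>) * ((2 * KA * \<gamma>) ^ N * norm E0)" for t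
    have Tle: "T <= 1" "KA * T <= 1/4" "\<gamma> <= 1" "KA * \<gamma> <= 1/4"
    proof -
      show "T <= 1" "\<gamma> <= 1" using T g by (auto simp: T0_def g0_def \<gamma>_def)
      have "T <= 1 / (4 * KA)" "\<gamma> <= 1 / (4 * KA)" using T g by (auto simp: T0_def g0_def \<gamma>_def)
      hence "T * (4 * KA) <= 1" "\<gamma> * (4 * KA) <= 1" using KA by (simp_all add: pos_le_divide_eq)
      thus "KA * T <= 1/4" "KA * \<gamma> <= 1/4" by (simp_all add: mult_ac)
    qed
    have "norm (d T) <= 2 * integral {0..T} q"
    proof (rule gronwall_short[where l="\<lambda>t. KA + norm (G t)", OF _ _ dd])
      fix t assume t: "t \<in> {0..T}"
      have "norm (AL X0 * d t + G t * d t + (R t + G t * P N t * E0))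
         <= norm (AL X0 * d t) + norm (G t * d t) + (norm (R t) + norm (G t * P N t * E0))"
        by (intro norm_triangle_le add_mono norm_triangle_ineq) auto
      also have "\<dots> <= KA * norm (d t) + norm (G t) * norm (d t) + ((1 + \<bar>u t\<bar> + \<bar>v t\<bar>) * (Kr * (C1 * \<gamma>) ^ Suc N)
          + KA * (\<bar>u t\<bar> + \<bar>v t\<bar>) * ((2 * KA * \<gamma>) ^ N * norm E0))"
      proof (intro add_mono Rb t)
        show "norm (AL X0 * d t) <= KA * norm (d t)"
          by (rule order_trans[OF norm_mult_ineq]) (intro mult_right_mono KA, simp)
        show "norm (G t * d t) <= norm (G t) * norm (d t)" by (rule norm_mult_ineq)
        have "norm (G t * P N t * E0) <= norm (G t) * (norm (P N t) * norm E0)"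
          unfolding mult.assoc by (intro order_trans[OF norm_mult_ineq] mult_left_mono norm_mult_ineq) auto
        also have "\<dots> <= (KA * (\<bar>u t\<bar> + \<bar>v t\<bar>)) * ((2 * KA * \<gamma>) ^ N * norm E0)"
          by (intro mult_mono mult_right_mono Gb Pb t) (use KA g' in auto)
        finally show "norm (G t * P N t * E0) <= KA * (\<bar>u t\<bar> + \<bar>v t\<bar>) * ((2 * KA * \<gamma>) ^ N * norm E0)" .
      qed
      finally show "norm (AL X0 * d t + G t * d t + (R t + G t * P N t * E0)) <= (KA + norm (G t)) * norm (d t) + q t"
        by (simp add: q_def distrib_right add.assoc)
      show "0 <= KA + norm (G t)" using KA by (simp add: add_nonneg_nonneg)
      show "0 <= q t" unfolding q_def using KA g' Kr ap(1)
        by (intro add_nonneg_nonneg mult_nonneg_nonneg zero_le_power) auto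
    next
      show "d 0 = 0"
      proof -
        have "(\<Sum>n\<le>N. P n 0 * E0) = (\<Sum>n\<le>N. if n = 0 then E0 else 0)"
        proof (intro sum.cong refl)
          fix n show "P n 0 * E0 = (if n = 0 then E0 else 0)" using P(1,2) by (cases n) auto
        qed
        thus ?thesis by (simp add: d_def tr' mom_0 sum.delta)
      qed
      show "continuous_on {0..T} (\<lambda>t. KA + norm (G t))" by (intro continuous_intros cG)
      show "continuous_on {0..T} q" unfolding q_def by (intro continuous_intros tr')
      have "integral {0..T} (\<lambda>t. KA + norm (G t)) = KA * T + integral {0..T} (\<lambda>t. norm (G t))"
        using tr' by (subst integral_add) (auto intro!: integrable_continuous_real continuous_on_norm cG)
      thus "integral {0..T} (\<lambda>t. KA + norm (G t)) <= 1/2" using iG Tle by linarith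
    qed (use tr' in auto)
    also have "integral {0..T} q = (T + \<gamma>) * (Kr * (C1 * \<gamma>) ^ Suc N) + KA * \<gamma> * ((2 * KA * \<gamma>) ^ N * norm E0)"
    proof -
      have "((\<lambda>t. \<bar>u t\<bar> + \<bar>v t\<bar>) has_integral \<gamma>) {0..T}" using iu by (simp add: \<gamma>_def l1n_def integrable_integral)
      hence "(q has_integral ((1 * T + \<gamma>) * (Kr * (C1 * \<gamma>) ^ Suc N) + KA * \<gamma> * ((2 * KA * \<gamma>) ^ N * norm E0))) {0..T}"
        unfolding q_def using has_integral_const_real[of "1::real" 0 T] tr'
        by (intro has_integral_add has_integral_mult_left has_integral_mult_right) auto
      thus ?thesis by (simp add: integral_unique)
    qed
    also have "\<dots> <= 2 * (Kr * (C1 * \<gamma>) ^ Suc N) + KA * \<gamma> * ((2 * KA * \<gamma>) ^ N * norm E0)"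
      using Tle Kr ap(1) g' by (intro add_right_mono mult_right_mono) auto
    also have "2 * (Kr * (C1 * \<gamma>) ^ Suc N) + KA * \<gamma> * ((2 * KA * \<gamma>) ^ N * norm E0) = C / 2 * \<gamma> ^ Suc N"
      by (simp add: C_def power_mult_distrib algebra_simps)
    finally show ?thesis using xb(2)[of T] tr' by (simp add: d_def \<gamma>_def)
  qed
  have pos: "C \<ge> 0" "T0 > 0" "g0 > 0"
    subgoal unfolding C_def using Kr ap KA by (intro mult_nonneg_nonneg add_nonneg_nonneg zero_le_power) auto
    using ap KA by (auto simp: T0_def g0_def)
  show ?thesis
    by (rule exI[of _ C], rule conjI, rule pos, rule exI[of _ T0], rule conjI, rule pos,
        rule exI[of _ g0], rule conjI, rule pos, intro allI impI, rule main; blast)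
qed

text \<open>The evaluations at \<open>0\<close> of the homogeneous components of the Magnus logarithm sum up to the
  endpoint, up to an error that is small relative to the endpoint or of order \<open>N + 1\<close>.\<close>
definition magnus_rep where
  "magnus_rep C T u v x Z \<longleftrightarrow>
     4 * norm (AL X0) * T <= 1 \<and>
     (\<forall>n\<in>{1..N}. \<forall>t\<in>{0..T}. Z n t \<in> Lie n \<and> norm (Z n t) <= C * l1n T u v ^ n) \<and>
     Z 1 0 = 0 \<and> Z 2 0 = 0 \<and>
     (\<forall>t\<in>{0..T}. (Z 1 has_vector_derivative (lbr (AL X0) (Z 1 t) + (inp u v t))) (at t within {0..T}) \<and>
       (Z 2 has_vector_derivative (lbr (AL X0) (Z 2 t) - (1/2) *\<^sub>R lbr (Z 1 t) (inp u v t))) (at t within {0..T})) \<and>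
     norm ((\<Sum>n=1..N. bvec (Z n T)) - x T) <= C * (l1n T u v * norm (x T) + l1n T u v ^ Suc N)"

text \<open>Moments, Chen series and logarithm are compared on the column \<open>E0\<close>. The
  relative error of \<open>exp_column\<close> is measured by the logarithm at first and, for small
  controls, by the endpoint in the end.\<close>

theorem magnus_representation:
  "\<exists>C\<ge>0. \<exists>T0>0. \<exists>g0>0. \<forall>T u v x. traj f T u v x --> T <= T0 --> l1n T u v <= g0 --> (\<exists>Z. magnus_rep C T u v x Z)"
proof -
  obtain C1 T1 g1 where me: "C1 \<ge> 0" "T1 > 0" "g1 > 0"
    "\<forall>T u v x P. traj f T u v x --> T <= T1 --> l1n T u v <= g1 -->
     chen_seq (AL X0) (inp u v) T P -->
     norm (x T) <= 1 \<and> norm (mom (x T) - (\<Sum>n\<le>N. P n T * E0)) <= C1 * l1n T u v ^ Suc N"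
    using moment_estimate by (elim exE conjE) (rule that)
  obtain c where c: "\<And>g (p::('d => nat) bop fps). g \<ge> 0 ==> hb (\<lambda>_. 1) g p ==> hb c g (logit N N p)"
    using hb_logit by blast
  obtain C2 where C2: "C2 \<ge> 0" "\<And>g (p::('d => nat) bop fps) e. 0 <= g ==> g <= 1 ==> p $$ 0 = 1 ==> hb (\<lambda>_. 1) g p ==>
     norm ((\<Sum>n=1..N. p $$ n * e) - (\<Sum>n=1..N. logit N N p $$ n * e))
       <= C2 * (g * norm (\<Sum>n=1..N. logit N N p $$ n * e) + g ^ Suc N * norm e)"
  proof -
    have "1 <= N" using N2 by simp
    from exp_column[OF this, where ?'a="('d => nat) bop"] show ?thesis using that by blast
  qed
  obtain C4 where C4: "C4 \<ge> 0" "\<And>x. norm x <= 1 ==> norm (mom x - E0) <= C4 * norm x" using mom_bound by blast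
  obtain Kv where Kv: "Kv \<ge> 0" "\<And>B. norm (bvec B) <= Kv * norm B"
    using bounded_linear.nonneg_bounded[OF bounded_linear_bvec] by (metis mult.commute)
  define KK where "KK = 2 * KA"
  have KK: "KK \<ge> 2" using KA by (simp add: KK_def)
  define C3 where "C3 = C1 + C2 * KK + C2 * KK ^ Suc N * norm E0"
  have C3: "C3 \<ge> 0" unfolding C3_def using me C2 KK by (intro add_nonneg_nonneg mult_nonneg_nonneg zero_le_power) auto
  define C5 where "C5 = Kv * (C3 * (2 * C4 + 2 * C3 + 1))"
  define C where "C = C5 + (\<Sum>n=1..N. \<bar>c n\<bar> * KK ^ n)"
  define T0 where "T0 = min T1 (1 / (4 * KA))"
  \<comment> \<open>\<open>1 / KK\<close> puts the scaled size \<open>KK * \<gamma>\<close> below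
    \<open>1\<close>, as required by \<open>exp_column\<close>; \<open>1 / (2 * C3 + 2)\<close>
    makes \<open>C3 * \<gamma> * norm \<zeta>\<close> absorbable.\<close>
  define g0 where "g0 = min g1 (min (1 / KK) (1 / (2 * C3 + 2)))"
  have S0: "(\<Sum>n=1..N. \<bar>c n\<bar> * KK ^ n) \<ge> 0" using KK by (intro sum_nonneg mult_nonneg_nonneg) auto
  have C5: "C5 \<ge> 0" unfolding C5_def using Kv C3 C4 by (intro mult_nonneg_nonneg add_nonneg_nonneg) auto
  have "\<exists>Z. magnus_rep C T u v x Z"
    if tr: "traj f T u v x" and T: "T <= T0" and g: "l1n T u v <= g0" for T u v x
  proof -
    define \<gamma> where "\<gamma> = l1n T u v"
    define G where "G t = inp u v t" for t
    have tr': "0 < T" "continuous_on {0..T} u" "continuous_on {0..T} v"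
      using tr by (auto simp: traj_def)
    have g': "0 <= \<gamma>" using l1n_nonneg tr' by (simp add: \<gamma>_def)
    have gb: "KK * \<gamma> <= 1" "C3 * \<gamma> <= 1/2" "\<gamma> <= 1"
    proof -
      have "\<gamma> <= 1 / KK" "\<gamma> <= 1 / (2 * C3 + 2)" using g by (auto simp: g0_def \<gamma>_def)
      hence 1: "\<gamma> * KK <= 1" and "\<gamma> * (2 * C3 + 2) <= 1" using KK C3 by (auto simp: pos_le_divide_eq)
      hence "2 * (C3 * \<gamma>) + 2 * \<gamma> <= 1" by (simp add: algebra_simps)
      thus "C3 * \<gamma> <= 1/2" "\<gamma> <= 1" using g' C3 mult_nonneg_nonneg[OF C3 g'] by linarith+
      show "KK * \<gamma> <= 1" using 1 by (simp add: mult.commute)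
    qed
    have cG: "continuous_on {0..T} G" unfolding G_def by (intro continuous_intros tr')
    obtain P where ch: "chen_seq (AL X0) G T P" using chen_exists[OF cG, of "AL X0"] tr' by auto
    note P = chen_seqD[OF ch]
    have T4: "4 * norm (AL X0) * T <= 1" using T by (intro KA_time tr') (simp add: T0_def)
    have iG: "integral {0..T} (\<lambda>t. norm (G t)) <= KA * \<gamma>"
      unfolding G_def \<gamma>_def by (intro inp_L1 tr')
    define p where "p t = Abs_fps (\<lambda>n. P n t)" for t
    have p0: "p t $$ 0 = 1" for t by (simp add: p_def P)
    have hp: "hb (\<lambda>_. 1) (KK * \<gamma>) (p t)" if "t \<in> {0..T}" for t
    proof -
      have "norm (P n t) <= (KK * \<gamma>) ^ n" for n
      proof -
        have "norm (P n t) <= (2 * integral {0..T} (\<lambda>s. norm (G s))) ^ n"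
          by (rule chen_bound[where P=P and G=G and A="AL X0", OF cG _ T4 ch that]) (use tr' in auto)
        also have "\<dots> <= (KK * \<gamma>) ^ n"
          using iG integral_nonneg[OF integrable_continuous_real[OF continuous_on_norm[OF cG]]]
          by (intro power_mono) (auto simp: KK_def)
        finally show ?thesis .
      qed
      thus ?thesis by (simp add: hb_def p_def)
    qed
    define z where "z t = logit N N (p t)" for t
    have z0: "z t $$ 0 = 0" for t unfolding z_def by (rule logit_0[OF p0])
    have zz: "z 0 = 0"
    proof -
      have "p 0 $$ n = (1 :: ('d => nat) bop fps) $$ n" for n using P(1,2) by (cases n) (auto simp: p_def)
      hence "p 0 = 1" by (rule fps_ext)
      thus ?thesis by (simp add: z_def logit_one)
    qed
    have "N \<ge> 1" using N2 by simp
    obtain Y where Y: "\<And>t. t \<in> {0..T} ==> hasDD (AL X0) {0..T} t z (Y t)"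
      "\<And>t. t \<in> {0..T} ==> Y t $$ 0 = 0"
      "\<And>t. t \<in> {0..T} ==> eqm N (\<Sum>j<N. cf (Suc j) * (lbr (z t) ^^ j) (Y t)) (fps_X * fps_const (G t))"
      unfolding z_def p_def
      using magnus_derivative[where P=P and G=G and A="AL X0", OF tr'(1) \<open>N \<ge> 1\<close> ch] by blast
    define Z where "Z n t = z t $$ n" for n t
    have GL: "G t \<in> Lie 1" for t
      unfolding G_def by (intro subspace_add[OF subspace_bispan] subspace_scale[OF subspace_bispan] Aop_Lie) auto
    have ZL: "Z n t \<in> Lie n" if "n \<in> {1..N}" "t \<in> {0..T}" for n t
      unfolding Z_def
      by (rule magnus_Lie[where Y=Y and G=G and A="AL X0" and S=Lset and M=N, OF tr'(1) T4 N2 Y(1) z0 zz Y(2,3) GL Lset_lbr])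
        (use that Lie_lbr_A0 bispan_base in auto)
    have Zb: "norm (Z n t) <= C * \<gamma> ^ n" if n: "n \<in> {1..N}" and t: "t \<in> {0..T}" for n t
    proof -
      have "norm (Z n t) <= c n * (KK * \<gamma>) ^ n"
        using c[OF _ hp[OF t]] KK g' by (simp add: hb_def Z_def z_def)
      also have "\<dots> <= (\<bar>c n\<bar> * KK ^ n) * \<gamma> ^ n"
        using KK g' by (simp add: power_mult_distrib mult.assoc mult_right_mono)
      also have "\<dots> <= C * \<gamma> ^ n"
      proof (intro mult_right_mono)
        have "\<bar>c n\<bar> * KK ^ n <= (\<Sum>n=1..N. \<bar>c n\<bar> * KK ^ n)"
          by (rule member_le_sum[OF n]) (use KK in auto)
        thus "\<bar>c n\<bar> * KK ^ n <= C" using C5 by (simp add: C_def)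
      qed (use g' in auto)
      finally show ?thesis .
    qed
    have D: "(Z n has_vector_derivative (Y t $$ n + lbr (AL X0) (Z n t))) (at t within {0..T})" if "t \<in> {0..T}" for n t
      using Y(1)[OF that] by (simp add: hasDD_def Z_def[abs_def])
    have Z12: "Y t $$ 1 = G t" "Y t $$ 2 = - (1/2) *\<^sub>R lbr (Z 1 t) (G t)" if "t \<in> {0..T}" for t
      using dexp_coeff(2,3)[OF z0 Y(2)[OF that] N2 Y(3)[OF that]] by (simp_all add: Z_def)
    define \<zeta> where "\<zeta> = (\<Sum>n=1..N. Z n T * E0)"
    define W where "W = mom (x T) - E0"
    have Tin: "T \<in> {0..T}" using tr' by simp
    have m: "norm (x T) <= 1" "norm (mom (x T) - (\<Sum>n\<le>N. P n T * E0)) <= C1 * \<gamma> ^ Suc N"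
      using me(4)[rule_format, OF tr, of P] T g ch by (auto simp: T0_def g0_def \<gamma>_def G_def[abs_def])
    have "norm (W - \<zeta>) <= C3 * (\<gamma> * norm \<zeta> + \<gamma> ^ Suc N)"
    proof -
      have "{..N} = insert 0 {1..N}" by auto
      hence "(\<Sum>n\<le>N. P n T * E0) = E0 + (\<Sum>n=1..N. p T $$ n * E0)" by (simp add: P p_def)
      hence "W - \<zeta> = (mom (x T) - (\<Sum>n\<le>N. P n T * E0)) + ((\<Sum>n=1..N. p T $$ n * E0) - \<zeta>)"
        by (simp add: W_def)
      also have "norm \<dots> <= C1 * \<gamma> ^ Suc N + C2 * ((KK * \<gamma>) * norm \<zeta> + (KK * \<gamma>) ^ Suc N * norm E0)"
        using m(2) C2(2)[OF _ gb(1) p0 hp[OF Tin], of E0] KK g'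
        by (intro norm_triangle_le add_mono) (auto simp: \<zeta>_def Z_def z_def)
      also have "\<dots> = (C2 * KK) * (\<gamma> * norm \<zeta>) + (C1 + C2 * KK ^ Suc N * norm E0) * \<gamma> ^ Suc N"
        by (simp add: power_mult_distrib algebra_simps)
      also have "\<dots> <= C3 * (\<gamma> * norm \<zeta>) + C3 * \<gamma> ^ Suc N"
        using me C2 KK g' by (intro add_mono mult_right_mono) (auto simp: C3_def)
      finally show ?thesis by (simp add: distrib_left)
    qed
    moreover have Wb: "norm W <= C4 * norm (x T)" unfolding W_def by (rule C4(2)[OF m(1)])
    moreover have "norm \<zeta> <= norm W + norm (W - \<zeta>)"
      using norm_triangle_ineq4[of W "W - \<zeta>"] by simp
    moreover have "C3 * \<gamma> * norm \<zeta> <= 1/2 * norm \<zeta>" by (intro mult_right_mono gb) auto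
    \<comment> \<open>Half of \<open>norm \<zeta>\<close> is absorbed, which replaces the logarithm
      by the endpoint on the right-hand side.\<close>
    ultimately have zb: "norm \<zeta> <= 2 * C4 * norm (x T) + 2 * C3 * \<gamma> ^ Suc N"
      by (simp add: algebra_simps)
    have "norm (W - \<zeta>) <= C3 * (2 * C4 + 2 * C3 + 1) * (\<gamma> * norm (x T) + \<gamma> ^ Suc N)"
    proof -
      have "\<gamma> * norm \<zeta> <= \<gamma> * (2 * C4 * norm (x T) + 2 * C3 * \<gamma> ^ Suc N)" using zb g' by (rule mult_left_mono)
      also have "\<dots> <= 2 * C4 * (\<gamma> * norm (x T)) + 2 * C3 * \<gamma> ^ Suc N"
      proof -
        have "\<gamma> * (2 * C3 * \<gamma> ^ Suc N) <= 1 * (2 * C3 * \<gamma> ^ Suc N)" using gb C3 g' by (intro mult_right_mono) auto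
        thus ?thesis by (simp add: algebra_simps)
      qed
      finally have "\<gamma> * norm \<zeta> + \<gamma> ^ Suc N <= 2 * C4 * (\<gamma> * norm (x T)) + (2 * C3 + 1) * \<gamma> ^ Suc N" by (simp add: algebra_simps)
      also have "\<dots> <= (2 * C4 + 2 * C3 + 1) * (\<gamma> * norm (x T)) + (2 * C4 + 2 * C3 + 1) * \<gamma> ^ Suc N"
        using C3 C4 g' by (intro add_mono mult_right_mono) auto
      finally have "C3 * (\<gamma> * norm \<zeta> + \<gamma> ^ Suc N) <= C3 * ((2 * C4 + 2 * C3 + 1) * (\<gamma> * norm (x T) + \<gamma> ^ Suc N))"
        using C3 by (intro mult_left_mono) (simp_all add: distrib_left)
      thus ?thesis using \<open>norm (W - \<zeta>) <= C3 * (\<gamma> * norm \<zeta> + \<gamma> ^ Suc N)\<close> by (simp add: mult.assoc)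
    qed
    hence "norm (bvec (W - \<zeta>)) <= Kv * (C3 * (2 * C4 + 2 * C3 + 1) * (\<gamma> * norm (x T) + \<gamma> ^ Suc N))"
      using Kv by (meson mult_left_mono order_trans)
    also have "\<dots> = C5 * (\<gamma> * norm (x T) + \<gamma> ^ Suc N)" by (simp add: C5_def mult.assoc)
    also have "\<dots> <= C * (\<gamma> * norm (x T) + \<gamma> ^ Suc N)"
      using S0 g' by (intro mult_right_mono add_nonneg_nonneg mult_nonneg_nonneg) (auto simp: C_def)
    also have "bvec (W - \<zeta>) = x T - (\<Sum>n=1..N. bvec (Z n T))"
    proof -
      have lin: "linear bvec" using bounded_linear_bvec by (rule bounded_linear.linear)
      have "bvec (Z n T * E0) = bvec (Z n T)" for n by (simp add: bvec_def ment_mult_munit)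
      thus ?thesis
        by (simp add: W_def \<zeta>_def linear_diff[OF lin] linear_sum[OF lin] bvec_mom bvec_E0)
    qed
    finally have fin: "norm ((\<Sum>n=1..N. bvec (Z n T)) - x T) <= C * (\<gamma> * norm (x T) + \<gamma> ^ Suc N)"
      by (simp add: norm_minus_commute)
    have "magnus_rep C T u v x Z"
      unfolding magnus_rep_def
    proof (intro conjI ballI)
      show "4 * norm (AL X0) * T <= 1" by (rule T4)
      show "Z n t \<in> Lie n" "norm (Z n t) <= C * l1n T u v ^ n" if "n \<in> {1..N}" "t \<in> {0..T}" for n t
        using ZL[OF that] Zb[OF that] by (simp_all add: \<gamma>_def)
      show "Z 1 0 = 0" "Z 2 0 = 0" by (simp_all add: Z_def zz)
      show "norm ((\<Sum>n=1..N. bvec (Z n T)) - x T) <= C * (l1n T u v * norm (x T) + l1n T u v ^ Suc N)"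
        using fin by (simp add: \<gamma>_def)
      fix t assume t: "t \<in> {0..T}"
      show "(Z 1 has_vector_derivative (lbr (AL X0) (Z 1 t) + (inp u v t))) (at t within {0..T})"
        using D[OF t, of 1] Z12[OF t] by (simp add: G_def add.commute)
      show "(Z 2 has_vector_derivative (lbr (AL X0) (Z 2 t) - (1/2) *\<^sub>R lbr (Z 1 t) (inp u v t))) (at t within {0..T})"
        using D[OF t, of 2] Z12[OF t] by (simp add: G_def add.commute)
    qed
    thus ?thesis by blast
  qed
  moreover have "T0 > 0" "g0 > 0" using me KA KK C3 by (auto simp: T0_def g0_def)
  moreover have "C \<ge> 0" using C5 S0 by (simp add: C_def)
  ultimately show ?thesis by blast
qed

end

section \<open>The quadratic drift\<close>

primrec prim :: "(real => real) => nat => real => real" where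
  "prim u 0 = u"
| "prim u (Suc l) = (\<lambda>t. integral {0..t} (prim u l))"

lemma prim_continuous: "continuous_on {0..T} u ==> continuous_on {0..T} (prim u l)"
proof (induction l)
  case (Suc l)
  thus ?case using indefinite_integral_continuous_1[OF integrable_continuous_real[OF Suc.IH]] by simp
qed simp

lemma prim_derivative:
  "continuous_on {0..T} u ==> t \<in> {0..T} ==> (prim u (Suc l) has_vector_derivative prim u l t) (at t within {0..T})"
  using integral_has_vector_derivative[OF prim_continuous] by simp

primrec adb :: "letter => nat => br" where
  "adb i 0 = Leaf i"
| "adb i (Suc l) = Bracket (adb i l) (Leaf X0)"

lemma nocc_adb: "i \<noteq> X0 ==> nocc (adb i l) = 1"
  by (induction l) (cases i; auto)+

text \<open>The integral of the square of \<open>w - m\<close> is nonnegative, where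
  \<open>m\<close> is the mean of \<open>w\<close>.\<close>

lemma cauchy_schwarz_one:
  fixes w :: "real => real"
  assumes "continuous_on {0..T} w" "T > 0"
  shows "(integral {0..T} w)\<^sup>2 <= T * integral {0..T} (\<lambda>t. (w t)\<^sup>2)"
proof -
  define m where "m = integral {0..T} w / T"
  have i: "w integrable_on {0..T}" "(\<lambda>t. (w t)\<^sup>2) integrable_on {0..T}"
    using assms by (auto intro!: integrable_continuous_real continuous_intros)
  have "((\<lambda>t. (w t)\<^sup>2 - 2 * m * w t + m\<^sup>2 * 1) has_integral
     (integral {0..T} (\<lambda>t. (w t)\<^sup>2) - 2 * m * integral {0..T} w + m\<^sup>2 * T)) {0..T}"
    using i has_integral_const_real[of "1::real" 0 T] assms(2)
    by (intro has_integral_add has_integral_diff has_integral_mult_right) (auto simp: integrable_integral)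
  moreover have "(w t)\<^sup>2 - 2 * m * w t + m\<^sup>2 * 1 \<ge> 0" for t
    using zero_le_power2[of "w t - m"] by (simp add: power2_eq_square algebra_simps)
  ultimately have "0 <= integral {0..T} (\<lambda>t. (w t)\<^sup>2) - 2 * m * integral {0..T} w + m\<^sup>2 * T"
    by (rule has_integral_nonneg)
  also have "\<dots> = integral {0..T} (\<lambda>t. (w t)\<^sup>2) - (integral {0..T} w)\<^sup>2 / T"
    using assms(2) by (simp add: m_def power2_eq_square field_simps)
  finally show ?thesis using assms(2) by (simp add: field_simps)
qed

abbreviation L12 :: "letter set" where "L12 \<equiv> {X1, X2}"

definition ctl :: "(real => real) => (real => real) => letter => real => real" where
  "ctl u v i = (if i = X1 then u else v)"

lemma ctl_simps [simp]: "ctl u v X1 = u" "ctl u v X2 = v"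
  by (simp_all add: ctl_def)

text \<open>\<open>Q\<close> is a projection with kernel \<open>V\<close>, and the \<open>\<psi> i l\<close> recover the primitives of the controls
  from the linear part of the endpoint without seeing the brackets of \<open>2..r\<close> controlled fields.\<close>
locale closed_loop = carleman f N a
  for f :: "letter => real^'d::finite => real^'d" and N a +
  fixes k r :: nat and V :: "(real^'d) set" and Q :: "real^'d => real^'d" and c :: "real^'d"
    and \<psi> :: "letter => nat => real^'d => real"
  assumes k1: "k \<ge> 1" and rN: "r <= N"
    and linQ: "linear Q" and QV: "\<And>x. x \<in> V ==> Q x = 0" and QV': "\<And>x. x - Q x \<in> V"
    and HV: "\<And>x. x \<in> V ==> Hmap x \<in> V"
    and V2: "\<And>i j a b. i \<in> L12 ==> j \<in> L12 ==> a + b <= 2 * k - 2 ==> Fb (Bracket (adb i a) (adb j b)) 0 \<in> V"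
    and V1: "\<And>b. nocc b \<in> {1..N} - {2} ==> Fb b 0 \<in> V"
    and cV: "\<And>x. x \<in> V ==> c \<bullet> x = 0"
    and lin\<psi>: "\<And>i l. linear (\<psi> i l)"
    and \<psi>1: "\<And>i j l l'. i \<in> L12 ==> j \<in> L12 ==> l < k ==> l' < k ==>
      \<psi> i l (Fb (adb j l') 0) = (if i = j \<and> l = l' then 1 else 0)"
    and \<psi>2: "\<And>i l b. 2 <= nocc b ==> nocc b <= r ==> \<psi> i l (Fb b 0) = 0"
begin

definition Sij :: "letter => letter => real^'d" where
  "Sij i j = Fb (Bracket (adb i (k - 1)) (adb j k)) 0"

lemma bvec_lbr_adb:
  "i \<in> L12 ==> j \<in> L12 ==> bvec (lbr (Aop (adb i l)) (Aop (adb j l'))) = - Fb (Bracket (adb i l) (adb j l')) 0"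
proof -
  assume ij: "i \<in> L12" "j \<in> L12"
  have "nocc (Bracket (adb j l') (adb i l)) <= N" using ij N2 nocc_adb[of i] nocc_adb[of j] by auto
  hence "bvec (lbr (Aop (adb i l)) (Aop (adb j l'))) = Fb (Bracket (adb j l') (adb i l)) 0"
    by (simp add: Aop_Bracket[symmetric] bvec_Aop)
  thus ?thesis by (simp add: Fb_Bracket field_bracket_def)
qed

text \<open>The outcome of \<open>k\<close> integrations by parts in the first Magnus component:
  \<open>Yop\<close> collects the terms that survive at the final time, and \<open>Wop\<close> is
  the source that is left over, which contains only the \<open>k\<close>-th primitives.\<close>

definition Yop where "Yop u v t = (\<Sum>i\<in>L12. \<Sum>l<k. prim (ctl u v i) (Suc l) t *\<^sub>R Aop (adb i l))"
definition Wop where "Wop u v t = (\<Sum>i\<in>L12. prim (ctl u v i) k t *\<^sub>R Aop (adb i k))"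

definition wl1 where "wl1 u v t = \<bar>prim u k t\<bar> + \<bar>prim v k t\<bar>"

definition UT where "UT u v T = (\<Sum>i\<in>L12. \<Sum>l<k. \<bar>prim (ctl u v i) (Suc l) T\<bar>)"

lemma Yop_derivative:
  assumes "continuous_on {0..T} u" "continuous_on {0..T} v" "t \<in> {0..T}"
  shows "(Yop u v has_vector_derivative (lbr (AL X0) (Yop u v t) + ((inp u v t) - Wop u v t))) (at t within {0..T})"
proof -
  let ?p = "\<lambda>i l. prim (ctl u v i) l t"
  have ct: "continuous_on {0..T} (ctl u v i)" for i using assms by (simp add: ctl_def)
  have d: "(Yop u v has_vector_derivative (\<Sum>i\<in>L12. \<Sum>l<k. ?p i l *\<^sub>R Aop (adb i l))) (at t within {0..T})"
    unfolding Yop_def[abs_def]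
    by (intro has_vector_derivative_sum bounded_linear.has_vector_derivative[OF bounded_linear_scaleR_left] prim_derivative ct assms(3))
  have l: "lbr (AL X0) (Yop u v t) = (\<Sum>i\<in>L12. \<Sum>l<k. ?p i (Suc l) *\<^sub>R Aop (adb i (Suc l)))"
    unfolding Yop_def lbr_sum lbr_scaleR by (simp only: adb.simps Aop_Bracket)
  \<comment> \<open>Differentiation lowers the index of the primitive and \<open>lbr (AL X0)\<close>
    raises that of the bracket, so the two sums telescope to their ends \<open>l = 0\<close> and
    \<open>l = k\<close>.\<close>
  have e: "(\<Sum>l<k. ?p i l *\<^sub>R Aop (adb i l)) = (\<Sum>l<k. ?p i (Suc l) *\<^sub>R Aop (adb i (Suc l)))
      + (?p i 0 *\<^sub>R Aop (adb i 0) - ?p i k *\<^sub>R Aop (adb i k))" for i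
    using sum_lessThan_telescope[of "\<lambda>l. ?p i l *\<^sub>R Aop (adb i l)" k]
    by (simp add: sum_subtractf algebra_simps del: prim.simps adb.simps)
  have "(\<Sum>i\<in>L12. \<Sum>l<k. ?p i l *\<^sub>R Aop (adb i l))
     = lbr (AL X0) (Yop u v t) + ((inp u v t) - Wop u v t)"
    unfolding l Wop_def e by (simp add: algebra_simps del: prim.simps(2) adb.simps(2))
  thus ?thesis using d by simp
qed

lemma Yop_Lie: "Yop u v t \<in> Lie 1"
  unfolding Yop_def
  by (intro subspace_sum[OF subspace_bispan] subspace_scale[OF subspace_bispan] Aop_Lie nocc_adb) auto

lemma Yop_0: "Yop u v 0 = 0"
  by (simp add: Yop_def)

lemma bounded_linear_Q_bvec: "bounded_linear (\<lambda>B. Q (bvec B))"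
  using bounded_linear_compose[OF linear_conv_bounded_linear[THEN iffD1, OF linQ] bounded_linear_bvec] .

text \<open>\<open>V\<close> is invariant under \<open>Hmap\<close>, so the linearised drift acts on
  the quotient by \<open>V\<close>, which \<open>Q\<close> realises as a complement.\<close>

lemma QH: "Q (Hmap x) = Q (Hmap (Q x))"
proof -
  have "Hmap x - Hmap (Q x) \<in> V" using HV[OF QV'[of x]] by (simp add: linear_diff[OF linear_Hmap])
  thus ?thesis using QV by (fastforce simp: linear_diff[OF linQ])
qed

text \<open>The brackets that occur contain \<open>l < k\<close> drifts in total, hence at most
  \<open>2 * k - 2\<close>, and lie in \<open>V\<close>.\<close>

lemma Q_bvec_YG: "Q (bvec (lbr (Yop u v t) (u' *\<^sub>R AL X1 + v' *\<^sub>R AL X2))) = 0"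
proof -
  have lin: "linear (\<lambda>B. Q (bvec B))" using bounded_linear_Q_bvec by (rule bounded_linear.linear)
  have "Q (bvec (lbr (Aop (adb i l)) (AL j))) = 0" if "i \<in> L12" "j \<in> L12" "l < k" for i j l
  proof -
    have "Fb (Bracket (adb i l) (adb j 0)) 0 \<in> V" using that k1 by (intro V2) auto
    thus ?thesis using bvec_lbr_adb[of i j l 0] that QV by (simp add: linear_neg[OF linQ])
  qed
  thus ?thesis
    unfolding Yop_def lbr_sum lbr_simps lbr_scaleR
    by (simp add: linear_sum[OF lin] linear_add[OF lin] linear_cmul[OF lin] del: prim.simps)
qed

abbreviation "ww u v i j t \<equiv> prim (ctl u v i) k t * prim (ctl u v j) k t"

abbreviation "qform u v t \<equiv> \<Sum>i\<in>L12. \<Sum>j\<in>L12. ww u v i j t *\<^sub>R Q (Sij i j)"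

text \<open>A bracket with \<open>l + k\<close> drifts lies in \<open>V\<close> unless
  \<open>l = k - 1\<close>; the survivors are the coefficients \<open>Sij\<close> of the quadratic
  form.\<close>

lemma Q_bvec_YW:
  "Q (bvec (lbr (Yop u v t) (Wop u v t))) = - qform u v t"
proof -
  have lin: "linear (\<lambda>B. Q (bvec B))" using bounded_linear_Q_bvec by (rule bounded_linear.linear)
  let ?p = "\<lambda>i l. prim (ctl u v i) l t"
  have e: "Q (bvec (lbr (Aop (adb i l)) (Aop (adb j k)))) = (if l = k - 1 then - Q (Sij i j) else 0)"
    if "i \<in> L12" "j \<in> L12" "l < k" for i j l
  proof (cases "l = k - 1")
    case True
    thus ?thesis using bvec_lbr_adb[of i j l k] that by (simp add: Sij_def linear_neg[OF linQ])
  next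
    case False
    hence "Fb (Bracket (adb i l) (adb j k)) 0 \<in> V" using that by (intro V2) auto
    thus ?thesis using False bvec_lbr_adb[of i j l k] that QV by (simp add: linear_neg[OF linQ])
  qed
  have "Q (bvec (lbr (Yop u v t) (Wop u v t)))
     = (\<Sum>j\<in>L12. \<Sum>i\<in>L12. \<Sum>l<k. ?p j k *\<^sub>R ?p i (Suc l) *\<^sub>R Q (bvec (lbr (Aop (adb i l)) (Aop (adb j k)))))"
    unfolding Wop_def Yop_def lbr_sum lbr_scaleR
    by (simp only: linear_sum[OF lin] linear_cmul[OF lin] scaleR_sum_right)
  also have "\<dots> = (\<Sum>j\<in>L12. \<Sum>i\<in>L12. \<Sum>l<k. if l = k - 1 then - (?p j k *\<^sub>R ?p i (Suc l) *\<^sub>R Q (Sij i j)) else 0)"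
    by (intro sum.cong refl) (simp add: e del: prim.simps)
  also have "\<dots> = (\<Sum>j\<in>L12. \<Sum>i\<in>L12. - ((?p i k * ?p j k) *\<^sub>R Q (Sij i j)))"
    using k1 by (simp add: sum.delta mult.commute del: prim.simps)
  also have "\<dots> = - (\<Sum>i\<in>L12. \<Sum>j\<in>L12. (?p i k * ?p j k) *\<^sub>R Q (Sij i j))"
    by (subst sum.swap) (simp only: sum_negf)
  finally show ?thesis .
qed

definition form where
  "form u v t = (\<Sum>i\<in>L12. \<Sum>j\<in>L12. ww u v i j t * (c \<bullet> Sij i j))"

lemma cQ: "c \<bullet> Q x = c \<bullet> x"
  using cV[OF QV'[of x]] by (simp add: inner_diff_right)

lemma wl1_continuous:
  "continuous_on {0..T} u ==> continuous_on {0..T} v ==> continuous_on {0..T} (wl1 u v)"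
  unfolding wl1_def[abs_def] by (intro continuous_intros prim_continuous)

lemma prim_le_wl1: "i \<in> L12 ==> \<bar>prim (ctl u v i) k t\<bar> <= wl1 u v t"
  by (auto simp: wl1_def)

lemma Wop_bound: "\<exists>K\<ge>0. \<forall>u v t. norm (Wop u v t) <= K * wl1 u v t"
proof (intro exI[of _ "\<Sum>i\<in>L12. norm (Aop (adb i k))"] conjI allI)
  fix u v t
  have "norm (Wop u v t) <= (\<Sum>i\<in>L12. wl1 u v t * norm (Aop (adb i k)))"
    unfolding Wop_def
    by (rule sum_norm_le) (auto simp: wl1_def intro!: mult_right_mono)
  thus "norm (Wop u v t) <= (\<Sum>i\<in>L12. norm (Aop (adb i k))) * wl1 u v t"
    by (simp add: algebra_simps)
qed (intro sum_nonneg norm_ge_zero)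

lemma Yop_bound: "\<exists>K\<ge>0. \<forall>u v t. norm (Yop u v t) <= K * UT u v t"
proof (intro exI[of _ "\<Sum>i\<in>L12. \<Sum>l<k. norm (Aop (adb i l))"] conjI allI)
  fix u v t
  let ?K = "\<Sum>i\<in>L12. \<Sum>l<k. norm (Aop (adb i l))"
  have m: "norm (Aop (adb i l)) <= ?K" if "i \<in> L12" "l < k" for i l
  proof -
    have "norm (Aop (adb i l)) <= (\<Sum>l<k. norm (Aop (adb i l)))"
      by (rule member_le_sum) (use that in auto)
    also have "\<dots> <= ?K" by (rule member_le_sum[of i L12 "\<lambda>i. \<Sum>l<k. norm (Aop (adb i l))"]) (use that in \<open>auto intro: sum_nonneg\<close>)
    finally show ?thesis .
  qed
  have "norm (Yop u v t) <= (\<Sum>i\<in>L12. \<Sum>l<k. \<bar>prim (ctl u v i) (Suc l) t\<bar> * ?K)"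
    unfolding Yop_def
  proof (rule order_trans[OF norm_sum sum_mono], rule order_trans[OF norm_sum sum_mono])
    fix i l assume "i \<in> L12" "l \<in> {..<k}"
    thus "norm (prim (ctl u v i) (Suc l) t *\<^sub>R Aop (adb i l)) <= \<bar>prim (ctl u v i) (Suc l) t\<bar> * ?K"
      unfolding norm_scaleR by (intro mult_left_mono m) auto
  qed
  thus "norm (Yop u v t) <= ?K * UT u v t"
    by (simp only: UT_def sum_distrib_right[symmetric] mult.commute)
qed (intro sum_nonneg norm_ge_zero)

lemma lbr_product_derivative:
  fixes A :: "'b::real_normed_algebra"
  assumes "(p has_vector_derivative (lbr A (p t) + p')) (at t within S)" "(q has_vector_derivative (lbr A (q t) + q')) (at t within S)"
  shows "((\<lambda>t. lbr (p t) (q t)) has_vector_derivative (lbr A (lbr (p t) (q t)) + (lbr p' (q t) + lbr (p t) q'))) (at t within S)"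
proof -
  have "((\<lambda>t. lbr (p t) (q t)) has_vector_derivative
     ((p t * (lbr A (q t) + q') + (lbr A (p t) + p') * q t) - (q t * (lbr A (p t) + p') + (lbr A (q t) + q') * p t))) (at t within S)"
    unfolding lbr_def[of "p _"] by (intro has_vector_derivative_diff has_vector_derivative_mult assms)
  thus ?thesis by (simp add: lbr_def algebra_simps)
qed

text \<open>The source of \<open>Z 2\<close> contains the controls themselves. Writing
  \<open>Z 1 = \<omega> + Y\<close> and adding half the bracket of \<open>\<omega>\<close> and
  \<open>Y\<close> trades them for \<open>W\<close>: modulo \<open>V\<close> the new source is half
  the quadratic form plus a bracket of \<open>\<omega>\<close> with \<open>W\<close>, and
  \<open>\<omega>\<close> is bounded by the L1 norm of the \<open>k\<close>-th primitives.\<close>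

lemma quadratic_estimate:
  "\<exists>K\<ge>0. \<exists>T0>0. \<forall>T u v x C Z. traj f T u v x --> T <= T0 --> magnus_rep C T u v x Z -->
     norm (Z 1 T - Yop u v T) <= K * integral {0..T} (wl1 u v) \<and>
     \<bar>c \<bullet> bvec (Z 2 T) - 1/2 * integral {0..T} (form u v)\<bar>
       <= K * (T * integral {0..T} (\<lambda>t. (wl1 u v t)\<^sup>2) + integral {0..T} (wl1 u v) * UT u v T)"
proof -
  obtain KW where KW: "KW \<ge> 0" "\<And>u v t. norm (Wop u v t) <= KW * wl1 u v t" using Wop_bound by blast
  obtain KY where KY: "KY \<ge> 0" "\<And>u v t. norm (Yop u v t) <= KY * UT u v t" using Yop_bound by blast
  have H: "bounded_linear Hmap" "bounded_linear Q" using linear_Hmap linQ by (simp_all add: linear_conv_bounded_linear)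
  obtain KB where KB: "KB \<ge> 0" "\<And>B. norm (bvec B) <= KB * norm B"
    using bounded_linear.nonneg_bounded[OF bounded_linear_bvec] by (metis mult.commute)
  obtain KQ where KQ: "KQ \<ge> 0" "\<And>B. norm (Q (bvec B)) <= KQ * norm B"
    using bounded_linear.nonneg_bounded[OF bounded_linear_Q_bvec] by (metis mult.commute)
  obtain KH where KH: "KH \<ge> 0" "\<And>y. norm (Q (Hmap y)) <= KH * norm y"
    using bounded_linear.nonneg_bounded[OF bounded_linear_compose[OF H(2,1)]] by (metis mult.commute)
  define KS where "KS = (\<Sum>i\<in>L12. \<Sum>j\<in>L12. norm (Q (Sij i j)))"
  have KS: "KS \<ge> 0" unfolding KS_def by (intro sum_nonneg norm_ge_zero)
  define K1 where "K1 = 2 * KW"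
  define Kq where "Kq = KS + KQ * K1 * KW"
  define K where "K = K1 + (norm c * KH * 4 * Kq + norm c * KQ * K1 * KW) + norm c * KB * K1 * KY"
  have K1: "K1 \<ge> 0" using KW by (simp add: K1_def)
  have Kq: "Kq \<ge> 0" using KS KQ K1 KW by (simp add: Kq_def)
  have Kpos: "norm c * KH * 4 * Kq \<ge> 0" "norm c * KQ * K1 * KW \<ge> 0" "norm c * KB * K1 * KY \<ge> 0"
    using KS KQ K1 KW KB KY KH Kq by simp_all
  \<comment> \<open>Ensures \<open>KH * T <= 1/2\<close>, the smallness behind the Gronwall bound on
    \<open>y\<close>.\<close>
  define T0 where "T0 = min 1 (1 / (2 * (KH + 1)))"
  have main: "norm (Z 1 T - Yop u v T) <= K * integral {0..T} (wl1 u v) \<and>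
     \<bar>c \<bullet> bvec (Z 2 T) - 1/2 * integral {0..T} (form u v)\<bar>
       <= K * (T * integral {0..T} (\<lambda>t. (wl1 u v t)\<^sup>2) + integral {0..T} (wl1 u v) * UT u v T)"
    if tr: "traj f T u v x" and T: "T <= T0" and mr: "magnus_rep C T u v x Z" for T u v x C Z
  proof -
    define G where "G t = inp u v t" for t
    let ?w = "wl1 u v"
    have T0: "0 < T" "T <= 1" and cu: "continuous_on {0..T} u" "continuous_on {0..T} v"
      using tr T by (auto simp: traj_def T0_def)
    have mr': "4 * norm (AL X0) * T <= 1" "\<And>t. t \<in> {0..T} ==> Z 1 t \<in> Lie 1" "\<And>t. t \<in> {0..T} ==> Z 2 t \<in> Lie 2"
      "Z 1 0 = 0" "Z 2 0 = 0"
      "\<And>t. t \<in> {0..T} ==> (Z 1 has_vector_derivative (lbr (AL X0) (Z 1 t) + G t)) (at t within {0..T})"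
      "\<And>t. t \<in> {0..T} ==> (Z 2 has_vector_derivative (lbr (AL X0) (Z 2 t) - (1/2) *\<^sub>R lbr (Z 1 t) (G t))) (at t within {0..T})"
      using mr N2 unfolding magnus_rep_def G_def by auto
    have cw: "continuous_on {0..T} ?w" using wl1_continuous cu by blast
    have w0: "?w t \<ge> 0" for t by (simp add: wl1_def)
    have iw: "?w integrable_on {0..T}" by (rule integrable_continuous_real[OF cw])
    define w1 where "w1 = integral {0..T} ?w"
    define w2 where "w2 = integral {0..T} (\<lambda>t. (?w t)\<^sup>2)"
    have cw2: "continuous_on {0..T} (\<lambda>t. (?w t)\<^sup>2)" by (intro continuous_intros cw)
    have iw2: "(\<lambda>t. (?w t)\<^sup>2) integrable_on {0..T}" by (rule integrable_continuous_real[OF cw2])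
    have w1n: "w1 \<ge> 0" "w2 \<ge> 0" unfolding w1_def w2_def using w0 iw iw2 by (auto intro!: integral_nonneg)
    have cs: "w1\<^sup>2 <= T * w2" unfolding w1_def w2_def by (rule cauchy_schwarz_one[OF cw T0(1)])
    define \<omega> where "\<omega> t = Z 1 t - Yop u v t" for t
    define Y where "Y = Yop u v"
    define W where "W = Wop u v"
    have dY: "(Y has_vector_derivative (lbr (AL X0) (Y t) + (G t - W t))) (at t within {0..T})" if "t \<in> {0..T}" for t
      unfolding Y_def W_def G_def by (rule Yop_derivative[OF cu that])
    have d\<omega>: "(\<omega> has_vector_derivative (lbr (AL X0) (\<omega> t) + W t)) (at t within {0..T})" if "t \<in> {0..T}" for t
      using has_vector_derivative_diff[OF mr'(6)[OF that] dY[OF that]]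
      unfolding \<omega>_def[abs_def] Y_def by (simp add: lbr_simps algebra_simps)
    have \<omega>b: "norm (\<omega> t) <= K1 * w1" if t: "t \<in> {0..T}" for t
    proof -
      have "norm (\<omega> t) <= 2 * integral {0..T} (\<lambda>t. KW * ?w t)"
      proof (rule gronwall_short[where l="\<lambda>_. 2 * norm (AL X0)", OF _ _ d\<omega>])
        fix s
        have "norm (lbr (AL X0) (\<omega> s) + W s) <= norm (lbr (AL X0) (\<omega> s)) + norm (W s)" by (rule norm_triangle_ineq)
        also have "\<dots> <= 2 * norm (AL X0) * norm (\<omega> s) + KW * ?w s"
          unfolding W_def by (intro add_mono norm_lbr_le KW)
        finally show "norm (lbr (AL X0) (\<omega> s) + W s) <= 2 * norm (AL X0) * norm (\<omega> s) + KW * ?w s" .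
      qed (use t T0 mr' cw w0 KW in \<open>auto intro!: continuous_intros simp: \<omega>_def Yop_0 mult_ac\<close>)
      thus ?thesis by (simp add: K1_def w1_def)
    qed
    \<comment> \<open>The corrected second component; the terms in which \<open>\<omega>\<close>
      meets the control \<open>G\<close> cancel in its derivative.\<close>
    define \<theta> where "\<theta> t = Z 2 t + (1/2) *\<^sub>R lbr (\<omega> t) (Y t)" for t
    define q where "q t = -(1/2) *\<^sub>R (lbr (Y t) (G t) + lbr (Y t) (W t) + lbr (\<omega> t) (W t))" for t
    have d\<theta>: "(\<theta> has_vector_derivative (lbr (AL X0) (\<theta> t) + q t)) (at t within {0..T})" if t: "t \<in> {0..T}" for t
    proof -
      have "(\<theta> has_vector_derivative ((lbr (AL X0) (Z 2 t) - (1/2) *\<^sub>R lbr (Z 1 t) (G t))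
         + (1/2) *\<^sub>R (lbr (AL X0) (lbr (\<omega> t) (Y t)) + (lbr (W t) (Y t) + lbr (\<omega> t) (G t - W t))))) (at t within {0..T})"
        unfolding \<theta>_def[abs_def]
        by (intro has_vector_derivative_add mr'(7) t bounded_linear.has_vector_derivative[OF bounded_linear_scaleR_right]
            lbr_product_derivative d\<omega> dY)
      moreover have "Z 1 t = \<omega> t + Y t" by (simp add: \<omega>_def Y_def)
      moreover have "lbr (W t) (Y t) = - lbr (Y t) (W t)" by (simp add: lbr_def)
      ultimately show ?thesis by (simp add: \<theta>_def q_def lbr_simps lbr_scaleR algebra_simps)
    qed
    have \<theta>L: "\<theta> t \<in> Lie 2" if t: "t \<in> {0..T}" for t
    proof -
      have "\<omega> t \<in> Lie 1" unfolding \<omega>_def using mr'(2)[OF t] Yop_Lie by (rule subspace_diff[OF subspace_bispan])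
      hence "lbr (\<omega> t) (Y t) \<in> Lie (1 + 1)" unfolding Y_def using Yop_Lie by (rule Lie_lbr)
      thus ?thesis unfolding \<theta>_def using mr'(3)[OF t]
        by (intro subspace_add[OF subspace_bispan] subspace_scale[OF subspace_bispan]) (auto simp: numeral_2_eq_2)
    qed
    define y where "y t = Q (bvec (\<theta> t))" for t
    define qq where "qq t = Q (bvec (q t))" for t
    have linB: "linear (\<lambda>B. Q (bvec B))" using bounded_linear_Q_bvec by (rule bounded_linear.linear)
    have dy: "(y has_vector_derivative (Q (Hmap (y t)) + qq t)) (at t within {0..T})" if t: "t \<in> {0..T}" for t
    proof -
      have "(y has_vector_derivative Q (bvec (lbr (AL X0) (\<theta> t) + q t))) (at t within {0..T})"
        unfolding y_def[abs_def] by (rule bounded_linear.has_vector_derivative[OF bounded_linear_Q_bvec d\<theta>[OF t]])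
      moreover have "Q (bvec (lbr (AL X0) (\<theta> t) + q t)) = Q (Hmap (y t)) + qq t"
        using bvec_lbr_A0[OF \<theta>L[OF t] N2] QH[of "bvec (\<theta> t)"] by (simp add: linear_add[OF linB] y_def qq_def)
      ultimately show ?thesis by simp
    qed
    have qq: "qq t = (1/2) *\<^sub>R qform u v t
        - (1/2) *\<^sub>R Q (bvec (lbr (\<omega> t) (W t)))" for t
    proof -
      have "qq t = -(1/2) *\<^sub>R (Q (bvec (lbr (Y t) (G t))) + Q (bvec (lbr (Y t) (W t))) + Q (bvec (lbr (\<omega> t) (W t))))"
        unfolding qq_def q_def by (simp only: linear_cmul[OF linB] linear_add[OF linB])
      thus ?thesis unfolding Y_def W_def G_def Q_bvec_YG Q_bvec_YW by (simp add: algebra_simps)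
    qed
    have \<omega>W: "norm (lbr (\<omega> t) (W t)) <= 2 * (K1 * w1 * (KW * ?w t))" if t: "t \<in> {0..T}" for t
    proof -
      have "norm (lbr (\<omega> t) (W t)) <= 2 * (norm (\<omega> t) * norm (W t))" using norm_lbr_le[of "\<omega> t" "W t"] by simp
      also have "\<dots> <= 2 * (K1 * w1 * (KW * ?w t))"
        unfolding W_def using \<omega>b[OF t] KW K1 w1n by (intro mult_left_mono mult_mono) auto
      finally show ?thesis .
    qed
    have Q\<omega>W: "norm ((1/2) *\<^sub>R Q (bvec (lbr (\<omega> t) (W t)))) <= KQ * K1 * KW * w1 * ?w t" if t: "t \<in> {0..T}" for t
    proof -
      have "norm (Q (bvec (lbr (\<omega> t) (W t)))) <= KQ * (2 * (K1 * w1 * (KW * ?w t)))"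
        by (rule order_trans[OF KQ(2) mult_left_mono[OF \<omega>W[OF t] KQ(1)]])
      thus ?thesis by (simp add: mult_ac)
    qed
    have sb: "norm (qform u v t) <= KS * (?w t)\<^sup>2" for t
    proof -
      have "norm (qform u v t)
         <= (\<Sum>i\<in>L12. \<Sum>j\<in>L12. (?w t)\<^sup>2 * norm (Q (Sij i j)))"
      proof (rule order_trans[OF norm_sum sum_mono], rule order_trans[OF norm_sum sum_mono])
        fix i j assume ij: "i \<in> L12" "j \<in> L12"
        have "\<bar>ww u v i j t\<bar> <= ?w t * ?w t"
          unfolding abs_mult by (intro mult_mono prim_le_wl1 ij w0) auto
        thus "norm (ww u v i j t *\<^sub>R Q (Sij i j)) <= (?w t)\<^sup>2 * norm (Q (Sij i j))"
          unfolding norm_scaleR power2_eq_square by (rule mult_right_mono) simp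
      qed
      thus ?thesis unfolding KS_def sum_distrib_right by (simp only: mult.commute)
    qed
    have qqb: "norm (qq t) <= KS * (?w t)\<^sup>2 + KQ * K1 * KW * w1 * ?w t" if t: "t \<in> {0..T}" for t
    proof -
      have "norm ((1/2) *\<^sub>R qform u v t) <= KS * (?w t)\<^sup>2"
      proof -
        have "KS * (?w t)\<^sup>2 \<ge> 0" using KS by simp
        thus ?thesis using sb[of t] unfolding norm_scaleR by linarith
      qed
      thus ?thesis unfolding qq using Q\<omega>W[OF t] by (intro norm_triangle_le_diff add_mono) auto
    qed
    have yb: "norm (y t) <= 2 * (Kq * w2)" if t: "t \<in> {0..T}" for t
    proof -
      have "norm (y t) <= 2 * integral {0..T} (\<lambda>t. KS * (?w t)\<^sup>2 + KQ * K1 * KW * w1 * ?w t)"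
      proof (rule gronwall_short[where l="\<lambda>_. KH", OF _ _ dy])
        fix s assume s: "s \<in> {0..T}"
        show "norm (Q (Hmap (y s)) + qq s) <= KH * norm (y s) + (KS * (?w s)\<^sup>2 + KQ * K1 * KW * w1 * ?w s)"
          by (intro norm_triangle_le add_mono KH qqb s)
        show "0 <= KS * (?w s)\<^sup>2 + KQ * K1 * KW * w1 * ?w s" using KS KQ K1 KW w1n w0[of s] by simp
      next
        show "y 0 = 0" by (simp add: y_def \<theta>_def \<omega>_def mr' Y_def Yop_0 linear_0[OF linB])
        show "continuous_on {0..T} (\<lambda>t. KS * (?w t)\<^sup>2 + KQ * K1 * KW * w1 * ?w t)" by (intro continuous_intros cw)
        have "T <= 1 / (2 * (KH + 1))" using T by (simp add: T0_def)
        hence "T * (2 * (KH + 1)) <= 1" using KH by (simp add: pos_le_divide_eq)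
        thus "integral {0..T} (\<lambda>_. KH) <= 1/2" using T0 by (simp add: algebra_simps)
      qed (use t T0 KH in auto)
      also have "integral {0..T} (\<lambda>t. KS * (?w t)\<^sup>2 + KQ * K1 * KW * w1 * ?w t) = KS * w2 + KQ * K1 * KW * w1\<^sup>2"
        using iw iw2 by (simp add: integral_add integrable_on_mult_right w1_def w2_def power2_eq_square)
      also have "\<dots> <= KS * w2 + KQ * K1 * KW * (1 * w2)"
      proof (intro add_left_mono mult_left_mono)
        have "T * w2 <= 1 * w2" using T0 w1n by (intro mult_right_mono) auto
        thus "w1\<^sup>2 <= 1 * w2" using cs by linarith
      qed (use KQ K1 KW in auto)
      finally show ?thesis by (simp add: Kq_def algebra_simps)
    qed
    have cform: "c \<bullet> qform u v t = form u v t" for t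
      unfolding form_def by (simp only: inner_sum_right inner_scaleR_right cQ)
    have cform2: "continuous_on {0..T} (form u v)"
      unfolding form_def[abs_def] ctl_def
      by (intro continuous_intros prim_continuous) (auto simp: cu)
    have "((\<lambda>t. c \<bullet> y t - 1/2 * integral {0..t} (form u v)) has_vector_derivative
       (c \<bullet> (Q (Hmap (y t)) + qq t) - 1/2 * form u v t)) (at t within {0..T})" if t: "t \<in> {0..T}" for t
      by (intro has_vector_derivative_diff bounded_linear.has_vector_derivative[OF bounded_linear_inner_right dy[OF t]]
          bounded_linear.has_vector_derivative[OF bounded_linear_mult_right integral_has_vector_derivative[OF cform2 t]])
    hence "((\<lambda>t. c \<bullet> (Q (Hmap (y t)) + qq t) - 1/2 * form u v t) has_integral
       ((c \<bullet> y T - 1/2 * integral {0..T} (form u v)) - (c \<bullet> y 0 - 1/2 * integral {0..0} (form u v)))) {0..T}"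
      using T0 by (intro fundamental_theorem_of_calculus) auto
    hence hi: "((\<lambda>t. c \<bullet> (Q (Hmap (y t)) + qq t) - 1/2 * form u v t) has_integral
       (c \<bullet> y T - 1/2 * integral {0..T} (form u v))) {0..T}"
      by (simp add: y_def \<theta>_def \<omega>_def mr' Y_def Yop_0 linear_0[OF linB])
    \<comment> \<open>The drift term is of size \<open>w2\<close> pointwise and gains the factor
      \<open>T\<close> by integration; the bracket of \<open>\<omega>\<close> and \<open>W\<close>
      gives \<open>w1\<close> squared, which \<open>cs\<close> bounds by \<open>T * w2\<close> as
      well.\<close>
    have "norm (c \<bullet> y T - 1/2 * integral {0..T} (form u v)) <= integral {0..T} (\<lambda>t. norm c * KH * (2 * (Kq * w2)) + norm c * (KQ * K1 * KW * w1) * ?w t)"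
      unfolding integral_unique[OF hi, symmetric]
    proof (rule integral_norm_bound_integral)
      show "(\<lambda>t. c \<bullet> (Q (Hmap (y t)) + qq t) - 1/2 * form u v t) integrable_on {0..T}" using hi by blast
      show "(\<lambda>t. norm c * KH * (2 * (Kq * w2)) + norm c * (KQ * K1 * KW * w1) * ?w t) integrable_on {0..T}"
        by (intro integrable_continuous_real continuous_intros cw)
      fix t assume t: "t \<in> {0..T}"
      have "c \<bullet> (Q (Hmap (y t)) + qq t) - 1/2 * form u v t = c \<bullet> Q (Hmap (y t)) - c \<bullet> ((1/2) *\<^sub>R Q (bvec (lbr (\<omega> t) (W t))))"
        unfolding qq inner_add_right inner_diff_right inner_scaleR_right cform by simp
      also have "norm \<dots> <= norm c * (KH * norm (y t)) + norm c * (KQ * K1 * KW * w1 * ?w t)"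
      proof (intro norm_triangle_le_diff add_mono)
        show "norm (c \<bullet> Q (Hmap (y t))) <= norm c * (KH * norm (y t))"
          by (simp, rule order_trans[OF Cauchy_Schwarz_ineq2]) (intro mult_left_mono KH, simp)
        show "norm (c \<bullet> (1/2) *\<^sub>R Q (bvec (lbr (\<omega> t) (W t)))) <= norm c * (KQ * K1 * KW * w1 * ?w t)"
          unfolding real_norm_def
          by (rule order_trans[OF Cauchy_Schwarz_ineq2]) (intro mult_left_mono Q\<omega>W t, simp)
      qed
      also have "\<dots> <= norm c * (KH * (2 * (Kq * w2))) + norm c * (KQ * K1 * KW * w1 * ?w t)"
        by (intro add_right_mono mult_left_mono yb t KH) auto
      finally show "norm (c \<bullet> (Q (Hmap (y t)) + qq t) - 1/2 * form u v t) <= norm c * KH * (2 * (Kq * w2)) + norm c * (KQ * K1 * KW * w1) * ?w t"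
        by (simp add: mult.assoc)
    qed
    also have "\<dots> = norm c * KH * (2 * (Kq * w2)) * T + norm c * (KQ * K1 * KW * w1) * w1"
      using iw T0 by (subst integral_add) (auto simp: w1_def intro!: integrable_on_mult_right)
    also have "\<dots> <= (norm c * KH * 4 * Kq + norm c * KQ * K1 * KW) * (T * w2)"
    proof -
      have "(norm c * KQ * K1 * KW) * w1\<^sup>2 <= (norm c * KQ * K1 * KW) * (T * w2)" by (rule mult_left_mono[OF cs Kpos(2)])
      moreover have "(norm c * KH * 4 * Kq) * (T * w2) \<ge> 0" using Kpos(1) T0 w1n by simp
      ultimately show ?thesis by (simp add: algebra_simps power2_eq_square)
    qed
    finally have e1: "\<bar>c \<bullet> y T - 1/2 * integral {0..T} (form u v)\<bar> <= (norm c * KH * 4 * Kq + norm c * KQ * K1 * KW) * (T * w2)" by simp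
    \<comment> \<open>Undoing the correction leaves a boundary term in \<open>\<omega> T\<close> and
      \<open>Y T\<close>; this is where the primitives at the final time enter.\<close>
    have e2: "\<bar>c \<bullet> bvec (Z 2 T) - c \<bullet> y T\<bar> <= (norm c * KB * K1 * KY) * (w1 * UT u v T)"
    proof -
      have linb: "linear bvec" using bounded_linear_bvec by (rule bounded_linear.linear)
      have "c \<bullet> y T = c \<bullet> bvec (Z 2 T) + c \<bullet> ((1/2) *\<^sub>R bvec (lbr (\<omega> T) (Y T)))"
        by (simp add: y_def cQ \<theta>_def linear_add[OF linb] linear_cmul[OF linb] inner_add_right)
      hence "\<bar>c \<bullet> bvec (Z 2 T) - c \<bullet> y T\<bar> = \<bar>c \<bullet> ((1/2) *\<^sub>R bvec (lbr (\<omega> T) (Y T)))\<bar>" by simp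
      also have "\<dots> <= norm c * norm ((1/2) *\<^sub>R bvec (lbr (\<omega> T) (Y T)))" by (rule Cauchy_Schwarz_ineq2)
      also have "\<dots> <= norm c * ((1/2) * (KB * (2 * (K1 * w1) * (KY * UT u v T))))"
      proof (intro mult_left_mono)
        have "norm (bvec (lbr (\<omega> T) (Y T))) <= KB * norm (lbr (\<omega> T) (Y T))" by (rule KB)
        also have "norm (lbr (\<omega> T) (Y T)) <= 2 * norm (\<omega> T) * norm (Y T)" by (rule norm_lbr_le)
        also have "\<dots> <= 2 * (K1 * w1) * (KY * UT u v T)"
          unfolding Y_def using \<omega>b[of T] T0 KY K1 w1n by (intro mult_mono mult_left_mono) auto
        finally show "norm ((1/2) *\<^sub>R bvec (lbr (\<omega> T) (Y T))) <= (1/2) * (KB * (2 * (K1 * w1) * (KY * UT u v T)))"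
          using KB by (simp add: mult_left_mono)
      qed simp
      finally show ?thesis by (simp add: mult_ac)
    qed
    have UT0: "UT u v T \<ge> 0" unfolding UT_def by (intro sum_nonneg) auto
    have "\<bar>c \<bullet> bvec (Z 2 T) - 1/2 * integral {0..T} (form u v)\<bar>
       <= (norm c * KH * 4 * Kq + norm c * KQ * K1 * KW) * (T * w2) + (norm c * KB * K1 * KY) * (w1 * UT u v T)"
      using e1 e2 by linarith
    also have "\<dots> <= K * (T * w2) + K * (w1 * UT u v T)"
      using Kpos K1 T0 w1n UT0 by (intro add_mono mult_right_mono) (auto simp: K_def)
    finally have "\<bar>c \<bullet> bvec (Z 2 T) - 1/2 * integral {0..T} (form u v)\<bar> <= K * (T * w2 + w1 * UT u v T)"
      by (simp add: distrib_left)
    moreover have "norm (Z 1 T - Yop u v T) <= K * w1"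
    proof -
      have "K1 * w1 <= K * w1" using Kpos w1n by (intro mult_right_mono) (auto simp: K_def)
      thus ?thesis using \<omega>b[of T] T0 by (simp add: \<omega>_def)
    qed
    ultimately show ?thesis by (simp add: w1_def w2_def)
  qed
  have pos: "K \<ge> 0" "T0 > 0" using Kpos K1 KH by (auto simp: K_def T0_def)
  show ?thesis
    by (rule exI[of _ K], rule conjI, rule pos, rule exI[of _ T0], rule conjI, rule pos, intro allI impI, rule main)
qed

end

context closed_loop
begin

lemma bispan_functional:
  assumes "bounded_linear lam" "B \<in> Lie n" "n <= N" "\<And>b. nocc b = n ==> lam (Fb b 0) = (0::real)"
  shows "lam (bvec B) = 0"
  by (rule bispan_real[OF assms(2) bounded_linear_compose[OF assms(1) bounded_linear_bvec]])
    (use assms(3,4) in \<open>auto simp: Lset_def bvec_Aop\<close>)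

text \<open>By duality with the vectors \<open>Fb (adb i l) 0\<close>, which carry the primitives as
  coefficients in \<open>Yop\<close>.\<close>

lemma psi_Yop:
  assumes i: "i \<in> L12" and l: "l < k"
  shows "\<psi> i l (bvec (Yop u v t)) = prim (ctl u v i) (Suc l) t"
proof -
  have lin: "linear bvec" using bounded_linear_bvec by (rule bounded_linear.linear)
  have "bvec (Aop (adb j l')) = Fb (adb j l') 0" if "j \<in> L12" for j l'
    using that N2 nocc_adb[of j l'] by (intro bvec_Aop) auto
  hence "\<psi> i l (bvec (Yop u v t)) = (\<Sum>j\<in>L12. \<Sum>l'<k. prim (ctl u v j) (Suc l') t * \<psi> i l (Fb (adb j l') 0))"
    unfolding Yop_def
    by (simp add: linear_sum[OF lin] linear_add[OF lin] linear_cmul[OF lin] linear_sum[OF lin\<psi>] linear_add[OF lin\<psi>] linear_cmul[OF lin\<psi>] del: prim.simps)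
  also have "\<dots> = (\<Sum>j\<in>L12. \<Sum>l'<k. if l' = l then (if j = i then prim (ctl u v i) (Suc l) t else 0) else 0)"
    by (intro sum.cong refl, subst \<psi>1[OF i _ l]) (auto simp del: prim.simps)
  also have "\<dots> = prim (ctl u v i) (Suc l) t" using i l by (auto simp: sum.delta simp del: prim.simps)
  finally show ?thesis .
qed

text \<open>The loop is closed: the \<open>\<psi> i l\<close> read the primitives at the final time
  off \<open>x T\<close>, up to components of degree above \<open>r\<close> and the L1 norm of the
  \<open>k\<close>-th primitives. Inserted into \<open>quadratic_estimate\<close> this eliminates
  \<open>UT\<close>; the product of the L1 norm with itself is again bounded by
  Cauchy-Schwarz.\<close>

lemma key_estimate:
  "\<exists>K\<ge>0. \<exists>T0>0. \<exists>g0>0. \<forall>T u v x. traj f T u v x --> T <= T0 --> l1n T u v <= g0 -->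
     \<bar>c \<bullet> x T - 1/2 * integral {0..T} (form u v)\<bar>
       <= K * (l1n T u v * norm (x T) + l1n T u v ^ Suc N + T * integral {0..T} (\<lambda>t. (wl1 u v t)\<^sup>2)
          + integral {0..T} (wl1 u v) * (norm (x T) + l1n T u v ^ Suc r))"
proof -
  obtain C T1 g1 where C: "C \<ge> 0" "T1 > 0" "g1 > 0"
    "\<forall>T u v x. traj f T u v x --> T <= T1 --> l1n T u v <= g1 --> (\<exists>Z. magnus_rep C T u v x Z)"
    using magnus_representation by (elim exE conjE) (rule that)
  obtain K2 T2 where K2: "K2 \<ge> 0" "T2 > 0"
    "\<forall>T u v x C Z. traj f T u v x --> T <= T2 --> magnus_rep C T u v x Z -->
     norm (Z 1 T - Yop u v T) <= K2 * integral {0..T} (wl1 u v) \<and>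
     \<bar>c \<bullet> bvec (Z 2 T) - 1/2 * integral {0..T} (form u v)\<bar>
       <= K2 * (T * integral {0..T} (\<lambda>t. (wl1 u v t)\<^sup>2) + integral {0..T} (wl1 u v) * UT u v T)"
    using quadratic_estimate by (elim exE conjE) (rule that)
  have bl\<psi>: "bounded_linear (\<psi> i l)" for i l using lin\<psi> by (simp add: linear_conv_bounded_linear)
  obtain KB where KB: "KB \<ge> 0" "\<And>B. norm (bvec B) <= KB * norm B"
    using bounded_linear.nonneg_bounded[OF bounded_linear_bvec] by (metis mult.commute)
  have "\<exists>K\<ge>0. \<forall>i\<in>L12. \<forall>l<k. \<forall>y. \<bar>\<psi> i l y\<bar> <= K * norm y"
  proof -
    have "onorm (\<psi> i l) <= (\<Sum>i\<in>L12. \<Sum>l<k. onorm (\<psi> i l))" if "i \<in> L12" "l < k" for i l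
    proof -
      have "onorm (\<psi> i l) <= (\<Sum>l<k. onorm (\<psi> i l))"
        by (rule member_le_sum) (use that onorm_pos_le[OF bl\<psi>] in auto)
      also have "\<dots> <= (\<Sum>i\<in>L12. \<Sum>l<k. onorm (\<psi> i l))"
        by (rule member_le_sum[of i L12 "\<lambda>i. \<Sum>l<k. onorm (\<psi> i l)"]) (use that onorm_pos_le[OF bl\<psi>] in \<open>auto intro: sum_nonneg\<close>)
      finally show ?thesis .
    qed
    moreover have "\<bar>\<psi> i l y\<bar> <= onorm (\<psi> i l) * norm y" for i l y using onorm[OF bl\<psi>, of i l y] by simp
    ultimately have "\<forall>i\<in>L12. \<forall>l<k. \<forall>y. \<bar>\<psi> i l y\<bar> <= (\<Sum>i\<in>L12. \<Sum>l<k. onorm (\<psi> i l)) * norm y"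
      by (meson mult_right_mono norm_ge_zero order_trans)
    thus ?thesis using onorm_pos_le[OF bl\<psi>] by (intro exI[of _ "\<Sum>i\<in>L12. \<Sum>l<k. onorm (\<psi> i l)"]) (auto intro!: add_nonneg_nonneg sum_nonneg)
  qed
  then obtain Kp where Kp: "Kp \<ge> 0" "\<And>i l y. i \<in> L12 ==> l < k ==> \<bar>\<psi> i l y\<bar> <= Kp * norm y" by blast
  define KU where "KU = Kp * ((1 + 2 * C) + real N * (KB * C) + KB * K2)"
  have KU: "KU \<ge> 0" using Kp C KB K2 by (simp add: KU_def)
  define K3 where "K3 = norm c * C"
  define K where "K = K3 + 2 * K2 + K2 * (2 * real k * KU) * 2"
  define T0 where "T0 = min 1 (min T1 T2)"
  define g0 where "g0 = min 1 g1"
  have K3: "K3 \<ge> 0" using C by (simp add: K3_def)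
  have Kn: "K2 * (2 * real k * KU) \<ge> 0" using K2 KU by simp
  have main: "\<bar>c \<bullet> x T - 1/2 * integral {0..T} (form u v)\<bar>
       <= K * (l1n T u v * norm (x T) + l1n T u v ^ Suc N + T * integral {0..T} (\<lambda>t. (wl1 u v t)\<^sup>2)
          + integral {0..T} (wl1 u v) * (norm (x T) + l1n T u v ^ Suc r))"
    if tr: "traj f T u v x" and T: "T <= T0" and g: "l1n T u v <= g0" for T u v x
  proof -
    define \<gamma> where "\<gamma> = l1n T u v"
    define w1 where "w1 = integral {0..T} (wl1 u v)"
    define w2 where "w2 = integral {0..T} (\<lambda>t. (wl1 u v t)\<^sup>2)"
    have tr': "0 < T" "continuous_on {0..T} u" "continuous_on {0..T} v" using tr by (auto simp: traj_def)
    have Tin: "T \<in> {0..T}" using tr' by simp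
    have g': "0 <= \<gamma>" "\<gamma> <= 1" using l1n_nonneg tr' g by (auto simp: \<gamma>_def g0_def)
    have cw: "continuous_on {0..T} (wl1 u v)" using wl1_continuous tr' by blast
    have cw2: "continuous_on {0..T} (\<lambda>t. (wl1 u v t)\<^sup>2)" by (intro continuous_intros cw)
    have wn: "w1 \<ge> 0" "w2 \<ge> 0"
      unfolding w1_def w2_def
      using integrable_continuous_real[OF cw] integrable_continuous_real[OF cw2]
      by (auto intro!: integral_nonneg simp: wl1_def)
    have cs: "w1\<^sup>2 <= T * w2" unfolding w1_def w2_def by (rule cauchy_schwarz_one[OF cw tr'(1)])
    obtain Z where Z: "magnus_rep C T u v x Z" 
    proof -
      have "T <= T1" "l1n T u v <= g1" using T g by (auto simp: T0_def g0_def)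
      thus ?thesis using C(4) tr that by blast
    qed
    have ZL: "Z n T \<in> Lie n" "norm (Z n T) <= C * \<gamma> ^ n" if "n \<in> {1..N}" for n
      using Z that Tin unfolding magnus_rep_def \<gamma>_def by blast+
    define S where "S = (\<Sum>n=1..N. bvec (Z n T))"
    have SX: "norm (S - x T) <= C * (\<gamma> * norm (x T) + \<gamma> ^ Suc N)"
      using Z unfolding magnus_rep_def S_def \<gamma>_def by blast
    have q: "norm (Z 1 T - Yop u v T) <= K2 * w1"
      "\<bar>c \<bullet> bvec (Z 2 T) - 1/2 * integral {0..T} (form u v)\<bar> <= K2 * (T * w2 + w1 * UT u v T)"
      using K2(3) tr T Z unfolding w1_def w2_def T0_def by auto
    \<comment> \<open>In all degrees up to \<open>N\<close> other than two the bracket values lie in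
      \<open>V\<close>, on which \<open>c\<close> vanishes.\<close>
    have cz: "c \<bullet> bvec (Z n T) = 0" if "n \<in> {1..N}" "n \<noteq> 2" for n
      by (rule bispan_functional[OF bounded_linear_inner_right ZL(1)]) (use that V1 cV in auto)
    have "c \<bullet> S = (\<Sum>n\<in>{1..N}. if n = 2 then c \<bullet> bvec (Z 2 T) else 0)"
      unfolding S_def inner_sum_right by (intro sum.cong refl) (use cz in auto)
    hence cS: "c \<bullet> S = c \<bullet> bvec (Z 2 T)" using N2 by (simp add: sum.delta)
    have e1: "\<bar>c \<bullet> x T - c \<bullet> bvec (Z 2 T)\<bar> <= K3 * (\<gamma> * norm (x T) + \<gamma> ^ Suc N)"
    proof -
      have "\<bar>c \<bullet> (S - x T)\<bar> <= norm c * norm (S - x T)" by (rule Cauchy_Schwarz_ineq2)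
      also have "\<dots> <= norm c * (C * (\<gamma> * norm (x T) + \<gamma> ^ Suc N))" by (intro mult_left_mono SX) auto
      finally show ?thesis unfolding inner_diff_right cS K3_def by (simp add: mult.assoc abs_minus_commute)
    qed
    have gN: "\<gamma> ^ Suc N <= \<gamma> ^ Suc r" using g' rN by (intro power_decreasing) auto
    have Sb: "norm S <= (1 + 2 * C) * (norm (x T) + \<gamma> ^ Suc r)"
    proof -
      have "norm S <= norm (x T) + norm (S - x T)" using norm_triangle_ineq[of "x T" "S - x T"] by simp
      also have "\<dots> <= norm (x T) + C * (1 * norm (x T) + \<gamma> ^ Suc r)"
        by (intro add_left_mono order_trans[OF SX] mult_left_mono add_mono mult_right_mono gN g' C) auto
      also have "\<dots> <= (1 + 2 * C) * (norm (x T) + \<gamma> ^ Suc r)"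
        using C g' by (simp add: algebra_simps add_increasing)
      finally show ?thesis .
    qed
    have U: "\<bar>prim (ctl u v i) (Suc l) T\<bar> <= KU * (norm (x T) + \<gamma> ^ Suc r + w1)" if il: "i \<in> L12" "l < k" for i l
    proof -
      have lb: "linear bvec" using bounded_linear_bvec by (rule bounded_linear.linear)
      have "{1..N} = insert 1 {2..N}" using N2 by auto
      \<comment> \<open>The component that contains the primitives is the endpoint sum minus the
        higher components, and the degrees \<open>2..r\<close> among these are invisible to
        \<open>\<psi> i l\<close>.\<close>
      hence "bvec (Z 1 T) = S - (\<Sum>n=2..N. bvec (Z n T))" by (simp add: S_def)
      hence "\<psi> i l (bvec (Yop u v T)) = \<psi> i l S - (\<Sum>n=2..N. \<psi> i l (bvec (Z n T))) - \<psi> i l (bvec (Z 1 T - Yop u v T))"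
        by (simp add: linear_diff[OF lb] linear_diff[OF lin\<psi>] linear_sum[OF lin\<psi>])
      hence "\<bar>prim (ctl u v i) (Suc l) T\<bar> <= \<bar>\<psi> i l S\<bar> + \<bar>\<Sum>n=2..N. \<psi> i l (bvec (Z n T))\<bar> + \<bar>\<psi> i l (bvec (Z 1 T - Yop u v T))\<bar>"
        unfolding psi_Yop[OF il] by linarith
      also have "\<dots> <= Kp * ((1 + 2 * C) * (norm (x T) + \<gamma> ^ Suc r)) + real N * (Kp * (KB * (C * \<gamma> ^ Suc r))) + Kp * (KB * (K2 * w1))"
      proof (intro add_mono)
        show "\<bar>\<psi> i l S\<bar> <= Kp * ((1 + 2 * C) * (norm (x T) + \<gamma> ^ Suc r))"
          by (rule order_trans[OF Kp(2)[OF il] mult_left_mono[OF Sb Kp(1)]])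
        show "\<bar>\<psi> i l (bvec (Z 1 T - Yop u v T))\<bar> <= Kp * (KB * (K2 * w1))"
          by (intro order_trans[OF Kp(2)[OF il]] mult_left_mono Kp order_trans[OF KB(2)] q KB)
        have "\<bar>\<psi> i l (bvec (Z n T))\<bar> <= Kp * (KB * (C * \<gamma> ^ Suc r))" if n: "n \<in> {2..N}" for n
        proof (cases "n <= r")
          case True
          have "\<psi> i l (bvec (Z n T)) = 0"
            by (rule bispan_functional[OF bl\<psi> ZL(1)]) (use n True \<psi>2 in auto)
          thus ?thesis using Kp KB C g' by simp
        next
          case False
          have "\<gamma> ^ n <= \<gamma> ^ Suc r" using False g' by (intro power_decreasing) auto
          hence "norm (Z n T) <= C * \<gamma> ^ Suc r"
            using ZL(2)[of n] n mult_left_mono[OF _ C(1), of "\<gamma> ^ n" "\<gamma> ^ Suc r"] by (auto simp del: power_Suc)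
          thus ?thesis
            by (intro order_trans[OF Kp(2)[OF il]] mult_left_mono Kp order_trans[OF KB(2)] KB)
        qed
        hence "\<bar>\<Sum>n=2..N. \<psi> i l (bvec (Z n T))\<bar> <= (\<Sum>n=2..N. Kp * (KB * (C * \<gamma> ^ Suc r)))"
          by (intro order_trans[OF sum_abs] sum_mono)
        also have "\<dots> <= real N * (Kp * (KB * (C * \<gamma> ^ Suc r)))"
          using Kp KB C g' by (simp add: mult_right_mono)
        finally show "\<bar>\<Sum>n=2..N. \<psi> i l (bvec (Z n T))\<bar> <= real N * (Kp * (KB * (C * \<gamma> ^ Suc r)))" .
      qed
      also have "\<dots> = Kp * (1 + 2 * C) * (norm (x T) + \<gamma> ^ Suc r) + Kp * (real N * (KB * C)) * \<gamma> ^ Suc r + Kp * (KB * K2) * w1"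
        by (simp only: mult_ac)
      also have "\<dots> <= Kp * (1 + 2 * C) * (norm (x T) + \<gamma> ^ Suc r + w1) + Kp * (real N * (KB * C)) * (norm (x T) + \<gamma> ^ Suc r + w1)
          + Kp * (KB * K2) * (norm (x T) + \<gamma> ^ Suc r + w1)"
      proof -
        have "norm (x T) + \<gamma> ^ Suc r <= norm (x T) + \<gamma> ^ Suc r + w1" "\<gamma> ^ Suc r <= norm (x T) + \<gamma> ^ Suc r + w1"
          "w1 <= norm (x T) + \<gamma> ^ Suc r + w1" using g' wn by auto
        moreover have "Kp * (1 + 2 * C) \<ge> 0" "Kp * (real N * (KB * C)) \<ge> 0" "Kp * (KB * K2) \<ge> 0"
          using Kp KB C K2 by simp_all
        ultimately show ?thesis by (meson add_mono mult_left_mono)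
      qed
      also have "\<dots> = KU * (norm (x T) + \<gamma> ^ Suc r + w1)" by (simp only: KU_def distrib_right distrib_left)
      finally show ?thesis .
    qed
    have UTb: "UT u v T <= 2 * real k * KU * (norm (x T) + \<gamma> ^ Suc r + w1)"
    proof -
      have "UT u v T <= (\<Sum>i\<in>L12. \<Sum>l<k. KU * (norm (x T) + \<gamma> ^ Suc r + w1))"
        unfolding UT_def by (intro sum_mono U) auto
      thus ?thesis by simp
    qed
    have "w1 * UT u v T <= w1 * (2 * real k * KU * (norm (x T) + \<gamma> ^ Suc r + w1))"
      by (rule mult_left_mono[OF UTb wn(1)])
    also have "\<dots> = 2 * real k * KU * (w1 * (norm (x T) + \<gamma> ^ Suc r)) + 2 * real k * KU * w1\<^sup>2"
      by (simp add: power2_eq_square algebra_simps)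
    also have "\<dots> <= 2 * real k * KU * (w1 * (norm (x T) + \<gamma> ^ Suc r)) + 2 * real k * KU * (T * w2)"
      using cs KU by (intro add_left_mono mult_left_mono) auto
    also have "\<dots> = (2 * real k * KU) * (w1 * (norm (x T) + \<gamma> ^ Suc r) + T * w2)" by (simp only: distrib_left)
    finally have "w1 * UT u v T <= (2 * real k * KU) * (w1 * (norm (x T) + \<gamma> ^ Suc r) + T * w2)" .
    from mult_left_mono[OF this K2(1)]
    have UT': "K2 * (w1 * UT u v T) <= K2 * (2 * real k * KU) * (w1 * (norm (x T) + \<gamma> ^ Suc r) + T * w2)"
      by (simp only: mult.assoc)
    let ?A = "\<gamma> * norm (x T) + \<gamma> ^ Suc N" and ?B = "T * w2" and ?D = "w1 * (norm (x T) + \<gamma> ^ Suc r)"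
    have nn: "?A \<ge> 0" "?B \<ge> 0" "?D \<ge> 0" using g' wn tr' by auto
    have "\<bar>c \<bullet> x T - 1/2 * integral {0..T} (form u v)\<bar> <= K3 * ?A + K2 * ?B + K2 * (w1 * UT u v T)"
      using e1 q(2) by (simp add: distrib_left)
    also have "\<dots> <= K3 * ?A + K2 * ?B + K2 * (2 * real k * KU) * (?D + ?B)" using UT' by simp
    also have "\<dots> <= K * ?A + K * ?B + K * ?D"
    proof -
      have "K3 * ?A <= K * ?A" using nn K2 Kn by (intro mult_right_mono) (auto simp: K_def)
      moreover have "K2 * (2 * real k * KU) * ?D <= K * ?D" using nn K2 K3 Kn by (intro mult_right_mono) (auto simp: K_def)
      moreover have "(K2 + K2 * (2 * real k * KU)) * ?B <= K * ?B" using nn K2 K3 Kn by (intro mult_right_mono) (auto simp: K_def)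
      ultimately show ?thesis by (simp only: distrib_left distrib_right)
    qed
    finally show ?thesis unfolding \<gamma>_def[symmetric] w1_def[symmetric] w2_def[symmetric] by (simp only: distrib_left add.assoc)
  qed
  have pos: "K \<ge> 0" "T0 > 0" "g0 > 0" using K3 K2 Kn C by (auto simp: K_def T0_def g0_def)
  show ?thesis
    by (rule exI[of _ K], rule conjI, rule pos, rule exI[of _ T0], rule conjI, rule pos,
        rule exI[of _ g0], rule conjI, rule pos, intro allI impI, rule main)
qed

end

section \<open>Sobolev functions on an interval\<close>

primrec ndiff :: "nat => (real => real) => bool" where
  "ndiff 0 g = True"
| "ndiff (Suc n) g = (\<exists>g'. (\<forall>x. (g has_real_derivative g' x) (at x)) \<and> ndiff n g')"

lemma ndiff_SucI: "(\<And>x. (g has_real_derivative g' x) (at x)) ==> ndiff n g' ==> ndiff (Suc n) g"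
  by (subst ndiff.simps) (rule exI[of _ g'], simp)

lemma ndiff_Suc_D: "ndiff (Suc n) g ==> ndiff n g"
proof (induction n arbitrary: g)
  case (Suc n)
  then obtain g' where "\<forall>x. (g has_real_derivative g' x) (at x)" "ndiff (Suc n) g'" by (subst (asm) ndiff.simps) blast
  with Suc.IH[of g'] show ?case by (subst ndiff.simps) blast
qed simp

lemma ndiff_const [simp]: "ndiff n (\<lambda>x. c)"
proof (induction n arbitrary: c)
  case (Suc n)
  have "\<forall>x. ((\<lambda>x. c) has_real_derivative 0) (at x)" by simp
  with Suc[of 0] show ?case by (subst ndiff.simps) (rule exI[of _ "\<lambda>x. 0"], simp)
qed simp

lemma ndiff_ident [simp]: "ndiff n (\<lambda>x. x)"
proof (cases n)
  case (Suc n')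
  have "\<forall>x. ((\<lambda>x::real. x) has_real_derivative 1) (at x)" by simp
  thus ?thesis unfolding Suc by (subst ndiff.simps) (rule exI[of _ "\<lambda>x. 1"], simp)
qed simp

lemma ndiff_add: "ndiff n f ==> ndiff n g ==> ndiff n (\<lambda>x. f x + g x)"
proof (induction n arbitrary: f g)
  case (Suc n)
  then obtain f' g' where "\<forall>x. (f has_real_derivative f' x) (at x)" "ndiff n f'"
    "\<forall>x. (g has_real_derivative g' x) (at x)" "ndiff n g'" by auto
  with Suc.IH[of f' g'] show ?case
    by (subst ndiff.simps) (rule exI[of _ "\<lambda>x. f' x + g' x"], auto intro!: derivative_intros)
qed simp

lemma ndiff_mult: "ndiff n f ==> ndiff n g ==> ndiff n (\<lambda>x. f x * g x)"
proof (induction n arbitrary: f g)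
  case (Suc n)
  from Suc.prems obtain f' g' where d: "\<forall>x. (f has_real_derivative f' x) (at x)" "ndiff n f'"
    "\<forall>x. (g has_real_derivative g' x) (at x)" "ndiff n g'" by auto
  have "ndiff n f" "ndiff n g" using Suc.prems by (auto simp del: ndiff.simps dest: ndiff_Suc_D)
  hence "ndiff n (\<lambda>x. f' x * g x + f x * g' x)" using d Suc.IH by (intro ndiff_add) auto
  moreover have "((\<lambda>x. f x * g x) has_real_derivative f' x * g x + f x * g' x) (at x)" for x
    using d by (auto intro!: derivative_eq_intros)
  ultimately show ?case by (intro ndiff_SucI)
qed simp

lemma ndiff_affine: "ndiff n g ==> ndiff n (\<lambda>x. g (a * x + b))"
proof (induction n arbitrary: g)
  case (Suc n)
  then obtain g' where g: "\<forall>x. (g has_real_derivative g' x) (at x)" "ndiff n g'" by auto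
  have "((\<lambda>x. g (a * x + b)) has_real_derivative g' (a * x + b) * a) (at x)" for x
    by (rule DERIV_chain'[where f="\<lambda>x. a * x + b" and g=g]) (use g(1) in \<open>auto intro!: derivative_eq_intros\<close>)
  moreover have "ndiff n (\<lambda>x. g' (a * x + b) * a)"
    using ndiff_mult[OF Suc.IH[OF g(2)] ndiff_const] .
  ultimately show ?case by (intro ndiff_SucI)
qed simp

lemma ndiff_diff: "ndiff n f ==> ndiff n g ==> ndiff n (\<lambda>x. f x - g x)"
  using ndiff_add[OF _ ndiff_mult[OF ndiff_const[of n "-1"], of g], of f] by simp

lemma ndiff_inverse: "ndiff n g ==> (\<And>x. g x \<noteq> 0) ==> ndiff n (\<lambda>x. inverse (g x))"
proof (induction n arbitrary: g)
  case (Suc n)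
  then obtain g' where g: "\<forall>x. (g has_real_derivative g' x) (at x)" "ndiff n g'" by auto
  have "((\<lambda>x. inverse (g x)) has_real_derivative (- 1) * (g' x * (inverse (g x) * inverse (g x)))) (at x)" for x
    using g(1) Suc.prems(2) by (auto intro!: derivative_eq_intros)
  moreover have "ndiff n (\<lambda>x. (- 1) * (g' x * (inverse (g x) * inverse (g x))))"
    by (intro ndiff_mult ndiff_const g Suc.IH Suc.prems ndiff_Suc_D[OF Suc.prems(1)])
  ultimately show ?case by (intro ndiff_SucI)
qed simp

lemma ndiff_deriv: "ndiff (Suc n) g ==> ndiff n (deriv g)"
proof -
  assume "ndiff (Suc n) g"
  then obtain g' where g: "\<forall>x. (g has_real_derivative g' x) (at x)" "ndiff n g'" by auto
  hence "deriv g = g'" by (auto simp: fun_eq_iff DERIV_imp_deriv)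
  with g show ?thesis by simp
qed

lemma ndiff_funpow_deriv: "(\<And>n. ndiff n g) ==> (deriv ^^ j) g differentiable_on UNIV"
proof -
  assume a: "\<And>n. ndiff n g"
  have "ndiff n ((deriv ^^ j) g)" for n by (induction j arbitrary: n) (simp_all add: a ndiff_deriv del: ndiff.simps)
  from this[of 1] show ?thesis by (auto simp: differentiable_on_def real_differentiable_def)
qed

lemma poly_div_exp_tendsto_0: "((\<lambda>z::real. poly q z / exp z) \<longlongrightarrow> 0) at_top"
proof -
  have "((\<lambda>z::real. \<Sum>i\<le>degree q. coeff q i * (z ^ i / exp z)) \<longlongrightarrow> (\<Sum>i\<le>degree q. coeff q i * 0)) at_top"
    by (intro tendsto_sum tendsto_mult tendsto_const tendsto_power_div_exp_0)
  thus ?thesis by (simp add: poly_altdef sum_divide_distrib)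
qed

text \<open>The functions \<open>q (1/x) * exp (-1/x)\<close> with polynomial \<open>q\<close> are
  closed under differentiation, which replaces \<open>q\<close> by \<open>y^2 (q - q')\<close>.
  Smoothness across \<open>0\<close> is thereby one computation for all orders.\<close>

definition flat_exp :: "real poly => real => real" where
  "flat_exp q x = (if x > 0 then poly q (1 / x) * exp (- (1 / x)) else 0)"

lemma flat_exp_deriv:
  "(flat_exp q has_real_derivative flat_exp (monom 1 2 * (q - pderiv q)) x) (at x)"
proof -
  consider "x > 0" | "x < 0" | "x = 0" by linarith
  thus ?thesis
  proof cases
    case 1
    have "((\<lambda>x. poly q (1 / x) * exp (- (1 / x))) has_real_derivative flat_exp (monom 1 2 * (q - pderiv q)) x) (at x)"
      using 1 by (auto intro!: derivative_eq_intros DERIV_chain'[where g="poly q" and f="\<lambda>x. 1/x"] poly_DERIV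
          simp: flat_exp_def poly_monom field_simps power2_eq_square)
    thus ?thesis
      by (rule has_field_derivative_transform_within_open[where S="{0<..}"]) (use 1 in \<open>auto simp: flat_exp_def\<close>)
  next
    case 2
    have "((\<lambda>x. 0) has_real_derivative flat_exp (monom 1 2 * (q - pderiv q)) x) (at x)" using 2 by (simp add: flat_exp_def)
    thus ?thesis
      by (rule has_field_derivative_transform_within_open[where S="{..<0}"]) (use 2 in \<open>auto simp: flat_exp_def\<close>)
  next
    case 3
    have r: "((\<lambda>h. flat_exp q h / h) \<longlongrightarrow> 0) (at_right 0)"
    proof -
      have "((\<lambda>z. flat_exp q (inverse z) / inverse z) \<longlongrightarrow> 0) at_top"
      proof (rule Lim_transform_eventually[OF poly_div_exp_tendsto_0[of "pCons 0 q"]])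
        show "\<forall>\<^sub>F z in at_top. poly (pCons 0 q) z / exp z = flat_exp q (inverse z) / inverse z"
          using eventually_gt_at_top[of 0] by eventually_elim (simp add: flat_exp_def exp_minus field_simps)
      qed
      thus ?thesis by (subst filterlim_at_right_to_top)
    qed
    have l: "((\<lambda>h. flat_exp q h / h) \<longlongrightarrow> 0) (at_left 0)"
      by (rule Lim_transform_eventually[OF tendsto_const])
        (auto simp: eventually_at_filter flat_exp_def)
    show ?thesis using filterlim_split_at[OF l r] 3 by (simp add: DERIV_def flat_exp_def)
  qed
qed

lemma ndiff_flat_exp: "ndiff n (flat_exp q)"
  by (induction n arbitrary: q) (auto intro: flat_exp_deriv)

text \<open>A smooth function that agrees with the positive part up to a bounded error; its rescalings
  approximate piecewise linear functions, the rescalings of its derivative step functions.\<close>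

lemma smooth_positive_part:
  "\<exists>P P' B. (\<forall>x. (P has_real_derivative P' x) (at x)) \<and> (\<forall>n. ndiff n P) \<and> (\<forall>n. ndiff n P') \<and>
     (\<forall>x\<le>0. P x = 0 \<and> P' x = 0) \<and> (\<forall>x\<ge>1. P x = x \<and> P' x = 1) \<and>
     (\<forall>x. \<bar>P x - max 0 x\<bar> <= 1) \<and> (\<forall>x. \<bar>P' x\<bar> <= (B::real))"
proof -
  define e where "e = flat_exp 1"
  have e: "ndiff n e" for n unfolding e_def by (rule ndiff_flat_exp)
  have e0: "e x \<ge> 0" "e x > 0 \<longleftrightarrow> x > 0" "x <= 0 ==> e x = 0" for x by (auto simp: e_def flat_exp_def)
  \<comment> \<open>\<open>x\<close> and \<open>1 - x\<close> are never both nonpositive, so the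
    denominator of the smooth step \<open>S\<close> is positive.\<close>
  define d where "d x = e x + e (1 - x)" for x
  have d: "d x > 0" for x using e0(1)[of x] e0(1)[of "1 - x"] e0(2)[of x] e0(2)[of "1 - x"] unfolding d_def by linarith
  define S where "S x = e x * inverse (d x)" for x
  have S: "ndiff n S" for n
    unfolding S_def d_def
    by (intro ndiff_mult ndiff_inverse ndiff_add e)
      (use ndiff_affine[OF e, of n "-1" 1] less_imp_neq[OF d, symmetric] in \<open>auto simp: d_def\<close>)
  have S0: "x <= 0 ==> S x = 0" for x by (simp add: S_def e0)
  have S1: "x \<ge> 1 ==> S x = 1" for x using e0(2)[of x] e0(3)[of "1 - x"] by (simp add: S_def d_def)
  have S01: "0 <= S x" "S x <= 1" for x
    using d[of x] e0(1)[of x] e0(1)[of "1-x"] by (simp_all add: S_def d_def field_simps)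
  define P where "P x = x * S x" for x
  have P: "ndiff n P" for n unfolding P_def by (intro ndiff_mult S) simp
  obtain P1 where "\<And>x. (P has_real_derivative P1 x) (at x)" using P[of 1] by auto
  hence PD: "(P has_real_derivative deriv P x) (at x)" for x by (metis DERIV_imp_deriv)
  have Pd: "ndiff n (deriv P)" for n by (rule ndiff_deriv[OF P])
  have c: "continuous_on A (deriv P)" for A
  proof -
    have "\<forall>x. isCont (deriv P) x" using Pd[of 1] by (auto intro: DERIV_isCont)
    thus ?thesis by (simp add: continuous_at_imp_continuous_on)
  qed
  have l: "deriv P x = 0" if "x < 0" for x
  proof -
    have "((\<lambda>x. 0) has_real_derivative deriv P x) (at x)"
      by (rule has_field_derivative_transform_within_open[OF PD, where S="{..<0}"]) (use that in \<open>auto simp: P_def S0\<close>)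
    thus ?thesis using DERIV_unique DERIV_const by blast
  qed
  have r: "deriv P x = 1" if "x > 1" for x
  proof -
    have "((\<lambda>x. x) has_real_derivative deriv P x) (at x)"
      by (rule has_field_derivative_transform_within_open[OF PD, where S="{1<..}"]) (use that in \<open>auto simp: P_def S1\<close>)
    thus ?thesis using DERIV_unique DERIV_ident by blast
  qed
  \<comment> \<open>At the two junction points the value of the derivative follows by continuity
    from the open half-lines.\<close>
  have l0: "deriv P x = 0" if "x <= 0" for x
    by (rule continuous_constant_on_closure[of "{..<0}" "deriv P" 0 x]) (use that l c in auto)
  have r1: "deriv P x = 1" if "x \<ge> 1" for x
    by (rule continuous_constant_on_closure[of "{1<..}" "deriv P" 1 x]) (use that r c in auto)
  have "compact (deriv P ` {0..1})" by (intro compact_continuous_image c) auto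
  then obtain B where B: "\<And>x. x \<in> {0..1} ==> \<bar>deriv P x\<bar> <= B"
    using compact_imp_bounded bounded_iff by (metis imageI real_norm_def)
  have "\<bar>deriv P x\<bar> <= max B 1" for x
    by (cases "x <= 0"; cases "x \<ge> 1") (use l0 r1 B[of x] in \<open>auto simp: max_def\<close>)
  moreover have "\<bar>P x - max 0 x\<bar> <= 1" for x
  proof -
    consider "x <= 0" | "x \<ge> 1" | "0 < x" "x < 1" by linarith
    thus ?thesis
    proof cases
      case 3
      have "0 <= x * S x" "x * S x <= x * 1" using 3 S01[of x] by (auto intro: mult_left_mono simp del: mult_1_right)
      thus ?thesis using 3 unfolding P_def by simp
    qed (auto simp: P_def S0 S1)
  qed
  ultimately have "(\<forall>x. (P has_real_derivative deriv P x) (at x)) \<and> (\<forall>n. ndiff n P) \<and> (\<forall>n. ndiff n (deriv P)) \<and>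
     (\<forall>x\<le>0. P x = 0 \<and> deriv P x = 0) \<and> (\<forall>x\<ge>1. P x = x \<and> deriv P x = 1) \<and>
     (\<forall>x. \<bar>P x - max 0 x\<bar> <= 1) \<and> (\<forall>x. \<bar>deriv P x\<bar> <= max B 1)"
    using PD P Pd l0 r1 by (auto simp: P_def S0 S1)
  thus ?thesis by blast
qed

lemma test_functionI:
  assumes "\<And>n. ndiff n \<phi>" "0 < a" "b < T" "\<And>s. s \<notin> {a..b} ==> \<phi> s = 0"
  shows "test_function T \<phi>"
  unfolding test_function_def
  using assms ndiff_funpow_deriv[OF assms(1)] by (intro conjI allI exI[of _ "{a..b}"]) auto

text \<open>Henstock's lemma compares \<open>g x\<close> times the length of a cell with the
  integral over that cell. Here all these integrals vanish, so the Riemann sums of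
  \<open>\<bar>g x\<bar>\<close> over fine divisions tend to \<open>0\<close>. This avoids
  differentiating a primitive almost everywhere.\<close>

lemma interval_integral_zero_imp_AE:
  fixes g :: "real => real"
  assumes g: "g absolutely_integrable_on {a..b}"
    and z: "\<And>c d. a <= c ==> c <= d ==> d <= b ==> integral {c..d} g = 0"
  shows "AE x in lebesgue_on {a..b}. g x = 0"
proof -
  have gi: "g integrable_on cbox a b" "(\<lambda>x. \<bar>g x\<bar>) integrable_on cbox a b"
    using g by (auto simp: absolutely_integrable_on_def)
  have "((\<lambda>x. \<bar>g x\<bar>) has_integral 0) (cbox a b)"
    unfolding has_integral
  proof (intro allI impI)
    fix e :: real assume e: "e > 0"
    obtain \<gamma> where \<gamma>: "gauge \<gamma>"
      "\<And>p. p tagged_partial_division_of (cbox a b) ==> \<gamma> fine p ==>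
             sum (\<lambda>(x,k). norm (measure lborel k *\<^sub>R g x - integral k g)) p < e"
      by (rule Henstock_lemma[OF gi(1) e], rule that, assumption, assumption)
    have "norm ((\<Sum>(x,k)\<in>\<D>. measure lborel k *\<^sub>R \<bar>g x\<bar>) - 0) < e" if D: "\<D> tagged_division_of cbox a b" "\<gamma> fine \<D>" for \<D>
    proof -
      have "measure lborel k *\<^sub>R \<bar>g x\<bar> = norm (measure lborel k *\<^sub>R g x - integral k g)" if xk: "(x, k) \<in> \<D>" for x k
      proof -
        obtain c d where k: "k = cbox c d" "k \<subseteq> cbox a b" "x \<in> k"
          using D(1) xk by (metis tagged_division_ofD(2,3,4))
        hence "integral k g = 0" using z[of c d] by auto
        thus ?thesis by (simp add: abs_mult)
      qed
      hence "(\<Sum>(x,k)\<in>\<D>. measure lborel k *\<^sub>R \<bar>g x\<bar>) = sum (\<lambda>(x,k). norm (measure lborel k *\<^sub>R g x - integral k g)) \<D>"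
        by (intro sum.cong refl) auto
      moreover have "\<dots> < e" by (rule \<gamma>(2)) (use D in \<open>auto simp: tagged_division_of_def\<close>)
      moreover have "(\<Sum>(x,k)\<in>\<D>. measure lborel k *\<^sub>R \<bar>g x\<bar>) \<ge> 0" by (intro sum_nonneg) auto
      ultimately show ?thesis by simp
    qed
    thus "\<exists>\<gamma>. gauge \<gamma> \<and> (\<forall>\<D>. \<D> tagged_division_of cbox a b \<and> \<gamma> fine \<D> -->
        norm ((\<Sum>(x,k)\<in>\<D>. measure lborel k *\<^sub>R \<bar>g x\<bar>) - 0) < e)" using \<gamma>(1) by blast
  qed
  hence "integral {a..b} (\<lambda>x. \<bar>g x\<bar>) = 0" by (simp add: integral_unique)
  moreover have i: "integrable (lebesgue_on {a..b}) (\<lambda>x. \<bar>g x\<bar>)"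
    using absolutely_integrable_imp_integrable[OF g] by auto
  ultimately have "integral\<^sup>L (lebesgue_on {a..b}) (\<lambda>x. \<bar>g x\<bar>) = 0"
    using lebesgue_integral_eq_integral[OF i] by simp
  hence "AE x in lebesgue_on {a..b}. \<bar>g x\<bar> = 0" using integral_nonneg_eq_0_iff_AE[OF i] by simp
  thus ?thesis by simp
qed

text \<open>Countably many compact intervals exhaust the open one.\<close>

lemma AE_on_Ioo:
  assumes "\<And>a b. 0 < a ==> a < b ==> b < T ==> AE x in lebesgue_on {a..b}. Q x"
  shows "AE x in I_leb T. Q x"
proof -
  have Icc: "AE x in lebesgue. x \<in> {inverse (real (Suc n))..T - inverse (real (Suc n))} --> Q x" for n
  proof (cases "inverse (real (Suc n)) < T - inverse (real (Suc n))")
    case True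
    thus ?thesis using assms[of "inverse (real (Suc n))" "T - inverse (real (Suc n))"]
      by (simp add: AE_restrict_space_iff)
  next
    case False
    have "AE x in lebesgue. x \<noteq> inverse (real (Suc n))"
      using AE_not_in[of "{inverse (real (Suc n))}" lebesgue] by simp
    thus ?thesis by eventually_elim (use False in auto)
  qed
  have "AE x in lebesgue. \<forall>n. x \<in> {inverse (real (Suc n))..T - inverse (real (Suc n))} --> Q x"
    unfolding AE_all_countable using Icc by blast
  hence "AE x in lebesgue. x \<in> {0<..<T} --> Q x"
  proof eventually_elim
    case (elim x)
    show ?case
    proof
      assume "x \<in> {0<..<T}"
      hence "0 < min x (T - x)" by simp
      then obtain n where "inverse (real (Suc n)) < min x (T - x)" using reals_Archimedean by blast
      thus "Q x" using elim[rule_format, of n] by auto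
    qed
  qed
  thus ?thesis by (simp add: AE_restrict_space_iff)
qed

lemma mult_continuous_absolutely_integrable:
  fixes g \<phi> :: "real => real"
  assumes "g absolutely_integrable_on {a..b}" "continuous_on {a..b} \<phi>"
  shows "(\<lambda>x. g x * \<phi> x) absolutely_integrable_on {a..b}"
  using absolutely_integrable_bounded_measurable_product_real[OF _ _ _ assms(1), of \<phi>]
    continuous_imp_measurable_on_sets_lebesgue[OF assms(2)] compact_imp_bounded[OF compact_continuous_image[OF assms(2)]]
  by (simp add: mult.commute)

lemma LINT_support:
  fixes h :: "real => real"
  assumes "0 < a" "b < T" "\<And>x. x \<notin> {a..b} ==> h x = 0" "h absolutely_integrable_on {a..b}"
  shows "(LINT x|I_leb T. h x) = integral {a..b} h"
proof -
  have "(LINT x|I_leb T. h x) = (LINT x|lebesgue. indicator {0<..<T} x *\<^sub>R h x)" by (simp add: integral_restrict_space)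
  also have "\<dots> = (LINT x|lebesgue. indicator {a..b} x *\<^sub>R h x)"
    by (intro Bochner_Integration.integral_cong refl) (use assms in \<open>auto simp: indicator_def\<close>)
  also have "\<dots> = integral {a..b} h" using set_lebesgue_integral_eq_integral(2)[OF assms(4)] by (simp add: set_lebesgue_integral_def)
  finally show ?thesis .
qed

lemma integrable_Icc_if:
  fixes g :: "real => real"
  assumes "integrable (I_leb T) g"
  shows "g absolutely_integrable_on {0..T}"
  unfolding absolutely_integrable_on_Icc_iff_Ioo
  using assms by (simp add: integrable_restrict_space set_integrable_def)

lemma LINT_eq_integral:
  fixes g :: "real => 'b::euclidean_space"
  assumes "integrable (I_leb T) g"
  shows "(LINT x|I_leb T. g x) = integral {0..T} g"
  using lebesgue_integral_eq_integral[OF assms] by (simp add: integral_open_interval_real)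

lemma integral_Icc_sub: "F integrable_on {0..T} ==> 0 <= x ==> y <= T ==> F integrable_on {x..y}"
  for F :: "real => real" using integrable_on_subinterval[of F "{0..T}" x y] by auto

lemma integral_Icc_diff:
  fixes F :: "real => real"
  assumes "F integrable_on {0..T}" "0 <= x" "x <= y" "y <= T"
  shows "integral {0..y} F - integral {0..x} F = integral {x..y} F"
  using Henstock_Kurzweil_Integration.integral_combine[of 0 x y F] integral_Icc_sub[OF assms(1), of 0 y] assms by simp

text \<open>The primitive \<open>D\<close> of a merely integrable \<open>h\<close> need not be differentiable, but
  \<open>t D(t) - \<integral>\<^sub>0\<^sup>t s h(s) ds\<close> is, with derivative \<open>D\<close>; this replaces integration by parts.\<close>

lemma integral_primitive:
  fixes h :: "real => real"
  assumes h: "h absolutely_integrable_on {0..T}" and t: "t \<in> {0..T}"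
  shows "integral {0..t} (\<lambda>x. integral {0..x} h) = t * integral {0..t} h - integral {0..t} (\<lambda>s. h s * s)"
proof -
  define D where "D x = integral {0..x} h" for x
  define N where "N x = integral {0..x} (\<lambda>s. \<bar>h s\<bar>)" for x
  define M where "M x = integral {0..x} (\<lambda>s. h s * s)" for x
  define \<Theta> where "\<Theta> x = x * D x - M x" for x
  have hs: "(\<lambda>s. h s * s) absolutely_integrable_on {0..T}" by (intro mult_continuous_absolutely_integrable h continuous_intros)
  have int: "h integrable_on {0..T}" "(\<lambda>s. \<bar>h s\<bar>) integrable_on {0..T}" "(\<lambda>s. h s * s) integrable_on {0..T}"
    using h hs by (auto simp: absolutely_integrable_on_def)
  note sub = integral_Icc_sub and diff = integral_Icc_diff
  \<comment> \<open>On \<open>{x..y}\<close> the factor \<open>s\<close> differs from either end by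
    at most \<open>y - x\<close>, and the mass of \<open>\<bar>h\<bar>\<close> on this interval is
    small by continuity of \<open>N\<close>; the remainder is thus \<open>o(y - x)\<close>.\<close>
  have est: "\<bar>z * (D y - D x) - (M y - M x)\<bar> <= (y - x) * (N y - N x)" if xy: "0 <= x" "x <= y" "y <= T" "z \<in> {x, y}" for x y z
  proof -
    have i: "(\<lambda>s. z * h s) integrable_on {x..y}" "(\<lambda>s. h s * s) integrable_on {x..y}" "(\<lambda>s. (y - x) * \<bar>h s\<bar>) integrable_on {x..y}"
      using sub[OF int(1) xy(1,3)] sub[OF int(2) xy(1,3)] sub[OF int(3) xy(1,3)] by (auto intro: integrable_on_mult_right)
    have "z * (D y - D x) - (M y - M x) = integral {x..y} (\<lambda>s. z * h s - h s * s)"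
      unfolding D_def M_def diff[OF int(1) xy(1-3)] diff[OF int(3) xy(1-3)]
        Henstock_Kurzweil_Integration.integral_diff[OF i(1,2)] by simp
    also have "norm \<dots> <= integral {x..y} (\<lambda>s. (y - x) * \<bar>h s\<bar>)"
    proof (rule integral_norm_bound_integral)
      show "(\<lambda>s. z * h s - h s * s) integrable_on {x..y}" by (intro Henstock_Kurzweil_Integration.integrable_diff i)
      show "(\<lambda>s. (y - x) * \<bar>h s\<bar>) integrable_on {x..y}" by (rule i)
      fix s assume s: "s \<in> {x..y}"
      have "norm (z * h s - h s * s) = \<bar>z - s\<bar> * \<bar>h s\<bar>" by (simp add: abs_mult[symmetric] algebra_simps)
      also have "\<dots> <= (y - x) * \<bar>h s\<bar>" using s xy by (intro mult_right_mono) auto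
      finally show "norm (z * h s - h s * s) <= (y - x) * \<bar>h s\<bar>" .
    qed
    also have "\<dots> = (y - x) * (N y - N x)" unfolding N_def by (simp add: diff[OF int(2) xy(1-3)])
    finally show ?thesis by simp
  qed
  have cN: "continuous_on {0..T} N" unfolding N_def by (rule indefinite_integral_continuous_1[OF int(2)])
  have d: "(\<Theta> has_vector_derivative D x) (at x within {0..T})" if x: "x \<in> {0..T}" for x
  proof -
    have bnd: "norm (\<Theta> y - \<Theta> x - (y - x) * D x) <= \<bar>N y - N x\<bar> * \<bar>y - x\<bar>" if y: "y \<in> {0..T}" for y
    proof (cases "x <= y")
      case True
      have "N x <= N y" using diff[OF int(2), of x y] True x y integral_nonneg[OF sub[OF int(2), of x y]] by (simp add: N_def)
      thus ?thesis using est[of x y y] True x y by (simp add: \<Theta>_def algebra_simps)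
    next
      case False
      have "N y <= N x" using diff[OF int(2), of y x] False x y integral_nonneg[OF sub[OF int(2), of y x]] by (simp add: N_def)
      moreover have "\<Theta> y - \<Theta> x - (y - x) * D x = - (y * (D x - D y) - (M x - M y))" by (simp add: \<Theta>_def algebra_simps)
      ultimately show ?thesis using est[of y x y] False x y by (simp add: algebra_simps)
    qed
    show ?thesis
      unfolding has_vector_derivative_def has_derivative_within_alt
    proof (intro conjI allI impI)
      show "bounded_linear (\<lambda>xa. xa *\<^sub>R D x)" by (rule bounded_linear_scaleR_left)
      fix e :: real assume e: "e > 0"
      obtain \<delta> where \<delta>: "\<delta> > 0" "\<And>y. y \<in> {0..T} ==> \<bar>y - x\<bar> < \<delta> ==> \<bar>N y - N x\<bar> < e"
        using cN x e unfolding continuous_on_iff by (metis dist_real_def)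
      have "norm (\<Theta> y - \<Theta> x - (y - x) *\<^sub>R D x) <= e * norm (y - x)" if "y \<in> {0..T}" "norm (y - x) < \<delta>" for y
        using bnd[OF that(1)] \<delta>(2)[OF that(1)] that(2) mult_right_mono[of "\<bar>N y - N x\<bar>" e "\<bar>y - x\<bar>"] by simp
      thus "\<exists>d>0. \<forall>y\<in>{0..T}. norm (y - x) < d --> norm (\<Theta> y - \<Theta> x - (y - x) *\<^sub>R D x) <= e * norm (y - x)"
        using \<delta>(1) by blast
    qed
  qed
  have "(D has_integral (\<Theta> t - \<Theta> 0)) {0..t}"
    by (rule fundamental_theorem_of_calculus) (use t in \<open>auto intro: has_vector_derivative_within_subset[OF d]\<close>)
  hence "integral {0..t} D = \<Theta> t - \<Theta> 0" by (rule integral_unique)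
  thus ?thesis by (simp add: \<Theta>_def M_def D_def[abs_def])
qed

section \<open>Testing with smoothed steps and ramps\<close>

locale smooth_ramp =
  fixes P P' :: "real => real" and B :: real
  assumes deriv_P: "(P has_real_derivative P' x) (at x)"
    and ndiff_P: "ndiff n P" and ndiff_P': "ndiff n P'"
    and P_le_0: "x <= 0 ==> P x = 0" "x <= 0 ==> P' x = 0"
    and P_ge_1: "x \<ge> 1 ==> P x = x" "x \<ge> 1 ==> P' x = 1"
    and P_max: "\<bar>P x - max 0 x\<bar> <= 1" and P'_bound: "\<bar>P' x\<bar> <= B"
begin

lemma continuous_P [continuous_intros]: "continuous_on A P"
  by (rule continuous_at_imp_continuous_on) (use deriv_P in \<open>auto intro: DERIV_isCont\<close>)

lemma continuous_P' [continuous_intros]: "continuous_on A P'"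
proof -
  obtain Q where "\<And>x. (P' has_real_derivative Q x) (at x)" using ndiff_P'[of 1] by auto
  thus ?thesis by (intro continuous_at_imp_continuous_on) (auto intro: DERIV_isCont)
qed

lemma scale_ge_1:
  assumes "0 < y"
  shows "\<forall>\<^sub>F n in sequentially. 1 <= real (Suc n) * y"
proof -
  obtain n where n: "inverse (real (Suc n)) < y" using reals_Archimedean[OF assms] by blast
  have "1 <= real (Suc m) * y" if "m \<ge> n" for m
  proof -
    have "1 < real (Suc n) * y" using n by (simp add: field_simps)
    also have "\<dots> <= real (Suc m) * y" using that assms by (intro mult_right_mono) auto
    finally show ?thesis by simp
  qed
  thus ?thesis unfolding eventually_sequentially by blast
qed

text \<open>Rescaling sends \<open>P'\<close> boundedly to a unit step, so dominated convergence
  applies.\<close>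

lemma step_limit:
  assumes g: "g absolutely_integrable_on {\<alpha>..\<beta>}" and a: "a \<in> {\<alpha>..\<beta>}"
  shows "(\<lambda>n. integral {\<alpha>..\<beta>} (\<lambda>x. g x * P' (real (Suc n) * (x - a)))) \<longlonglongrightarrow> integral {a..\<beta>} g"
proof -
  have "(\<lambda>n. integral {\<alpha>..\<beta>} (\<lambda>x. g x * P' (real (Suc n) * (x - a)))) \<longlonglongrightarrow> integral {\<alpha>..\<beta>} (\<lambda>x. if x \<in> {a<..} then g x else 0)"
  proof (rule dominated_convergence(2))
    show "(\<lambda>x. g x * P' (real (Suc n) * (x - a))) integrable_on {\<alpha>..\<beta>}" for n
      by (rule absolutely_integrable_on_def[THEN iffD1, THEN conjunct1], intro mult_continuous_absolutely_integrable g
          continuous_on_compose2[OF continuous_P'[of UNIV]] continuous_intros) auto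
    show "(\<lambda>x. \<bar>g x\<bar> * B) integrable_on {\<alpha>..\<beta>}" using g by (auto simp: absolutely_integrable_on_def intro: integrable_on_mult_left)
    show "norm (g x * P' (real (Suc n) * (x - a))) <= \<bar>g x\<bar> * B" for n x
      using P'_bound by (auto simp: abs_mult intro: mult_left_mono)
    show "(\<lambda>n. g x * P' (real (Suc n) * (x - a))) \<longlonglongrightarrow> (if x \<in> {a<..} then g x else 0)" for x
    proof (cases "a < x")
      case True
      hence "\<forall>\<^sub>F n in sequentially. 1 <= real (Suc n) * (x - a)" by (intro scale_ge_1) simp
      hence "\<forall>\<^sub>F n in sequentially. g x * P' (real (Suc n) * (x - a)) = g x"
        by eventually_elim (simp add: P_ge_1)
      thus ?thesis using True by (simp add: tendsto_eventually)
    next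
      case False
      hence "real (Suc n) * (x - a) <= 0" for n by (simp add: mult_nonneg_nonpos)
      thus ?thesis using False by (simp add: P_le_0)
    qed
  qed
  also have "integral {\<alpha>..\<beta>} (\<lambda>x. if x \<in> {a<..} then g x else 0) = integral ({\<alpha>..\<beta>} \<inter> {a<..}) g"
    unfolding Henstock_Kurzweil_Integration.integral_restrict_Int by (simp only: Int_commute)
  also have "\<dots> = integral {a..\<beta>} g"
    by (rule integral_spike_set; rule negligible_subset[of "{a}"]) (use a in auto)
  finally show ?thesis .
qed

text \<open>\<open>max 0\<close> is positively homogeneous, so the bounded error of \<open>P\<close>
  is divided by the scale and tends to \<open>0\<close> uniformly.\<close>

lemma ramp_limit:
  assumes h: "h absolutely_integrable_on {\<alpha>..\<beta>}" and a: "a \<in> {\<alpha>..\<beta>}"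
  shows "(\<lambda>n. integral {\<alpha>..\<beta>} (\<lambda>x. h x * (P (real (Suc n) * (x - a)) / real (Suc n)))) \<longlonglongrightarrow> integral {\<alpha>..\<beta>} (\<lambda>x. h x * max 0 (x - a))"
proof (rule dominated_convergence(2))
  have e: "\<bar>P (real (Suc n) * y) / real (Suc n) - max 0 y\<bar> <= 1 / real (Suc n)" for n y
  proof -
    have "P (real (Suc n) * y) / real (Suc n) - max 0 y = (P (real (Suc n) * y) - max 0 (real (Suc n) * y)) / real (Suc n)"
      using max_mult_distrib_left[of "real (Suc n)" 0 y] by (simp add: field_simps del: of_nat_Suc)
    also have "\<bar>\<dots>\<bar> <= 1 / real (Suc n)" using P_max[of "real (Suc n) * y"] by (simp add: divide_right_mono)
    finally show ?thesis .
  qed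
  show "(\<lambda>x. h x * (P (real (Suc n) * (x - a)) / real (Suc n))) integrable_on {\<alpha>..\<beta>}" for n
    by (rule absolutely_integrable_on_def[THEN iffD1, THEN conjunct1], intro mult_continuous_absolutely_integrable h
        continuous_on_divide continuous_on_compose2[OF continuous_P[of UNIV]] continuous_intros) auto
  show "(\<lambda>x. \<bar>h x\<bar> * (1 + (\<beta> - \<alpha>))) integrable_on {\<alpha>..\<beta>}"
    using h by (auto simp: absolutely_integrable_on_def intro: integrable_on_mult_left)
  show "norm (h x * (P (real (Suc n) * (x - a)) / real (Suc n))) <= \<bar>h x\<bar> * (1 + (\<beta> - \<alpha>))" if x: "x \<in> {\<alpha>..\<beta>}" for n x
  proof -
    have "1 / real (Suc n) <= 1" by simp
    hence "\<bar>P (real (Suc n) * (x - a)) / real (Suc n)\<bar> <= 1 + (\<beta> - \<alpha>)" using e[of n "x - a"] x a by (simp only: atLeastAtMost_iff) linarith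
    thus ?thesis by (simp only: real_norm_def abs_mult) (intro mult_left_mono, auto)
  qed
  have l: "(\<lambda>n. P (real (Suc n) * y) / real (Suc n)) \<longlonglongrightarrow> max 0 y" for y
  proof (rule LIM_zero_cancel, rule Lim_null_comparison)
    show "\<forall>\<^sub>F n in sequentially. norm (P (real (Suc n) * y) / real (Suc n) - max 0 y) <= inverse (real (Suc n))"
      using e by (auto simp: inverse_eq_divide)
  qed (rule LIMSEQ_inverse_real_of_nat)
  show "(\<lambda>n. h x * (P (real (Suc n) * (x - a)) / real (Suc n))) \<longlonglongrightarrow> h x * max 0 (x - a)" for x
    by (intro tendsto_mult tendsto_const l)
qed

lemma ndiff_scaled: "ndiff n g ==> ndiff n (\<lambda>x. g (real N * (x - a)))"
  using ndiff_affine[of n g "real N" "- real N * a"] by (simp add: algebra_simps)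

text \<open>The test function is a difference of two smoothed steps and tends to the indicator of
  the interval. Its support reaches slightly beyond \<open>b\<close>; \<open>b2\<close> provides the
  room.\<close>

lemma integral_zero_if_tests_zero:
  assumes g: "\<And>a b. 0 < a ==> b < T ==> g absolutely_integrable_on {a..b}"
    and z: "\<And>\<phi>. test_function T \<phi> ==> (LINT x|I_leb T. g x * \<phi> x) = 0"
    and ab: "0 < a" "a < b" "b < T"
  shows "integral {a..b} g = 0"
proof -
  define b2 where "b2 = (b + T) / 2"
  have b2: "b < b2" "b2 < T" using ab by (auto simp: b2_def)
  have gi: "g absolutely_integrable_on {a..b2}" using g ab b2 by auto
  define \<phi> where "\<phi> n x = P' (real (Suc n) * (x - a)) - P' (real (Suc n) * (x - b))" for n x
  have int: "(\<lambda>x. g x * P' (real (Suc n) * (x - c))) absolutely_integrable_on {a..b2}" for n c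
    by (intro mult_continuous_absolutely_integrable gi continuous_on_compose2[OF continuous_P'[of UNIV]] continuous_intros) auto
  have "\<forall>\<^sub>F n in sequentially. 1 <= real (Suc n) * (b2 - b)" using b2 by (intro scale_ge_1) simp
  hence ev: "\<forall>\<^sub>F n in sequentially. integral {a..b2} (\<lambda>x. g x * \<phi> n x) = 0"
  proof eventually_elim
    case (elim n)
    have supp: "\<phi> n x = 0" if "x \<notin> {a..b2}" for x
    proof (cases "x < a")
      case True
      hence "real (Suc n) * (x - a) <= 0" "real (Suc n) * (x - b) <= 0" using ab by (auto simp: mult_nonneg_nonpos)
      thus ?thesis by (simp add: \<phi>_def P_le_0)
    next
      case False
      hence "x > b2" using that by auto
      hence "real (Suc n) * (b2 - b) <= real (Suc n) * (x - b)" "real (Suc n) * (x - b) <= real (Suc n) * (x - a)"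
        using ab by (auto intro!: mult_left_mono)
      hence "1 <= real (Suc n) * (x - b)" "1 <= real (Suc n) * (x - a)" using elim by linarith+
      thus ?thesis by (simp add: \<phi>_def P_ge_1)
    qed
    have "test_function T (\<phi> n)"
      by (rule test_functionI[of _ a b2]) (use supp ab b2 in \<open>auto simp: \<phi>_def[abs_def] simp del: of_nat_Suc intro!: ndiff_diff ndiff_scaled ndiff_P'\<close>)
    hence "(LINT x|I_leb T. g x * \<phi> n x) = 0" by (rule z)
    moreover have "(\<lambda>x. g x * \<phi> n x) absolutely_integrable_on {a..b2}"
      using set_integral_diff(1)[OF int[of n a] int[of n b]] by (simp add: \<phi>_def right_diff_distrib)
    ultimately show ?case using LINT_support[of a b2 T "\<lambda>x. g x * \<phi> n x"] ab b2 supp by simp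
  qed
  have "integral {a..b2} (\<lambda>x. g x * \<phi> n x) = integral {a..b2} (\<lambda>x. g x * P' (real (Suc n) * (x - a))) - integral {a..b2} (\<lambda>x. g x * P' (real (Suc n) * (x - b)))" for n
  proof -
    have "(\<lambda>x. g x * P' (real (Suc n) * (x - c))) integrable_on {a..b2}" for c using int[of n c] by (simp only: absolutely_integrable_on_def)
    from Henstock_Kurzweil_Integration.integral_diff[OF this this] show ?thesis by (simp only: \<phi>_def right_diff_distrib[of "g _"])
  qed
  hence "(\<lambda>n. integral {a..b2} (\<lambda>x. g x * \<phi> n x)) \<longlonglongrightarrow> integral {a..b2} g - integral {b..b2} g"
    using tendsto_diff[OF step_limit[OF gi, of a] step_limit[OF gi, of b]] ab b2 by simp
  moreover have "(\<lambda>n. integral {a..b2} (\<lambda>x. g x * \<phi> n x)) \<longlonglongrightarrow> 0"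
    using ev by (rule tendsto_eventually)
  ultimately have "integral {a..b2} g - integral {b..b2} g = 0" by (rule LIMSEQ_unique)
  thus ?thesis
    using Henstock_Kurzweil_Integration.integral_combine[of a b b2 g] ab b2 gi by (auto simp: absolutely_integrable_on_def)
qed

text \<open>Four corners suffice for a piecewise linear test function whose slope is \<open>1\<close> on \<open>[a, b]\<close>
  and constant on a fixed reference interval \<open>[p, q]\<close>, which compensates its increase.\<close>

lemma primitive_if_tests:
  assumes g: "integrable (I_leb T) g" and h: "integrable (I_leb T) h"
    and z: "\<And>\<phi>. test_function T \<phi> ==> (LINT x|I_leb T. g x * deriv \<phi> x) = - (LINT x|I_leb T. h x * \<phi> x)"
    and T: "0 < T"
  shows "\<exists>\<kappa>. AE x in I_leb T. g x = \<kappa> + integral {0..x} h"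
proof -
  have ga: "g absolutely_integrable_on {0..T}" "h absolutely_integrable_on {0..T}" using g h by (auto intro: integrable_Icc_if)
  hence gi: "g integrable_on {0..T}" "h integrable_on {0..T}" by (auto simp: absolutely_integrable_on_def)
  define D where "D x = integral {0..x} h" for x
  define W where "W x = integral {0..x} g" for x
  define DD where "DD x = integral {0..x} D" for x
  define p where "p = T / 3"
  define q where "q = 2 * T / 3"
  have pq: "0 < p" "p < q" "q < T" using T by (auto simp: p_def q_def)
  \<comment> \<open>The constant of integration is the mean slope of \<open>W - DD\<close> on the
    reference interval, hence the same for all intervals \<open>{a..b}\<close> tested below.\<close>
  define \<kappa> where "\<kappa> = ((W q - DD q) - (W p - DD p)) / (q - p)"
  have cD: "continuous_on {0..T} D" unfolding D_def by (rule indefinite_integral_continuous_1[OF gi(2)])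
  note comb = integral_Icc_diff
  have K: "integral {0..T} (\<lambda>x. h x * max 0 (x - a)) = (T - a) * D T - DD T + DD a" if a: "0 <= a" "a <= T" for a
  proof -
    let ?M = "\<lambda>t. integral {0..t} (\<lambda>s. h s * s)"
    have hs: "(\<lambda>s. h s * s) integrable_on {0..T}"
      using mult_continuous_absolutely_integrable[OF ga(2), of "\<lambda>s. s"] by (auto simp: absolutely_integrable_on_def intro: continuous_intros)
    have "integral {0..T} (\<lambda>x. h x * max 0 (x - a)) = integral {0..T} (\<lambda>x. if x \<in> {a..} then h x * s x - a * h x else 0)"
      if "s = (\<lambda>x. x)" for s :: "real => real"
      by (rule Henstock_Kurzweil_Integration.integral_cong) (auto simp: max_def that algebra_simps)
    hence "integral {0..T} (\<lambda>x. h x * max 0 (x - a)) = integral {0..T} (\<lambda>x. if x \<in> {a..} then h x * x - a * h x else 0)" by simp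
    also have "\<dots> = integral ({0..T} \<inter> {a..}) (\<lambda>x. h x * x - a * h x)"
      unfolding Henstock_Kurzweil_Integration.integral_restrict_Int by (simp only: Int_commute)
    also have "{0..T} \<inter> {a..} = {a..T}" using a by auto
    also have "integral {a..T} (\<lambda>x. h x * x - a * h x) = integral {a..T} (\<lambda>x. h x * x) - a * integral {a..T} h"
    proof -
      have "(\<lambda>x. h x * x) integrable_on {a..T}" "(\<lambda>x. a * h x) integrable_on {a..T}"
        using integrable_on_subinterval[OF hs, of a T] integrable_on_subinterval[OF gi(2), of a T] a
        by (auto intro: integrable_on_mult_right)
      thus ?thesis by (simp add: Henstock_Kurzweil_Integration.integral_diff)
    qed
    also have "\<dots> = (?M T - ?M a) - a * (D T - D a)" using comb[OF hs, of a T] comb[OF gi(2), of a T] a by (simp add: D_def)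
    also have "\<dots> = (T - a) * D T - DD T + DD a"
      using integral_primitive[OF ga(2), of T] integral_primitive[OF ga(2), of a] a by (simp add: D_def[abs_def] DD_def algebra_simps)
    finally show ?thesis .
  qed
  have main: "integral {a..b} g = \<kappa> * (b - a) + integral {a..b} D" if ab: "0 < a" "a < b" "b < T" for a b
  proof -
    \<comment> \<open>Scales the reference piece so that the total increase is zero and the test
      function vanishes to the right of its corners.\<close>
    define c where "c = (b - a) / (q - p)"
    have c: "c * (q - p) = b - a" using pq by (simp add: c_def)
    define al where "al = min a p"
    define be where "be = max b q"
    define b2 where "b2 = (be + T) / 2"
    have be: "be < b2" "b2 < T" "be < T" using ab pq by (auto simp: b2_def be_def)
    have al: "0 < al" using ab pq by (auto simp: al_def)
    let ?N = "\<lambda>n. real (Suc n)"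
    define S where "S F n x = F (?N n * (x - a)) - F (?N n * (x - b)) - c * (F (?N n * (x - p)) - F (?N n * (x - q)))" for F :: "real => real" and n x
    have supp: "S P n x / ?N n = 0" if "1 <= ?N n * (b2 - be)" "x \<notin> {al..b2}" for n x
    proof (cases "x < al")
      case True
      hence "?N n * (x - y) <= 0" if "y \<in> {a, b, p, q}" for y
        using that ab pq by (intro mult_nonneg_nonpos) (auto simp: al_def)
      thus ?thesis by (simp add: S_def P_le_0)
    next
      case False
      hence "x > b2" using that by auto
      have "1 <= ?N n * (x - y)" if y: "y \<in> {a, b, p, q}" for y
      proof -
        have "b2 - be <= x - y" using y ab pq \<open>x > b2\<close> by (auto simp: be_def)
        hence "?N n * (b2 - be) <= ?N n * (x - y)" by (intro mult_left_mono) auto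
        with \<open>1 <= ?N n * (b2 - be)\<close> show ?thesis by linarith
      qed
      hence "P (?N n * (x - y)) = ?N n * (x - y)" if "y \<in> {a, b, p, q}" for y using that by (intro P_ge_1) simp
      hence "S P n x = ?N n * (x - a) - ?N n * (x - b) - c * (?N n * (x - p) - ?N n * (x - q))" by (simp only: S_def insert_iff simp_thms)
      also have "\<dots> = ?N n * ((b - a) - c * (q - p))" by (simp add: algebra_simps)
      finally have "S P n x = ?N n * ((b - a) - c * (q - p))" .
      thus ?thesis by (simp add: c)
    qed
    have dS: "((\<lambda>x. S P n x / ?N n) has_real_derivative S P' n x) (at x)" for n x
    proof -
      have "((\<lambda>x. P (?N n * (x - y))) has_real_derivative P' (?N n * (x - y)) * ?N n) (at x)" for y
        by (rule DERIV_chain'[where f="\<lambda>x. ?N n * (x - y)" and g=P]) (auto intro!: derivative_eq_intros deriv_P)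
      hence "((\<lambda>x. S P n x / ?N n) has_real_derivative
          (P' (?N n * (x - a)) * ?N n - P' (?N n * (x - b)) * ?N n - c * (P' (?N n * (x - p)) * ?N n - P' (?N n * (x - q)) * ?N n)) / ?N n) (at x)"
        unfolding S_def by (intro DERIV_cdivide DERIV_diff DERIV_cmult)
      moreover have "(P' (?N n * (x - a)) * ?N n - P' (?N n * (x - b)) * ?N n - c * (P' (?N n * (x - p)) * ?N n - P' (?N n * (x - q)) * ?N n)) / ?N n = S P' n x"
        by (simp add: S_def field_simps del: of_nat_Suc)
      ultimately show ?thesis by (simp only:)
    qed
    have nd: "ndiff j (\<lambda>x. S P n x / ?N n)" for j n
      unfolding S_def divide_inverse by (intro ndiff_mult ndiff_diff ndiff_const ndiff_scaled ndiff_P)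
    have intg: "(\<lambda>x. g x * P' (?N n * (x - y))) integrable_on {0..T}" for n y
      by (rule absolutely_integrable_on_def[THEN iffD1, THEN conjunct1], intro mult_continuous_absolutely_integrable ga
          continuous_on_compose2[OF continuous_P'[of UNIV]] continuous_intros) auto
    have inth: "(\<lambda>x. h x * (P (?N n * (x - y)) / ?N n)) integrable_on {0..T}" for n y
      by (rule absolutely_integrable_on_def[THEN iffD1, THEN conjunct1], intro mult_continuous_absolutely_integrable ga
          continuous_on_divide continuous_on_compose2[OF continuous_P[of UNIV]] continuous_intros) auto
    let ?G = "\<lambda>n y. integral {0..T} (\<lambda>x. g x * P' (?N n * (x - y)))"
    let ?H = "\<lambda>n y. integral {0..T} (\<lambda>x. h x * (P (?N n * (x - y)) / ?N n))"
    have eqG: "((\<lambda>x. g x * S P' n x) has_integral (?G n a - ?G n b - c * (?G n p - ?G n q))) {0..T}" for n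
    proof -
      have "((\<lambda>x. g x * P' (?N n * (x - a)) - g x * P' (?N n * (x - b)) - c * (g x * P' (?N n * (x - p)) - g x * P' (?N n * (x - q))))
         has_integral (?G n a - ?G n b - c * (?G n p - ?G n q))) {0..T}"
        by (intro has_integral_diff has_integral_mult_right integrable_integral intg)
      thus ?thesis unfolding S_def by (simp add: algebra_simps)
    qed
    have eqH: "((\<lambda>x. h x * (S P n x / ?N n)) has_integral (?H n a - ?H n b - c * (?H n p - ?H n q))) {0..T}" for n
    proof -
      have "((\<lambda>x. h x * (P (?N n * (x - a)) / ?N n) - h x * (P (?N n * (x - b)) / ?N n) - c * (h x * (P (?N n * (x - p)) / ?N n) - h x * (P (?N n * (x - q)) / ?N n)))
         has_integral (?H n a - ?H n b - c * (?H n p - ?H n q))) {0..T}"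
        by (intro has_integral_diff has_integral_mult_right integrable_integral inth)
      moreover have "h x * (S P n x / ?N n) = h x * (P (?N n * (x - a)) / ?N n) - h x * (P (?N n * (x - b)) / ?N n) - c * (h x * (P (?N n * (x - p)) / ?N n) - h x * (P (?N n * (x - q)) / ?N n))" for x
        by (simp add: S_def diff_divide_distrib right_diff_distrib mult_ac)
      ultimately show ?thesis by simp
    qed
    have LI: "integrable (I_leb T) (\<lambda>x. F x * G x)" if F: "integrable (I_leb T) F" and G: "continuous_on {0..T} G" for F G :: "real => real"
      using mult_continuous_absolutely_integrable[OF integrable_Icc_if[OF F] G]
      unfolding absolutely_integrable_on_Icc_iff_Ioo by (simp add: integrable_restrict_space set_integrable_def)
    have cP: "continuous_on {0..T} (\<lambda>x. S P' n x)" "continuous_on {0..T} (\<lambda>x. S P n x / ?N n)" for n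
      unfolding S_def by (intro continuous_on_divide continuous_intros continuous_on_compose2[OF continuous_P'[of UNIV]] continuous_on_compose2[OF continuous_P[of UNIV]]; auto)+
    have "\<forall>\<^sub>F n in sequentially. 1 <= ?N n * (b2 - be)" using be by (intro scale_ge_1) simp
    hence ev: "\<forall>\<^sub>F n in sequentially. ?G n a - ?G n b - c * (?G n p - ?G n q) = - (?H n a - ?H n b - c * (?H n p - ?H n q))"
    proof eventually_elim
      case (elim n)
      have "test_function T (\<lambda>x. S P n x / ?N n)"
        by (rule test_functionI[of _ al b2]) (use supp[OF elim] al be nd in auto)
      from z[OF this] have "(LINT x|I_leb T. g x * S P' n x) = - (LINT x|I_leb T. h x * (S P n x / ?N n))"
        by (simp only: DERIV_imp_deriv[OF dS])
      thus ?case
        unfolding LINT_eq_integral[OF LI[OF g cP(1)]] LINT_eq_integral[OF LI[OF h cP(2)]] integral_unique[OF eqG] integral_unique[OF eqH] .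
    qed
    have mem: "a \<in> {0..T}" "b \<in> {0..T}" "p \<in> {0..T}" "q \<in> {0..T}" using ab pq by auto
    have l1: "(\<lambda>n. ?G n a - ?G n b - c * (?G n p - ?G n q)) \<longlonglongrightarrow> integral {a..T} g - integral {b..T} g - c * (integral {p..T} g - integral {q..T} g)"
      by (intro tendsto_diff tendsto_mult tendsto_const step_limit[OF ga(1)] mem)
    have l2: "(\<lambda>n. - (?H n a - ?H n b - c * (?H n p - ?H n q))) \<longlonglongrightarrow> - (integral {0..T} (\<lambda>x. h x * max 0 (x - a)) - integral {0..T} (\<lambda>x. h x * max 0 (x - b))
      - c * (integral {0..T} (\<lambda>x. h x * max 0 (x - p)) - integral {0..T} (\<lambda>x. h x * max 0 (x - q))))"
      by (intro tendsto_minus tendsto_diff tendsto_mult tendsto_const ramp_limit[OF ga(2)] mem)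
    have "integral {a..T} g - integral {b..T} g - c * (integral {p..T} g - integral {q..T} g)
       = - (integral {0..T} (\<lambda>x. h x * max 0 (x - a)) - integral {0..T} (\<lambda>x. h x * max 0 (x - b))
      - c * (integral {0..T} (\<lambda>x. h x * max 0 (x - p)) - integral {0..T} (\<lambda>x. h x * max 0 (x - q))))"
      by (rule LIMSEQ_unique[OF l1 Lim_transform_eventually[OF l2]]) (use ev in eventually_elim, simp)
    moreover have W: "integral {y..T} g = W T - W y" if "y \<in> {0..T}" for y using comb[OF gi(1), of y T] that by (simp add: W_def)
    moreover have K': "integral {0..T} (\<lambda>x. h x * max 0 (x - y)) = (T - y) * D T - DD T + DD y" if "y \<in> {0..T}" for y using K that by auto
    ultimately have "(W T - W a) - (W T - W b) - c * ((W T - W p) - (W T - W q))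
       = - (((T - a) * D T - DD T + DD a) - ((T - b) * D T - DD T + DD b) - c * (((T - p) * D T - DD T + DD p) - ((T - q) * D T - DD T + DD q)))"
      by (simp only: W[OF mem(1)] W[OF mem(2)] W[OF mem(3)] W[OF mem(4)] K'[OF mem(1)] K'[OF mem(2)] K'[OF mem(3)] K'[OF mem(4)])
    hence "(W b - W a) - c * (W q - W p) = - ((b - a) - c * (q - p)) * D T + (DD b - DD a) - c * (DD q - DD p)"
      by (simp add: algebra_simps)
    hence "W b - W a = (DD b - DD a) + c * ((W q - DD q) - (W p - DD p))"
      unfolding c by (simp add: algebra_simps)
    moreover have "c * ((W q - DD q) - (W p - DD p)) = \<kappa> * (b - a)" by (simp add: c_def \<kappa>_def)
    moreover have "W b - W a = integral {a..b} g" using comb[OF gi(1), of a b] ab by (simp add: W_def)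
    moreover have "DD b - DD a = integral {a..b} D" using comb[OF integrable_continuous_real[OF cD], of a b] ab by (simp add: DD_def)
    ultimately show ?thesis by simp
  qed
  have "AE x in I_leb T. g x - (\<kappa> + D x) = 0"
  proof (rule AE_on_Ioo, rule interval_integral_zero_imp_AE)
    fix a b :: real assume ab: "0 < a" "a < b" "b < T"
    have cD': "continuous_on {a..b} (\<lambda>x. \<kappa> + D x)" using ab by (intro continuous_intros continuous_on_subset[OF cD]) auto
    have gab: "g absolutely_integrable_on {a..b}" using absolutely_integrable_on_subinterval[OF ga(1)] ab by auto
    show "(\<lambda>x. g x - (\<kappa> + D x)) absolutely_integrable_on {a..b}"
      by (rule set_integral_diff(1)[OF gab absolutely_integrable_continuous_real[OF cD']])
    fix c d assume cd: "a <= c" "c <= d" "d <= b"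
    show "integral {c..d} (\<lambda>x. g x - (\<kappa> + D x)) = 0"
    proof (cases "c = d")
      case False
      have i: "g integrable_on {c..d}" "D integrable_on {c..d}"
        using gab integrable_on_subinterval[of g "{a..b}" c d] integrable_continuous_real[OF continuous_on_subset[OF cD, of "{c..d}"]] ab cd
        by (auto simp: absolutely_integrable_on_def)
      hence "((\<lambda>x. g x - (\<kappa> + D x)) has_integral (integral {c..d} g - (measure lborel {c..d} *\<^sub>R \<kappa> + integral {c..d} D))) {c..d}"
        using has_integral_const_real[of \<kappa> c d] by (intro has_integral_diff has_integral_add integrable_integral) auto
      thus ?thesis using main[of c d] ab cd False by (simp add: integral_unique mult.commute)
    qed simp
  qed
  thus ?thesis by (intro exI[of _ \<kappa>]) (simp add: D_def algebra_simps)
qed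

end

lemma smooth_ramp_exists: "\<exists>P P' B. smooth_ramp P P' B"
  using smooth_positive_part unfolding smooth_ramp_def by (elim exE conjE) blast

section \<open>Change of representatives, L1 bounds and weak derivatives\<close>

lemma AE_negligible:
  assumes "AE x in I_leb T. Q x"
  shows "negligible {x \<in> {0..T}. \<not> Q x}"
proof -
  have "AE x in lebesgue. x \<in> {0<..<T} --> Q x" using assms by (simp add: AE_restrict_space_iff)
  then obtain N where N: "N \<in> null_sets lebesgue" "{x. \<not> (x \<in> {0<..<T} --> Q x)} \<subseteq> N"
    unfolding eventually_ae_filter by auto
  have "negligible (insert 0 (insert T N))" using N(1) by (simp add: negligible_iff_null_sets)
  thus ?thesis by (rule negligible_subset) (use N(2) in \<open>force simp: less_le\<close>)
qed

lemma integral_AE_eq: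
  assumes "AE x in I_leb T. F x = G x" "S \<subseteq> {0..T}"
  shows "integral S F = integral S G"
  by (rule integral_spike[OF AE_negligible[OF assms(1)]]) (use assms(2) in auto)

lemma measurable_AE_eq:
  fixes F G :: "real => 'b::euclidean_space"
  assumes "AE x in I_leb T. F x = G x" "F \<in> borel_measurable (I_leb T)"
  shows "G \<in> borel_measurable (I_leb T)"
proof -
  have "(\<lambda>x. indicator {0<..<T} x *\<^sub>R G x) \<in> borel_measurable lebesgue"
  proof (rule borel_measurable_AE)
    show "(\<lambda>x. indicator {0<..<T} x *\<^sub>R F x) \<in> borel_measurable lebesgue"
      using assms(2) by (subst (asm) borel_measurable_restrict_space_iff) auto
    have "AE x in lebesgue. x \<in> {0<..<T} --> F x = G x" using assms(1) by (simp add: AE_restrict_space_iff)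
    thus "AE x in lebesgue. indicator {0<..<T} x *\<^sub>R F x = indicator {0<..<T} x *\<^sub>R G x"
      by eventually_elim (auto simp: indicator_def)
  qed
  thus ?thesis by (subst borel_measurable_restrict_space_iff) auto
qed

lemma Lp_norm_AE_eq:
  assumes "AE x in I_leb T. F x = G x" "F \<in> borel_measurable (I_leb T)"
  shows "Lp_norm T p F = Lp_norm T p G"
proof (cases "p = \<infinity>")
  case True
  have [measurable]: "F \<in> borel_measurable (I_leb T)" "G \<in> borel_measurable (I_leb T)" using assms measurable_AE_eq by auto
  have "esssup (I_leb T) (\<lambda>s. ennreal \<bar>F s\<bar>) = esssup (I_leb T) (\<lambda>s. ennreal \<bar>G s\<bar>)"
  proof (rule antisym)
    show "esssup (I_leb T) (\<lambda>s. ennreal \<bar>F s\<bar>) <= esssup (I_leb T) (\<lambda>s. ennreal \<bar>G s\<bar>)"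
      by (rule esssup_AE_mono) (use assms(1) in \<open>auto elim: eventually_mono\<close>)
    show "esssup (I_leb T) (\<lambda>s. ennreal \<bar>G s\<bar>) <= esssup (I_leb T) (\<lambda>s. ennreal \<bar>F s\<bar>)"
      by (rule esssup_AE_mono) (use assms(1) in \<open>auto elim: eventually_mono\<close>)
  qed
  thus ?thesis using True by (simp add: Lp_norm_def)
next
  case False
  have [measurable]: "F \<in> borel_measurable (I_leb T)" "G \<in> borel_measurable (I_leb T)" using assms measurable_AE_eq by auto
  have "(LINT s|I_leb T. \<bar>F s\<bar> powr enn2real p) = (LINT s|I_leb T. \<bar>G s\<bar> powr enn2real p)"
    by (rule integral_cong_AE) (use assms(1) in \<open>auto elim: eventually_mono\<close>)
  thus ?thesis using False by (simp add: Lp_norm_def)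
qed

lemma Lp_norm_nonneg: "Lp_norm T p w \<ge> 0"
  by (simp add: Lp_norm_def)

text \<open>For finite exponents the pointwise inequality
  \<open>\<bar>y\<bar> <= \<rho> + \<rho>^(1 - q) * \<bar>y\<bar>^q\<close>, once integrated, plays
  the role of Hoelder's inequality; its two terms give \<open>T * \<rho>\<close> and
  \<open>\<rho>\<close>, a constant independent of \<open>p\<close>.\<close>

lemma in_Lp_L1:
  assumes w: "in_Lp T p w" and p: "p \<ge> 1" and T: "0 < T" and \<rho>: "Lp_norm T p w <= \<rho>" "0 < \<rho>"
  shows "integrable (I_leb T) w" "integral {0..T} (\<lambda>x. \<bar>w x\<bar>) <= (T + 1) * \<rho>"
proof -
  have [measurable]: "w \<in> borel_measurable (I_leb T)" using w by (simp add: in_Lp_def)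
  have "emeasure (I_leb T) {0<..<T} = emeasure lebesgue {0<..<T}" by (rule emeasure_restrict_space) auto
  hence em: "emeasure (I_leb T) {0<..<T} = ennreal T" using T by simp
  hence ms: "measure (I_leb T) {0<..<T} = T" using T by (simp add: measure_def)
  have fin: "finite_measure (I_leb T)" by (rule finite_measureI) (simp add: em)
  have const: "integrable (I_leb T) (\<lambda>x. c)" for c :: real using fin by (simp add: finite_measure.integrable_const)
  have "\<exists>G. integrable (I_leb T) G \<and> (AE x in I_leb T. \<bar>w x\<bar> <= G x) \<and> (LINT x|I_leb T. G x) <= (T + 1) * \<rho>"
  proof (cases "p = \<infinity>")
    case True
    define E where "E = esssup (I_leb T) (\<lambda>s. ennreal \<bar>w s\<bar>)"
    have E: "E < \<infinity>" "enn2real E <= \<rho>" using w \<rho> True by (auto simp: in_Lp_def Lp_norm_def E_def)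
    have "AE x in I_leb T. ennreal \<bar>w x\<bar> <= E" unfolding E_def by (rule esssup_AE)
    hence "AE x in I_leb T. \<bar>w x\<bar> <= \<rho>"
    proof eventually_elim
      case (elim x)
      have "\<bar>w x\<bar> <= enn2real E" using enn2real_mono[OF elim] E(1) by simp
      with E(2) show ?case by linarith
    qed
    moreover have "(LINT x|I_leb T. \<rho>) <= (T + 1) * \<rho>" using \<rho> by (simp add: ms mult_right_mono)
    ultimately show ?thesis using const by blast
  next
    case False
    define q where "q = enn2real p"
    have q: "q \<ge> 1" using enn2real_mono[of 1 p] p False by (simp add: q_def top.not_eq_extremum)
    have i: "integrable (I_leb T) (\<lambda>s. \<bar>w s\<bar> powr q)" using w False by (simp add: in_Lp_def q_def)
    define J where "J = (LINT s|I_leb T. \<bar>w s\<bar> powr q)"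
    have J: "J \<ge> 0" "J powr (1 / q) <= \<rho>" using \<rho>(1) False by (auto simp: J_def Lp_norm_def q_def)
    have "(J powr (1 / q)) powr q <= \<rho> powr q" using J q by (intro powr_mono2) auto
    hence J': "J <= \<rho> powr q" using J(1) q by (simp add: powr_powr)
    have pt: "\<bar>y\<bar> <= \<rho> + \<rho> powr (1 - q) * \<bar>y\<bar> powr q" for y :: real
    proof (cases "\<bar>y\<bar> <= \<rho>")
      case False
      hence "\<rho> powr (q - 1) <= \<bar>y\<bar> powr (q - 1)" using \<rho> q by (intro powr_mono2) auto
      hence "\<rho> powr (1 - q) * (\<rho> powr (q - 1) * \<bar>y\<bar>) <= \<rho> powr (1 - q) * (\<bar>y\<bar> powr (q - 1) * \<bar>y\<bar>)"
        by (intro mult_left_mono mult_right_mono) auto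
      moreover have "\<rho> powr (1 - q) * (\<rho> powr (q - 1) * \<bar>y\<bar>) = \<bar>y\<bar>"
        using \<rho> by (simp add: mult.assoc[symmetric] powr_add[symmetric])
      moreover have "\<bar>y\<bar> powr (q - 1) * \<bar>y\<bar> = \<bar>y\<bar> powr q" using powr_mult_base[of "\<bar>y\<bar>" "q - 1"] by (simp add: mult.commute)
      ultimately show ?thesis using \<rho> by simp
    qed (use \<rho> in \<open>simp add: add_increasing2\<close>)
    have "(LINT s|I_leb T. \<rho> + \<rho> powr (1 - q) * \<bar>w s\<bar> powr q) = T * \<rho> + \<rho> powr (1 - q) * J"
      using const i by (simp add: ms J_def)
    also have "\<dots> <= T * \<rho> + \<rho> powr (1 - q) * \<rho> powr q" using J' by (intro add_left_mono mult_left_mono) auto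
    also have "\<dots> = (T + 1) * \<rho>" using \<rho> by (simp add: powr_add[symmetric] distrib_right)
    finally have "(LINT s|I_leb T. \<rho> + \<rho> powr (1 - q) * \<bar>w s\<bar> powr q) <= (T + 1) * \<rho>" .
    moreover have "integrable (I_leb T) (\<lambda>s. \<rho> + \<rho> powr (1 - q) * \<bar>w s\<bar> powr q)" using const i by simp
    ultimately show ?thesis using pt by (intro exI[of _ "\<lambda>s. \<rho> + \<rho> powr (1 - q) * \<bar>w s\<bar> powr q"]) auto
  qed
  then obtain G where G: "integrable (I_leb T) G" "AE x in I_leb T. \<bar>w x\<bar> <= G x" "(LINT x|I_leb T. G x) <= (T + 1) * \<rho>" by blast
  show int: "integrable (I_leb T) w"
    by (rule Bochner_Integration.integrable_bound[OF G(1)]) (use G(2) in \<open>auto elim: eventually_mono\<close>)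
  have "(LINT x|I_leb T. \<bar>w x\<bar>) <= (LINT x|I_leb T. G x)"
    by (rule integral_mono_AE) (use int G in auto)
  thus "integral {0..T} (\<lambda>x. \<bar>w x\<bar>) <= (T + 1) * \<rho>"
    using G(3) LINT_eq_integral[of T "\<lambda>x. \<bar>w x\<bar>"] int by simp
qed

lemma locally_integrable_Icc:
  assumes "locally_integrable T w" "0 < a" "b < T"
  shows "w absolutely_integrable_on {a..b}"
proof -
  have "integrable (lebesgue_on {a..b}) w" using assms unfolding locally_integrable_def by (intro assms(1)[unfolded locally_integrable_def, rule_format]) auto
  thus ?thesis by (simp add: integrable_restrict_space set_integrable_def)
qed

lemma test_function_continuous: "test_function T \<phi> ==> continuous_on A \<phi>"
  using differentiable_imp_continuous_on[of \<phi> UNIV] continuous_on_subset[of UNIV \<phi> A]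
  unfolding test_function_def by (metis funpow_0 subset_UNIV)

lemma locally_integrable_times_test:
  assumes w: "locally_integrable T w" and \<phi>: "test_function T \<phi>"
  shows "integrable (I_leb T) (\<lambda>x. w x * \<phi> x)"
proof -
  obtain K where K: "compact K" "K \<subseteq> {0<..<T}" "\<And>s. s \<notin> K ==> \<phi> s = 0" using \<phi> unfolding test_function_def by auto
  have Kl: "K \<in> sets lebesgue" using K(1) by (simp add: lmeasurable_compact fmeasurableD)
  have "integrable (lebesgue_on K) w" using w K unfolding locally_integrable_def by auto
  hence "w absolutely_integrable_on K" using Kl by (simp add: integrable_restrict_space set_integrable_def)
  hence "(\<lambda>x. \<phi> x * w x) absolutely_integrable_on K"
    using K(1) Kl test_function_continuous[OF \<phi>, of K] compact_imp_bounded[OF compact_continuous_image]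
    by (intro absolutely_integrable_bounded_measurable_product_real continuous_imp_measurable_on_sets_lebesgue) auto
  hence "integrable lebesgue (\<lambda>x. indicator K x *\<^sub>R (\<phi> x * w x))" by (simp add: set_integrable_def)
  moreover have "(\<lambda>x. indicator K x *\<^sub>R (\<phi> x * w x)) = (\<lambda>x. indicator {0<..<T} x *\<^sub>R (w x * \<phi> x))"
    using K by (auto simp: fun_eq_iff indicator_def mult.commute)
  ultimately have "integrable lebesgue (\<lambda>x. indicator {0<..<T} x *\<^sub>R (w x * \<phi> x))" by (simp only:)
  thus ?thesis by (simp add: integrable_restrict_space)
qed

text \<open>The difference of two weak derivatives has zero integral against test functions, hence
  over compact subintervals, hence it vanishes almost everywhere. The norm therefore does not depend
  on the choice in \<open>weak_deriv\<close>.\<close>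

lemma weak_deriv_unique:
  assumes "has_weak_deriv T j u w" "has_weak_deriv T j u w'"
  shows "AE x in I_leb T. w x = w' x"
proof -
  obtain P P' B where "smooth_ramp P P' B" using smooth_ramp_exists by blast
  then interpret smooth_ramp P P' B .
  have l: "locally_integrable T w" "locally_integrable T w'" using assms by (auto simp: has_weak_deriv_def)
  have ai: "(\<lambda>x. w x - w' x) absolutely_integrable_on {a..b}" if "0 < a" "b < T" for a b
    using set_integral_diff(1)[OF locally_integrable_Icc[OF l(1) that] locally_integrable_Icc[OF l(2) that]] .
  have z: "(LINT x|I_leb T. (w x - w' x) * \<phi> x) = 0" if "test_function T \<phi>" for \<phi>
  proof -
    have "(LINT s|I_leb T. u s * (deriv ^^ j) \<phi> s) = (- 1) ^ j * (LINT s|I_leb T. w s * \<phi> s)"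
      "(LINT s|I_leb T. u s * (deriv ^^ j) \<phi> s) = (- 1) ^ j * (LINT s|I_leb T. w' s * \<phi> s)"
      using assms that by (auto simp: has_weak_deriv_def)
    hence "(- 1) ^ j * (LINT s|I_leb T. w s * \<phi> s) = (- 1) ^ j * (LINT s|I_leb T. w' s * \<phi> s)" by (simp only:)
    thus ?thesis
      using locally_integrable_times_test[OF l(1) that] locally_integrable_times_test[OF l(2) that]
      by (simp add: left_diff_distrib)
  qed
  have "AE x in I_leb T. w x - w' x = 0"
  proof (rule AE_on_Ioo, rule interval_integral_zero_imp_AE)
    fix a b :: real assume ab: "0 < a" "a < b" "b < T"
    show "(\<lambda>x. w x - w' x) absolutely_integrable_on {a..b}" using ab by (intro ai) auto
    fix c d assume cd: "a <= c" "c <= d" "d <= b"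
    show "integral {c..d} (\<lambda>x. w x - w' x) = 0"
    proof (cases "c = d")
      case False
      thus ?thesis using integral_zero_if_tests_zero[of T "\<lambda>x. w x - w' x" c d] ai z ab cd by auto
    qed simp
  qed
  thus ?thesis by simp
qed

lemma test_function_deriv:
  assumes "test_function T \<phi>"
  shows "test_function T (deriv \<phi>)"
proof -
  have e: "(deriv ^^ n) (deriv \<phi>) = (deriv ^^ Suc n) \<phi>" for n by (simp add: funpow_swap1)
  obtain K where K: "compact K" "K \<subseteq> {0<..<T}" "\<And>s. s \<notin> K ==> \<phi> s = 0" using assms unfolding test_function_def by auto
  have "deriv \<phi> s = 0" if "s \<notin> K" for s
  proof -
    have "((\<lambda>_. 0) has_real_derivative 0) (at s)" by simp
    hence "(\<phi> has_real_derivative 0) (at s)"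
      by (rule has_field_derivative_transform_within_open[where S="- K"]) (use K that compact_imp_closed in auto)
    thus ?thesis by (rule DERIV_imp_deriv)
  qed
  thus ?thesis using assms K(1,2) unfolding test_function_def e by (intro conjI allI exI[of _ K]) (auto simp del: funpow.simps)
qed

text \<open>Weak derivatives are replaced by functions each of which is, up to a constant, exactly
  the integral of the next. Of the Sobolev norm only the L1 bounds on this chain are used for the
  interpolation.\<close>

lemma sobolev_chain:
  assumes u: "in_Wmp T m p u" and p: "p \<ge> 1" and T: "0 < T" and \<rho>: "Wmp_norm T m p u <= \<rho>" "0 < \<rho>"
  shows "\<exists>D. (AE x in I_leb T. u x = D 0 x)
     \<and> (\<forall>j<m. continuous_on {0..T} (D j) \<and> (\<forall>t\<in>{0..T}. D j t = D j 0 + integral {0..t} (D (Suc j))))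
     \<and> (\<forall>j\<le>m. D j absolutely_integrable_on {0..T} \<and> integral {0..T} (\<lambda>x. \<bar>D j x\<bar>) <= (T + 1) * \<rho>)"
proof -
  obtain P P' B where "smooth_ramp P P' B" using smooth_ramp_exists by blast
  then interpret smooth_ramp P P' B .
  have "\<forall>j. \<exists>w. j <= m --> in_Lp T p w \<and> has_weak_deriv T j u w" using u unfolding in_Wmp_def by blast
  then obtain w where w: "\<And>j. j <= m ==> in_Lp T p (w j)" "\<And>j. j <= m ==> has_weak_deriv T j u (w j)" by metis
  have nw: "Lp_norm T p (w j) <= \<rho>" if j: "j <= m" for j
  proof -
    have "has_weak_deriv T j u (weak_deriv T j u)" unfolding weak_deriv_def by (rule someI[of _ "w j"]) (rule w(2)[OF j])
    hence "Lp_norm T p (w j) = Lp_norm T p (weak_deriv T j u)"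
      using w[OF j] by (intro Lp_norm_AE_eq weak_deriv_unique) (auto simp: in_Lp_def)
    also have "\<dots> <= Wmp_norm T m p u" unfolding Wmp_norm_def
      by (rule member_le_sum[where f="\<lambda>j. Lp_norm T p (weak_deriv T j u)"]) (use j Lp_norm_nonneg in auto)
    finally show ?thesis using \<rho>(1) by linarith
  qed
  have int: "integrable (I_leb T) (w j)" "integral {0..T} (\<lambda>x. \<bar>w j x\<bar>) <= (T + 1) * \<rho>" if "j <= m" for j
    using in_Lp_L1[OF w(1)[OF that] p T nw[OF that] \<rho>(2)] by auto
  have "\<exists>\<kappa>. AE x in I_leb T. w j x = \<kappa> + integral {0..x} (w (Suc j))" if j: "j < m" for j
  proof (rule primitive_if_tests)
    show "integrable (I_leb T) (w j)" "integrable (I_leb T) (w (Suc j))" using int j by auto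
    fix \<phi> assume \<phi>: "test_function T \<phi>"
    have "(LINT s|I_leb T. u s * (deriv ^^ j) (deriv \<phi>) s) = (-1) ^ j * (LINT s|I_leb T. w j s * deriv \<phi> s)"
      using w(2)[of j] j test_function_deriv[OF \<phi>] by (auto simp: has_weak_deriv_def)
    moreover have "(LINT s|I_leb T. u s * (deriv ^^ Suc j) \<phi> s) = (-1) ^ Suc j * (LINT s|I_leb T. w (Suc j) s * \<phi> s)"
      using w(2)[of "Suc j"] j \<phi> by (auto simp: has_weak_deriv_def simp del: funpow.simps)
    moreover have "(deriv ^^ j) (deriv \<phi>) = (deriv ^^ Suc j) \<phi>" by (simp add: funpow_swap1)
    ultimately have "(-1) ^ j * (LINT s|I_leb T. w j s * deriv \<phi> s) = (-1) ^ j * (- (LINT s|I_leb T. w (Suc j) s * \<phi> s))" by simp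
    thus "(LINT s|I_leb T. w j s * deriv \<phi> s) = - (LINT s|I_leb T. w (Suc j) s * \<phi> s)"
      by (simp only: mult_cancel_left) simp
  qed (rule T)
  hence "\<forall>j. \<exists>\<kappa>. j < m --> (AE x in I_leb T. w j x = \<kappa> + integral {0..x} (w (Suc j)))" by blast
  then obtain \<kappa> where \<kappa>: "\<And>j. j < m ==> AE x in I_leb T. w j x = \<kappa> j + integral {0..x} (w (Suc j))" by metis
  \<comment> \<open>Below the top order the continuous representative is taken; the top derivative
    is merely integrable and kept as it is.\<close>
  define D where "D j x = (if j < m then \<kappa> j + integral {0..x} (w (Suc j)) else w j x)" for j x
  have Dw: "AE x in I_leb T. w j x = D j x" if "j <= m" for j
    using \<kappa>[of j] by (cases "j < m") (auto simp: D_def)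
  have wi: "w j absolutely_integrable_on {0..T}" if "j <= m" for j using integrable_Icc_if[OF int(1)[OF that]] .
  have "has_weak_deriv T 0 u u" using w(2)[of 0] by (simp add: has_weak_deriv_def)
  hence "AE x in I_leb T. u x = w 0 x" using w(2)[of 0] by (intro weak_deriv_unique) auto
  hence DA: "AE x in I_leb T. u x = D 0 x" using Dw[of 0] by auto
  have DB: "continuous_on {0..T} (D j)" "D j t = D j 0 + integral {0..t} (D (Suc j))" if j: "j < m" and t: "t \<in> {0..T}" for j t
  proof -
    have "w (Suc j) integrable_on {0..T}" using wi[of "Suc j"] j by (auto simp: absolutely_integrable_on_def)
    hence "continuous_on {0..T} (\<lambda>x. \<kappa> j + integral {0..x} (w (Suc j)))"
      by (intro continuous_intros indefinite_integral_continuous_1)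
    thus "continuous_on {0..T} (D j)" using j by (simp add: D_def[abs_def])
    have "integral {0..t} (w (Suc j)) = integral {0..t} (D (Suc j))" by (rule integral_AE_eq[OF Dw]) (use j t in auto)
    thus "D j t = D j 0 + integral {0..t} (D (Suc j))" using j by (simp add: D_def)
  qed
  have DC: "D j absolutely_integrable_on {0..T}" "integral {0..T} (\<lambda>x. \<bar>D j x\<bar>) <= (T + 1) * \<rho>" if j: "j <= m" for j
  proof -
    show "D j absolutely_integrable_on {0..T}"
      by (rule absolutely_integrable_spike[OF wi[OF j] AE_negligible[OF Dw[OF j]]]) auto
    have "integral {0..T} (\<lambda>x. \<bar>w j x\<bar>) = integral {0..T} (\<lambda>x. \<bar>D j x\<bar>)"
      by (rule integral_AE_eq[where T=T]) (use Dw[OF j] in \<open>auto elim: eventually_mono\<close>)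
    thus "integral {0..T} (\<lambda>x. \<bar>D j x\<bar>) <= (T + 1) * \<rho>" using int(2)[OF j] by simp
  qed
  have "0 \<in> {0..T}" using T by simp
  show ?thesis
    by (rule exI[of _ D], intro conjI allI impI ballI)
      (rule DA, erule DB(1)[OF _ \<open>0 \<in> {0..T}\<close>], erule (1) DB(2), erule DC(1), erule DC(2))
qed

section \<open>Interpolation\<close>

text \<open>A Landau-type inequality in L1: on \<open>{t..t + h}\<close> the derivative
  \<open>F1\<close> differs from the difference quotient of \<open>F\<close> by at most the mass of
  \<open>\<bar>F2\<bar>\<close> there. Used at both ends of the interval, it covers
  \<open>{0..T}\<close> because \<open>h <= T / 2\<close>.\<close>

lemma interpolation_step:
  fixes F F1 F2 :: "real => real"
  assumes c: "continuous_on {0..T} F" "continuous_on {0..T} F1" and F2: "F2 absolutely_integrable_on {0..T}"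
    and F: "\<And>t. t \<in> {0..T} ==> F t = F 0 + integral {0..t} F1" and F1: "\<And>t. t \<in> {0..T} ==> F1 t = F1 0 + integral {0..t} F2"
    and h: "0 < h" "h <= T / 2"
  shows "integral {0..T} (\<lambda>t. \<bar>F1 t\<bar>) <= 4 / h * integral {0..T} (\<lambda>t. \<bar>F t\<bar>) + 2 * h * integral {0..T} (\<lambda>t. \<bar>F2 t\<bar>)"
proof -
  define \<Gamma> where "\<Gamma> t = integral {0..t} (\<lambda>s. \<bar>F2 s\<bar>)" for t
  have i2: "F2 integrable_on {0..T}" "(\<lambda>s. \<bar>F2 s\<bar>) integrable_on {0..T}" using F2 by (auto simp: absolutely_integrable_on_def)
  have i1: "F1 integrable_on {0..T}" by (rule integrable_continuous_real[OF c(2)])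
  note sub = integral_Icc_sub and diff = integral_Icc_diff
  have c\<Gamma>: "continuous_on {0..T} \<Gamma>" unfolding \<Gamma>_def by (rule indefinite_integral_continuous_1[OF i2(2)])
  have \<Gamma>mono: "\<Gamma> x <= \<Gamma> y" if "0 <= x" "x <= y" "y <= T" for x y
    using diff[OF i2(2) that] integral_nonneg[OF sub[OF i2(2), of x y]] that by (simp add: \<Gamma>_def)
  have \<Gamma>0: "0 <= \<Gamma> x" if "x \<in> {0..T}" for x using \<Gamma>mono[of 0 x] that by (simp add: \<Gamma>_def)
  have F1d: "\<bar>F1 y - F1 x\<bar> <= \<Gamma> y - \<Gamma> x" if xy: "0 <= x" "x <= y" "y <= T" for x y
  proof -
    have "F1 y - F1 x = integral {x..y} F2" using F1[of x] F1[of y] diff[OF i2(1) xy] xy by simp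
    also have "norm \<dots> <= integral {x..y} (\<lambda>s. \<bar>F2 s\<bar>)"
      by (rule integral_norm_bound_integral) (use sub[OF i2(1) xy(1,3)] sub[OF i2(2) xy(1,3)] in auto)
    finally show ?thesis using diff[OF i2(2) xy] by (simp add: \<Gamma>_def)
  qed
  define R where "R t = \<bar>F (t + h)\<bar> + \<bar>F t\<bar> + h * (\<Gamma> (t + h) - \<Gamma> t)" for t
  have pt: "h * \<bar>F1 z\<bar> <= R t" if t: "t \<in> {0..T - h}" and z: "z \<in> {t, t + h}" for t z
  proof -
    have t': "0 <= t" "t <= t + h" "t + h <= T" using t h by auto
    have ii: "F1 integrable_on {t..t+h}" by (rule sub[OF i1 t'(1,3)])
    have "h * F1 z - (F (t + h) - F t) = integral {t..t+h} (\<lambda>s. F1 z) - integral {t..t+h} F1"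
      using F[of t] F[of "t + h"] diff[OF i1 t'] t' h by simp
    also have "\<dots> = integral {t..t+h} (\<lambda>s. F1 z - F1 s)"
      by (rule Henstock_Kurzweil_Integration.integral_diff[symmetric]) (use ii in auto)
    also have "norm \<dots> <= integral {t..t+h} (\<lambda>s. \<Gamma> (t + h) - \<Gamma> t)"
    proof (rule integral_norm_bound_integral)
      show "(\<lambda>s. F1 z - F1 s) integrable_on {t..t+h}" by (intro Henstock_Kurzweil_Integration.integrable_diff ii) auto
      fix s assume s: "s \<in> {t..t+h}"
      show "norm (F1 z - F1 s) <= \<Gamma> (t + h) - \<Gamma> t"
        using z F1d[of t s] F1d[of s "t + h"] \<Gamma>mono[of t s] \<Gamma>mono[of s "t + h"] s t' by auto
    qed auto
    also have "\<dots> = h * (\<Gamma> (t + h) - \<Gamma> t)" using h by simp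
    finally have "\<bar>h * F1 z\<bar> <= R t" unfolding R_def real_norm_def by linarith
    thus ?thesis using h by (simp add: abs_mult)
  qed
  have hT: "0 <= T - h" "h <= T - h" "T - h + h = T" using h by auto
  have sh: "integral {0..T - h} (\<lambda>t. G (t + h)) = integral {h..T} G" "continuous_on {0..T - h} (\<lambda>t. G (t + h))"
    if "continuous_on {0..T} G" for G :: "real => real"
  proof -
    have "continuous_on {h..T} G" using that h by (auto intro: continuous_on_subset)
    thus "integral {0..T - h} (\<lambda>t. G (t + h)) = integral {h..T} G" using integral_shift[of 0 h "T - h" G] by (simp add: o_def)
    show "continuous_on {0..T - h} (\<lambda>t. G (t + h))"
      by (rule continuous_on_compose2[OF that]) (use h in \<open>auto intro: continuous_intros\<close>)
  qed
  have s0: "continuous_on {0..T - h} G" if "continuous_on {0..T} G" for G :: "real => real"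
    using that h by (auto intro: continuous_on_subset)
  have ca: "continuous_on {0..T} (\<lambda>t. \<bar>F t\<bar>)" "continuous_on {0..T} (\<lambda>t. \<bar>F1 t\<bar>)" by (intro continuous_intros c)+
  have cR: "continuous_on {0..T - h} R" unfolding R_def
    by (intro continuous_intros sh(2)[OF ca(1)] sh(2)[OF c\<Gamma>] s0[OF ca(1)] s0[OF c\<Gamma>])
  have le: "integral {x..y} G <= integral {0..T} G" if "continuous_on {0..T} G" "\<And>t. t \<in> {0..T} ==> 0 <= G t" "0 <= x" "y <= T" for G :: "real => real" and x y
    by (rule integral_subset_le) (use that integrable_continuous_real[OF that(1)] sub in auto)
  have "((\<lambda>t. \<bar>F (t + h)\<bar> + \<bar>F t\<bar> + h * (\<Gamma> (t + h) - \<Gamma> t)) has_integral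
     integral {h..T} (\<lambda>t. \<bar>F t\<bar>) + integral {0..T - h} (\<lambda>t. \<bar>F t\<bar>) + h * (integral {h..T} \<Gamma> - integral {0..T - h} \<Gamma>)) {0..T - h}"
    unfolding sh(1)[OF ca(1), symmetric] sh(1)[OF c\<Gamma>, symmetric]
    by (intro has_integral_add has_integral_mult_right has_integral_diff integrable_integral integrable_continuous_real
        sh(2)[OF ca(1)] sh(2)[OF c\<Gamma>] s0[OF ca(1)] s0[OF c\<Gamma>])
  hence "integral {0..T - h} R = integral {h..T} (\<lambda>t. \<bar>F t\<bar>) + integral {0..T - h} (\<lambda>t. \<bar>F t\<bar>) + h * (integral {h..T} \<Gamma> - integral {0..T - h} \<Gamma>)"
    unfolding R_def[abs_def] by (rule integral_unique)
  also have "\<dots> <= 2 * integral {0..T} (\<lambda>t. \<bar>F t\<bar>) + h * (h * \<Gamma> T)"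
  proof -
    \<comment> \<open>The two shifted integrals cancel except on end intervals of length
      \<open>h\<close>, which gives the second factor \<open>h\<close>.\<close>
    have "integral {h..T} \<Gamma> - integral {0..T - h} \<Gamma> = integral {T - h..T} \<Gamma> - integral {0..h} \<Gamma>"
      using diff[OF integrable_continuous_real[OF c\<Gamma>], of h T] diff[OF integrable_continuous_real[OF c\<Gamma>], of "T - h" T] h by simp
    also have "\<dots> <= integral {T - h..T} \<Gamma>" using integral_nonneg[OF sub[OF integrable_continuous_real[OF c\<Gamma>], of 0 h]] \<Gamma>0 h by auto
    also have "\<dots> <= integral {T - h..T} (\<lambda>t. \<Gamma> T)"
      by (rule integral_le) (use h \<Gamma>mono sub[OF integrable_continuous_real[OF c\<Gamma>]] in auto)
    finally have "h * (integral {h..T} \<Gamma> - integral {0..T - h} \<Gamma>) <= h * (h * \<Gamma> T)" using h by simp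
    moreover have "integral {h..T} (\<lambda>t. \<bar>F t\<bar>) <= integral {0..T} (\<lambda>t. \<bar>F t\<bar>)" "integral {0..T - h} (\<lambda>t. \<bar>F t\<bar>) <= integral {0..T} (\<lambda>t. \<bar>F t\<bar>)"
      using h by (auto intro!: le ca)
    ultimately show ?thesis by linarith
  qed
  finally have IR: "integral {0..T - h} R <= 2 * integral {0..T} (\<lambda>t. \<bar>F t\<bar>) + h * (h * \<Gamma> T)" .
  have "h * integral {0..T - h} (\<lambda>t. \<bar>F1 t\<bar>) = integral {0..T - h} (\<lambda>t. h * \<bar>F1 t\<bar>)" by simp
  also have "\<dots> <= integral {0..T - h} R"
    by (rule integral_le) (use pt in \<open>auto intro!: integrable_continuous_real cR s0 ca continuous_intros\<close>)
  finally have a1: "h * integral {0..T - h} (\<lambda>t. \<bar>F1 t\<bar>) <= integral {0..T - h} R" .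
  have "h * integral {h..T} (\<lambda>t. \<bar>F1 t\<bar>) = integral {0..T - h} (\<lambda>t. h * \<bar>F1 (t + h)\<bar>)" using sh(1)[OF ca(2)] by simp
  also have "\<dots> <= integral {0..T - h} R"
    by (rule integral_le) (use pt in \<open>auto intro!: integrable_continuous_real cR sh ca continuous_intros\<close>)
  finally have a2: "h * integral {h..T} (\<lambda>t. \<bar>F1 t\<bar>) <= integral {0..T - h} R" .
  have "integral {0..T} (\<lambda>t. \<bar>F1 t\<bar>) <= integral {0..T - h} (\<lambda>t. \<bar>F1 t\<bar>) + integral {h..T} (\<lambda>t. \<bar>F1 t\<bar>)"
    using diff[OF integrable_continuous_real[OF ca(2)], of "T - h" T] h
      integral_subset_le[of "{T - h..T}" "{h..T}" "\<lambda>t. \<bar>F1 t\<bar>"] sub[OF integrable_continuous_real[OF ca(2)]] by auto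
  hence "h * integral {0..T} (\<lambda>t. \<bar>F1 t\<bar>) <= h * integral {0..T - h} (\<lambda>t. \<bar>F1 t\<bar>) + h * integral {h..T} (\<lambda>t. \<bar>F1 t\<bar>)"
    unfolding distrib_left[symmetric] using h by (intro mult_left_mono) auto
  also have "\<dots> <= 2 * (2 * integral {0..T} (\<lambda>t. \<bar>F t\<bar>) + h * (h * \<Gamma> T))" using add_mono[OF order_trans[OF a1 IR] order_trans[OF a2 IR]] by (simp only: mult_2)
  finally show ?thesis using h by (simp add: \<Gamma>_def field_simps)
qed

text \<open>Log-convexity bounds \<open>a k\<close> by a constant times the geometric mean of
  \<open>a 0\<close> and \<open>a n\<close> with weights \<open>1 - k/n\<close> and
  \<open>k/n\<close>; the \<open>n\<close>-th power keeps the exponents integral. \<open>K\<close>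
  is chosen before the sequence.\<close>

lemma log_convex_power:
  fixes C :: real
  assumes C: "C \<ge> 1"
  shows "\<exists>K\<ge>1. \<forall>a. (\<forall>j. 0 <= a j) --> (\<forall>j. 0 < j \<and> j < n --> (a j)\<^sup>2 <= C * a (j - 1) * a (Suc j)) -->
     k <= n --> 0 < k --> (a k :: real) ^ n <= K * a 0 ^ (n - k) * a n ^ k"
proof -
  \<comment> \<open>First \<open>a j\<close> against \<open>a 0\<close> and its right neighbour, by
    induction on \<open>j\<close>; a power of the middle term appears on both sides and is
    cancelled.\<close>
  have step: "\<exists>K\<ge>1. \<forall>a. (\<forall>j. 0 <= a j) --> (\<forall>j. 0 < j \<and> j < n --> (a j)\<^sup>2 <= C * a (j - 1) * a (Suc j)) -->
     j < n --> (a j :: real) ^ Suc j <= K * a 0 * a (Suc j) ^ j" for j n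
  proof (induction j)
    case 0
    thus ?case by (intro exI[of _ 1]) simp
  next
    case (Suc j)
    then obtain K where K: "K \<ge> 1" "\<And>a. (\<forall>j. 0 <= a j) ==> (\<forall>j. 0 < j \<and> j < n --> (a j)\<^sup>2 <= C * a (j - 1) * a (Suc j)) ==>
     j < n ==> (a j :: real) ^ Suc j <= K * a 0 * a (Suc j) ^ j" by blast
    have "a (Suc j) ^ Suc (Suc j) <= (C ^ Suc j * K) * a 0 * a (Suc (Suc j)) ^ Suc j"
      if a: "\<forall>j. 0 <= a j" "\<forall>j. 0 < j \<and> j < n --> (a j)\<^sup>2 <= C * a (j - 1) * a (Suc j)" and j: "Suc j < n" for a :: "nat => real"
    proof (cases "a (Suc j) = 0")
      case False
      hence "a (Suc j) > 0" using a(1)[rule_format, of "Suc j"] by linarith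
      hence pos: "a (Suc j) ^ j > 0" by (rule zero_less_power)
      have "a (Suc j) ^ Suc (Suc j) * a (Suc j) ^ j = ((a (Suc j))\<^sup>2) ^ Suc j"
      proof -
        have "Suc (Suc j) + j = 2 * Suc j" by simp
        thus ?thesis by (simp only: power_add[symmetric] power_mult[symmetric])
      qed
      also have "\<dots> <= (C * a j * a (Suc (Suc j))) ^ Suc j" using a(2)[rule_format, of "Suc j"] j by (intro power_mono) auto
      also have "\<dots> = C ^ Suc j * a (Suc (Suc j)) ^ Suc j * a j ^ Suc j" by (simp only: power_mult_distrib mult_ac)
      also have "\<dots> <= C ^ Suc j * a (Suc (Suc j)) ^ Suc j * (K * a 0 * a (Suc j) ^ j)"
        using K(2)[OF a] j a(1) C by (intro mult_left_mono mult_nonneg_nonneg zero_le_power) auto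
      also have "\<dots> = ((C ^ Suc j * K) * a 0 * a (Suc (Suc j)) ^ Suc j) * a (Suc j) ^ j" by (simp only: mult_ac)
      finally show ?thesis using pos by (simp only: mult_le_cancel_right_pos)
    qed (use a(1) K(1) C in simp)
    moreover have "C ^ Suc j * K \<ge> 1" using C K(1) mult_mono[of 1 "C ^ Suc j" 1 K] by (simp add: one_le_power del: power_Suc)
    ultimately show ?case by blast
  qed
  show ?thesis
  proof (cases "0 < k")
    case k: True
    show ?thesis
    proof (induction n)
      case 0
      thus ?case by (intro exI[of _ 1]) (use k in simp)
    next
      case (Suc n)
      obtain K where K: "K \<ge> 1" "\<And>a. (\<forall>j. 0 <= a j) ==> (\<forall>j. 0 < j \<and> j < n --> (a j)\<^sup>2 <= C * a (j - 1) * a (Suc j)) ==>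
         k <= n ==> (a k :: real) ^ n <= K * a 0 ^ (n - k) * a n ^ k" using Suc k by blast
      obtain L where L: "L \<ge> 1" "\<And>a. (\<forall>j. 0 <= a j) ==> (\<forall>j. 0 < j \<and> j < Suc n --> (a j)\<^sup>2 <= C * a (j - 1) * a (Suc j)) ==>
         (a n :: real) ^ Suc n <= L * a 0 * a (Suc n) ^ n" using step[of "Suc n" n] by blast
      define M where "M = K ^ Suc n * L ^ k"
      have M: "M \<ge> 1" unfolding M_def using mult_mono[of 1 "K ^ Suc n" 1 "L ^ k"] K(1) L(1) by (simp add: one_le_power del: power_Suc)
      have "a k ^ Suc n <= M * a 0 ^ (Suc n - k) * a (Suc n) ^ k"
        if a: "\<forall>j. 0 <= a j" "\<forall>j. 0 < j \<and> j < Suc n --> (a j)\<^sup>2 <= C * a (j - 1) * a (Suc j)" and kn: "k <= Suc n" for a :: "nat => real"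
      proof (cases "k = Suc n")
        case True
        thus ?thesis using M mult_right_mono[of 1 M "a (Suc n) ^ Suc n"] a(1) by simp
      next
        case False
        hence kn: "k <= n" "0 < n" using kn k by auto
        \<comment> \<open>The bound for \<open>n\<close> is combined with the neighbouring bound for
          \<open>a n\<close>, raised to powers that eliminate \<open>a n\<close>; an
          \<open>n\<close>-th root is taken at the end.\<close>
        have "(a k ^ Suc n) ^ n = (a k ^ n) ^ Suc n" by (simp only: power_mult[symmetric] mult.commute)
        also have "\<dots> <= (K * a 0 ^ (n - k) * a n ^ k) ^ Suc n" using K(2)[of a] a kn by (intro power_mono) auto
        also have "\<dots> = K ^ Suc n * (a 0 ^ (n - k)) ^ Suc n * (a n ^ Suc n) ^ k"
          by (simp only: power_mult_distrib power_mult[symmetric] mult.commute)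
        also have "\<dots> <= K ^ Suc n * (a 0 ^ (n - k)) ^ Suc n * (L * a 0 * a (Suc n) ^ n) ^ k"
          using L(2)[OF a] a(1) K(1) by (intro mult_left_mono power_mono mult_nonneg_nonneg zero_le_power) auto
        also have "\<dots> = M * (a 0 ^ ((n - k) * Suc n) * a 0 ^ k) * (a (Suc n) ^ k) ^ n"
          by (simp only: M_def power_mult_distrib power_mult[symmetric] mult_ac)
        also have "a 0 ^ ((n - k) * Suc n) * a 0 ^ k = (a 0 ^ (Suc n - k)) ^ n"
        proof -
          have "(n - k) * Suc n + k = (Suc n - k) * n" using kn(1) by (simp add: Suc_diff_le add_mult_distrib)
          thus ?thesis by (simp only: power_add[symmetric] power_mult[symmetric])
        qed
        also have "M * (a 0 ^ (Suc n - k)) ^ n * (a (Suc n) ^ k) ^ n <= M ^ n * (a 0 ^ (Suc n - k)) ^ n * (a (Suc n) ^ k) ^ n"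
          using M kn(2) a(1) self_le_power[OF M kn(2)] by (intro mult_right_mono) auto
        also have "\<dots> = (M * a 0 ^ (Suc n - k) * a (Suc n) ^ k) ^ n" by (simp only: power_mult_distrib)
        finally show ?thesis using kn(2) a(1) M by (subst (asm) power_mono_iff) auto
      qed
      thus ?case using M by blast
    qed
  qed (auto intro: exI[of _ 1])
qed

text \<open>The choice \<open>h = sqrt (A / B)\<close> balances the two terms: then
  \<open>a <= 6 * (h * B)\<close> and \<open>A <= h * B\<close>, whence \<open>49 = 7^2\<close>. If
  this \<open>h\<close> exceeds \<open>H\<close>, then \<open>A > H^2 * B\<close> and the bound
  \<open>A + a <= B\<close> suffices.\<close>

lemma sqrt_optimization:
  fixes a A B C H :: real
  assumes nn: "0 <= a" "0 <= A" "0 <= B" "0 < H" and le: "\<And>h. 0 < h ==> h <= H ==> a <= 4 / h * A + 2 * h * B"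
    and mono: "A + a <= B"
    and C: "49 <= C" "1 / H\<^sup>2 <= C"
  shows "(A + a)\<^sup>2 <= C * A * B"
proof (cases "A = 0")
  case True
  have "a <= 0"
  proof (rule field_le_epsilon)
    fix e :: real assume e: "e > 0"
    define h where "h = min H (e / (2 * B + 1))"
    have h: "0 < h" "h <= H" using e nn by (auto simp: h_def)
    have "2 * h * B <= 2 * (e / (2 * B + 1)) * B" using nn by (intro mult_right_mono mult_left_mono) (auto simp: h_def)
    also have "\<dots> <= e" using e nn by (simp add: field_simps)
    finally show "a <= 0 + e" using le[OF h] True by simp
  qed
  thus ?thesis using True nn by simp
next
  case False
  hence A: "A > 0" using nn by simp
  hence B: "B > 0" using mono nn by linarith
  show ?thesis
  proof (cases "A <= H\<^sup>2 * B")
    case True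
    define h where "h = sqrt (A / B)"
    have h: "0 < h" "h\<^sup>2 = A / B" using A B by (auto simp: h_def)
    have "A / B <= H\<^sup>2" using True B by (simp add: pos_divide_le_eq)
    hence "h\<^sup>2 <= H\<^sup>2" using h(2) by simp
    hence hH: "h <= H" by (rule power2_le_imp_le) (use nn in simp)
    have "h * (h * B) = h\<^sup>2 * B" by (simp add: power2_eq_square)
    also have "\<dots> = A" unfolding h(2) using B by simp
    finally have hB: "A = h * (h * B)" by (rule sym)
    have "a <= 4 / h * A + 2 * h * B" by (rule le[OF h(1) hH])
    also have "\<dots> = 6 * (h * B)" using h(1) by (subst hB) simp
    finally have "a <= 6 * (h * B)" .
    moreover have "A <= h * B"
    proof -
      have "A\<^sup>2 <= A * B" using A mono nn by (simp add: power2_eq_square)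
      also have "\<dots> = (h * B)\<^sup>2" using hB by (simp add: power2_eq_square)
      finally show ?thesis by (rule power2_le_imp_le) (use h B in simp)
    qed
    ultimately have "(A + a)\<^sup>2 <= (7 * (h * B))\<^sup>2" using nn A by (intro power_mono) auto
    also have "\<dots> = 49 * (A * B)" using hB by (simp add: power2_eq_square)
    also have "\<dots> <= C * (A * B)" using C A B by (intro mult_right_mono) auto
    finally show ?thesis by (simp add: mult.assoc)
  next
    case False
    have "(A + a)\<^sup>2 <= B\<^sup>2" using mono nn by (intro power_mono) auto
    also have "\<dots> <= (1 / H\<^sup>2) * A * B" using False B nn by (simp add: power2_eq_square field_simps)
    also have "\<dots> <= C * A * B" using C A B by (intro mult_right_mono) auto
    finally show ?thesis .
  qed
qed

lemma norm1_prim: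
  assumes u: "continuous_on {0..T} u" and T: "0 < T"
  shows "integral {0..T} (\<lambda>t. \<bar>prim u l t\<bar>) <= T ^ l * integral {0..T} (\<lambda>t. \<bar>u t\<bar>)"
proof (induction l)
  case (Suc l)
  have c: "continuous_on {0..T} (\<lambda>t. \<bar>prim u l t\<bar>)" for l by (intro continuous_intros prim_continuous u)
  have "integral {0..T} (\<lambda>t. \<bar>prim u (Suc l) t\<bar>) <= integral {0..T} (\<lambda>t. integral {0..T} (\<lambda>t. \<bar>prim u l t\<bar>))"
  proof (rule integral_le)
    fix t assume t: "t \<in> {0..T}"
    have cu: "continuous_on {0..t} (prim u l)" "continuous_on {0..t} (\<lambda>t. \<bar>prim u l t\<bar>)"
      using t by (auto intro: continuous_on_subset[OF prim_continuous[OF u]] continuous_on_subset[OF c])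
    have "\<bar>prim u (Suc l) t\<bar> <= integral {0..t} (\<lambda>t. \<bar>prim u l t\<bar>)"
      using integral_norm_bound_integral[OF integrable_continuous_real[OF cu(1)] integrable_continuous_real[OF cu(2)]] by simp
    also have "\<dots> <= integral {0..T} (\<lambda>t. \<bar>prim u l t\<bar>)"
      by (rule integral_subset_le) (use t integrable_continuous_real[OF cu(2)] integrable_continuous_real[OF c] in auto)
    finally show "\<bar>prim u (Suc l) t\<bar> <= integral {0..T} (\<lambda>t. \<bar>prim u l t\<bar>)" .
  qed (use integrable_continuous_real[OF c[of "Suc l"]] in auto)
  also have "\<dots> = T * integral {0..T} (\<lambda>t. \<bar>prim u l t\<bar>)" using T by simp
  also have "\<dots> <= T * (T ^ l * integral {0..T} (\<lambda>t. \<bar>u t\<bar>))" using Suc T by (intro mult_left_mono) auto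
  finally show ?case by (simp add: mult.assoc del: prim.simps)
qed simp

text \<open>The \<open>k\<close>-th primitive and the \<open>m\<close>-th derivative are the ends of
  one chain of \<open>m + k\<close> integrations, with the control at position \<open>k\<close>;
  log-convexity of the norms along the chain gives the exponents.\<close>

lemma sobolev_interpolation_single:
  assumes p: "p \<ge> 1" and T: "0 < T" and m: "m \<ge> 1" and k: "k \<ge> 1"
  shows "\<exists>C>0. \<forall>u \<rho>. in_Wmp T m p u --> Wmp_norm T m p u <= \<rho> --> 0 < \<rho> -->
     (\<exists>u'. continuous_on {0..T} u' \<and> (AE x in I_leb T. u x = u' x) \<and> integral {0..T} (\<lambda>t. \<bar>u' t\<bar>) <= C * \<rho> \<and>
       integral {0..T} (\<lambda>t. \<bar>u' t\<bar>) ^ (2 * (m + k)) <= C * integral {0..T} (\<lambda>t. (prim u' k t)\<^sup>2) ^ m * \<rho> ^ (2 * k))"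
proof -
  define n where "n = m + k"
  \<comment> \<open>The two thresholds of \<open>sqrt_optimization\<close> for
    \<open>H = T / 2\<close>.\<close>
  define c where "c = max 49 (1 / (T / 2)\<^sup>2)"
  have c1: "c \<ge> 1" by (simp add: c_def)
  obtain K where K: "K \<ge> 1" "\<And>a :: nat => real. (\<forall>j. 0 <= a j) ==> (\<forall>j. 0 < j \<and> j < n --> (a j)\<^sup>2 <= c * a (j - 1) * a (Suc j)) ==>
     k <= n ==> 0 < k ==> a k ^ n <= K * a 0 ^ (n - k) * a n ^ k" using log_convex_power[OF c1, of n k] by blast
  define E where "E = real (Suc n) * ((T + 1) ^ k * (T + 1))"
  have E: "E > 0" using T by (simp add: E_def)
  define C where "C = max (T + 1) (K\<^sup>2 * T ^ m * E ^ (2 * k))"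
  have Cpos: "C > 0" using T by (simp add: C_def)
  have main: "\<exists>u'. continuous_on {0..T} u' \<and> (AE x in I_leb T. u x = u' x) \<and> integral {0..T} (\<lambda>t. \<bar>u' t\<bar>) <= C * \<rho> \<and>
       integral {0..T} (\<lambda>t. \<bar>u' t\<bar>) ^ (2 * (m + k)) <= C * integral {0..T} (\<lambda>t. (prim u' k t)\<^sup>2) ^ m * \<rho> ^ (2 * k)"
    if u: "in_Wmp T m p u" and \<rho>: "Wmp_norm T m p u <= \<rho>" "0 < \<rho>" for u \<rho>
  proof -
    obtain D where D: "AE x in I_leb T. u x = D 0 x"
      "\<And>j. j < m ==> continuous_on {0..T} (D j)" "\<And>j t. j < m ==> t \<in> {0..T} ==> D j t = D j 0 + integral {0..t} (D (Suc j))"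
      "\<And>j. j <= m ==> D j absolutely_integrable_on {0..T}" "\<And>j. j <= m ==> integral {0..T} (\<lambda>x. \<bar>D j x\<bar>) <= (T + 1) * \<rho>"
      using sobolev_chain[OF u p T \<rho>] by blast
    have cu: "continuous_on {0..T} (D 0)" using D(2) m by simp
    define F where "F j = (if j <= k then prim (D 0) (k - j) else D (j - k))" for j
    have cF: "continuous_on {0..T} (F j)" if "j < n" for j
      using that D(2)[of "j - k"] prim_continuous[OF cu] by (auto simp: F_def n_def)
    have aF: "F j absolutely_integrable_on {0..T}" if "j <= n" for j
    proof (cases "j < n")
      case False
      hence "F j = D m" using that m by (auto simp: F_def n_def)
      thus ?thesis using D(4)[of m] by simp
    qed (auto intro: absolutely_integrable_continuous_real cF)
    have rF: "F j t = F j 0 + integral {0..t} (F (Suc j))" if j: "j < n" and t: "t \<in> {0..T}" for j t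
    proof (cases "j < k")
      case True
      hence "k - j = Suc (k - Suc j)" by simp
      with True show ?thesis by (simp add: F_def)
    next
      case False
      hence "F j = D (j - k)" "F (Suc j) = D (Suc (j - k))" by (auto simp: F_def Suc_diff_le)
      thus ?thesis using D(3)[of "j - k" t] False j t by (simp add: n_def)
    qed
    define b where "b i = (if i <= n then integral {0..T} (\<lambda>t. \<bar>F i t\<bar>) else 0)" for i
    \<comment> \<open>On a bounded interval the inequality between consecutive orders needs terms of
      lower order; partial sums of the norms contain them and supply the monotonicity required by
      \<open>sqrt_optimization\<close>.\<close>
    define a where "a j = (\<Sum>i\<le>j. b i)" for j
    have b0: "0 <= b i" for i
    proof (cases "i <= n")
      case True
      hence "(\<lambda>t. \<bar>F i t\<bar>) integrable_on {0..T}" using aF[of i] by (auto simp: absolutely_integrable_on_def)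
      thus ?thesis using True by (auto simp: b_def intro: integral_nonneg)
    qed (simp add: b_def)
    hence a0: "\<forall>j. 0 <= a j" by (auto simp: a_def intro: sum_nonneg)
    have conv: "(a j)\<^sup>2 <= c * a (j - 1) * a (Suc j)" if j: "0 < j" "j < n" for j
    proof -
      obtain l where l: "j = Suc l" using j by (cases j) auto
      have aj: "a j = a l + b j" "a (Suc j) = a l + b j + b (Suc j)" by (simp_all add: a_def l)
      have bl: "b l <= a l" unfolding a_def by (rule member_le_sum) (use b0 in auto)
      have "(a l + b j)\<^sup>2 <= c * a l * a (Suc j)"
      proof (rule sqrt_optimization[where H="T / 2"])
        fix h assume h: "0 < h" "h <= T / 2"
        have "b j <= 4 / h * b l + 2 * h * b (Suc j)"
          using interpolation_step[OF cF[of l] cF[of "Suc l"] aF[of "Suc (Suc l)"] rF[of l] rF[of "Suc l"] h] j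
          by (simp add: b_def l)
        also have "\<dots> <= 4 / h * a l + 2 * h * a (Suc j)"
          using bl h b0 a0 aj by (intro add_mono mult_left_mono) auto
        finally show "b j <= 4 / h * a l + 2 * h * a (Suc j)" .
      qed (use a0 b0 T aj in \<open>auto simp: c_def\<close>)
      thus ?thesis using aj l by simp
    qed
    have kn: "k <= n" "0 < k" "n - k = m" using k by (auto simp: n_def)
    have ak: "a k ^ n <= K * a 0 ^ m * a n ^ k" using K(2)[OF a0 _ kn(1,2)] conv kn(3) by auto
    have Fk: "F k = D 0" by (simp add: F_def)
    define N where "N = integral {0..T} (\<lambda>t. \<bar>D 0 t\<bar>)"
    define A where "A = integral {0..T} (\<lambda>t. (prim (D 0) k t)\<^sup>2)"
    have Nk: "N <= a k" "0 <= N"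
    proof -
      have "b k = N" using kn by (simp add: b_def Fk N_def)
      thus "0 <= N" using b0[of k] by simp
      show "N <= a k" unfolding a_def \<open>b k = N\<close>[symmetric] by (rule member_le_sum) (use b0 in auto)
    qed
    have N\<rho>: "N <= (T + 1) * \<rho>" using D(5)[of 0] by (simp add: N_def)
    have bn: "b i <= (T + 1) ^ k * (T + 1) * \<rho>" for i
    proof -
      have e: "(T + 1) ^ k \<ge> 1" using T by (simp add: one_le_power)
      have pos: "0 <= (T + 1) * \<rho>" using T \<rho> by simp
      have ge: "x <= (T + 1) ^ k * (T + 1) * \<rho>" if "x <= (T + 1) * \<rho>" for x
        using that mult_right_mono[OF e pos] by (simp add: mult.assoc)
      show ?thesis
      proof (cases "i <= k")
        case True
        have "b i <= T ^ (k - i) * N" using norm1_prim[OF cu T, of "k - i"] True by (simp add: b_def F_def N_def n_def)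
        also have "\<dots> <= (T + 1) ^ k * ((T + 1) * \<rho>)"
        proof (rule mult_mono)
          have "T ^ (k - i) <= (T + 1) ^ (k - i)" using T by (intro power_mono) auto
          also have "\<dots> <= (T + 1) ^ k" using T by (intro power_increasing) auto
          finally show "T ^ (k - i) <= (T + 1) ^ k" .
        qed (use N\<rho> Nk T in auto)
        finally show ?thesis by (simp add: mult.assoc)
      next
        case False
        thus ?thesis using D(5)[of "i - k"] pos by (intro ge) (auto simp: b_def F_def n_def)
      qed
    qed
    have an: "a n <= E * \<rho>"
    proof -
      have "a n <= (\<Sum>i\<le>n. (T + 1) ^ k * (T + 1) * \<rho>)" unfolding a_def by (intro sum_mono bn)
      thus ?thesis by (simp add: E_def mult.assoc)
    qed
    have F0: "F 0 = prim (D 0) k" by (simp add: F_def)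
    \<comment> \<open>Passes from the L1 norm of the \<open>k\<close>-th primitive to the L2 norm,
      in which the drift is coercive.\<close>
    have cs: "(a 0)\<^sup>2 <= T * A"
    proof -
      have "continuous_on {0..T} (\<lambda>t. \<bar>prim (D 0) k t\<bar>)" by (intro continuous_intros prim_continuous cu)
      from cauchy_schwarz_one[OF this T] show ?thesis by (simp add: a_def b_def F0 A_def)
    qed
    have "N ^ (2 * n) = (N ^ n)\<^sup>2" by (simp add: power_mult[symmetric] mult.commute)
    also have "\<dots> <= (K * a 0 ^ m * a n ^ k)\<^sup>2"
      using Nk ak order_trans[OF power_mono[OF Nk] ak] by (intro power_mono) auto
    also have "\<dots> = K\<^sup>2 * ((a 0)\<^sup>2) ^ m * a n ^ (2 * k)" by (simp add: power_mult_distrib power_mult[symmetric] mult.commute)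
    also have "\<dots> <= K\<^sup>2 * (T * A) ^ m * (E * \<rho>) ^ (2 * k)"
      using cs an a0 K(1) order_trans[OF zero_le_power2 cs] by (intro mult_mono power_mono mult_nonneg_nonneg) auto
    also have "\<dots> = (K\<^sup>2 * T ^ m * E ^ (2 * k)) * (A ^ m * \<rho> ^ (2 * k))" by (simp add: power_mult_distrib mult_ac)
    also have "\<dots> <= C * (A ^ m * \<rho> ^ (2 * k))"
    proof (rule mult_right_mono)
      have "A \<ge> 0" unfolding A_def
        by (rule integral_nonneg) (auto intro!: integrable_continuous_real continuous_intros prim_continuous cu)
      thus "0 <= A ^ m * \<rho> ^ (2 * k)" using \<rho> by simp
    qed (simp add: C_def)
    finally have "N ^ (2 * (m + k)) <= C * A ^ m * \<rho> ^ (2 * k)" by (simp add: n_def mult.assoc)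
    moreover have "N <= C * \<rho>" by (rule order_trans[OF N\<rho> mult_right_mono]) (use \<rho> in \<open>auto simp: C_def\<close>)
    ultimately show ?thesis using D(1) cu unfolding N_def A_def by blast
  qed
  show ?thesis by (rule exI[of _ C], rule conjI, rule Cpos, intro allI impI, rule main)
qed

lemma sobolev_interpolation:
  assumes p: "p \<ge> 1" and T: "0 < T" and m: "m \<ge> 1" and k: "k \<ge> 1"
  shows "\<exists>C>0. \<forall>u v \<rho>. in_Wmp T m p u --> in_Wmp T m p v --> Wmp_norm T m p u + Wmp_norm T m p v <= \<rho> --> 0 < \<rho> -->
     (\<exists>u' v'. continuous_on {0..T} u' \<and> continuous_on {0..T} v' \<and> (AE x in I_leb T. u x = u' x) \<and> (AE x in I_leb T. v x = v' x) \<and>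
       l1n T u' v' <= C * \<rho> \<and>
       l1n T u' v' ^ (2 * (m + k)) <= C * integral {0..T} (\<lambda>t. (prim u' k t)\<^sup>2 + (prim v' k t)\<^sup>2) ^ m * \<rho> ^ (2 * k))"
proof -
  obtain C where C: "C > 0" "\<And>u \<rho>. in_Wmp T m p u ==> Wmp_norm T m p u <= \<rho> ==> 0 < \<rho> ==>
     (\<exists>u'. continuous_on {0..T} u' \<and> (AE x in I_leb T. u x = u' x) \<and> integral {0..T} (\<lambda>t. \<bar>u' t\<bar>) <= C * \<rho> \<and>
       integral {0..T} (\<lambda>t. \<bar>u' t\<bar>) ^ (2 * (m + k)) <= C * integral {0..T} (\<lambda>t. (prim u' k t)\<^sup>2) ^ m * \<rho> ^ (2 * k))"
    using sobolev_interpolation_single[OF p T m k] by blast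
  define M where "M = max (2 * C) (2 ^ (2 * (m + k)) * (2 * C))"
  have M: "M > 0" using C by (simp add: M_def)
  have main: "\<exists>u' v'. continuous_on {0..T} u' \<and> continuous_on {0..T} v' \<and> (AE x in I_leb T. u x = u' x) \<and> (AE x in I_leb T. v x = v' x) \<and>
       l1n T u' v' <= M * \<rho> \<and>
       l1n T u' v' ^ (2 * (m + k)) <= M * integral {0..T} (\<lambda>t. (prim u' k t)\<^sup>2 + (prim v' k t)\<^sup>2) ^ m * \<rho> ^ (2 * k)"
    if uv: "in_Wmp T m p u" "in_Wmp T m p v" and \<rho>: "Wmp_norm T m p u + Wmp_norm T m p v <= \<rho>" "0 < \<rho>" for u v \<rho>
  proof -
    have nn: "0 <= Wmp_norm T m p w" for w unfolding Wmp_norm_def by (intro sum_nonneg Lp_norm_nonneg)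
    obtain u' where u': "continuous_on {0..T} u'" "AE x in I_leb T. u x = u' x" "integral {0..T} (\<lambda>t. \<bar>u' t\<bar>) <= C * \<rho>"
       "integral {0..T} (\<lambda>t. \<bar>u' t\<bar>) ^ (2 * (m + k)) <= C * integral {0..T} (\<lambda>t. (prim u' k t)\<^sup>2) ^ m * \<rho> ^ (2 * k)"
      using C(2)[OF uv(1) _ \<rho>(2)] nn[of v] \<rho>(1) by force
    obtain v' where v': "continuous_on {0..T} v'" "AE x in I_leb T. v x = v' x" "integral {0..T} (\<lambda>t. \<bar>v' t\<bar>) <= C * \<rho>"
       "integral {0..T} (\<lambda>t. \<bar>v' t\<bar>) ^ (2 * (m + k)) <= C * integral {0..T} (\<lambda>t. (prim v' k t)\<^sup>2) ^ m * \<rho> ^ (2 * k)"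
      using C(2)[OF uv(2) _ \<rho>(2)] nn[of u] \<rho>(1) by force
    let ?n = "2 * (m + k)"
    define x where "x = integral {0..T} (\<lambda>t. \<bar>u' t\<bar>)"
    define y where "y = integral {0..T} (\<lambda>t. \<bar>v' t\<bar>)"
    define A where "A = integral {0..T} (\<lambda>t. (prim u' k t)\<^sup>2)"
    define B where "B = integral {0..T} (\<lambda>t. (prim v' k t)\<^sup>2)"
    have ii: "(\<lambda>t. \<bar>u' t\<bar>) integrable_on {0..T}" "(\<lambda>t. \<bar>v' t\<bar>) integrable_on {0..T}"
      "(\<lambda>t. (prim u' k t)\<^sup>2) integrable_on {0..T}" "(\<lambda>t. (prim v' k t)\<^sup>2) integrable_on {0..T}"
      by (auto intro!: integrable_continuous_real continuous_intros prim_continuous u'(1) v'(1))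
    have nonneg: "0 <= x" "0 <= y" "0 <= A" "0 <= B" unfolding x_def y_def A_def B_def by (auto intro!: integral_nonneg ii)
    have l: "l1n T u' v' = x + y" unfolding l1n_def x_def y_def by (rule Henstock_Kurzweil_Integration.integral_add[OF ii(1,2)])
    have AB: "integral {0..T} (\<lambda>t. (prim u' k t)\<^sup>2 + (prim v' k t)\<^sup>2) = A + B"
      unfolding A_def B_def by (rule Henstock_Kurzweil_Integration.integral_add[OF ii(3,4)])
    have b1: "l1n T u' v' <= M * \<rho>"
    proof -
      have "x + y <= (2 * C) * \<rho>" using u'(3) v'(3) by (simp add: x_def y_def)
      also have "\<dots> <= M * \<rho>" using \<rho> by (intro mult_right_mono) (auto simp: M_def)
      finally show ?thesis by (simp add: l)
    qed
    have "(x + y) ^ ?n <= (2 * max x y) ^ ?n" using nonneg by (intro power_mono) auto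
    also have "\<dots> <= 2 ^ ?n * (x ^ ?n + y ^ ?n)" using nonneg by (auto simp: power_mult_distrib max_def)
    also have "\<dots> <= 2 ^ ?n * (C * A ^ m * \<rho> ^ (2 * k) + C * B ^ m * \<rho> ^ (2 * k))"
      using u'(4) v'(4) unfolding x_def y_def A_def B_def by (intro mult_left_mono add_mono) auto
    also have "\<dots> <= 2 ^ ?n * (C * (A + B) ^ m * \<rho> ^ (2 * k) + C * (A + B) ^ m * \<rho> ^ (2 * k))"
      using nonneg C \<rho> by (intro mult_left_mono add_mono mult_right_mono power_mono) auto
    also have "\<dots> = (2 ^ ?n * (2 * C)) * ((A + B) ^ m * \<rho> ^ (2 * k))" by (simp add: mult_ac)
    also have "\<dots> <= M * ((A + B) ^ m * \<rho> ^ (2 * k))" using nonneg \<rho> by (intro mult_right_mono) (auto simp: M_def)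
    finally have "l1n T u' v' ^ ?n <= M * integral {0..T} (\<lambda>t. (prim u' k t)\<^sup>2 + (prim v' k t)\<^sup>2) ^ m * \<rho> ^ (2 * k)"
      by (simp add: l AB mult.assoc)
    thus ?thesis using u'(1,2) v'(1,2) b1 by blast
  qed
  show ?thesis by (rule exI[of _ M], rule conjI, rule M, intro allI impI, rule main)
qed

section \<open>Evaluated brackets\<close>

lemma scaleR_free_alg: "c *\<^sub>R a = Poly_Mapping.single 0 c * (a :: free_alg)"
proof (induction a rule: free_alg_induct)
  case (single w d)
  have "c *\<^sub>R Poly_Mapping.single w d = Poly_Mapping.single w (c * d)"
    by (rule poly_mapping_eqI) (simp add: scaleR_poly_mapping.rep_eq lookup_single when_def)
  thus ?case by (simp add: mult_single)
qed (simp_all add: scaleR_right_distrib distrib_left)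

lemma single_0_central: "a * Poly_Mapping.single 0 c = Poly_Mapping.single 0 c * (a :: free_alg)"
  by (induction a rule: free_alg_induct) (simp_all add: mult_single mult.commute distrib_left distrib_right)

text \<open>Scalars act as multiplication by central elements supported on the empty word, so the
  claim is a ring identity.\<close>

lemma comm_scaleR:
  "comm (c *\<^sub>R a) b = c *\<^sub>R comm a b" "comm a (c *\<^sub>R b) = c *\<^sub>R comm a b"
proof -
  have "a * (Poly_Mapping.single 0 c * b) = Poly_Mapping.single 0 c * (a * b)" for a b :: free_alg
    by (simp only: mult.assoc[symmetric] single_0_central)
  thus "comm (c *\<^sub>R a) b = c *\<^sub>R comm a b" "comm a (c *\<^sub>R b) = c *\<^sub>R comm a b"
    by (simp_all add: comm_def scaleR_free_alg algebra_simps mult.assoc)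
qed

lemma comm_add: "comm (a + a') b = comm a b + comm a' b" "comm a (b + b') = comm a b + comm a b'"
  by (simp_all add: comm_def algebra_simps)

lemma linear_comm: "linear (\<lambda>a. comm a b)" "linear (\<lambda>b. comm a b)"
  by (auto intro!: linearI simp: comm_add comm_scaleR)

lemma comm_deriv: "comm (comm a b) c = comm (comm a c) b + comm a (comm b c)"
  by (simp add: comm_def algebra_simps)

lemma comm_S_span:
  assumes "x \<in> S_span A" "y \<in> S_span B" "\<And>a b. a \<in> A ==> b \<in> B ==> a + b \<in> C"
  shows "comm x y \<in> S_span C"
proof -
  have sub: "subspace {x. comm x b \<in> S_span C}" "subspace {x. comm b x \<in> S_span C}" for b
    using linear_subspace_vimage[OF linear_comm(1) subspace_span] linear_subspace_vimage[OF linear_comm(2) subspace_span]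
    by (simp_all add: vimage_def S_span_def)
  have 1: "comm (Ev b) (Ev b') \<in> S_span C" if "occ X1 b + occ X2 b \<in> A" "occ X1 b' + occ X2 b' \<in> B" for b b'
  proof -
    have "occ X1 (Bracket b b') + occ X2 (Bracket b b') \<in> C" using assms(3)[OF that] by (simp add: ac_simps)
    thus ?thesis unfolding S_span_def Ev.simps(2)[symmetric] by (intro span_base) blast
  qed
  have 2: "S_span B \<subseteq> {y. comm (Ev b) y \<in> S_span C}" if "occ X1 b + occ X2 b \<in> A" for b
    unfolding S_span_def[of B] by (rule span_minimal[OF _ sub(2)]) (use 1 that in auto)
  have "S_span A \<subseteq> {x. comm x y \<in> S_span C}"
    unfolding S_span_def[of A] by (rule span_minimal[OF _ sub(1)]) (use 2 assms(2) in auto)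
  thus ?thesis using assms(1) by blast
qed

lemma S_span_mono: "A \<subseteq> B ==> S_span A \<subseteq> S_span B"
  unfolding S_span_def by (rule span_mono) blast

lemma ad0_Suc: "ad0 b (Suc l) = comm (ad0 b l) (gen X0)"
  by (simp add: ad0_def)

lemma ad0_0 [simp]: "ad0 b 0 = b"
  by (simp add: ad0_def)

lemma ad0_Ev_adb: "ad0 (gen i) l = Ev (adb i l)"
  by (induction l) (simp_all add: ad0_Suc)

lemma ad0_Ev_adb': "ad0 (Ev (adb i l)) n = Ev (adb i (l + n))"
  by (induction n) (simp_all add: ad0_Suc)

lemma linear_ad0: "linear (\<lambda>b. ad0 b l)"
proof (induction l)
  case (Suc l)
  from linear_compose[OF Suc linear_comm(1)] show ?case by (simp add: ad0_Suc o_def)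
qed (simp add: linear_ident)

lemma ad0_S_span: "x \<in> S_span A ==> ad0 x l \<in> S_span A"
proof (induction l)
  case (Suc l)
  have "gen X0 \<in> S_span {0}" unfolding S_span_def
    by (rule span_base) (auto intro!: exI[of _ "Leaf X0"])
  thus ?case unfolding ad0_Suc by (intro comm_S_span[OF Suc.IH[OF Suc.prems]]) auto
qed simp

lemma S_span_free_Lie: "S_span A \<subseteq> free_Lie"
  unfolding S_span_def by (rule span_minimal[OF _ subspace_free_Lie]) auto

lemma ad0_free_Lie: "x \<in> free_Lie ==> ad0 x l \<in> free_Lie"
  by (induction l) (simp_all add: ad0_Suc)

section \<open>Linear algebra: dual functionals and projections\<close>

lemma dual_functionals:
  fixes e :: "'i => 'a::euclidean_space"
  assumes fin: "finite I" and R: "subspace R"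
    and ind: "\<And>\<alpha>. (\<Sum>i\<in>I. \<alpha> i *\<^sub>R e i) \<in> R ==> \<forall>i\<in>I. \<alpha> i = 0"
  shows "\<exists>\<psi>. (\<forall>i. linear (\<psi> i)) \<and> (\<forall>i\<in>I. \<forall>j\<in>I. \<psi> i (e j) = (if i = j then 1 else (0::real))) \<and> (\<forall>i. \<forall>x\<in>R. \<psi> i x = 0)"
proof -
  have "\<exists>\<phi>. linear \<phi> \<and> (i \<in> I --> (\<forall>j\<in>I. \<phi> (e j) = (if i = j then 1 else (0::real)))) \<and> (\<forall>x\<in>R. \<phi> x = 0)" for i
  proof (cases "i \<in> I")
    case False
    thus ?thesis by (intro exI[of _ "\<lambda>x. 0"]) (simp add: linear_zero)
  next
    case i: True
    define S where "S = R \<union> e ` (I - {i})"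
    \<comment> \<open>An explicit subspace that contains \<open>span S\<close>; membership of
      \<open>e i\<close> in it would be a relation that \<open>ind\<close> forbids.\<close>
    define Z where "Z = {x. \<exists>\<beta>. x - (\<Sum>j\<in>I - {i}. \<beta> j *\<^sub>R e j) \<in> R}"
    have "subspace Z"
    proof (rule subspaceI)
      show "0 \<in> Z" unfolding Z_def using subspace_0[OF R] by (auto intro!: exI[of _ "\<lambda>_. 0"])
    next
      fix x y assume "x \<in> Z" "y \<in> Z"
      then obtain \<beta> \<gamma> where "x - (\<Sum>j\<in>I - {i}. \<beta> j *\<^sub>R e j) \<in> R" "y - (\<Sum>j\<in>I - {i}. \<gamma> j *\<^sub>R e j) \<in> R" by (auto simp: Z_def)
      from subspace_add[OF R this] have "(x + y) - (\<Sum>j\<in>I - {i}. (\<beta> j + \<gamma> j) *\<^sub>R e j) \<in> R"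
        by (simp add: scaleR_left_distrib sum.distrib algebra_simps)
      thus "x + y \<in> Z" unfolding Z_def by (intro CollectI exI[of _ "\<lambda>j. \<beta> j + \<gamma> j"])
    next
      fix c x assume "x \<in> Z"
      then obtain \<beta> where "x - (\<Sum>j\<in>I - {i}. \<beta> j *\<^sub>R e j) \<in> R" by (auto simp: Z_def)
      from subspace_scale[OF R this, of c] have "c *\<^sub>R x - (\<Sum>j\<in>I - {i}. (c * \<beta> j) *\<^sub>R e j) \<in> R"
        by (simp add: scaleR_right_diff_distrib scaleR_sum_right)
      thus "c *\<^sub>R x \<in> Z" unfolding Z_def by (intro CollectI exI[of _ "\<lambda>j. c * \<beta> j"])
    qed
    moreover have "S \<subseteq> Z"
    proof
      fix x assume "x \<in> S"
      then consider "x \<in> R" | j where "j \<in> I - {i}" "x = e j" unfolding S_def by blast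
      thus "x \<in> Z"
      proof cases
        case 1
        thus ?thesis unfolding Z_def by (intro CollectI exI[of _ "\<lambda>_. 0"]) simp
      next
        case 2
        have "(\<Sum>j'\<in>I - {i}. (if j' = j then 1 else 0) *\<^sub>R e j') = (\<Sum>j'\<in>I - {i}. if j' = j then e j else 0)"
          by (intro sum.cong) auto
        hence "x - (\<Sum>j'\<in>I - {i}. (if j' = j then 1 else 0) *\<^sub>R e j') = 0" using 2 fin by (simp add: sum.delta)
        thus ?thesis unfolding Z_def using subspace_0[OF R] by (intro CollectI exI[of _ "\<lambda>j'. if j' = j then 1 else 0"]) simp
      qed
    qed
    ultimately have SZ: "span S \<subseteq> Z" by (intro span_minimal)
    have "e i \<notin> span S"
    proof
      assume "e i \<in> span S"
      then obtain \<beta> where b: "e i - (\<Sum>j\<in>I - {i}. \<beta> j *\<^sub>R e j) \<in> R" using SZ by (auto simp: Z_def)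
      have "(\<Sum>j\<in>I. (if j = i then 1 else - \<beta> j) *\<^sub>R e j) = e i - (\<Sum>j\<in>I - {i}. \<beta> j *\<^sub>R e j)"
        using fin i by (subst sum.remove[of I i]) (auto simp: sum_negf intro!: sum.cong)
      with b ind[of "\<lambda>j. if j = i then 1 else - \<beta> j"] i show False by auto
    qed
    \<comment> \<open>The component of \<open>e i\<close> orthogonal to \<open>R\<close> and to the
      other vectors provides the functional, after normalisation.\<close>
    obtain y z where yz: "y \<in> span S" "\<And>w. w \<in> span S ==> orthogonal z w" "e i = y + z"
      using orthogonal_subspace_decomp_exists[of S "e i"] by metis
    have z0: "z \<bullet> z \<noteq> 0" using yz \<open>e i \<notin> span S\<close> by auto
    have zS: "z \<bullet> w = 0" if "w \<in> S" for w using yz(2)[OF span_base[OF that]] by (simp add: orthogonal_def)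
    define \<phi> where "\<phi> x = (z \<bullet> x) / (z \<bullet> z)" for x
    have "linear \<phi>" unfolding \<phi>_def by (intro linearI) (auto simp: inner_add_right add_divide_distrib)
    moreover have "\<phi> (e i) = 1" using yz z0 by (simp add: \<phi>_def inner_add_right orthogonal_def)
    moreover have "\<phi> (e j) = 0" if "j \<in> I" "j \<noteq> i" for j using zS[of "e j"] that by (simp add: \<phi>_def S_def)
    moreover have "\<phi> x = 0" if "x \<in> R" for x using zS[of x] that by (simp add: \<phi>_def S_def)
    ultimately show ?thesis by (intro exI[of _ \<phi>]) auto
  qed
  hence "\<forall>i. \<exists>\<phi>. linear \<phi> \<and> (i \<in> I --> (\<forall>j\<in>I. \<phi> (e j) = (if i = j then 1 else (0::real)))) \<and> (\<forall>x\<in>R. \<phi> x = 0)" by blast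
  from choice[OF this] show ?thesis by blast
qed

lemma linear_projection:
  fixes V :: "'a::euclidean_space set"
  assumes "subspace V"
  shows "\<exists>Q. linear Q \<and> (\<forall>x\<in>V. Q x = 0) \<and> (\<forall>x. x - Q x \<in> V)"
proof -
  obtain B where B: "B \<subseteq> V" "pairwise orthogonal B" "\<And>x. x \<in> B ==> norm x = 1" "independent B" "span B = V"
    using orthonormal_basis_subspace[OF assms] by metis
  have fin: "finite B" using B(4) independent_imp_finite by blast
  define Q where "Q x = x - (\<Sum>b\<in>B. (x \<bullet> b) *\<^sub>R b)" for x
  have "linear Q" unfolding Q_def
    by (intro linearI) (simp_all add: inner_add_left scaleR_left_distrib sum.distrib scaleR_right_diff_distrib scaleR_sum_right)
  moreover have "Q x = 0" if "x \<in> V" for x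
    using orthonormal_basis_expand[OF B(2,3) _ fin, of x] that B(5) by (simp add: Q_def)
  moreover have "x - Q x \<in> V" for x
    unfolding Q_def using B(1) by (auto intro!: subspace_sum[OF assms] subspace_scale[OF assms])
  ultimately show ?thesis by blast
qed

section \<open>The set \<open>N_set\<close> and its evaluation at the origin\<close>

lemma Cbr_Suc: "Cbr j (Suc l) = comm (Cbr j l) (gen X0)"
  by (simp add: Cbr_def ad0_Suc comm_scaleR)

lemma Wbr_Suc: "Wbr i j (Suc l) = comm (Wbr i j l) (gen X0)"
  by (simp add: Wbr_def ad0_Suc)

lemma Wbr_0: "Wbr i j 0 = Ev (Bracket (adb i (j - 1)) (adb i j))"
  by (simp add: Wbr_def ad0_Ev_adb)

lemma Cbr_0: "Cbr j 0 = (- 1) ^ j *\<^sub>R Ev (Bracket (adb X1 ((j + 1) div 2)) (adb X2 (j div 2)))"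
  by (simp add: Cbr_def ad0_Ev_adb)

lemma Wbr_in_N_set: "i \<in> {X1, X2} ==> j \<in> {1..k - 1} ==> Wbr i j l \<in> N_set k m"
  unfolding N_set_def by blast

lemma Cbr_in_N_set: "j \<in> {0..2 * k - 2} ==> Cbr j l \<in> N_set k m"
  unfolding N_set_def by blast

text \<open>Each of the three families is stable under a further \<open>X0\<close>: the first counts
  only controlled fields, the other two contain all \<open>l\<close>.\<close>

lemma N_set_X0:
  assumes "x \<in> N_set k m"
  shows "comm x (gen X0) \<in> N_set k m"
proof -
  have "gen X0 \<in> S_span {0}" unfolding S_span_def
    by (rule span_base) (auto intro!: exI[of _ "Leaf X0"])
  hence "comm x (gen X0) \<in> S_span A" if "x \<in> S_span A" for A
    using comm_S_span[OF that, of "gen X0" "{0}" A] by auto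
  moreover have "x \<in> S_span ({1..pi_km k m} - {2}) \<or> (\<exists>j l. x = Cbr j l \<and> j \<in> {0..2 * k - 2})
      \<or> (\<exists>i j l. x = Wbr i j l \<and> i \<in> {X1, X2} \<and> j \<in> {1..k - 1})"
    using assms unfolding N_set_def by blast
  ultimately have "comm x (gen X0) \<in> S_span ({1..pi_km k m} - {2}) \<or> (\<exists>j l. comm x (gen X0) = Cbr j l \<and> j \<in> {0..2 * k - 2})
      \<or> (\<exists>i j l. comm x (gen X0) = Wbr i j l \<and> i \<in> {X1, X2} \<and> j \<in> {1..k - 1})"
    using Cbr_Suc[symmetric] Wbr_Suc[symmetric] by metis
  thus ?thesis unfolding N_set_def by blast
qed

lemma N_set_free_Lie: "N_set k m \<subseteq> free_Lie"
proof -
  have "Cbr j l \<in> free_Lie" for j l by (induction l) (simp_all add: Cbr_0 Cbr_Suc)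
  moreover have "Wbr i j l \<in> free_Lie" for i j l by (induction l) (simp_all add: Wbr_0 Wbr_Suc)
  ultimately show ?thesis using S_span_free_Lie unfolding N_set_def by blast
qed

lemma subspace_eval_span: "subspace (eval_span f S)"
  by (simp add: eval_span_def)

lemma eval_span_base: "x \<in> S ==> Lam f x 0 \<in> eval_span f S"
  unfolding eval_span_def by (rule span_base) blast

context carleman
begin

lemma Lam_comm_X0: "x \<in> free_Lie ==> Lam f (comm x (gen X0)) 0 = Hmap (Lam f x 0)"
proof -
  assume x: "x \<in> free_Lie"
  have sx: "sfield (Lam f x)" by (rule Lam_sfield[OF sf x])
  have "linear (frechet_derivative (Lam f x) (at 0))"
    using sfield_frechet[OF sx] by (intro linear_frechet_derivative) (auto simp: differentiable_def)
  thus ?thesis by (simp add: Lam_comm[OF sf] x Lam_gen[OF sf] field_bracket_def f00 Hmap_def linear_0)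
qed

lemma Lam_comm_vanishing:
  "x \<in> free_Lie ==> y \<in> free_Lie ==> Lam f x 0 = 0 ==> Lam f y 0 = 0 ==> Lam f (comm x y) 0 = 0"
  by (simp add: Lam_comm[OF sf] field_bracket_at Lam_sfield[OF sf])

lemma Lam_ad0_vanishing: "x \<in> free_Lie ==> Lam f x 0 = 0 ==> Lam f (ad0 x l) 0 = 0"
  by (induction l) (simp_all add: ad0_Suc Lam_comm_X0 ad0_free_Lie linear_0[OF linear_Hmap])

lemma eval_span_Hmap: "x \<in> eval_span f (N_set k m) ==> Hmap x \<in> eval_span f (N_set k m)"
proof -
  have "subspace {x. Hmap x \<in> eval_span f (N_set k m)}"
    using linear_subspace_vimage[OF linear_Hmap subspace_eval_span] by (simp add: vimage_def)
  moreover have "Hmap (Lam f b 0) \<in> eval_span f (N_set k m)" if "b \<in> N_set k m" for b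
  proof -
    have "b \<in> free_Lie" using that N_set_free_Lie by blast
    from Lam_comm_X0[OF this, symmetric] show ?thesis by (simp add: eval_span_base[OF N_set_X0[OF that]])
  qed
  ultimately have "eval_span f (N_set k m) \<subseteq> {x. Hmap x \<in> eval_span f (N_set k m)}"
    unfolding eval_span_def by (intro span_minimal) auto
  thus "x \<in> eval_span f (N_set k m) ==> Hmap x \<in> eval_span f (N_set k m)" by blast
qed

lemma S_span_eval: "x \<in> S_span ({1..pi_km k m} - {2}) ==> Lam f x 0 \<in> eval_span f (N_set k m)"
  by (rule eval_span_base) (simp add: N_set_def)

lemma Fb_eval_span: "nocc b \<in> {1..pi_km k m} - {2} ==> Fb b 0 \<in> eval_span f (N_set k m)"
  unfolding Fb_def by (rule S_span_eval) (auto simp: S_span_def nocc_def intro!: span_base)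

section \<open>Brackets of two controlled fields\<close>

definition br2 :: "letter => letter => nat => nat => real^'d" where
  "br2 i j p b = Fb (Bracket (adb i p) (adb j b)) 0"

text \<open>Bracketing with \<open>X0\<close> is a derivation and acts on values at \<open>0\<close>
  by \<open>Hmap\<close>.\<close>

lemma br2_shift: "br2 i j (Suc p) b + br2 i j p (Suc b) = Hmap (br2 i j p b)"
proof -
  have "Hmap (br2 i j p b) = Lam f (comm (comm (Ev (adb i p)) (Ev (adb j b))) (gen X0)) 0"
    by (subst Lam_comm_X0) (simp_all add: br2_def Fb_def)
  thus ?thesis by (simp add: comm_deriv[of _ _ "gen X0"] Lam_add[OF sf] br2_def Fb_def)
qed

lemma br2_antisym: "br2 i j p b = - br2 j i b p"
  by (simp add: br2_def Fb_Bracket field_bracket_def)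

lemma Lam_Wbr: "Lam f (Wbr i j 0) 0 = br2 i i (j - 1) j"
  by (simp add: Wbr_0 br2_def Fb_def del: Ev.simps)

lemma Lam_Cbr: "Lam f (Cbr j 0) 0 = (- 1) ^ j *\<^sub>R br2 X1 X2 ((j + 1) div 2) (j div 2)"
  by (simp add: Cbr_0 br2_def Fb_def Lam_scaleR[OF sf] del: Ev.simps)

text \<open>By \<open>br2_shift\<close>, neighbours on the antidiagonal \<open>p + b = s\<close> are
  opposite modulo \<open>V\<close>, so one member decides for all. This is why one generator per
  antidiagonal suffices in \<open>N_set\<close>.\<close>

lemma br2_diagonal:
  assumes V: "subspace V" and H: "\<And>p b. Suc (p + b) = s ==> Hmap (br2 i j p b) \<in> V"
    and 0: "br2 i j a0 b0 \<in> V" "a0 + b0 = s" and ab: "p + b = s"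
  shows "br2 i j p b \<in> V"
proof -
  have shift: "br2 i j (Suc p) b \<in> V \<longleftrightarrow> br2 i j p (Suc b) \<in> V" if "Suc (p + b) = s" for p b
  proof -
    have e: "br2 i j (Suc p) b = Hmap (br2 i j p b) - br2 i j p (Suc b)" "br2 i j p (Suc b) = Hmap (br2 i j p b) - br2 i j (Suc p) b"
      using br2_shift[of i j p b] by (simp_all add: algebra_simps)
    show ?thesis using subspace_diff[OF V H[OF that]] e by metis
  qed
  have "br2 i j p b \<in> V \<longleftrightarrow> br2 i j 0 s \<in> V" if "p + b = s" for p b
    using that by (induction p arbitrary: b) (use shift in auto)
  thus ?thesis using 0 ab by blast
qed

text \<open>Even antidiagonals contain the bracket of an element with itself, which is zero; odd
  ones contain \<open>Wbr i (q + 1) 0\<close>.\<close>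

lemma br2_same_in_eval_span:
  assumes i: "i \<in> L12"
  shows "p + b <= 2 * k - 2 ==> br2 i i p b \<in> eval_span f (N_set k m)"
proof (induction "p + b" arbitrary: p b rule: less_induct)
  case less
  obtain q where q: "p + b = 2 * q \<or> p + b = q + Suc q" by (metis add_Suc_right evenE mult_2 oddE Suc_eq_plus1)
  have 0: "\<exists>a0 b0. a0 + b0 = p + b \<and> br2 i i a0 b0 \<in> eval_span f (N_set k m)"
  proof (cases "p + b = 2 * q")
    case True
    have "br2 i i q q = 0" using br2_antisym[of i i q q] by (simp add: vec_eq_iff)
    thus ?thesis using True subspace_0[OF subspace_eval_span] by (intro exI[of _ q]) simp
  next
    case False
    hence "p + b = q + Suc q" using q by blast
    moreover have "Wbr i (Suc q) 0 \<in> N_set k m"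
      by (rule Wbr_in_N_set) (use i less.prems \<open>p + b = q + Suc q\<close> in auto)
    ultimately show ?thesis using eval_span_base[of "Wbr i (Suc q) 0" "N_set k m" f] by (intro exI[of _ q] exI[of _ "Suc q"]) (simp add: Lam_Wbr)
  qed
  then obtain a0 b0 where ab0: "a0 + b0 = p + b" "br2 i i a0 b0 \<in> eval_span f (N_set k m)" by blast
  show ?case
  proof (rule br2_diagonal[OF subspace_eval_span _ ab0(2,1) refl])
    show "Hmap (br2 i i x y) \<in> eval_span f (N_set k m)" if "Suc (x + y) = p + b" for x y
      using less that by (intro eval_span_Hmap) auto
  qed
qed

text \<open>Up to sign, \<open>Cbr s 0\<close> sits in the middle of the antidiagonal
  \<open>s\<close>.\<close>

lemma br2_12_in_eval_span:
  "p + b <= 2 * k - 2 ==> br2 X1 X2 p b \<in> eval_span f (N_set k m)"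
proof (induction "p + b" arbitrary: p b rule: less_induct)
  case less
  let ?s = "p + b"
  have "Cbr ?s 0 \<in> N_set k m" by (rule Cbr_in_N_set) (use less.prems in auto)
  from eval_span_base[OF this, of f] have "(- 1) ^ ?s *\<^sub>R br2 X1 X2 ((?s + 1) div 2) (?s div 2) \<in> eval_span f (N_set k m)"
    by (simp add: Lam_Cbr)
  from subspace_scale[OF subspace_eval_span this, of "(- 1) ^ ?s"]
  have "br2 X1 X2 ((?s + 1) div 2) (?s div 2) \<in> eval_span f (N_set k m)"
    by (simp add: power_add[symmetric] mult_2[symmetric])
  thus ?case
  proof (rule br2_diagonal[OF subspace_eval_span, rotated])
    show "(?s + 1) div 2 + ?s div 2 = ?s" by presburger
    show "Hmap (br2 X1 X2 x y) \<in> eval_span f (N_set k m)" if "Suc (x + y) = ?s" for x y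
      using less that by (intro eval_span_Hmap) auto
  qed simp
qed

lemma br2_in_eval_span:
  assumes ij: "i \<in> L12" "j \<in> L12" and ab: "p + b <= 2 * k - 2"
  shows "br2 i j p b \<in> eval_span f (N_set k m)"
proof (cases "i = j")
  case True
  thus ?thesis using br2_same_in_eval_span ij ab by auto
next
  case False
  then consider "i = X1" "j = X2" | "i = X2" "j = X1" using ij by auto
  thus ?thesis
  proof cases
    case 2
    thus ?thesis using br2_12_in_eval_span[of b p k m] ab br2_antisym[of X2 X1 p b] subspace_neg[OF subspace_eval_span]
      by (simp add: add.commute)
  qed (use br2_12_in_eval_span ab in simp)
qed

text \<open>On the antidiagonal \<open>2 * k - 1\<close> the two mixed brackets agree modulo the
  span. Hence the quadratic form is symmetric, with \<open>Cbr (2 * k - 1) 0\<close> as its mixed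
  coefficient.\<close>

lemma br2_top:
  assumes k: "k \<ge> 1"
  shows "br2 X2 X1 (k - 1) k = Lam f (Cbr (2 * k - 1) 0) 0"
    "br2 X1 X2 (k - 1) k - Lam f (Cbr (2 * k - 1) 0) 0 \<in> eval_span f (N_set k m)"
proof -
  obtain k' where k': "k = Suc k'" using k by (cases k) auto
  have C: "Lam f (Cbr (2 * k - 1) 0) 0 = - br2 X1 X2 k (k - 1)"
    by (simp add: Lam_Cbr k')
  show "br2 X2 X1 (k - 1) k = Lam f (Cbr (2 * k - 1) 0) 0" unfolding C by (rule br2_antisym)
  have "br2 X1 X2 k (k - 1) + br2 X1 X2 (k - 1) k = Hmap (br2 X1 X2 (k - 1) (k - 1))"
    using br2_shift[of X1 X2 "k - 1" "k - 1"] k by simp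
  moreover have "Hmap (br2 X1 X2 (k - 1) (k - 1)) \<in> eval_span f (N_set k m)"
    by (intro eval_span_Hmap br2_12_in_eval_span) (use k in auto)
  ultimately show "br2 X1 X2 (k - 1) k - Lam f (Cbr (2 * k - 1) 0) 0 \<in> eval_span f (N_set k m)"
    unfolding C by (simp add: add.commute)
qed

text \<open>Lifts a relation between values at \<open>0\<close> to the free Lie algebra, where
  further brackets can be formed.\<close>

lemma span_Fb_S_span:
  assumes "y \<in> span {Fb b 0 | b. nocc b \<in> A}"
  shows "\<exists>q\<in>S_span A. Lam f q 0 = y"
proof -
  let ?Z = "{y. \<exists>q\<in>S_span A. Lam f q 0 = y}"
  have fl: "q \<in> S_span A ==> q \<in> free_Lie" for q using S_span_free_Lie by blast
  have sub: "subspace (S_span A)" by (simp add: S_span_def)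
  have "subspace ?Z"
  proof (rule subspaceI)
    show "0 \<in> ?Z" using subspace_0[OF sub] Lam_zero[OF sf] by (intro CollectI bexI[of _ 0]) auto
  next
    fix x y assume "x \<in> ?Z" "y \<in> ?Z"
    then obtain p q where "p \<in> S_span A" "q \<in> S_span A" "Lam f p 0 = x" "Lam f q 0 = y" by blast
    thus "x + y \<in> ?Z" using subspace_add[OF sub, of p q] fl
      by (intro CollectI bexI[of _ "p + q"]) (simp_all add: Lam_add[OF sf])
  next
    fix c x assume "x \<in> ?Z"
    then obtain p where "p \<in> S_span A" "Lam f p 0 = x" by blast
    thus "c *\<^sub>R x \<in> ?Z" using subspace_scale[OF sub, of p c] fl
      by (intro CollectI bexI[of _ "c *\<^sub>R p"]) (simp_all add: Lam_scaleR[OF sf])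
  qed
  moreover have "{Fb b 0 | b. nocc b \<in> A} \<subseteq> ?Z"
    by (auto simp: Fb_def nocc_def S_span_def intro!: bexI[of _ "Ev _"] span_base)
  ultimately show ?thesis using span_minimal assms by blast
qed

text \<open>Multiplication by \<open>A\<close> completes the square.\<close>

lemma quadratic_definite:
  fixes A B C x y :: real
  assumes "A > 0" "A * B > C\<^sup>2" "A * x\<^sup>2 + 2 * C * (x * y) + B * y\<^sup>2 = 0"
  shows "x = 0 \<and> y = 0"
proof -
  have "(A * x + C * y)\<^sup>2 + (A * B - C\<^sup>2) * y\<^sup>2 = A * (A * x\<^sup>2 + 2 * C * (x * y) + B * y\<^sup>2)"
    by (simp add: power2_eq_square algebra_simps)
  also have "\<dots> = 0" unfolding assms(3) by simp
  finally have e: "(A * x + C * y)\<^sup>2 + (A * B - C\<^sup>2) * y\<^sup>2 = 0" .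
  have p: "A * B - C\<^sup>2 > 0" using assms(2) by simp
  have "0 <= (A * B - C\<^sup>2) * y\<^sup>2" using p by simp
  hence "(A * x + C * y)\<^sup>2 = 0 \<and> (A * B - C\<^sup>2) * y\<^sup>2 = 0"
    using e zero_le_power2[of "A * x + C * y"] by linarith
  hence "A * x + C * y = 0" "y = 0" using p by auto
  thus ?thesis using assms(1) by simp
qed

text \<open>If a combination \<open>B\<close> of the \<open>X\<^sub>i0\<^sup>l\<close> and of longer brackets vanished at \<open>0\<close>, so would
  \<open>[B0\<^sup>n, B0\<^sup>n\<^sup>+\<^sup>1]\<close>; for a suitable \<open>n\<close> the functional \<open>c\<close> sees of the latter
  only the quadratic form, evaluated at the top coefficients of \<open>B\<close>.\<close>

lemma adb_independent:
  assumes k: "k \<ge> 1" and r: "r \<ge> 1" "2 * r <= pi_km k m"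
    and cV: "\<And>x. x \<in> eval_span f (N_set k m) ==> c \<bullet> x = 0"
    and A: "A = c \<bullet> br2 X1 X1 (k - 1) k" "A > 0" and B: "B = c \<bullet> br2 X2 X2 (k - 1) k"
    and C: "C = c \<bullet> br2 X1 X2 (k - 1) k" "C = c \<bullet> br2 X2 X1 (k - 1) k" and ABC: "A * B > C\<^sup>2"
    and dep: "(\<Sum>i\<in>L12. \<Sum>l<k. \<alpha> i l *\<^sub>R Fb (adb i l) 0) \<in> span {Fb b 0 | b. nocc b \<in> {2..r}}"
  shows "\<forall>i\<in>L12. \<forall>l<k. \<alpha> i l = 0"
proof (rule ccontr)
  assume neg: "\<not> (\<forall>i\<in>L12. \<forall>l<k. \<alpha> i l = 0)"
  \<comment> \<open>\<open>J\<close> will be the highest number of drifts at which the relation has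
    a nonzero coefficient.\<close>
  define L where "L = {l. l < k \<and> (\<exists>i\<in>L12. \<alpha> i l \<noteq> 0)}"
  define J where "J = Max L"
  have L: "finite L" "L \<noteq> {}" using neg by (auto simp: L_def)
  hence "J \<in> L" unfolding J_def by (rule Max_in)
  hence J: "J < k" "\<exists>i\<in>L12. \<alpha> i J \<noteq> 0" by (auto simp: L_def)
  have Jmax: "\<alpha> i l = 0" if "i \<in> L12" "l < k" "l > J" for i l
    using Max_ge[OF L(1), of l] that unfolding J_def[symmetric] by (force simp: L_def)
  obtain q0 where q0: "q0 \<in> S_span {2..r}" "Lam f q0 0 = (\<Sum>i\<in>L12. \<Sum>l<k. \<alpha> i l *\<^sub>R Fb (adb i l) 0)"
    using span_Fb_S_span[OF dep] by blast
  have sub: "subspace (S_span A)" for A by (simp add: S_span_def)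
  define q where "q = (- 1) *\<^sub>R q0"
  have q: "q \<in> S_span {2..r}" unfolding q_def by (rule subspace_scale[OF sub q0(1)])
  define P where "P n = (\<Sum>i\<in>L12. \<Sum>l<k. \<alpha> i l *\<^sub>R Ev (adb i (l + n)))" for n
  have P1: "P n \<in> S_span {1}" for n
    unfolding P_def
  proof (intro subspace_sum[OF sub] subspace_scale[OF sub])
    fix i l assume "i \<in> L12"
    hence "nocc (adb i (l + n)) = 1" by (intro nocc_adb) auto
    thus "Ev (adb i (l + n)) \<in> S_span {1}" unfolding S_span_def nocc_def by (intro span_base) blast
  qed
  have PL: "P n \<in> free_Lie" and qL: "q \<in> free_Lie" for n using P1 q S_span_free_Lie by blast+
  have adP: "ad0 (P 0) n = P n" for n
    unfolding P_def by (simp add: linear_sum[OF linear_ad0] linear_add[OF linear_ad0] linear_cmul[OF linear_ad0] ad0_Ev_adb')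
  have "Lam f (P 0) 0 = (\<Sum>i\<in>L12. \<Sum>l<k. \<alpha> i l *\<^sub>R Fb (adb i l) 0)"
    unfolding P_def Fb_def
    by (simp add: Lam_sum[OF sf] Lam_add[OF sf] Lam_scaleR[OF sf] sum_free_Lie)
  moreover have "Lam f q 0 = - Lam f q0 0"
    unfolding q_def by (subst Lam_scaleR[OF sf]) (use q0(1) S_span_free_Lie in auto)
  ultimately have B0: "Lam f (P 0 + q) 0 = 0" using q0(2) by (simp add: Lam_add[OF sf PL qL])
  \<comment> \<open>The shifts move index \<open>J\<close> to \<open>k - 1\<close> in one factor and
    to \<open>k\<close> in the other, the positions of the quadratic form.\<close>
  define n1 where "n1 = k - 1 - J"
  define n2 where "n2 = k - J"
  have n12: "J + n1 = k - 1" "J + n2 = k" using J k by (auto simp: n1_def n2_def)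
  have BL: "P 0 + q \<in> free_Lie" using PL qL by simp
  have van: "Lam f (comm (ad0 (P 0 + q) n1) (ad0 (P 0 + q) n2)) 0 = 0"
    by (intro Lam_comm_vanishing Lam_ad0_vanishing ad0_free_Lie BL B0)
  have ad: "ad0 (P 0 + q) n = P n + ad0 q n" for n
    using linear_add[OF linear_ad0[of n], of "P 0" q] adP by simp
  \<comment> \<open>Every term contains a factor from \<open>q\<close>, hence between three and
    \<open>2 * r\<close> controlled fields, and is therefore invisible to \<open>c\<close>.\<close>
  define R where "R = comm (P n1) (ad0 q n2) + comm (ad0 q n1) (P n2) + comm (ad0 q n1) (ad0 q n2)"
  have "R \<in> S_span {3..2 * r}"
    unfolding R_def
    by (intro subspace_add[OF sub] comm_S_span[OF P1 ad0_S_span[OF q]] comm_S_span[OF ad0_S_span[OF q] P1]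
        comm_S_span[OF ad0_S_span[OF q] ad0_S_span[OF q]]) (use r in auto)
  hence RS: "R \<in> S_span ({1..pi_km k m} - {2})" by (rule S_span_mono[THEN subsetD, rotated]) (use r in auto)
  have RL: "R \<in> free_Lie" using RS S_span_free_Lie by blast
  have "comm (ad0 (P 0 + q) n1) (ad0 (P 0 + q) n2) = comm (P n1) (P n2) + R"
    by (simp add: ad comm_add R_def add.assoc)
  hence "Lam f (comm (P n1) (P n2)) 0 + Lam f R 0 = 0"
    using van RL PL by (simp add: Lam_add[OF sf])
  hence "c \<bullet> Lam f (comm (P n1) (P n2)) 0 + c \<bullet> Lam f R 0 = 0" by (metis inner_add_right inner_zero_right)
  hence z: "c \<bullet> Lam f (comm (P n1) (P n2)) 0 = 0" using cV[OF S_span_eval[OF RS]] by simp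
  have CA: "comm (P n1) y = (\<Sum>i\<in>L12. \<Sum>l<k. \<alpha> i l *\<^sub>R comm (Ev (adb i (l + n1))) y)" for y
    unfolding P_def by (simp only: linear_sum[OF linear_comm(1)] linear_cmul[OF linear_comm(1)])
  have CB: "comm x (P n2) = (\<Sum>j\<in>L12. \<Sum>l'<k. \<alpha> j l' *\<^sub>R comm x (Ev (adb j (l' + n2))))" for x
    unfolding P_def by (simp only: linear_sum[OF linear_comm(2)] linear_cmul[OF linear_comm(2)])
  have "comm (P n1) (P n2) = (\<Sum>i\<in>L12. \<Sum>l<k. \<Sum>j\<in>L12. \<Sum>l'<k. (\<alpha> i l * \<alpha> j l') *\<^sub>R Ev (Bracket (adb i (l + n1)) (adb j (l' + n2))))"
    unfolding CA[of "P n2"] by (simp only: CB scaleR_sum_right scaleR_scaleR Ev.simps(2))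
  hence "Lam f (comm (P n1) (P n2)) 0 = (\<Sum>i\<in>L12. \<Sum>l<k. \<Sum>j\<in>L12. \<Sum>l'<k. (\<alpha> i l * \<alpha> j l') *\<^sub>R br2 i j (l + n1) (l' + n2))"
    by (simp only: br2_def Fb_def Lam_sum[OF sf] Lam_scaleR[OF sf] sum_free_Lie free_Lie_simps Ev_free_Lie)
  hence "0 = (\<Sum>i\<in>L12. \<Sum>l<k. \<Sum>j\<in>L12. \<Sum>l'<k. (\<alpha> i l * \<alpha> j l') * (c \<bullet> br2 i j (l + n1) (l' + n2)))"
    using z by (simp only: inner_sum_right inner_scaleR_right)
  \<comment> \<open>Coefficients beyond \<open>J\<close> vanish, and the other index pairs except
    \<open>(J, J)\<close> have at most \<open>2 * k - 2\<close> drifts in total.\<close>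
  also have "\<dots> = (\<Sum>i\<in>L12. \<Sum>l<k. \<Sum>j\<in>L12. \<Sum>l'<k. if l' = J then (if l = J then (\<alpha> i J * \<alpha> j J) * (c \<bullet> br2 i j (k - 1) k) else 0) else 0)"
  proof (intro sum.cong refl)
    fix i l j l' assume h: "i \<in> L12" "l \<in> {..<k}" "j \<in> L12" "l' \<in> {..<k}"
    show "\<alpha> i l * \<alpha> j l' * (c \<bullet> br2 i j (l + n1) (l' + n2)) = (if l' = J then if l = J then \<alpha> i J * \<alpha> j J * (c \<bullet> br2 i j (k - 1) k) else 0 else 0)"
    proof (cases "l = J \<and> l' = J")
      case True
      thus ?thesis using n12 by simp
    next
      case False
      have "\<alpha> i l * \<alpha> j l' * (c \<bullet> br2 i j (l + n1) (l' + n2)) = 0"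
      proof (cases "l > J \<or> l' > J")
        case True
        thus ?thesis using Jmax h by auto
      next
        case False
        with \<open>\<not> (l = J \<and> l' = J)\<close> have "(l + n1) + (l' + n2) <= 2 * k - 2" using n12 by linarith
        thus ?thesis using cV[OF br2_in_eval_span[OF h(1,3)]] by simp
      qed
      thus ?thesis using False by auto
    qed
  qed
  also have "\<dots> = (\<Sum>i\<in>L12. \<Sum>j\<in>L12. \<alpha> i J * \<alpha> j J * (c \<bullet> br2 i j (k - 1) k))"
  proof (rule sum.cong[OF refl])
    fix i
    have "(\<Sum>l<k. \<Sum>j\<in>L12. \<Sum>l'<k. if l' = J then if l = J then \<alpha> i J * \<alpha> j J * (c \<bullet> br2 i j (k - 1) k) else 0 else 0)
      = (\<Sum>l<k. if l = J then \<Sum>j\<in>L12. \<alpha> i J * \<alpha> j J * (c \<bullet> br2 i j (k - 1) k) else 0)"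
      using J(1) by (intro sum.cong refl) (simp add: sum.delta)
    thus "(\<Sum>l<k. \<Sum>j\<in>L12. \<Sum>l'<k. if l' = J then if l = J then \<alpha> i J * \<alpha> j J * (c \<bullet> br2 i j (k - 1) k) else 0 else 0)
      = (\<Sum>j\<in>L12. \<alpha> i J * \<alpha> j J * (c \<bullet> br2 i j (k - 1) k))" using J(1) by (simp add: sum.delta)
  qed
  also have "\<dots> = A * (\<alpha> X1 J)\<^sup>2 + 2 * C * (\<alpha> X1 J * \<alpha> X2 J) + B * (\<alpha> X2 J)\<^sup>2"
    using A(1) B C by (simp add: power2_eq_square)
  finally have "\<alpha> X1 J = 0 \<and> \<alpha> X2 J = 0" by (intro quadratic_definite[OF A(2) ABC]) simp
  thus False using J(2) by auto
qed

end

section \<open>The obstruction\<close>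

lemma orthogonal_functional:
  fixes x :: "'a::euclidean_space"
  assumes "subspace V" "x \<notin> V"
  shows "\<exists>c. (\<forall>v\<in>V. c \<bullet> v = 0) \<and> c \<bullet> x = 1"
proof -
  obtain y z where yz: "y \<in> V" "\<And>w. w \<in> V ==> orthogonal z w" "x = y + z"
    using orthogonal_subspace_decomp_exists[of V x] span_eq_iff[THEN iffD2, OF assms(1)] by metis
  hence "z \<bullet> z \<noteq> 0" "z \<bullet> y = 0" using assms(2) by (auto simp: orthogonal_def)
  hence "(inverse (z \<bullet> z) *\<^sub>R z) \<bullet> x = 1" by (simp add: yz(3) inner_add_right)
  moreover have "(inverse (z \<bullet> z) *\<^sub>R z) \<bullet> v = 0" if "v \<in> V" for v using yz(2)[OF that] by (simp add: orthogonal_def)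
  ultimately show ?thesis by blast
qed

lemma span_insert_subspace: "subspace V ==> y \<in> span (insert x V) \<longleftrightarrow> (\<exists>k. y - k *\<^sub>R x \<in> V)"
  by (simp add: span_breakdown_eq span_eq_iff[THEN iffD2])

text \<open>If \<open>x3\<close> is no combination of \<open>x1\<close> and \<open>x2\<close> modulo
  \<open>V\<close>, a functional can be made to vanish on it. If \<open>x2\<close> is a multiple of
  \<open>x1\<close>, the value at \<open>x1\<close> is normalised to \<open>1\<close>. Otherwise
  \<open>x3\<close> is \<open>a *\<^sub>R x1 + b *\<^sub>R x2\<close> modulo \<open>V\<close>, the
  values \<open>s\<close> at \<open>x1\<close> and \<open>t\<close> at \<open>x2\<close> are free,
  and \<open>(a s + b t)^2 < s t\<close> is solvable exactly if \<open>a b < 1/4\<close>.\<close>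

lemma definite_functional:
  fixes x1 x2 x3 :: "'a::euclidean_space"
  assumes V: "subspace V" and nV: "x1 \<notin> V" "x2 \<notin> V"
    and n1: "\<And>a b. (\<And>\<alpha> \<beta>. \<alpha> *\<^sub>R x1 + \<beta> *\<^sub>R x2 \<in> V ==> \<alpha> = 0 \<and> \<beta> = 0) ==> x3 - (a *\<^sub>R x1 + b *\<^sub>R x2) \<in> V ==> a * b < 1 / 4"
    and n2: "\<And>\<beta>. x2 - \<beta> *\<^sub>R x1 \<in> V ==> 0 <= \<beta>"
    and n3: "\<And>\<beta> \<gamma>. x2 - \<beta> *\<^sub>R x1 \<in> V ==> x3 - \<gamma> *\<^sub>R x1 \<in> V ==> \<beta> \<noteq> 0 ==> \<gamma>\<^sup>2 < \<beta>"
  shows "\<exists>c. (\<forall>x\<in>V. c \<bullet> x = 0) \<and> 0 < c \<bullet> x1 \<and> (c \<bullet> x3)\<^sup>2 < (c \<bullet> x1) * (c \<bullet> x2)"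
proof (cases "x2 \<in> span (insert x1 V)")
  case True
  then obtain b where b: "x2 - b *\<^sub>R x1 \<in> V" using span_insert_subspace[OF V] by blast
  have "b \<noteq> 0" using b nV by auto
  hence b0: "b > 0" using n2[OF b] by simp
  show ?thesis
  proof (cases "\<exists>\<gamma>. x3 - \<gamma> *\<^sub>R x1 \<in> V")
    case True
    then obtain \<gamma> where g: "x3 - \<gamma> *\<^sub>R x1 \<in> V" by blast
    obtain c where c: "\<forall>v\<in>V. c \<bullet> v = 0" "c \<bullet> x1 = 1" using orthogonal_functional[OF V nV(1)] by blast
    have "c \<bullet> x2 = b" "c \<bullet> x3 = \<gamma>" using bspec[OF c(1) b] bspec[OF c(1) g] c(2) by (simp_all add: inner_diff_right)
    thus ?thesis using n3[OF b g] b0 c by (intro exI[of _ c]) auto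
  next
    case False
    have "x1 \<notin> span (insert x3 V)"
    proof
      assume "x1 \<in> span (insert x3 V)"
      then obtain k where k: "x1 - k *\<^sub>R x3 \<in> V" using span_insert_subspace[OF V] by blast
      hence "k \<noteq> 0" using nV(1) by auto
      hence "(- inverse k) *\<^sub>R (x1 - k *\<^sub>R x3) = x3 - inverse k *\<^sub>R x1" by (simp add: algebra_simps)
      thus False using subspace_scale[OF V k, of "- inverse k"] False by auto
    qed
    from orthogonal_functional[OF subspace_span this]
    obtain c where c: "\<forall>v\<in>span (insert x3 V). c \<bullet> v = 0" "c \<bullet> x1 = 1" by blast
    hence cV: "\<forall>v\<in>V. c \<bullet> v = 0" "c \<bullet> x3 = 0" by (auto simp: span_base)
    have "c \<bullet> x2 = b" using bspec[OF cV(1) b] c(2) by (simp add: inner_diff_right)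
    thus ?thesis using cV c(2) b0 by (intro exI[of _ c]) auto
  qed
next
  case False
  have ind: "\<alpha> = 0 \<and> \<beta> = 0" if h: "\<alpha> *\<^sub>R x1 + \<beta> *\<^sub>R x2 \<in> V" for \<alpha> \<beta>
  proof (cases "\<beta> = 0")
    case True
    thus ?thesis using subspace_scale[OF V h, of "inverse \<alpha>"] nV(1) by (cases "\<alpha> = 0") auto
  next
    case b: False
    hence "inverse \<beta> *\<^sub>R (\<alpha> *\<^sub>R x1 + \<beta> *\<^sub>R x2) = x2 - (- (\<alpha> / \<beta>)) *\<^sub>R x1" by (simp add: algebra_simps divide_inverse)
    thus ?thesis using subspace_scale[OF V h, of "inverse \<beta>"] False span_insert_subspace[OF V, of x2 x1] by metis
  qed
  have dual: "\<exists>c d. (\<forall>v\<in>W. c \<bullet> v = 0 \<and> d \<bullet> v = 0) \<and> c \<bullet> x1 = 1 \<and> c \<bullet> x2 = 0 \<and> d \<bullet> x1 = 0 \<and> d \<bullet> x2 = 1"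
    if W: "subspace W" and i: "\<And>\<alpha> \<beta>. \<alpha> *\<^sub>R x1 + \<beta> *\<^sub>R x2 \<in> W ==> \<alpha> = 0 \<and> \<beta> = 0" for W
  proof -
    have "x1 \<notin> span (insert x2 W)" "x2 \<notin> span (insert x1 W)"
      unfolding span_insert_subspace[OF W] using i[of 1 "- k" for k] i[of "- k" 1 for k] by auto
    from this[THEN orthogonal_functional[OF subspace_span]] obtain c d where
      "\<forall>v\<in>span (insert x2 W). c \<bullet> v = 0" "c \<bullet> x1 = 1" "\<forall>v\<in>span (insert x1 W). d \<bullet> v = 0" "d \<bullet> x2 = 1" by blast
    thus ?thesis by (intro exI[of _ c] exI[of _ d]) (auto simp: span_base)
  qed
  show ?thesis
  proof (cases "\<exists>a b. x3 - (a *\<^sub>R x1 + b *\<^sub>R x2) \<in> V")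
    case True
    then obtain a b where ab: "x3 - (a *\<^sub>R x1 + b *\<^sub>R x2) \<in> V" by blast
    have ab4: "a * b < 1 / 4" using n1[OF _ ab] ind by blast
    have "\<exists>s t. 0 < s \<and> (a * s + b * t)\<^sup>2 < s * (t :: real)"
    proof (cases "a = 0 \<or> b = 0")
      case True
      thus ?thesis
      proof
        assume "a = 0"
        thus ?thesis by (intro exI[of _ "b\<^sup>2 + 1"] exI[of _ 1]) (auto intro: add_nonneg_pos)
      next
        assume "b = 0"
        thus ?thesis by (intro exI[of _ 1] exI[of _ "a\<^sup>2 + 1"]) auto
      qed
    next
      case False
      \<comment> \<open>With \<open>s = \<bar>b\<bar>\<close> and \<open>t = \<bar>a\<bar>\<close>
        the two summands have equal size: for \<open>a * b > 0\<close> they add up to twice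
        \<open>a * b\<close> in absolute value, otherwise they cancel.\<close>
      have "(a * \<bar>b\<bar> + b * \<bar>a\<bar>)\<^sup>2 < \<bar>b\<bar> * \<bar>a\<bar>"
      proof (cases "a * b > 0")
        case True
        hence e: "a * \<bar>b\<bar> + b * \<bar>a\<bar> = 2 * (a * b) \<or> a * \<bar>b\<bar> + b * \<bar>a\<bar> = - (2 * (a * b))" "\<bar>b\<bar> * \<bar>a\<bar> = a * b"
          by (auto simp: zero_less_mult_iff)
        have "(4 * (a * b)) * (a * b) < 1 * (a * b)" using True ab4 by (intro mult_strict_right_mono) auto
        hence "(2 * (a * b))\<^sup>2 < a * b" by (simp add: power2_eq_square)
        thus ?thesis using e by auto
      next
        case neg: False
        hence "a * \<bar>b\<bar> + b * \<bar>a\<bar> = 0" using False by (auto simp: zero_less_mult_iff abs_if)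
        thus ?thesis using False by simp
      qed
      thus ?thesis using False by (intro exI[of _ "\<bar>b\<bar>"] exI[of _ "\<bar>a\<bar>"]) auto
    qed
    then obtain s t where st: "0 < s" "(a * s + b * t)\<^sup>2 < s * t" by blast
    obtain c1 c2 where c: "\<forall>v\<in>V. c1 \<bullet> v = 0 \<and> c2 \<bullet> v = 0" "c1 \<bullet> x1 = 1" "c1 \<bullet> x2 = 0" "c2 \<bullet> x1 = 0" "c2 \<bullet> x2 = 1"
      using dual[OF V ind] by blast
    define d where "d = s *\<^sub>R c1 + t *\<^sub>R c2"
    have d: "d \<bullet> x1 = s" "d \<bullet> x2 = t" "\<And>x. x \<in> V ==> d \<bullet> x = 0" using c by (simp_all add: d_def inner_add_left)
    have "d \<bullet> x3 = a * s + b * t" using d(3)[OF ab] by (simp add: inner_diff_right inner_add_right d)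
    thus ?thesis using st d by (intro exI[of _ d]) auto
  next
    case no: False
    have "\<alpha> = 0 \<and> \<beta> = 0" if h: "\<alpha> *\<^sub>R x1 + \<beta> *\<^sub>R x2 \<in> span (insert x3 V)" for \<alpha> \<beta>
    proof -
      obtain k where k: "\<alpha> *\<^sub>R x1 + \<beta> *\<^sub>R x2 - k *\<^sub>R x3 \<in> V" using h span_insert_subspace[OF V] by blast
      have "k = 0"
      proof (rule ccontr)
        assume "k \<noteq> 0"
        hence "(- inverse k) *\<^sub>R (\<alpha> *\<^sub>R x1 + \<beta> *\<^sub>R x2 - k *\<^sub>R x3) = x3 - ((\<alpha> / k) *\<^sub>R x1 + (\<beta> / k) *\<^sub>R x2)"
          by (simp add: algebra_simps divide_inverse)
        thus False using subspace_scale[OF V k, of "- inverse k"] no by metis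
      qed
      thus ?thesis using k ind by simp
    qed
    from dual[OF subspace_span this] obtain c d where
      "\<forall>v\<in>span (insert x3 V). c \<bullet> v = 0 \<and> d \<bullet> v = 0" "c \<bullet> x1 = 1" "c \<bullet> x2 = 0" "d \<bullet> x1 = 0" "d \<bullet> x2 = 1" by blast
    thus ?thesis by (intro exI[of _ "c + d"]) (auto simp: inner_add_left span_base)
  qed
qed

text \<open>A change of the controls on a null set leaves the integral equation intact, and for
  continuous controls its solution is differentiable.\<close>

lemma mild_solution_traj:
  fixes f :: "letter => real^'d::finite => real^'d"
  assumes f: "\<And>i. continuous_on UNIV (f i)" and x: "mild_solution f u v T x" and T: "0 < T"
    and c: "continuous_on {0..T} u'" "continuous_on {0..T} v'"
    and ae: "AE s in I_leb T. u s = u' s" "AE s in I_leb T. v s = v' s"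
  shows "traj f T u' v' x"
proof -
  have cx: "continuous_on {0..T} x" and xe: "\<And>t. t \<in> {0..T} ==> x t = (LINT s|I_leb t. f X0 (x s) + u s *\<^sub>R f X1 (x s) + v s *\<^sub>R f X2 (x s))"
    using x unfolding mild_solution_def by auto
  define g where "g s = f X0 (x s) + u' s *\<^sub>R f X1 (x s) + v' s *\<^sub>R f X2 (x s)" for s
  have cf: "continuous_on {0..T} (\<lambda>s. f i (x s))" for i by (rule continuous_on_compose2[OF f cx]) auto
  have cg: "continuous_on {0..T} g" unfolding g_def by (intro continuous_intros c cf)
  have xi: "x t = integral {0..t} g" if t: "t \<in> {0..T}" for t
  proof -
    have AEt: "AE s in I_leb t. Q s" if "AE s in I_leb T. Q s" for Q
      using that t unfolding AE_restrict_space_iff[of "{0<..<T}" lebesgue Q, simplified] by (auto simp: AE_restrict_space_iff elim: eventually_mono)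
    have ct: "continuous_on {0..t} g" using cg t by (auto intro: continuous_on_subset)
    hence "g absolutely_integrable_on {0..t}" by (rule absolutely_integrable_continuous_real)
    hence gi: "integrable (I_leb t) g"
      unfolding absolutely_integrable_on_Icc_iff_Ioo by (simp add: integrable_restrict_space set_integrable_def)
    have e: "AE s in I_leb t. g s = f X0 (x s) + u s *\<^sub>R f X1 (x s) + v s *\<^sub>R f X2 (x s)"
      using AEt[OF ae(1)] AEt[OF ae(2)] by eventually_elim (simp add: g_def)
    have "(LINT s|I_leb t. f X0 (x s) + u s *\<^sub>R f X1 (x s) + v s *\<^sub>R f X2 (x s)) = (LINT s|I_leb t. g s)"
      by (rule integral_cong_AE) (use gi e measurable_AE_eq[OF e] in \<open>auto elim: eventually_mono\<close>)
    thus ?thesis using xe[OF t] LINT_eq_integral[OF gi] by simp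
  qed
  have "(x has_vector_derivative g t) (at t within {0..T})" if t: "t \<in> {0..T}" for t
    by (rule has_vector_derivative_transform[OF t _ integral_has_vector_derivative[OF cg t]]) (use xi in auto)
  moreover have "x 0 = 0" using xi[of 0] T by simp
  ultimately show ?thesis using T c by (simp add: traj_def g_def)
qed

lemma small_scale:
  fixes K M z :: real
  assumes "0 < M" "0 < z" "0 <= K"
  shows "\<exists>t>0. t <= M \<and> K * t <= z"
proof (intro exI conjI)
  have "K * min M (z / (K + 1)) <= K * (z / (K + 1))" using assms by (intro mult_left_mono) auto
  also have "\<dots> <= z" using assms by (simp add: field_simps)
  finally show "K * min M (z / (K + 1)) <= z" .
qed (use assms in auto)

context closed_loop
begin

text \<open>The target is opposite to \<open>c\<close>, so that its distance \<open>X\<close> and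
  the drift add up on one side: a multiple of \<open>X\<close> plus a multiple of \<open>A2\<close>
  is bounded by smaller multiples of the same two quantities, whatever their ratio.\<close>

lemma not_STLC:
  assumes m: "m \<ge> 1" and p: "p \<ge> 1"
    and Nm: "2 * (m + k) <= Suc N * m" and rm: "m + k <= Suc r * m"
    and A: "A = c \<bullet> Sij X1 X1" "A > 0" and B: "B = c \<bullet> Sij X2 X2"
    and C: "C = c \<bullet> Sij X1 X2" "C = c \<bullet> Sij X2 X1" and ABC: "C\<^sup>2 < A * B"
  shows "\<not> W_STLC m p f"
proof
  assume stlc: "W_STLC m p f"
  obtain K T0 g0 where K: "K \<ge> 0" "T0 > 0" "g0 > 0"
    "\<forall>T u v x. traj f T u v x --> T <= T0 --> l1n T u v <= g0 -->
     \<bar>c \<bullet> x T - 1/2 * integral {0..T} (form u v)\<bar>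
       <= K * (l1n T u v * norm (x T) + l1n T u v ^ Suc N + T * integral {0..T} (\<lambda>t. (wl1 u v t)\<^sup>2)
          + integral {0..T} (wl1 u v) * (norm (x T) + l1n T u v ^ Suc r))"
    using key_estimate by (elim exE conjE) (rule that)
  have Bpos: "B > 0" using ABC A(2) zero_le_power2[of C] by (metis le_less_trans zero_less_mult_pos)
  \<comment> \<open>Determinant over trace, a lower bound for the smallest eigenvalue of the
    form.\<close>
  define c0 where "c0 = (A * B - C\<^sup>2) / (A + B)"
  have c0: "c0 > 0" using ABC A(2) Bpos by (simp add: c0_def)
  have form_ge: "c0 * ((prim u k t)\<^sup>2 + (prim v k t)\<^sup>2) <= form u v t" for u v t
  proof -
    define x where "x = prim u k t"
    define y where "y = prim v k t"
    have f: "form u v t = A * x\<^sup>2 + 2 * C * (x * y) + B * y\<^sup>2"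
      unfolding form_def using A(1) B C by (simp add: x_def y_def power2_eq_square)
    have "(A + B) * (A * x\<^sup>2 + 2 * C * (x * y) + B * y\<^sup>2) - (A * B - C\<^sup>2) * (x\<^sup>2 + y\<^sup>2) = (A * x + C * y)\<^sup>2 + (C * x + B * y)\<^sup>2"
      by (simp add: power2_eq_square algebra_simps)
    hence "(A * B - C\<^sup>2) * (x\<^sup>2 + y\<^sup>2) <= (A + B) * form u v t"
      unfolding f using zero_le_power2[of "A * x + C * y"] zero_le_power2[of "C * x + B * y"] by linarith
    thus ?thesis using A(2) Bpos unfolding x_def[symmetric] y_def[symmetric] c0_def by (simp add: field_simps)
  qed
  define nc where "nc = norm c"
  have nc: "nc > 0" using A by (auto simp: nc_def)
  \<comment> \<open>The horizon comes first and makes \<open>K * T\<close> small. The interpolation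
    constant \<open>D\<close> depends on it, so the size \<open>\<rho>\<close> of the controls is
    fixed afterwards.\<close>
  obtain T where T: "0 < T" "T <= min T0 1" "2 * K * T <= c0 / 8" using small_scale[of "min T0 1" "c0 / 8" "2 * K"] K c0 by auto
  obtain \<kappa> where \<kappa>: "0 < \<kappa>" "\<kappa> <= 1" "3 * K * \<kappa> <= c0 / 8" using small_scale[of 1 "c0 / 8" "3 * K"] K c0 by auto
  obtain D where D: "D > 0" "\<forall>u v \<rho>. in_Wmp T m p u --> in_Wmp T m p v --> Wmp_norm T m p u + Wmp_norm T m p v <= \<rho> --> 0 < \<rho> -->
     (\<exists>u' v'. continuous_on {0..T} u' \<and> continuous_on {0..T} v' \<and> (AE x in I_leb T. u x = u' x) \<and> (AE x in I_leb T. v x = v' x) \<and>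
       l1n T u' v' <= D * \<rho> \<and>
       l1n T u' v' ^ (2 * (m + k)) <= D * integral {0..T} (\<lambda>t. (prim u' k t)\<^sup>2 + (prim v' k t)\<^sup>2) ^ m * \<rho> ^ (2 * k))"
    using sobolev_interpolation[OF p T(1) m k1] by (elim exE conjE) (rule that)
  obtain gm where gm: "0 < gm" "gm <= min g0 1" "2 * K * gm <= nc / 2" using small_scale[of "min g0 1" "nc / 2" "2 * K"] K nc by auto
  \<comment> \<open>The first bound keeps the L1 norm below \<open>gm\<close>, the second brings the
    small factor \<open>\<kappa>\<close> into the interpolation inequality.\<close>
  define \<rho> where "\<rho> = min 1 (min (gm / D) (\<kappa> ^ (2 * m) / D))"
  have \<rho>: "0 < \<rho>" "\<rho> <= 1" using gm(1) D(1) \<kappa>(1) by (auto simp: \<rho>_def)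
  have D\<rho>: "D * \<rho> <= gm" "D * \<rho> <= \<kappa> ^ (2 * m)"
  proof -
    have "\<rho> <= gm / D" "\<rho> <= \<kappa> ^ (2 * m) / D" by (auto simp: \<rho>_def)
    thus "D * \<rho> <= gm" "D * \<rho> <= \<kappa> ^ (2 * m)" using D(1) by (simp_all add: pos_le_divide_eq mult.commute)
  qed
  obtain \<delta> where \<delta>: "\<delta> > 0" "\<forall>xs\<in>ball 0 \<delta>. \<exists>u v x.
     in_Wmp T m p u \<and> in_Wmp T m p v \<and> Wmp_norm T m p u + Wmp_norm T m p v <= \<rho> \<and>
     mild_solution f u v T x \<and> x T = xs"
    using stlc T(1) \<rho>(1) unfolding W_STLC_def by blast
  define xs where "xs = (- (\<delta> / (2 * nc))) *\<^sub>R c"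
  have nxs: "norm xs = \<delta> / 2" using nc by (simp add: xs_def nc_def abs_of_pos[OF \<delta>(1)])
  have cxs: "c \<bullet> xs = - (nc * norm xs)" unfolding nxs
    using nc by (simp add: xs_def nc_def dot_square_norm power2_eq_square)
  have "xs \<in> ball 0 \<delta>" using nxs \<delta>(1) by simp
  then obtain u v x where uv: "in_Wmp T m p u" "in_Wmp T m p v" "Wmp_norm T m p u + Wmp_norm T m p v <= \<rho>"
    "mild_solution f u v T x" "x T = xs" using \<delta>(2) by blast
  obtain u' v' where u': "continuous_on {0..T} u'" "continuous_on {0..T} v'" "AE x in I_leb T. u x = u' x" "AE x in I_leb T. v x = v' x"
       "l1n T u' v' <= D * \<rho>"
       "l1n T u' v' ^ (2 * (m + k)) <= D * integral {0..T} (\<lambda>t. (prim u' k t)\<^sup>2 + (prim v' k t)\<^sup>2) ^ m * \<rho> ^ (2 * k)"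
    using D(2)[rule_format, OF uv(1-3) \<rho>(1)] by (elim exE conjE) (rule that)
  have cf: "continuous_on UNIV (f i)" for i
    using Ck_sfield[OF sf[of i], of 0] by simp
  have tr: "traj f T u' v' x" by (rule mild_solution_traj[OF cf uv(4) T(1) u'(1-4)])
  define g where "g = l1n T u' v'"
  define X where "X = norm xs"
  define A2 where "A2 = integral {0..T} (\<lambda>t. (prim u' k t)\<^sup>2 + (prim v' k t)\<^sup>2)"
  define w1 where "w1 = integral {0..T} (wl1 u' v')"
  define w2 where "w2 = integral {0..T} (\<lambda>t. (wl1 u' v' t)\<^sup>2)"
  have X: "X > 0" unfolding X_def nxs using \<delta>(1) by simp
  have g: "0 <= g" "g <= gm" "g <= 1" using l1n_nonneg[OF u'(1,2)] u'(5) D\<rho>(1) gm(2) by (auto simp: g_def)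
  have cp: "continuous_on {0..T} (prim u' k)" "continuous_on {0..T} (prim v' k)" by (intro prim_continuous u')+
  have cw: "continuous_on {0..T} (wl1 u' v')" by (rule wl1_continuous[OF u'(1,2)])
  have ip: "(\<lambda>t. (prim u' k t)\<^sup>2 + (prim v' k t)\<^sup>2) integrable_on {0..T}"
    by (intro integrable_continuous_real continuous_intros cp)
  have iw: "(\<lambda>t. (wl1 u' v' t)\<^sup>2) integrable_on {0..T}" by (intro integrable_continuous_real continuous_intros cw)
  have A20: "A2 \<ge> 0" unfolding A2_def by (rule integral_nonneg[OF ip]) simp
  have w2: "w2 <= 2 * A2"
  proof -
    have "w2 <= integral {0..T} (\<lambda>t. 2 * ((prim u' k t)\<^sup>2 + (prim v' k t)\<^sup>2))"
      unfolding w2_def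
    proof (rule integral_le[OF iw])
      show "(\<lambda>t. 2 * ((prim u' k t)\<^sup>2 + (prim v' k t)\<^sup>2)) integrable_on {0..T}" using ip by (rule integrable_on_mult_right)
      fix t
      have "(wl1 u' v' t)\<^sup>2 + (\<bar>prim u' k t\<bar> - \<bar>prim v' k t\<bar>)\<^sup>2 = 2 * ((prim u' k t)\<^sup>2 + (prim v' k t)\<^sup>2)"
        by (simp add: wl1_def power2_sum power2_diff)
      thus "(wl1 u' v' t)\<^sup>2 <= 2 * ((prim u' k t)\<^sup>2 + (prim v' k t)\<^sup>2)"
        using zero_le_power2[of "\<bar>prim u' k t\<bar> - \<bar>prim v' k t\<bar>"] by linarith
    qed
    thus ?thesis unfolding A2_def by (simp only: Henstock_Kurzweil_Integration.integral_mult_right)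
  qed
  have w10: "0 <= w1" unfolding w1_def by (rule integral_nonneg[OF integrable_continuous_real[OF cw]]) (simp add: wl1_def)
  have w1g: "w1 <= g"
  proof -
    have i: "(\<lambda>t. \<bar>prim u' k t\<bar>) integrable_on {0..T}" "(\<lambda>t. \<bar>prim v' k t\<bar>) integrable_on {0..T}"
      "(\<lambda>t. \<bar>u' t\<bar>) integrable_on {0..T}" "(\<lambda>t. \<bar>v' t\<bar>) integrable_on {0..T}"
      by (intro integrable_continuous_real continuous_intros cp u')+
    have "w1 = integral {0..T} (\<lambda>t. \<bar>prim u' k t\<bar>) + integral {0..T} (\<lambda>t. \<bar>prim v' k t\<bar>)"
      unfolding w1_def wl1_def[abs_def] by (rule Henstock_Kurzweil_Integration.integral_add[OF i(1,2)])
    also have "\<dots> <= T ^ k * integral {0..T} (\<lambda>t. \<bar>u' t\<bar>) + T ^ k * integral {0..T} (\<lambda>t. \<bar>v' t\<bar>)"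
      by (intro add_mono norm1_prim u' T)
    also have "\<dots> = T ^ k * g"
      unfolding g_def l1n_def Henstock_Kurzweil_Integration.integral_add[OF i(3,4)] by (simp add: distrib_left)
    also have "\<dots> <= 1 * g" using T g by (intro mult_right_mono power_le_one) auto
    finally show ?thesis by simp
  qed
  have w1s: "w1 <= 2 * sqrt A2"
  proof (rule power2_le_imp_le)
    have "w1\<^sup>2 <= T * w2" unfolding w1_def w2_def by (rule cauchy_schwarz_one[OF cw T(1)])
    also have "\<dots> <= 1 * (2 * A2)" using T w2 A20 integral_nonneg[OF iw] by (intro mult_mono) (auto simp: w2_def)
    also have "\<dots> <= (2 * sqrt A2)\<^sup>2" using A20 by (simp add: power_mult_distrib)
    finally show "w1\<^sup>2 <= (2 * sqrt A2)\<^sup>2" .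
  qed (use A20 in simp)
  have gp: "g ^ (2 * (m + k)) <= \<kappa> ^ (2 * m) * A2 ^ m"
  proof -
    have "D * \<rho> ^ (2 * k) <= D * \<rho>"
      using \<rho> k1 D(1) power_decreasing[of 1 "2 * k" \<rho>] by (intro mult_left_mono) auto
    hence "D * \<rho> ^ (2 * k) <= \<kappa> ^ (2 * m)" using D\<rho>(2) by linarith
    hence "A2 ^ m * (D * \<rho> ^ (2 * k)) <= A2 ^ m * \<kappa> ^ (2 * m)" using A20 by (intro mult_left_mono) auto
    thus ?thesis using u'(6) unfolding g_def[symmetric] A2_def[symmetric] by (simp add: mult_ac)
  qed
  \<comment> \<open>\<open>Nm\<close> makes the remainder of the Magnus representation small against
    the drift; \<open>m\<close>-th powers are compared.\<close>
  have gN: "g ^ Suc N <= \<kappa> * A2"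
  proof (rule power_mono_iff[THEN iffD1])
    have "(g ^ Suc N) ^ m = g ^ (Suc N * m)" by (simp only: power_mult)
    also have "\<dots> <= g ^ (2 * (m + k))" using g Nm by (intro power_decreasing) auto
    also have "\<dots> <= \<kappa> ^ (2 * m) * A2 ^ m" by (rule gp)
    also have "\<dots> <= \<kappa> ^ m * A2 ^ m" using \<kappa> A20 by (intro mult_right_mono power_decreasing) auto
    finally show "(g ^ Suc N) ^ m <= (\<kappa> * A2) ^ m" by (simp only: power_mult_distrib)
  qed (use g \<kappa> A20 m in auto)
  \<comment> \<open>Half of that exponent suffices, because this term is multiplied by
    \<open>w1\<close>, itself of size \<open>sqrt A2\<close>.\<close>
  have gr: "g ^ Suc r <= \<kappa> * sqrt A2"
  proof (rule power_mono_iff[THEN iffD1])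
    have "(g ^ Suc r) ^ (2 * m) = g ^ (2 * (Suc r * m))" by (simp only: power_mult[symmetric] mult_ac)
    also have "\<dots> <= g ^ (2 * (m + k))" using g rm by (intro power_decreasing mult_le_mono2) auto
    also have "\<dots> <= \<kappa> ^ (2 * m) * A2 ^ m" by (rule gp)
    also have "A2 ^ m = (sqrt A2) ^ (2 * m)" using A20 by (simp add: power_mult)
    finally show "(g ^ Suc r) ^ (2 * m) <= (\<kappa> * sqrt A2) ^ (2 * m)" by (simp only: power_mult_distrib)
  qed (use g \<kappa> A20 m in auto)
  have I: "c0 * A2 <= integral {0..T} (form u' v')"
  proof -
    have cform: "continuous_on {0..T} (form u' v')"
    proof -
      have "continuous_on {0..T} (prim (ctl u' v' i) k)" for i by (cases "i = X1") (use cp in \<open>auto simp: ctl_def\<close>)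
      thus ?thesis unfolding form_def[abs_def] by (intro continuous_intros)
    qed
    have "integral {0..T} (\<lambda>t. c0 * ((prim u' k t)\<^sup>2 + (prim v' k t)\<^sup>2)) <= integral {0..T} (form u' v')"
      by (rule integral_le[OF integrable_on_mult_right[OF ip] integrable_continuous_real[OF cform] form_ge])
    thus ?thesis by (simp add: A2_def)
  qed
  have "\<bar>c \<bullet> x T - 1/2 * integral {0..T} (form u' v')\<bar> <= K * (g * X + g ^ Suc N + T * w2 + w1 * (X + g ^ Suc r))"
    using K(4)[rule_format, OF tr] T(2) g(2) gm(2) unfolding g_def w1_def w2_def X_def uv(5) by simp
  hence "nc * X + 1/2 * integral {0..T} (form u' v') <= K * (g * X + g ^ Suc N + T * w2 + w1 * (X + g ^ Suc r))"
    unfolding uv(5) cxs X_def[symmetric] by linarith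
  also have "\<dots> <= K * (g * X + \<kappa> * A2 + T * (2 * A2) + (g * X + 2 * \<kappa> * A2))"
  proof (intro mult_left_mono add_mono K(1))
    have "w1 * (X + g ^ Suc r) = w1 * X + w1 * g ^ Suc r" by (simp only: distrib_left)
    also have "\<dots> <= g * X + (2 * sqrt A2) * (\<kappa> * sqrt A2)"
      using w1g w1s gr X g A20 w10 by (intro add_mono mult_mono) auto
    also have "\<dots> = g * X + 2 * \<kappa> * A2" using A20 by simp
    finally show "w1 * (X + g ^ Suc r) <= g * X + 2 * \<kappa> * A2" .
  qed (use gN w2 T g X in auto)
  also have "\<dots> = (2 * K * g) * X + (3 * K * \<kappa>) * A2 + (2 * K * T) * A2" by (simp add: algebra_simps)
  also have "\<dots> <= (nc / 2) * X + (c0 / 8) * A2 + (c0 / 8) * A2"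
  proof (intro add_mono mult_right_mono)
    show "2 * K * g <= nc / 2" using gm(3) g(2) K(1) mult_left_mono[of g gm "2 * K"] by linarith
  qed (use \<kappa> T X A20 in auto)
  finally have "nc * X + 1/2 * (c0 * A2) <= (nc / 2) * X + (c0 / 8) * A2 + (c0 / 8) * A2" using I by linarith
  moreover have "c0 * A2 \<ge> 0" "nc * X > 0" using c0 A20 nc X by auto
  ultimately show False by (simp add: mult.commute[of A2 c0])
qed

end

text \<open>Rounding up \<open>k / m\<close> and doubling exceeds \<open>2 * k / m\<close> by less
  than \<open>2\<close>, so \<open>2 * r\<close> is at most one more than the rounded
  \<open>2 * k / m\<close>, which is \<open>pi_km k m\<close>.\<close>

lemma pi_km_bounds:
  fixes k m :: nat
  assumes k: "k \<ge> 1" and m: "m \<ge> 1"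
  defines "r \<equiv> nat \<lceil>real k / real m\<rceil>"
  shows "r \<ge> 1" "2 * r <= pi_km k m" "r <= pi_km k m" "pi_km k m \<ge> 2"
    "2 * (m + k) <= Suc (pi_km k m) * m" "m + k <= Suc r * m"
proof -
  define s where "s = nat \<lceil>2 * real k / real m\<rceil>"
  have pi: "pi_km k m = 1 + s" by (simp add: pi_km_def s_def)
  have pos: "0 < real k / real m" "0 < 2 * real k / real m" using k m by auto
  have r: "real k / real m <= real r" "real r < real k / real m + 1"
    using pos(1) by (simp_all add: r_def) linarith+
  have s: "2 * real k / real m <= real s"
    using pos(2) by (simp add: s_def)
  show "r \<ge> 1" using r(1) pos(1) by (cases r) auto
  have "s \<ge> 1" using s pos(2) by (cases s) auto
  have "2 * real r < 2 * (real k / real m) + 2" using r(2) by simp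
  also have "\<dots> <= real s + 2" using s by simp
  finally have "2 * r < s + 2" by linarith
  thus "2 * r <= pi_km k m" unfolding pi by simp
  thus "r <= pi_km k m" by simp
  show "pi_km k m \<ge> 2" using \<open>s \<ge> 1\<close> pi by simp
  have "2 * real k <= real s * real m" using s m by (simp add: field_simps)
  hence "2 * k <= s * m" by (metis of_nat_le_iff of_nat_mult of_nat_numeral)
  thus "2 * (m + k) <= Suc (pi_km k m) * m" unfolding pi by simp
  have "real k <= real r * real m" using r(1) m by (simp add: field_simps)
  hence "k <= r * m" by (metis of_nat_le_iff of_nat_mult)
  thus "m + k <= Suc r * m" by simp
qed

theorem theorem1p28:
  fixes f :: "letter \<Rightarrow> real^'d \<Rightarrow> real^'d" and k m :: nat and p :: ennreal
  assumes "\<And>i. real_analytic (f i)"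
    and "f X0 0 = 0"
    and "k \<ge> 1" and "m \<ge> 1"
    and "p \<ge> 1"
    and "W_STLC m p f"
  shows "let V = eval_span f (N_set k m);
             e1 = quot_proj V (Lam f (Wbr X1 k 0) 0);
             e2 = quot_proj V (Lam f (Wbr X2 k 0) 0);
             e3 = quot_proj V (Lam f (Cbr (2 * k - 1) 0) 0)
         in (e1 = quot_proj V 0 \<or> e2 = quot_proj V 0)
          \<or> (quot_indep2 V e1 e2 \<and>
             (\<exists>a b. e3 = quot_add (quot_scale V a e1) (quot_scale V b e2) \<and> a * b \<ge> 1 / 4))
          \<or> (\<exists>\<beta>. e2 = quot_scale V \<beta> e1 \<and> \<beta> < 0)
          \<or> (\<exists>\<beta> \<gamma>. e2 = quot_scale V \<beta> e1 \<and> e3 = quot_scale V \<gamma> e1 \<and> \<beta> \<le> \<gamma>\<^sup>2 \<and> \<beta> \<noteq> 0)"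
proof (rule ccontr)
  define V where "V = eval_span f (N_set k m)"
  define x1 where "x1 = Lam f (Wbr X1 k 0) 0"
  define x2 where "x2 = Lam f (Wbr X2 k 0) 0"
  define x3 where "x3 = Lam f (Cbr (2 * k - 1) 0) 0"
  have V: "subspace V" by (simp add: V_def subspace_eval_span)
  \<comment> \<open>Turns equations between cosets into memberships in \<open>V\<close>.\<close>
  note q = quot_proj_eq_iff[OF V] quot_proj_scale[OF V] quot_proj_add[OF V]
  have ind: "quot_indep2 V (quot_proj V x1) (quot_proj V x2) \<longleftrightarrow> (\<forall>\<alpha> \<beta>. \<alpha> *\<^sub>R x1 + \<beta> *\<^sub>R x2 \<in> V --> \<alpha> = 0 \<and> \<beta> = 0)"
    by (simp add: quot_indep2_def q)
  assume "\<not> ?thesis"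
  hence neg: "x1 \<notin> V" "x2 \<notin> V"
    "\<not> ((\<forall>\<alpha> \<beta>. \<alpha> *\<^sub>R x1 + \<beta> *\<^sub>R x2 \<in> V --> \<alpha> = 0 \<and> \<beta> = 0) \<and> (\<exists>a b. x3 - (a *\<^sub>R x1 + b *\<^sub>R x2) \<in> V \<and> a * b \<ge> 1 / 4))"
    "\<not> (\<exists>\<beta>. x2 - \<beta> *\<^sub>R x1 \<in> V \<and> \<beta> < 0)"
    "\<not> (\<exists>\<beta> \<gamma>. x2 - \<beta> *\<^sub>R x1 \<in> V \<and> x3 - \<gamma> *\<^sub>R x1 \<in> V \<and> \<beta> <= \<gamma>\<^sup>2 \<and> \<beta> \<noteq> 0)"
    unfolding Let_def V_def[symmetric] x1_def[symmetric] x2_def[symmetric] x3_def[symmetric] ind[symmetric]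
    by (simp_all add: q)
  have "\<exists>c. (\<forall>x\<in>V. c \<bullet> x = 0) \<and> 0 < c \<bullet> x1 \<and> (c \<bullet> x3)\<^sup>2 < (c \<bullet> x1) * (c \<bullet> x2)"
  proof (rule definite_functional[OF V neg(1,2)])
    show "a * b < 1 / 4" if "\<And>\<alpha> \<beta>. \<alpha> *\<^sub>R x1 + \<beta> *\<^sub>R x2 \<in> V ==> \<alpha> = 0 \<and> \<beta> = 0" "x3 - (a *\<^sub>R x1 + b *\<^sub>R x2) \<in> V" for a b
    proof (rule ccontr)
      assume "\<not> a * b < 1 / 4"
      hence "a * b \<ge> 1 / 4" by simp
      thus False using neg(3) that by blast
    qed
    show "0 <= \<beta>" if "x2 - \<beta> *\<^sub>R x1 \<in> V" for \<beta> using neg(4) that by (meson not_less)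
    show "\<gamma>\<^sup>2 < \<beta>" if "x2 - \<beta> *\<^sub>R x1 \<in> V" "x3 - \<gamma> *\<^sub>R x1 \<in> V" "\<beta> \<noteq> 0" for \<beta> \<gamma> using neg(5) that by (meson not_less)
  qed
  then obtain c where c: "\<forall>x\<in>V. c \<bullet> x = 0" "0 < c \<bullet> x1" "(c \<bullet> x3)\<^sup>2 < (c \<bullet> x1) * (c \<bullet> x2)"
    by (elim exE conjE) (rule that)
  define N where "N = pi_km k m"
  define r where "r = nat \<lceil>real k / real m\<rceil>"
  note b = pi_km_bounds[OF assms(3,4), folded N_def r_def]
  have an: "analytic_fun (\<lambda>x. f i x $ j)" for i j by (rule analytic_component[OF assms(1)])
  have "\<forall>i \<alpha>. \<exists>a. flat (Suc N) (\<lambda>x. der (f i) (mon \<alpha>) x - (\<Sum>\<beta>\<in>{\<beta>. deg \<beta> <= N}. a \<beta> * mon \<beta> x))"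
    using polyf_der_mon[OF an] unfolding polyf_def by blast
  hence ex: "\<exists>a. flat (Suc N) (\<lambda>x. der (f i) (mon \<alpha>) x - (\<Sum>\<beta>\<in>{\<beta>. deg \<beta> <= N}. a \<beta> * mon \<beta> x))" for i \<alpha>
    by blast
  \<comment> \<open>The Carleman coefficients, truncated at degree \<open>N = pi_km k m\<close>, the
    highest degree that \<open>c\<close> annihilates by assumption.\<close>
  define a where "a i \<alpha> = (SOME a. flat (Suc N) (\<lambda>x. der (f i) (mon \<alpha>) x - (\<Sum>\<beta>\<in>{\<beta>. deg \<beta> <= N}. a \<beta> * mon \<beta> x)))" for i \<alpha>
  have a: "flat (Suc N) (\<lambda>x. der (f i) (mon \<alpha>) x - (\<Sum>\<beta>\<in>{\<beta>. deg \<beta> <= N}. a i \<alpha> \<beta> * mon \<beta> x))" for i \<alpha>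
    unfolding a_def by (rule someI_ex[OF ex])
  interpret carleman f N a
    by unfold_locales (use an analytic_fun_smooth a assms(2) b(4) in \<open>auto simp: sfield_def\<close>)
  have S: "br2 X1 X1 (k - 1) k = x1" "br2 X2 X2 (k - 1) k = x2" by (simp_all add: x1_def x2_def Lam_Wbr)
  have S21: "br2 X2 X1 (k - 1) k = x3" and S12: "br2 X1 X2 (k - 1) k - x3 \<in> V"
    using br2_top[OF assms(3)] by (simp_all add: x3_def V_def)
  have c12: "c \<bullet> br2 X1 X2 (k - 1) k = c \<bullet> x3" using c(1) S12 by (auto simp: inner_diff_right)
  obtain Q where Q: "linear Q" "\<forall>x\<in>V. Q x = 0" "\<forall>x. x - Q x \<in> V"
    using linear_projection[OF V] by (elim exE conjE) (rule that)
  \<comment> \<open>Values of the intermediate brackets; the dual functionals are built to vanish on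
    them, and \<open>adb_independent\<close> is what makes this possible.\<close>
  define R where "R = span {Fb b 0 | b. nocc b \<in> {2..r}}"
  let ?I = "{X1, X2} \<times> {..<k}"
  have "\<exists>\<psi>. (\<forall>i. linear (\<psi> i)) \<and> (\<forall>i\<in>?I. \<forall>j\<in>?I. \<psi> i ((\<lambda>(i, l). Fb (adb i l) 0) j) = (if i = j then 1 else (0::real))) \<and> (\<forall>i. \<forall>x\<in>R. \<psi> i x = 0)"
  proof (rule dual_functionals)
    show "subspace R" by (simp add: R_def)
    fix \<alpha> :: "letter \<times> nat => real"
    assume "(\<Sum>i\<in>?I. \<alpha> i *\<^sub>R (\<lambda>(i, l). Fb (adb i l) 0) i) \<in> R"
    hence "(\<Sum>i\<in>{X1, X2}. \<Sum>l<k. \<alpha> (i, l) *\<^sub>R Fb (adb i l) 0) \<in> R"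
      by (subst sum.cartesian_product) (simp add: case_prod_unfold)
    hence "\<forall>i\<in>{X1, X2}. \<forall>l<k. \<alpha> (i, l) = 0"
      unfolding R_def
      by (intro adb_independent[where c=c, OF assms(3) b(1) b(2)[unfolded N_def] _ refl _ refl refl])
        (use c c12 S S21 in \<open>auto simp: V_def\<close>)
    thus "\<forall>i\<in>?I. \<alpha> i = 0" by auto
  qed simp
  then obtain \<psi> where \<psi>: "\<forall>i. linear (\<psi> i)" "\<forall>i\<in>?I. \<forall>j\<in>?I. \<psi> i ((\<lambda>(i, l). Fb (adb i l) 0) j) = (if i = j then 1 else (0::real))" "\<forall>i. \<forall>x\<in>R. \<psi> i x = 0"
    by (elim exE conjE) (rule that)
  interpret closed_loop f N a k r V Q c "\<lambda>i l. \<psi> (i, l)"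
  proof unfold_locales
    fix i j :: letter and a b :: nat
    assume "i \<in> {X1, X2}" "j \<in> {X1, X2}" "a + b <= 2 * k - 2"
    from br2_in_eval_span[OF this, of m] show "Fb (Bracket (adb i a) (adb j b)) 0 \<in> V" by (simp add: V_def br2_def)
  next
    fix i l b
    assume "2 <= nocc b" "nocc b <= r"
    hence "Fb b 0 \<in> R" unfolding R_def by (intro span_base) auto
    thus "\<psi> (i, l) (Fb b 0) = 0" using \<psi>(3) by blast
  next
    fix i j :: letter and l l' :: nat
    assume "i \<in> {X1, X2}" "j \<in> {X1, X2}" "l < k" "l' < k"
    thus "\<psi> (i, l) (Fb (adb j l') 0) = (if i = j \<and> l = l' then 1 else 0)"
      using \<psi>(2)[rule_format, of "(i, l)" "(j, l')"] by simp
  next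
    show "Hmap x \<in> V" if "x \<in> V" for x using eval_span_Hmap that by (simp add: V_def)
    show "Fb b 0 \<in> V" if "nocc b \<in> {1..N} - {2}" for b using Fb_eval_span that by (simp add: V_def N_def)
  qed (use assms(3) b Q c \<psi>(1) linear_add[OF Q(1)] linear_cmul[OF Q(1)]
      linear_add[OF \<psi>(1)[rule_format]] linear_cmul[OF \<psi>(1)[rule_format]] in auto)
  have "\<not> W_STLC m p f"
    by (rule not_STLC[OF assms(4,5) b(5,6) refl _ refl refl])
      (use c S S21 c12 in \<open>simp_all add: Sij_def br2_def\<close>)
  thus False using assms(6) by simp
qed

end
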